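(* Let $m$ be a positive integer and $\sigma$ be any element of $\widehat{\mathbb C}$. Let $N=|\sigma z|+\rho$ and $\varphi=\arg(\sigma z)$, and let $c(\varphi)$ be the function defined in the context. Let $\delta>0$ be a fixed (small) number. Then for any fixed non-negative integer $n$ and large $|\sigma z|$, $$\frac{\mathrm{e}^{-m\sigma z}}{(2\pi \mathrm{i})^m z^{mN-m-n}}F^{(m)}\left(z;\begin{array}{c}N,\ldots,N,N-n\\ \sigma,\ldots,\sigma,\sigma\end{array}\right)=\sum_{\pi(m)}\prod_{j=1}^m\frac{1}{(2j)^{k_j}k_j!}\operatorname{erfc}^{k_j}\Big(c(\varphi)\sqrt{\tfrac j2|\sigma z|}\Big)+E_1,$$ where $$E_1=\begin{cases}\mathcal O\left(\left|\dfrac{\mathrm{e}^{-\frac m2|\sigma z|c^2(\varphi)}}{\sqrt{|\sigma z|}}\right|\right), & \text{if } -\pi<-\pi+\delta\le\varphi\le\pi,\\[1em] \mathcal O\left(\left|\dfrac{\mathrm{e}^{-\frac12|\sigma z|c^2(\varphi)}}{\sqrt{|\sigma z|}}\right|\right), & \text{if } \pi<\varphi\le3\pi-\delta<3\pi,\end{cases}$$ and $$\frac{\mathrm{e}^{-2\pi \mathrm{i}mN}\mathrm{e}^{-m\sigma z}}{(2\pi \mathrm{i})^m z^{mN-m-n}}F^{(m)}\left(z;\begin{array}{c}N,\ldots,N,N-n\\ \sigma,\ldots,\sigma,\sigma\end{array}\right)=\sum_{\pi(m)}\prod_{j=1}^m\frac{(-1)^{k_j}}{(2j)^{k_j}k_j!}\operatorname{erfc}^{k_j}\Big(\overline{c(-\varphi)}\sqrt{\tfrac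 j2|\sigma z|}\Big)+E_2,$$ where $$E_2=\begin{cases}\mathcal O\left(\left|\dfrac{\mathrm{e}^{-\frac m2|\sigma z|c^2(-\varphi)}}{\sqrt{|\sigma z|}}\right|\right), & \text{if } -\pi\le\varphi\le\pi-\delta<\pi,\\[1em] \mathcal O\left(\left|\dfrac{\mathrm{e}^{-\frac12|\sigma z|c^2(-\varphi)}}{\sqrt{|\sigma z|}}\right|\right), & \text{if } -3\pi<-3\pi+\delta\le\varphi<-\pi,\end{cases}$$ uniformly with respect to $\varphi$ and bounded real values of $\rho$. Here the sum over $\pi(m)$ runs over all non-negative integer solutions $(k_1,\ldots,k_m)$ of $k_1+2k_2+\cdots+mk_m=m$, and in $F^{(m)}$ there are $m-1$ entries $N$ followed by one entry $N-n$, with all $m$ lower entries equal to $\sigma$.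
   Context: $\widehat{\mathbb C}$ denotes the Riemann surface of the complex logarithm: its elements have a modulus in $(0,\infty)$ and an argument in $\mathbb R$; under multiplication moduli multiply and arguments add; $\mathrm{e}^{\mathrm{i}\alpha}$ with $\alpha\in\mathbb R$ acts by adding $\alpha$ to the argument; and $t^{a}=\exp(a(\log|t|+\mathrm{i}\arg t))$ for $t\in\widehat{\mathbb C}$, $a\in\mathbb C$. The variable $z$ ranges over $\widehat{\mathbb C}$. Write $\int_0^{[\eta]}$ for the integral along the ray from $0$ to $+\infty\,\mathrm{e}^{\mathrm{i}\eta}$, on which the integration variable has argument $\eta$. Hyperterminants. For $m\ge 1$, complex numbers $N_1,\ldots,N_m$ with $\Re(N_k)>1$, and $\sigma_1,\ldots,\sigma_m\in\widehat{\mathbb C}$ with $\arg\sigma_k\ne\arg\sigma_{k+1}\pmod{2\pi}$ for $k=1,\ldots,m-1$, define for $|\arg(\sigma_1 z)|<\pi$ $$F^{(m)}\left(z;\begin{array}{c}N_1,\ldots,N_m\\ \sigma_1,\ldots,\sigma_m\end{array}\right)=\int_0^{[\pi-\arg\sigma_1]}\cdots\int_0^{[\pi-\arg\sigma_m]}\frac{\mathrm{e}^{\sigma_1t_1}t_1^{N_1-1}}{z-t_1}\prod_{k=2}^m\frac{\mathrm{e}^{\sigma_kt_k}t_k^{N_k-1}}{t_{k-1}-t_k}\,\mathrm{d}t_m\cdots \mathrm{d}t_1 .$$ If $\arg\sigma_k=\arg\sigma_{k+1}\pmod{2\pi}$ for some $k$, define $$F^{(m)}\left(z;\begin{array}{c}N_1,\ldots,N_m\\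 \sigma_1,\ldots,\sigma_m\end{array}\right)=\lim_{\varepsilon\to0^+}F^{(m)}\left(z;\begin{array}{c}N_1,\,N_2,\,\ldots,\,N_m\\ \sigma_1\mathrm{e}^{(m-1)\varepsilon \mathrm{i}},\,\sigma_2\mathrm{e}^{(m-2)\varepsilon \mathrm{i}},\,\ldots,\,\sigma_m\end{array}\right).$$ In all cases $F^{(m)}$ is extended to all other values of $\arg z$ (as a function of $z\in\widehat{\mathbb C}$) by analytic continuation. The function $c(\varphi)$, for real $\varphi$, is defined by $$\tfrac12c^2(\varphi)=1+\mathrm{i}(\varphi-\pi)-\mathrm{e}^{\mathrm{i}(\varphi-\pi)},$$ taking the (continuous) branch of the square root with $c(\varphi)=-(\varphi-\pi)-\frac{\mathrm{i}}{6}(\varphi-\pi)^2+\frac1{36}(\varphi-\pi)^3+\cdots$ near $\varphi=\pi$. Here $c^2(\varphi)=(c(\varphi))^2$, $\operatorname{erfc}$ is the complementary error function, $\operatorname{erfc}^{k}(w)=(\operatorname{erfc}(w))^k$, and a bar denotes complex conjugation. The $\mathcal O$-terms refer to $|\sigma z|\to\infty$ with $m$, $n$, $\delta$ fixed. *)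

theory Defs
  imports "HOL-Complex_Analysis.Complex_Analysis"
begin

text \<open>The Riemann surface of the complex logarithm, as pairs (modulus, argument).\<close>

typedef log_surface = "{(r::real, \<theta>::real). 0 < r}"
  morphisms Rep_log_surface Abs_log_surface
  by (rule exI[of _ "(1, 0)"]) simp

setup_lifting type_definition_log_surface

lift_definition modulus :: "log_surface \<Rightarrow> real" is fst .

lift_definition argument :: "log_surface \<Rightarrow> real" is snd .

text \<open>Only meaningful for \<open>r > 0\<close>.\<close>

definition polar :: "real \<Rightarrow> real \<Rightarrow> log_surface" where
  "polar r \<theta> = Abs_log_surface (r, \<theta>)"

instantiation log_surface :: times
begin

lift_definition times_log_surface :: "log_surface \<Rightarrow> log_surface \<Rightarrow> log_surface"
  is "\<lambda>(r, \<theta>) (s, \<phi>). (r * s, \<theta> + \<phi>)"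
  by auto

instance ..

end

lemma modulus_pos [simp]: "0 < modulus t"
  by transfer auto

lemma modulus_mult [simp]: "modulus (s * t) = modulus s * modulus t"
  by transfer auto

lemma argument_mult [simp]: "argument (s * t) = argument s + argument t"
  by transfer auto

lemma modulus_polar [simp]: "0 < r \<Longrightarrow> modulus (polar r \<theta>) = r"
  by (simp add: polar_def modulus.rep_eq Abs_log_surface_inverse)

lemma argument_polar [simp]: "0 < r \<Longrightarrow> argument (polar r \<theta>) = \<theta>"
  by (simp add: polar_def argument.rep_eq Abs_log_surface_inverse)

lemma polar_modulus_argument [simp]: "polar (modulus t) (argument t) = t"
  by (simp add: polar_def modulus.rep_eq argument.rep_eq Rep_log_surface_inverse)

text \<open>Multiplication by \<open>e\<^sup>i\<^sup>\<alpha>\<close>.\<close>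

definition rotate_by :: "real \<Rightarrow> log_surface \<Rightarrow> log_surface" where
  "rotate_by \<alpha> t = polar (modulus t) (argument t + \<alpha>)"

text \<open>The underlying nonzero complex number.\<close>

definition proj :: "log_surface \<Rightarrow> complex" where
  "proj t = rcis (modulus t) (argument t)"

definition lpow :: "log_surface \<Rightarrow> complex \<Rightarrow> complex" where
  "lpow t a = exp (a * (of_real (ln (modulus t)) + \<i> * of_real (argument t)))"

text \<open>
  The logarithm is a global holomorphic chart onto the complex plane, so a function on the
  surface is holomorphic iff it is entire in the coordinate \<open>w = log|z| + \<i> arg z\<close>.
\<close>

definition holomorphic_log_surface :: "(log_surface \<Rightarrow> complex) \<Rightarrow> bool" where
  "holomorphic_log_surface G \<longleftrightarrow> (\<lambda>w. G (polar (exp (Re w)) (Im w))) holomorphic_on UNIV"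

definition ray_integral :: "real \<Rightarrow> (log_surface \<Rightarrow> complex) \<Rightarrow> complex" where
  "ray_integral \<eta> f = (LBINT r:{0<..}. f (polar r \<eta>) * cis \<eta>)"

text \<open>The head of the list is the direction of the outermost integral.\<close>

primrec iterated_ray_integral :: "real list \<Rightarrow> (log_surface list \<Rightarrow> complex) \<Rightarrow> complex" where
  "iterated_ray_integral [] f = f []"
| "iterated_ray_integral (\<eta> # \<eta>s) f =
     ray_integral \<eta> (\<lambda>t. iterated_ray_integral \<eta>s (\<lambda>ts. f (t # ts)))"

text \<open>
  Lists are indexed from 0, so \<open>ts ! k\<close> is the variable \<open>t\<^sub>k\<^sub>+\<^sub>1\<close> and \<open>(z # ts) ! k\<close> is its
  predecessor \<open>t\<^sub>k\<close>, with \<open>t\<^sub>0 = z\<close>.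
\<close>

definition hyperterminant_integral ::
  "complex list \<Rightarrow> log_surface list \<Rightarrow> log_surface \<Rightarrow> complex" where
  "hyperterminant_integral Ns \<sigma>s z =
     iterated_ray_integral (map (\<lambda>\<sigma>. pi - argument \<sigma>) \<sigma>s)
       (\<lambda>ts. \<Prod>k<length \<sigma>s.
          exp (proj (\<sigma>s ! k) * proj (ts ! k)) * lpow (ts ! k) (Ns ! k - 1)
            / (proj ((z # ts) ! k) - proj (ts ! k)))"

definition consecutive_args_agree :: "log_surface list \<Rightarrow> bool" where
  "consecutive_args_agree \<sigma>s \<longleftrightarrow>
     (\<exists>k. Suc k < length \<sigma>s \<and>
       (\<exists>j::int. argument (\<sigma>s ! k) = argument (\<sigma>s ! Suc k) + 2 * pi * of_int j))"

definition perturb :: "real \<Rightarrow> log_surface list \<Rightarrow> log_surface list" where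
  "perturb \<epsilon> \<sigma>s =
     map (\<lambda>k. rotate_by (real (length \<sigma>s - Suc k) * \<epsilon>) (\<sigma>s ! k)) [0..<length \<sigma>s]"

text \<open>The values on the sector \<open>|arg(\<sigma>\<^sub>1 z)| < \<pi>\<close>, before analytic continuation.\<close>

definition hyperterminant_sector ::
  "complex list \<Rightarrow> log_surface list \<Rightarrow> log_surface \<Rightarrow> complex" where
  "hyperterminant_sector Ns \<sigma>s z =
     (if consecutive_args_agree \<sigma>s
      then Lim (at_right 0) (\<lambda>\<epsilon>. hyperterminant_integral Ns (perturb \<epsilon> \<sigma>s) z)
      else hyperterminant_integral Ns \<sigma>s z)"

text \<open>
  The order is the common length of the two lists (at least 1). By the identity theorem there
  is at most one such continuation.
\<close>

definition hyperterminant ::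
  "complex list \<Rightarrow> log_surface list \<Rightarrow> log_surface \<Rightarrow> complex" where
  "hyperterminant Ns \<sigma>s =
     (THE G. holomorphic_log_surface G \<and>
        (\<forall>z. \<bar>argument (hd \<sigma>s * z)\<bar> < pi \<longrightarrow> G z = hyperterminant_sector Ns \<sigma>s z))"

text \<open>
  The right-hand side of the equation vanishes only at \<open>\<phi> = \<pi>\<close>, so continuity and the expansion
  at that point select a unique branch of the square root.
\<close>

definition c_fun :: "real \<Rightarrow> complex" where
  "c_fun = (THE c.
     continuous_on UNIV c \<and>
     (\<forall>\<phi>. (c \<phi>)\<^sup>2 / 2 = 1 + \<i> * of_real (\<phi> - pi) - exp (\<i> * of_real (\<phi> - pi))) \<and>
     (\<lambda>\<phi>. c \<phi> - (- of_real (\<phi> - pi) - \<i> / 6 * of_real (\<phi> - pi) ^ 2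
                   + 1 / 36 * of_real (\<phi> - pi) ^ 3))
       \<in> O[at pi](\<lambda>\<phi>. of_real (\<phi> - pi) ^ 4))"

definition erfc :: "complex \<Rightarrow> complex" where
  "erfc w = 1 - 2 / of_real (sqrt pi) * contour_integral (linepath 0 w) (\<lambda>t. exp (- t\<^sup>2))"

text \<open>
  The solutions \<open>(k\<^sub>1, \<dots>, k\<^sub>m)\<close> of \<open>k\<^sub>1 + 2 k\<^sub>2 + \<dots> + m k\<^sub>m = m\<close>, extended by zero outside
  \<open>{1..m}\<close> so that each solution is represented by exactly one function.
\<close>

definition partition_solutions :: "nat \<Rightarrow> (nat \<Rightarrow> nat) set" where
  "partition_solutions m =
     {k. (\<forall>j. j \<notin> {1..m} \<longrightarrow> k j = 0) \<and> (\<Sum>j=1..m. j * k j) = m}"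

end

theory Submission
  imports Defs "HOL-Probability.Sinc_Integral" "HOL-Probability.Characteristic_Functions"
    "HOL-Real_Asymp.Real_Asymp"
begin

text \<open>
  Put \<open>w = log|\<sigma>z| + i(\<phi> - \<pi>)\<close> and substitute exponentials for the integration variables. With the weight
  \<open>f(v) = exp(-e\<^sup>v + (N-1)v)\<close> and the kernel \<open>1/(e\<^sup>w - 1)\<close>, the hyperterminant becomes, up to an explicit
  factor, an \<open>m\<close>-fold iterated Cauchy transform on the strip \<open>-2\<pi> < Im w < 0\<close>, and the limit over separated
  rays is the boundary value of each transform from below.

  For \<open>n = 0\<close> let \<open>G\<^sub>j\<close> be the entire continuation of the single transform of \<open>f\<^sup>j\<close>. The complete homogeneous
  polynomial whose power sums are \<open>(2\<pi>i)\<^sup>j\<^sup>-\<^sup>1G\<^sub>j\<close> has the right jump across the strip and decays at one end,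
  so a residue computation identifies it with the iterated transform. This is where the sum over partitions
  comes from. A factor \<open>e\<^sup>-\<^sup>n\<^sup>w\<close> in the innermost transform is removed by the identity
  \<open>e\<^sup>w/(e\<^sup>w\<^sup>-\<^sup>v - 1) = e\<^sup>v(1 + 1/(e\<^sup>w\<^sup>-\<^sup>v - 1))\<close>, at the cost of lower-order terms that contribute only to the error.

  It remains to compare \<open>G\<^sub>j/(2\<pi>if\<^sup>j)\<close> with half an error function. As functions of \<open>\<phi>\<close> both satisfy
  first-order equations with nearly equal right-hand sides; the two ends \<open>\<phi> < \<pi>\<close> and \<open>\<phi> > \<pi>\<close> are linked by
  the jump relation, and integrating from either side gives the uniform estimate together with the
  normalising constant. The second expansion follows from the first by complex conjugation.
\<close>

subsection \<open>The Cauchy kernel in the logarithmic coordinate\<close>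

text \<open>The estimates must hold across phi = pi, where the evaluation point meets the line of
  integration and bounds read off the Cauchy integral blow up. A single transform divided by its
  weight, however, has an explicit entire derivative. This gives the continuation at once, and
  bounds up to the cut follow by moving vertically from the interior of the strip. The factor
  1/sqrt|sigma z| has one source: when N - |sigma z| stays bounded, the mass of the weight is
  smaller than its value near the peak by this factor. The constants split off for n > 0 are
  integrals against the weight, hence carry it too. The two exponents in the error terms come from
  weighted homogeneity. Put q = exp(-|sigma z| (1 + cos phi)). Up to phi = pi the j-th normalised
  transform has size q^j, so a polynomial of weight m has size q^m. Beyond phi = pi it is merely
  bounded and only its distance from the error function is small, of relative size q, so that a
  single factor q survives.\<close>

definition lker :: "complex \<Rightarrow> complex" where
  "lker w = 1 / (exp w - 1)"

text \<open>On the real line \<open>gwt 1 b\<close> is the weight f, with \<open>b\<close> = N - 1.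
  The scale \<open>a\<close> is kept free because the j-th power of f is
  \<open>gwt j (j * b)\<close>, so that one analysis serves all transforms in the final sum.\<close>

definition gwt :: "real \<Rightarrow> real \<Rightarrow> complex \<Rightarrow> complex" where
  "gwt a b w = exp (- of_real a * exp w + of_real b * w)"

text \<open>With z = exp w and t = exp v the form dt / (z - t) becomes dv / (exp (w - v) - 1). The
  cuts of the transform are the lines on which Im w is a multiple of 2 pi.\<close>

definition lcauchy :: "(complex \<Rightarrow> complex) \<Rightarrow> complex \<Rightarrow> complex" where
  "lcauchy H w = (\<integral>v. H (of_real v) * lker (w - of_real v) \<partial>lborel)"

lemma cos_le_cos_strip:
  assumes "0 \<le> s" "s \<le> pi" "-2*pi + s \<le> \<theta>" "\<theta> \<le> -s"
  shows "cos \<theta> \<le> cos s"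
proof (cases "- \<theta> \<le> pi")
  case True
  then have "cos (- \<theta>) \<le> cos s" using assms by (intro cos_monotone_0_pi_le) auto
  then show ?thesis by simp
next
  case False
  then have "cos (2*pi + \<theta>) \<le> cos s" using assms by (intro cos_monotone_0_pi_le) auto
  then show ?thesis by (simp add: cos_add)
qed

text \<open>With r = |exp w| the squared modulus is at least r^2 - 2 r cos s + 1. Completing the
  square in r leaves sin^2 s; completing it in r cos s leaves r^2 sin^2 s. The second form gives the
  decay of the kernel to the right.\<close>

lemma norm_exp_minus_one_ge:
  assumes "0 \<le> s" "s \<le> pi/2" "cos (Im w) \<le> cos s"
  shows "sin s \<le> norm (exp w - 1)" "sin s * exp (Re w) \<le> norm (exp w - 1)"
proof -
  define r where "r = exp (Re w)"
  have r: "r > 0" by (simp add: r_def)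
  have n: "(norm (exp w - 1))\<^sup>2 = r\<^sup>2 - 2 * r * cos (Im w) + 1"
    unfolding cmod_power2 r_def
    by (simp add: Re_exp Im_exp power2_diff power_mult_distrib sin_squared_eq algebra_simps)
  have s0: "sin s \<ge> 0" using assms by (simp add: sin_ge_zero)
  have ge: "r\<^sup>2 - 2 * r * cos s + 1 \<le> (norm (exp w - 1))\<^sup>2"
    unfolding n using assms(3) r by simp
  have "r\<^sup>2 - 2 * r * cos s + 1 = (r - cos s)\<^sup>2 + (sin s)\<^sup>2"
    by (simp add: sin_squared_eq power2_diff algebra_simps)
  then have "(sin s)\<^sup>2 \<le> (norm (exp w - 1))\<^sup>2" using ge zero_le_power2[of "r - cos s"] by linarith
  then show "sin s \<le> norm (exp w - 1)" by (rule power2_le_imp_le) simp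
  have "r\<^sup>2 - 2 * r * cos s + 1 = (1 - r * cos s)\<^sup>2 + (sin s * r)\<^sup>2"
    by (simp add: sin_squared_eq power_mult_distrib power2_diff algebra_simps)
  then have "(sin s * r)\<^sup>2 \<le> (norm (exp w - 1))\<^sup>2"
    using ge zero_le_power2[of "1 - r * cos s"] by linarith
  then show "sin s * exp (Re w) \<le> norm (exp w - 1)" unfolding r_def by (rule power2_le_imp_le) simp
qed

lemma norm_lker_le:
  assumes "0 < s" "s \<le> pi/2" "cos (Im w) \<le> cos s"
  shows "norm (lker w) \<le> 1 / sin s" "norm (lker w) \<le> exp (- Re w) / sin s"
proof -
  have s: "sin s > 0" using assms by (simp add: sin_gt_zero)
  note b = norm_exp_minus_one_ge[of s w]
  have p: "norm (exp w - 1) > 0" using b assms s by linarith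
  show "norm (lker w) \<le> 1 / sin s"
    using b assms s p by (simp add: lker_def norm_divide frac_le)
  have "1 / norm (exp w - 1) \<le> 1 / (sin s * exp (Re w))"
    using b assms s by (intro frac_le) auto
  then show "norm (lker w) \<le> exp (- Re w) / sin s"
    by (simp add: lker_def norm_divide exp_minus field_simps)
qed

lemma exp_ne_1_strip:
  assumes "-2*pi < Im w" "Im w < 0"
  shows "exp w \<noteq> 1"
proof
  assume "exp w = 1"
  then obtain n::int where "Im w = of_int (2*n) * pi" by (auto simp: exp_eq_1)
  with assms have "of_int (2*n) * pi < 0 * pi" "(-2) * pi < of_int (2*n) * pi" by auto
  then have "real_of_int (2*n) < 0" "-2 < real_of_int (2*n)"
    using pi_gt_zero by (simp_all only: mult_less_cancel_right_pos)
  then have "n < 0" "- 1 < real_of_int n" by simp_all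
  moreover from this have "real_of_int n \<le> -1" by linarith
  ultimately show False by linarith
qed

lemma lker_holomorphic [holomorphic_intros]:
  assumes "f holomorphic_on A" "\<And>w. w \<in> A \<Longrightarrow> exp (f w) \<noteq> 1"
  shows "(\<lambda>w. lker (f w)) holomorphic_on A"
  unfolding lker_def
  by (intro holomorphic_on_divide holomorphic_on_const holomorphic_on_diff holomorphic_on_exp' assms) (simp add: assms)

lemma lker_continuous [continuous_intros]:
  assumes "continuous_on A f" "\<And>w. w \<in> A \<Longrightarrow> exp (f w) \<noteq> 1"
  shows "continuous_on A (\<lambda>w. lker (f w))"
  unfolding lker_def
  by (intro continuous_on_divide continuous_on_const continuous_on_diff continuous_on_exp assms) (simp add: assms)

lemma lker_shift_period: "lker (w - 2 * of_real pi * \<i>) = lker w"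
proof -
  have "exp (w - 2 * of_real pi * \<i>) = exp w"
    by (simp add: exp_diff)
  then show ?thesis by (simp add: lker_def)
qed

lemma exp_mult_lker:
  assumes "exp (w - v) \<noteq> 1"
  shows "exp w * lker (w - v) = exp v * (1 + lker (w - v))"
proof -
  have "exp w = exp v * exp (w - v)" by (simp add: exp_diff)
  then show ?thesis using assms by (simp add: lker_def field_simps)
qed

text \<open>Majorants of the shape B / (1 + v^2) serve throughout: the weight satisfies such a
  bound, bounded kernels preserve it, and its integral is B pi.\<close>

lemma integrable_inverse_square [simp, intro]: "integrable lborel (\<lambda>v::real. B / (1 + v\<^sup>2))"
proof -
  have "integrable lborel (\<lambda>x::real. inverse (1 + x\<^sup>2))"
    using integrable_inverse_1_plus_square
    by (simp add: set_integrable_def einterval_def)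
  then have "integrable lborel (\<lambda>x::real. B * inverse (1 + x\<^sup>2))" by (rule integrable_mult_right)
  then show ?thesis by (simp add: field_simps)
qed

lemma gwt_real_le:
  assumes "a > 0" "b > 0"
  obtains B where "\<And>v::real. exp (- a * exp v + b * v) \<le> B / (1 + v\<^sup>2)" "B > 0"
proof -
  define h where "h v = (1 + v\<^sup>2) * exp (- a * exp v + b * v)" for v :: real
  have top: "(h \<longlongrightarrow> 0) at_top" unfolding h_def using assms by real_asymp
  have bot: "(h \<longlongrightarrow> 0) at_bot" unfolding h_def using assms by real_asymp
  obtain T where T: "\<And>v. v \<ge> T \<Longrightarrow> h v < 1"
    using order_tendstoD(2)[OF top, of 1] by (auto simp: eventually_at_top_linorder)
  obtain S where S: "\<And>v. v \<le> S \<Longrightarrow> h v < 1"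
    using order_tendstoD(2)[OF bot, of 1] by (auto simp: eventually_at_bot_linorder)
  have "compact {S..T}" by simp
  moreover have "continuous_on {S..T} h" unfolding h_def by (intro continuous_intros)
  ultimately have "bounded (h ` {S..T})" by (meson compact_continuous_image compact_imp_bounded)
  then obtain C where C: "\<And>v. v \<in> {S..T} \<Longrightarrow> norm (h v) \<le> C"
    unfolding bounded_iff by blast
  have "h v \<le> max 1 C" for v
    using T[of v] S[of v] C[of v] by (cases "v \<ge> T"; cases "v \<le> S") (auto simp: le_max_iff_disj)
  then have "exp (- a * exp v + b * v) \<le> max 1 C / (1 + v\<^sup>2)" for v
    by (simp add: h_def pos_le_divide_eq add_pos_nonneg mult.commute[of _ "1 + _"])
  then show ?thesis using that[of "max 1 C"] by auto
qed

lemma norm_gwt: "norm (gwt a b w) = exp (- a * exp (Re w) * cos (Im w) + b * Re w)"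
  by (simp add: gwt_def Re_exp)

lemma norm_gwt_le:
  assumes "a > 0" "b > 0"
  obtains B where "\<And>w. \<bar>Im w\<bar> \<le> 1 \<Longrightarrow> norm (gwt a b w) \<le> B / (1 + (Re w)\<^sup>2)" "B > 0"
proof -
  obtain B where B: "\<And>v::real. exp (- (a/2) * exp v + b * v) \<le> B / (1 + v\<^sup>2)" "B > 0"
    using gwt_real_le[of "a/2" b] assms by auto
  have "norm (gwt a b w) \<le> B / (1 + (Re w)\<^sup>2)" if "\<bar>Im w\<bar> \<le> 1" for w
  proof -
    \<comment> \<open>The height 1 is below pi/3, so cos (Im w) >= 1/2 and half of the rate
      \<open>a\<close> survives off the real axis.\<close>
    have "1 \<le> pi/3" using pi_gt3 by simp
    then have "cos (pi/3) \<le> cos \<bar>Im w\<bar>" using that by (intro cos_monotone_0_pi_le) auto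
    then have c: "1/2 \<le> cos (Im w)" by (simp add: cos_60)
    have "norm (gwt a b w) \<le> exp (- (a/2) * exp (Re w) + b * Re w)"
      unfolding norm_gwt using c assms by (auto simp: field_simps)
    also have "\<dots> \<le> B / (1 + (Re w)\<^sup>2)" by (rule B)
    finally show ?thesis .
  qed
  then show ?thesis using that B(2) by blast
qed

lemma gwt_holomorphic [holomorphic_intros]:
  assumes "f holomorphic_on A" shows "(\<lambda>w. gwt a b (f w)) holomorphic_on A"
  unfolding gwt_def using assms by (intro holomorphic_intros)

lemma gwt_continuous [continuous_intros]:
  assumes "continuous_on A f" shows "continuous_on A (\<lambda>w. gwt a b (f w))"
  unfolding gwt_def using assms by (intro continuous_intros)

lemma gwt_nonzero [simp]: "gwt a b w \<noteq> 0" by (simp add: gwt_def)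

lemma gwt_of_real: "gwt a b (of_real v) = of_real (exp (- a * exp v + b * v))"
  unfolding gwt_def by (simp only: exp_of_real flip: of_real_mult of_real_minus of_real_add)

lemma gwt_shift_period: "gwt a b (w - 2 * of_real pi * \<i>) = exp (- 2 * of_real pi * \<i> * of_real b) * gwt a b w"
proof -
  have "exp (w - 2 * of_real pi * \<i>) = exp w"
    by (simp add: exp_diff)
  then show ?thesis by (simp add: gwt_def algebra_simps flip: exp_add)
qed

subsection \<open>Integrals depending on a complex parameter\<close>

text \<open>A majorant on a disc suffices for differentiation under the integral: Cauchy's
  inequality bounds the derivative of the integrand on the half-size disc by G / (r/2), and this
  dominates all difference quotients.\<close>

lemma has_field_derivative_lebesgue_integral:
  fixes F :: "complex \<Rightarrow> real \<Rightarrow> complex"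
  assumes r: "r > 0"
    and hol: "\<And>v. (\<lambda>w. F w v) holomorphic_on (cball w0 r)"
    and meas: "\<And>w. w \<in> cball w0 r \<Longrightarrow> F w \<in> borel_measurable lborel"
    and G: "integrable lborel G"
    and bd: "\<And>w v. w \<in> cball w0 r \<Longrightarrow> norm (F w v) \<le> G v"
  shows "((\<lambda>w. \<integral>v. F w v \<partial>lborel) has_field_derivative
           (\<integral>v. deriv (\<lambda>w. F w v) w0 \<partial>lborel)) (at w0)"
  unfolding DERIV_def tendsto_at_iff_sequentially comp_def
proof (intro allI impI)
  fix X :: "nat \<Rightarrow> complex"
  assume X0: "\<forall>i. X i \<in> UNIV - {0}" and X: "X \<longlonglongrightarrow> 0"
  have int: "integrable lborel (F w)" if "w \<in> cball w0 r" for w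
    using order_trans[OF bd[OF that] abs_ge_self]
    by (intro Bochner_Integration.integrable_bound[OF G meas[OF that]]) auto
  have dif: "((\<lambda>w. F w v) has_field_derivative deriv (\<lambda>w. F w v) w) (at w)" if "w \<in> ball w0 r" for v w
    using holomorphic_derivI[OF holomorphic_on_subset[OF hol ball_subset_cball]] that by auto
  have dbd: "norm (deriv (\<lambda>w. F w v) w) \<le> G v / (r/2)" if w: "w \<in> ball w0 (r/2)" for v w
  proof -
    have sub: "cball w (r/2) \<subseteq> cball w0 r"
    proof
      fix y assume "y \<in> cball w (r/2)"
      with w show "y \<in> cball w0 r" using dist_triangle[of w0 y w] by (auto simp: dist_commute)
    qed
    have "norm ((deriv ^^ 1) (\<lambda>w. F w v) w) \<le> fact 1 * G v / (r/2)^1"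
    proof (rule Cauchy_inequality)
      show "(\<lambda>w. F w v) holomorphic_on ball w (r/2)"
        by (rule holomorphic_on_subset[OF hol]) (use sub ball_subset_cball in blast)
      show "continuous_on (cball w (r/2)) (\<lambda>w. F w v)"
        by (rule continuous_on_subset[OF holomorphic_on_imp_continuous_on[OF hol] sub])
      show "norm (F x v) \<le> G v" if "norm (w - x) = r/2" for x
        using that sub by (intro bd) (auto simp: dist_norm subset_eq)
    qed (use r in auto)
    then show ?thesis by simp
  qed
  have lip: "norm (F (w0 + h) v - F w0 v) \<le> G v / (r/2) * norm h" if "norm h < r/2" for h v
  proof -
    have "norm (F (w0 + h) v - F w0 v) \<le> G v / (r/2) * norm (w0 + h - w0)"
    proof (rule field_differentiable_bound[of "ball w0 (r/2)"])
      show "((\<lambda>w. F w v) has_field_derivative deriv (\<lambda>w. F w v) z) (at z within ball w0 (r/2))"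
        if "z \<in> ball w0 (r/2)" for z
        using dif[of z v] that r by (auto intro: has_field_derivative_at_within)
    qed (use dbd that r in \<open>auto simp: dist_norm\<close>)
    then show ?thesis by simp
  qed
  obtain n0 where n0: "\<And>n. n \<ge> n0 \<Longrightarrow> norm (X n) < r/2"
    using LIMSEQ_D[OF X, of "r/2"] r by auto
  \<comment> \<open>Dropping finitely many terms keeps every increment inside the half-size disc;
    the offset is undone at the end.\<close>
  define Y where "Y n = X (n + n0)" for n
  have Y: "norm (Y n) < r/2" "Y n \<noteq> 0" for n using n0 X0 by (auto simp: Y_def)
  have Yl: "Y \<longlonglongrightarrow> 0" unfolding Y_def using X by (rule LIMSEQ_ignore_initial_segment)
  have mem: "w0 + Y n \<in> cball w0 r" "w0 \<in> cball w0 r" for n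
    using Y(1)[of n] r by (auto simp: dist_norm)
  let ?D = "\<lambda>n v. (F (w0 + Y n) v - F w0 v) / Y n"
  have lim: "(\<lambda>n. ?D n v) \<longlonglongrightarrow> deriv (\<lambda>w. F w v) w0" for v
  proof -
    have "((\<lambda>h. (F (w0 + h) v - F w0 v) / h) \<longlongrightarrow> deriv (\<lambda>w. F w v) w0) (at 0)"
      using dif[of w0 v] r unfolding DERIV_def by simp
    then show ?thesis unfolding tendsto_at_iff_sequentially comp_def using Y(2) Yl by auto
  qed
  have measD: "?D n \<in> borel_measurable lborel" for n
    using meas[OF mem(1)] meas[OF mem(2)] by measurable
  have "(\<lambda>n. \<integral>v. ?D n v \<partial>lborel) \<longlonglongrightarrow> (\<integral>v. deriv (\<lambda>w. F w v) w0 \<partial>lborel)"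
  proof (rule integral_dominated_convergence[where w="\<lambda>v. G v / (r/2)"])
    show "(\<lambda>v. deriv (\<lambda>w. F w v) w0) \<in> borel_measurable lborel"
      by (rule borel_measurable_LIMSEQ_metric[OF measD]) (use lim in auto)
    show "AE v in lborel. norm (?D n v) \<le> G v / (r/2)" for n
      using lip[OF Y(1)] Y(2) by (auto simp: norm_divide divide_le_eq)
    show "integrable lborel (\<lambda>v. G v / (r/2))" using G by (rule integrable_divide)
  qed (use lim measD in auto)
  moreover have "(\<integral>v. ?D n v \<partial>lborel)
      = ((\<integral>v. F (w0 + Y n) v \<partial>lborel) - (\<integral>v. F w0 v \<partial>lborel)) / Y n" for n
    using Bochner_Integration.integral_diff[OF int[OF mem(1)] int[OF mem(2)]] by simp
  ultimately have "(\<lambda>n. ((\<integral>v. F (w0 + Y n) v \<partial>lborel) - (\<integral>v. F w0 v \<partial>lborel)) / Y n)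
      \<longlonglongrightarrow> (\<integral>v. deriv (\<lambda>w. F w v) w0 \<partial>lborel)" by (simp only:)
  then show "(\<lambda>n. ((\<integral>v. F (w0 + X n) v \<partial>lborel) - (\<integral>v. F w0 v \<partial>lborel)) / X n)
      \<longlonglongrightarrow> (\<integral>v. deriv (\<lambda>w. F w v) w0 \<partial>lborel)"
    unfolding Y_def
    by (rule LIMSEQ_offset)
qed

text \<open>Integration by parts on the whole line, in the form needed for the recurrence of the
  masses and for the differential equation.\<close>

lemma lborel_integral_derivative_eq_0:
  fixes g :: "real \<Rightarrow> complex"
  assumes "\<And>v. (g has_vector_derivative g' v) (at v)" "continuous_on UNIV g'"
    "integrable lborel g'" "(g \<longlongrightarrow> 0) at_top" "(g \<longlongrightarrow> 0) at_bot"
  shows "(\<integral>v. g' v \<partial>lborel) = 0"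
proof -
  have "(LBINT v=-\<infinity>..\<infinity>. g' v) = 0 - 0"
    using assms
    by (intro interval_integral_FTC_integrable[where F=g])
       (auto simp: ereal_tendsto_simps einterval_def set_integrable_def continuous_on_eq_continuous_at)
  then show ?thesis by (simp add: interval_lebesgue_integral_def einterval_def set_lebesgue_integral_def)
qed

lemma has_field_derivative_lker:
  assumes "exp w \<noteq> 1"
  shows "(lker has_field_derivative - exp w / (exp w - 1)\<^sup>2) (at w)"
  unfolding lker_def [abs_def] using assms
  by (auto intro!: derivative_eq_intros simp: field_simps power2_eq_square)

lemma norm_lcauchy_integrand_le:
  fixes v :: real
  assumes bd: "\<And>v::real. norm (H (of_real v)) \<le> B / (1 + v\<^sup>2)"
    and s: "0 < s" "s \<le> pi/2" "-2*pi + s \<le> Im w" "Im w \<le> - s"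
  shows "norm (H (of_real v) * lker (w - of_real v)) \<le> B / sin s / (1 + v\<^sup>2)"
proof -
  have B: "B \<ge> 0" using order_trans[OF norm_ge_zero bd[of 0]] by simp
  have "norm (lker (w - of_real v)) \<le> 1 / sin s"
    using s by (intro norm_lker_le cos_le_cos_strip) auto
  then have "norm (H (of_real v)) * norm (lker (w - of_real v)) \<le> B / (1 + v\<^sup>2) * (1 / sin s)"
    by (intro mult_mono bd) (use B in auto)
  then show ?thesis by (simp add: norm_mult mult.commute)
qed

lemma lcauchy_has_field_derivative:
  assumes meas: "(\<lambda>v::real. H (of_real v)) \<in> borel_measurable borel"
    and bd: "\<And>v::real. norm (H (of_real v)) \<le> B / (1 + v\<^sup>2)"
    and w: "-2*pi < Im w" "Im w < 0"
  shows "(lcauchy H has_field_derivative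
           (\<integral>v. H (of_real v) * (- exp (w - of_real v) / (exp (w - of_real v) - 1)\<^sup>2) \<partial>lborel)) (at w)"
proof -
  define r where "r = min (- Im w) (Im w + 2*pi) / 3"
  have r: "r > 0" "3 * r \<le> - Im w" "3 * r \<le> Im w + 2*pi" using w by (auto simp: r_def)
  then have rpi: "r \<le> pi/2" by linarith
  have st: "-2*pi + r \<le> Im (z - of_real v)" "Im (z - of_real v) \<le> - r" if "z \<in> cball w r" for z and v :: real
  proof -
    have "\<bar>Im (w - z)\<bar> \<le> r" using that abs_Im_le_cmod[of "w - z"] by (auto simp: dist_norm)
    then show "-2*pi + r \<le> Im (z - of_real v)" "Im (z - of_real v) \<le> - r" using r by auto
  qed
  have ne: "exp (z - of_real v) \<noteq> 1" if "z \<in> cball w r" for z and v :: real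
    using st[OF that, of v] r by (intro exp_ne_1_strip) auto
  have der: "deriv (\<lambda>w. H (of_real v) * lker (w - of_real v)) w =
      H (of_real v) * (- exp (w - of_real v) / (exp (w - of_real v) - 1)\<^sup>2)" for v :: real
  proof (rule DERIV_imp_deriv)
    have "((\<lambda>w. lker (w - of_real v)) has_field_derivative
        - exp (w - of_real v) / (exp (w - of_real v) - 1)\<^sup>2 * 1) (at w)"
      using r ne[of w v] by (intro DERIV_chain'[of "\<lambda>w. w - of_real v" 1, OF _ has_field_derivative_lker])
        (auto intro!: derivative_eq_intros)
    from DERIV_cmult[OF this, of "H (of_real v)"]
    show "((\<lambda>w. H (of_real v) * lker (w - of_real v)) has_field_derivative
        H (of_real v) * (- exp (w - of_real v) / (exp (w - of_real v) - 1)\<^sup>2)) (at w)" by simp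
  qed
  have "((\<lambda>w. \<integral>v. H (of_real v) * lker (w - of_real v) \<partial>lborel) has_field_derivative
       (\<integral>v. deriv (\<lambda>w. H (of_real v) * lker (w - of_real v)) w \<partial>lborel)) (at w)"
  proof (rule has_field_derivative_lebesgue_integral[OF r(1), where G="\<lambda>v. B / sin r / (1 + v\<^sup>2)"])
    show "(\<lambda>w. H (of_real v) * lker (w - of_real v)) holomorphic_on cball w r" for v :: real
      using ne by (intro holomorphic_intros) auto
    show "(\<lambda>v. H (of_real v) * lker (z - of_real v)) \<in> borel_measurable lborel"
      if "z \<in> cball w r" for z
    proof -
      have "continuous_on UNIV (\<lambda>v::real. lker (z - of_real v))"
        using ne[OF that] by (intro continuous_intros) auto
      then have "(\<lambda>v::real. lker (z - of_real v)) \<in> borel_measurable borel"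
        by (rule borel_measurable_continuous_onI)
      then show ?thesis using meas by simp
    qed
    show "norm (H (of_real v) * lker (z - of_real v)) \<le> B / sin r / (1 + v\<^sup>2)"
      if "z \<in> cball w r" for z and v :: real
      using st[OF that, of 0] r rpi by (intro norm_lcauchy_integrand_le bd) auto
  qed (rule integrable_inverse_square)
  then show ?thesis unfolding der lcauchy_def [abs_def] .
qed

lemma lcauchy_holomorphic:
  assumes "(\<lambda>v::real. H (of_real v)) \<in> borel_measurable borel"
    and "\<And>v::real. norm (H (of_real v)) \<le> B / (1 + v\<^sup>2)"
  shows "lcauchy H holomorphic_on {w. -2*pi < Im w \<and> Im w < 0}"
  using lcauchy_has_field_derivative[OF assms]
  by (auto simp: holomorphic_on_def field_differentiable_def intro: has_field_derivative_at_within)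

lemma integrable_lcauchy:
  assumes meas: "(\<lambda>v::real. H (of_real v)) \<in> borel_measurable borel"
    and bd: "\<And>v::real. norm (H (of_real v)) \<le> B / (1 + v\<^sup>2)"
    and w: "-2*pi < Im w" "Im w < 0"
  shows "integrable lborel (\<lambda>v. H (of_real v) * lker (w - of_real v))"
proof -
  define s where "s = min (- Im w) (Im w + 2*pi) / 2"
  have s: "0 < s" "s \<le> pi/2" "-2*pi + s \<le> Im w" "Im w \<le> - s"
    using w by (auto simp: s_def min_def field_simps)
  have "continuous_on UNIV (\<lambda>v::real. lker (w - of_real v))"
    using w by (intro continuous_intros exp_ne_1_strip) auto
  then have "(\<lambda>v::real. lker (w - of_real v)) \<in> borel_measurable borel"
    by (rule borel_measurable_continuous_onI)
  then have m: "(\<lambda>v. H (of_real v) * lker (w - of_real v)) \<in> borel_measurable lborel" using meas by simp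
  have "norm (H (of_real v) * lker (w - of_real v)) \<le> norm (B / sin s / (1 + v\<^sup>2))" for v :: real
    using norm_lcauchy_integrand_le[OF bd s, of v] abs_ge_self[of "B / sin s / (1 + v\<^sup>2)"] by simp
  then show ?thesis
    by (intro Bochner_Integration.integrable_bound[OF integrable_inverse_square[of "B / sin s"] m]) auto
qed

lemma norm_integral_inverse_square_le:
  assumes "\<And>v::real. norm (f v :: complex) \<le> B / (1 + v\<^sup>2)"
  shows "norm (\<integral>v. f v \<partial>lborel) \<le> B * pi"
proof -
  have i: "(\<integral>v. B / (1 + (v::real)\<^sup>2) \<partial>lborel) = B * pi"
  proof -
    have "(\<integral>v. inverse (1 + (v::real)\<^sup>2) \<partial>lborel) = pi"
      using LBINT_inverse_1_plus_square
      by (simp add: interval_lebesgue_integral_def einterval_def set_lebesgue_integral_def)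
    moreover have "(\<integral>v. B / (1 + (v::real)\<^sup>2) \<partial>lborel) = B * (\<integral>v. inverse (1 + (v::real)\<^sup>2) \<partial>lborel)"
      by (simp add: divide_inverse)
    ultimately show ?thesis by simp
  qed
  have B: "B \<ge> 0" using order_trans[OF norm_ge_zero assms[of 0]] by simp
  have "norm (\<integral>v. f v \<partial>lborel) \<le> (\<integral>v. norm (f v) \<partial>lborel)" by (rule integral_norm_bound)
  also have "\<dots> \<le> (\<integral>v. B / (1 + (v::real)\<^sup>2) \<partial>lborel)"
    by (rule integral_mono') (use assms B in auto)
  finally show ?thesis unfolding i .
qed

lemma norm_lcauchy_le:
  assumes bd: "\<And>v::real. norm (H (of_real v)) \<le> B / (1 + v\<^sup>2)"
    and s: "0 < s" "s \<le> pi/2" "-2*pi + s \<le> Im w" "Im w \<le> - s"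
  shows "norm (lcauchy H w) \<le> B / sin s * pi"
  unfolding lcauchy_def
  by (intro norm_integral_inverse_square_le norm_lcauchy_integrand_le assms)

subsection \<open>Rectangular contours in a strip\<close>

lemma contour_integral_horizontal:
  assumes "a < b"
  shows "contour_integral (linepath (Complex a t) (Complex b t)) f = integral {a..b} (\<lambda>u. f (Complex u t))"
proof -
  let ?c = "\<i> * of_real t"
  have "contour_integral (linepath (Complex a t) (Complex b t)) f
      = contour_integral (linepath (of_real a) (of_real b)) (\<lambda>z. f (z + ?c))"
    unfolding contour_integral_integral
    by (intro integral_cong) (simp add: linepath_def Complex_eq algebra_simps scaleR_conv_of_real)
  also have "\<dots> = integral {a..b} (\<lambda>u. f (of_real u + ?c))"
    using contour_integral_linepath_Reals_eq[of "of_real a" "of_real b" "\<lambda>z. f (z + ?c)"] assms by simp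
  finally show ?thesis by (simp add: Complex_eq)
qed

text \<open>Rectangles of growing width, whose vertical sides contribute at most \<open>S L\<close>
  times their length. Integrability is asked of the difference of the two edges only: in the residue
  argument a single edge tends to 0 on the right at no known rate, while the difference is the jump
  and decays well.\<close>

lemma lborel_integral_strip_difference:
  assumes ab: "\<alpha> < \<beta>" and L0: "L0 > 0"
    and cont: "\<And>L. L \<ge> L0 \<Longrightarrow> continuous_on (path_image (rectpath (Complex (-L) \<alpha>) (Complex L \<beta>))) H"
    and side: "\<And>L t. L \<ge> L0 \<Longrightarrow> \<alpha> \<le> t \<Longrightarrow> t \<le> \<beta> \<Longrightarrow> norm (H (Complex L t)) \<le> S L"
              "\<And>L t. L \<ge> L0 \<Longrightarrow> \<alpha> \<le> t \<Longrightarrow> t \<le> \<beta> \<Longrightarrow> norm (H (Complex (-L) t)) \<le> S L"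
    and S: "(S \<longlongrightarrow> 0) at_top"
    and int: "integrable lborel (\<lambda>u. H (Complex u \<alpha>) - H (Complex u \<beta>))"
    and rect: "\<And>L. L \<ge> L0 \<Longrightarrow> contour_integral (rectpath (Complex (-L) \<alpha>) (Complex L \<beta>)) H = I"
  shows "(\<integral>u. H (Complex u \<alpha>) - H (Complex u \<beta>) \<partial>lborel) = I"
proof -
  define d where "d u = H (Complex u \<alpha>) - H (Complex u \<beta>)" for u
  have est: "norm ((\<integral>u. indicator {-L..L} u *\<^sub>R d u \<partial>lborel) - I) \<le> 2 * (S L * (\<beta> - \<alpha>))"
    if L: "L \<ge> L0" for L
  proof -
    let ?a = "Complex (-L) \<alpha>" and ?b = "Complex L \<alpha>" and ?c = "Complex L \<beta>" and ?d = "Complex (-L) \<beta>"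
    have Lp: "L > 0" using L L0 by simp
    have side': "norm (H x) \<le> S L" if "\<bar>Re x\<bar> = L" "\<alpha> \<le> Im x" "Im x \<le> \<beta>" for x
    proof (cases "Re x \<ge> 0")
      case True
      then have "x = Complex L (Im x)" using that by (simp add: complex_eq_iff)
      then show ?thesis using side(1)[OF L that(2,3)] by simp
    next
      case False
      then have "x = Complex (-L) (Im x)" using that by (simp add: complex_eq_iff)
      then show ?thesis using side(2)[OF L that(2,3)] by simp
    qed
    have im: "path_image (rectpath ?a ?c) = closed_segment ?a ?b \<union> closed_segment ?b ?c \<union> closed_segment ?c ?d \<union> closed_segment ?d ?a"
      by (simp add: rectpath_def Let_def path_image_join Un_assoc)
    have c: "continuous_on (closed_segment ?a ?b) H" "continuous_on (closed_segment ?b ?c) H"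
        "continuous_on (closed_segment ?c ?d) H" "continuous_on (closed_segment ?d ?a) H"
      using cont[OF L] unfolding im by (auto intro: continuous_on_subset)
    note ci = c[THEN contour_integrable_continuous_linepath]
    have "contour_integral (rectpath ?a ?c) H = contour_integral (linepath ?a ?b) H + contour_integral (linepath ?b ?c) H
        + contour_integral (linepath ?c ?d) H + contour_integral (linepath ?d ?a) H"
      unfolding rectpath_def Let_def using ci by (simp add: contour_integrable_joinI)
    also have "contour_integral (linepath ?c ?d) H = - contour_integral (linepath ?d ?c) H"
      by (rule contour_integral_reverse_linepath) (use c(3) in \<open>simp add: closed_segment_commute\<close>)
    finally have eq: "I = integral {-L..L} (\<lambda>u. H (Complex u \<alpha>)) + contour_integral (linepath ?b ?c) H
        - integral {-L..L} (\<lambda>u. H (Complex u \<beta>)) + contour_integral (linepath ?d ?a) H"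
      using Lp unfolding rect[OF L] by (simp add: contour_integral_horizontal)
    have hc: "continuous_on {-L..L} (\<lambda>u. H (Complex u t))"
      if "continuous_on (closed_segment (Complex (-L) t) (Complex L t)) H" for t
    proof (rule continuous_on_compose2[OF that])
      show "continuous_on {-L..L} (\<lambda>u. Complex u t)" unfolding Complex_eq by (intro continuous_intros)
      show "(\<lambda>u. Complex u t) ` {-L..L} \<subseteq> closed_segment (Complex (-L) t) (Complex L t)"
        using Lp by (auto simp: closed_segment_same_Im closed_segment_eq_real_ivl)
    qed
    have i1: "(\<lambda>u. H (Complex u \<alpha>)) integrable_on {-L..L}" "(\<lambda>u. H (Complex u \<beta>)) integrable_on {-L..L}"
      using hc[OF c(1)] hc[of \<beta>] c(3) by (auto intro!: integrable_continuous_interval simp: closed_segment_commute)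
    have "set_integrable lborel {-L..L} d"
      unfolding set_integrable_def d_def using int by (intro integrable_mult_indicator) auto
    then have "(\<integral>u. indicator {-L..L} u *\<^sub>R d u \<partial>lborel) = integral {-L..L} d"
      using set_borel_integral_eq_integral(2)[of "{-L..L}" d] by (simp add: set_lebesgue_integral_def)
    also have "\<dots> = integral {-L..L} (\<lambda>u. H (Complex u \<alpha>)) - integral {-L..L} (\<lambda>u. H (Complex u \<beta>))"
      unfolding d_def by (rule integral_diff[OF i1])
    finally have "(\<integral>u. indicator {-L..L} u *\<^sub>R d u \<partial>lborel) - I
        = - contour_integral (linepath ?b ?c) H - contour_integral (linepath ?d ?a) H"
      unfolding eq by simp
    moreover have "norm (contour_integral (linepath ?b ?c) H) \<le> S L * norm (?c - ?b)"
      using order_trans[OF norm_ge_zero side(1)[OF L, of \<alpha>]] ab Lp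
      by (intro contour_integral_bound_linepath ci side') (auto simp: closed_segment_same_Re closed_segment_eq_real_ivl)
    moreover have "norm (contour_integral (linepath ?d ?a) H) \<le> S L * norm (?a - ?d)"
      using order_trans[OF norm_ge_zero side(2)[OF L, of \<alpha>]] ab Lp
      by (intro contour_integral_bound_linepath ci side') (auto simp: closed_segment_same_Re closed_segment_eq_real_ivl)
    moreover have "norm (?c - ?b) = \<beta> - \<alpha>" "norm (?a - ?d) = \<beta> - \<alpha>"
      using ab by (simp_all add: cmod_def)
    ultimately show ?thesis
      using norm_triangle_ineq4[of "- contour_integral (linepath ?b ?c) H" "contour_integral (linepath ?d ?a) H"]
      by simp
  qed
  have lim: "((\<lambda>L. \<integral>u. indicator {-L..L} u *\<^sub>R d u \<partial>lborel) \<longlongrightarrow> (\<integral>u. d u \<partial>lborel)) at_top"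
  proof (rule integral_dominated_convergence_at_top[where w="\<lambda>u. norm (d u)"])
    show "integrable lborel (\<lambda>u. norm (d u))" "d \<in> borel_measurable lborel"
      using int unfolding d_def by auto
    then show "(\<lambda>u. indicator {-L..L} u *\<^sub>R d u) \<in> borel_measurable lborel" for L by measurable
    show "\<forall>\<^sub>F L in at_top. AE u in lborel. norm (indicator {-L..L} u *\<^sub>R d u) \<le> norm (d u)"
      by (auto intro!: always_eventually simp: indicator_def)
    show "AE u in lborel. ((\<lambda>L. indicator {-L..L} u *\<^sub>R d u) \<longlongrightarrow> d u) at_top"
    proof (rule AE_I2)
      fix u
      have "\<forall>\<^sub>F L in at_top. indicator {-L..L} u *\<^sub>R d u = d u"
        using eventually_ge_at_top[of "\<bar>u\<bar>"] by eventually_elim (auto simp: indicator_def)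
      then show "((\<lambda>L. indicator {-L..L} u *\<^sub>R d u) \<longlongrightarrow> d u) at_top" by (rule tendsto_eventually)
    qed
  qed
  have "((\<lambda>L. \<integral>u. indicator {-L..L} u *\<^sub>R d u \<partial>lborel) \<longlongrightarrow> I) at_top"
  proof (rule LIM_zero_cancel, rule tendsto_norm_zero_cancel, rule tendsto_sandwich[where f="\<lambda>_. 0"])
    show "\<forall>\<^sub>F L in at_top. norm ((\<integral>u. indicator {-L..L} u *\<^sub>R d u \<partial>lborel) - I) \<le> 2 * (S L * (\<beta> - \<alpha>))"
      using eventually_ge_at_top[of L0] by eventually_elim (rule est)
    show "((\<lambda>L. 2 * (S L * (\<beta> - \<alpha>))) \<longlongrightarrow> 0) at_top" using S by (auto intro!: tendsto_eq_intros)
  qed auto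
  then show ?thesis using lim tendsto_unique[OF _ lim] unfolding d_def by simp
qed

lemma lborel_integral_strip_shift:
  assumes ab: "\<alpha> < \<beta>"
    and hol: "H holomorphic_on {z. \<alpha> \<le> Im z \<and> Im z \<le> \<beta>}"
    and bd: "\<And>z. \<alpha> \<le> Im z \<Longrightarrow> Im z \<le> \<beta> \<Longrightarrow> norm (H z) \<le> B / (1 + (Re z)\<^sup>2)"
  shows "(\<integral>u. H (Complex u \<alpha>) \<partial>lborel) = (\<integral>u. H (Complex u \<beta>) \<partial>lborel)"
proof -
  let ?S = "{z. \<alpha> \<le> Im z \<and> Im z \<le> \<beta>}"
  have conv: "convex ?S"
    using convex_Int[OF convex_halfspace_Im_ge[of \<alpha>] convex_halfspace_Im_le[of \<beta>]] by (simp add: Int_def)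
  have contH: "continuous_on ?S H" using hol by (rule holomorphic_on_imp_continuous_on)
  have sub: "path_image (rectpath (Complex (-L) \<alpha>) (Complex L \<beta>)) \<subseteq> ?S" if "L > 0" for L
    using ab that by (auto simp: path_image_rectpath)
  have I: "integrable lborel (\<lambda>u. H (Complex u t))" if "\<alpha> \<le> t" "t \<le> \<beta>" for t
  proof (rule Bochner_Integration.integrable_bound[OF integrable_inverse_square[of B]])
    have "continuous_on UNIV (\<lambda>u. H (Complex u t))"
      using that by (intro continuous_on_compose2[OF contH]) (auto simp: Complex_eq intro!: continuous_intros)
    then show "(\<lambda>u. H (Complex u t)) \<in> borel_measurable lborel"
      by (simp add: borel_measurable_continuous_onI)
    have "norm (H (Complex u t)) \<le> norm (B / (1 + u\<^sup>2))" for u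
    proof -
      have "norm (H (Complex u t)) \<le> B / (1 + u\<^sup>2)" using bd[of "Complex u t"] that by simp
      also have "\<dots> \<le> norm (B / (1 + u\<^sup>2))" unfolding real_norm_def by (rule abs_ge_self)
      finally show ?thesis .
    qed
    then show "AE u in lborel. norm (H (Complex u t)) \<le> norm (B / (1 + u\<^sup>2))" by simp
  qed
  have "(\<integral>u. H (Complex u \<alpha>) - H (Complex u \<beta>) \<partial>lborel) = 0"
  proof (rule lborel_integral_strip_difference[OF ab, of 1 H "\<lambda>L. B / (1 + L\<^sup>2)"])
    show "continuous_on (path_image (rectpath (Complex (-L) \<alpha>) (Complex L \<beta>))) H" if "1 \<le> L" for L
      by (rule continuous_on_subset[OF contH sub]) (use that in simp)
    show "contour_integral (rectpath (Complex (-L) \<alpha>) (Complex L \<beta>)) H = 0" if "1 \<le> L" for L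
      by (rule contour_integral_unique, rule Cauchy_theorem_convex_simple[OF hol conv])
         (use sub[of L] that in auto)
    show "((\<lambda>L. B / (1 + L\<^sup>2)) \<longlongrightarrow> 0) at_top" by real_asymp
    show "integrable lborel (\<lambda>u. H (Complex u \<alpha>) - H (Complex u \<beta>))"
      using I ab by (intro Bochner_Integration.integrable_diff) auto
    show "norm (H (Complex L t)) \<le> B / (1 + L\<^sup>2)" "norm (H (Complex (- L) t)) \<le> B / (1 + L\<^sup>2)"
      if "\<alpha> \<le> t" "t \<le> \<beta>" for L t
      using bd[of "Complex L t"] bd[of "Complex (-L) t"] that by auto
  qed auto
  then show ?thesis using I ab by simp
qed

section \<open>Boundary values: the jump of the Cauchy kernel across the cut\<close>

lemma cosh_ge_quadratic: "1 + t\<^sup>2 / 4 \<le> cosh t" for t :: real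
proof -
  have *: "1 + t\<^sup>2 / 4 \<le> cosh t" if "t \<ge> 0" for t :: real
    using exp_lower_Taylor_quadratic[OF that] exp_ge_add_one_self[of "-t"] by (simp add: cosh_field_def)
  show ?thesis using *[of t] *[of "-t"] by (cases "t \<ge> 0") auto
qed

text \<open>The difference of the kernel at mirror-image points is i times the Poisson kernel of a
  strip, which is positive for small e > 0 and acts as an approximate identity.\<close>

lemma lker_jump:
  fixes t e :: real
  assumes "sin e \<noteq> 0"
  shows "lker (of_real t - \<i> * of_real e) - lker (of_real t + \<i> * of_real e)
     = \<i> * of_real (sin e / (cosh t - cos e))"
proof -
  define r where "r = exp t"
  have r: "r > 0" by (simp add: r_def)
  have e1: "exp (of_real t - \<i> * of_real e) = Complex (r * cos e) (- r * sin e)"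
       and e2: "exp (of_real t + \<i> * of_real e) = Complex (r * cos e) (r * sin e)"
    by (auto simp: complex_eq_iff Re_exp Im_exp r_def)
  have cosh: "cosh t = (r + 1 / r) / 2" by (simp add: cosh_field_def r_def exp_minus field_simps)
  have pos: "(r * cos e - 1)\<^sup>2 + (r * sin e)\<^sup>2 > 0" using assms r by (simp add: add_nonneg_pos)
  have D: "(r * cos e - 1)\<^sup>2 + (r * sin e)\<^sup>2 = 2 * r * (cosh t - cos e)"
  proof -
    have "(r * cos e - 1)\<^sup>2 + (r * sin e)\<^sup>2 = r\<^sup>2 - 2 * r * cos e + 1"
      by (simp add: power_mult_distrib sin_squared_eq power2_diff algebra_simps)
    also have "\<dots> = 2 * r * (cosh t - cos e)"
      using r by (simp add: cosh field_simps power2_eq_square)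
    finally show ?thesis .
  qed
  have "lker (of_real t - \<i> * of_real e) - lker (of_real t + \<i> * of_real e)
    = \<i> * of_real (2 * r * sin e / ((r * cos e - 1)\<^sup>2 + (r * sin e)\<^sup>2))"
    unfolding lker_def e1 e2 using pos
    by (simp add: complex_eq_iff Re_divide Im_divide)
       (simp add: power2_eq_square[of "(r * cos e - 1)\<^sup>2 + (r * sin e)\<^sup>2"])
  also have "\<dots> = \<i> * of_real (sin e / (cosh t - cos e))"
    unfolding D using r by simp
  finally show ?thesis .
qed

text \<open>The Sokhotski-Plemelj formula at 0. Rescaling v = e s turns the kernel into e sin e /
  (cosh (e s) - cos e), which tends to 2 / (1 + s^2), a function of total mass 2 pi.\<close>

lemma lker_jump_integral_tendsto:
  fixes f :: "real \<Rightarrow> complex"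
  assumes cont: "continuous_on UNIV f" and bd: "\<And>v. norm (f v) \<le> C"
  shows "((\<lambda>e. \<integral>v. f v * (lker (- of_real v - \<i> * of_real e) - lker (- of_real v + \<i> * of_real e)) \<partial>lborel)
            \<longlongrightarrow> 2 * of_real pi * \<i> * f 0) (at_right (0::real))"
proof -
  define g where "g e s = f (e * s) * (\<i> * of_real (e * sin e / (cosh (e * s) - cos e)))" for e s :: real
  have ev1: "\<forall>\<^sub>F e in at_right (0::real). 1 - cos e \<ge> e\<^sup>2 / 4" by real_asymp
  have ev2: "\<forall>\<^sub>F e in at_right (0::real). 0 < sin e \<and> sin e \<le> e" by (intro eventually_conj; real_asymp)
  have ev3: "\<forall>\<^sub>F e in at_right (0::real). e > 0" by (simp add: eventually_at_right_less)
  have C: "C \<ge> 0" using order_trans[OF norm_ge_zero bd[of 0]] .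
  have subst: "\<forall>\<^sub>F e in at_right 0. (\<integral>s. g e s \<partial>lborel)
      = (\<integral>v. f v * (lker (- of_real v - \<i> * of_real e) - lker (- of_real v + \<i> * of_real e)) \<partial>lborel)"
    using ev2 ev3
  proof eventually_elim
    case (elim e)
    let ?h = "\<lambda>v. f v * (lker (- of_real v - \<i> * of_real e) - lker (- of_real v + \<i> * of_real e))"
    have h: "?h v = f v * (\<i> * of_real (sin e / (cosh v - cos e)))" for v
      using lker_jump[of e "- v"] elim by simp
    have "(\<integral>v. ?h v \<partial>lborel) = \<bar>e\<bar> *\<^sub>R (\<integral>s. ?h (0 + e * s) \<partial>lborel)"
      by (rule lborel_integral_real_affine) (use elim in simp)
    also have "\<dots> = (\<integral>s. e *\<^sub>R ?h (0 + e * s) \<partial>lborel)"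
      using elim by simp
    also have "\<dots> = (\<integral>s. g e s \<partial>lborel)"
      by (intro Bochner_Integration.integral_cong refl)
        (simp only: h g_def scaleR_conv_of_real, simp add: mult_ac)
    finally show ?case by simp
  qed
  have lim: "((\<lambda>e. \<integral>s. g e s \<partial>lborel) \<longlongrightarrow> (\<integral>s. f 0 * (\<i> * of_real (2 / (1 + s\<^sup>2))) \<partial>lborel)) (at_right 0)"
    unfolding tendsto_at_iff_sequentially comp_def
  proof (intro allI impI)
    fix X :: "nat \<Rightarrow> real" assume X0: "\<forall>i. X i \<in> {0<..} - {0}" and X: "X \<longlonglongrightarrow> 0"
    have Xp: "X i > 0" for i using X0 by auto
    then have "X i \<noteq> 0" for i by (simp add: less_imp_neq[symmetric])
    with Xp have Xr: "filterlim X (at_right 0) sequentially"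
      using X by (simp add: filterlim_at)
    obtain n0 where n0: "\<And>n. n \<ge> n0 \<Longrightarrow> 1 - cos (X n) \<ge> (X n)\<^sup>2 / 4 \<and> 0 < sin (X n) \<and> sin (X n) \<le> X n"
      using eventually_compose_filterlim[OF eventually_conj[OF ev1 ev2] Xr]
      by (auto simp: eventually_sequentially)
    define Y where "Y n = X (n + n0)" for n
    have Y: "Y n > 0" "1 - cos (Y n) \<ge> (Y n)\<^sup>2 / 4" "0 < sin (Y n)" "sin (Y n) \<le> Y n" for n
      using X0 n0[of "n + n0"] by (auto simp: Y_def)
    have Yr: "filterlim Y (at_right 0) sequentially"
      unfolding Y_def by (rule filterlim_compose[OF Xr filterlim_add_const_nat_at_top])
    \<comment> \<open>The quarter in \<open>cosh_ge_quadratic\<close> matches the quarter in 1 - cos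
      e >= e^2/4, so both parts combine into 1 + s^2 and the rescaled kernel is at most 4 / (1 +
      s^2).\<close>
    have den: "cosh (Y n * s) - cos (Y n) \<ge> (Y n)\<^sup>2 * (1 + s\<^sup>2) / 4" for n s
      using cosh_ge_quadratic[of "Y n * s"] Y(2)[of n] by (simp add: power_mult_distrib algebra_simps add_divide_distrib)
    have "(\<lambda>n. \<integral>s. g (Y n) s \<partial>lborel) \<longlonglongrightarrow> (\<integral>s. f 0 * (\<i> * of_real (2 / (1 + s\<^sup>2))) \<partial>lborel)"
    proof (rule integral_dominated_convergence[where w="\<lambda>s. (C * 4) / (1 + s\<^sup>2)"])
      show "(\<lambda>s. f 0 * (\<i> * of_real (2 / (1 + s\<^sup>2)))) \<in> borel_measurable lborel" by measurable
      have denne: "cosh (Y n * s) - cos (Y n) \<noteq> 0" for n s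
        using den[where n=n and s=s] Y(1)[of n] by (smt (verit) divide_pos_pos mult_pos_pos zero_less_power zero_le_power2)
      show "g (Y n) \<in> borel_measurable lborel" for n
      proof -
        have "continuous_on UNIV (g (Y n))"
          unfolding g_def using denne
          by (intro continuous_intros continuous_on_compose2[OF cont]) auto
        then show ?thesis by (simp add: borel_measurable_continuous_onI)
      qed
      show "integrable lborel (\<lambda>s::real. (C * 4) / (1 + s\<^sup>2))" by (rule integrable_inverse_square)
      show "AE s in lborel. (\<lambda>n. g (Y n) s) \<longlonglongrightarrow> f 0 * (\<i> * of_real (2 / (1 + s\<^sup>2)))"
      proof (rule AE_I2)
        fix s :: real
        have p: "1 + s\<^sup>2 > 0" by (simp add: add_pos_nonneg)
        have "((\<lambda>e. e * sin e / (cosh (e * s) - cos e)) \<longlongrightarrow> 2 / (1 + s\<^sup>2)) (at_right 0)"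
        proof (cases "s = 0")
          case True
          then show ?thesis by (simp, real_asymp)
        next
          case False
          have "((\<lambda>e. (e * sin e / e\<^sup>2) / ((cosh (e * s) - 1) / e\<^sup>2 + (1 - cos e) / e\<^sup>2)) \<longlongrightarrow> 1 / (s\<^sup>2/2 + 1/2)) (at_right 0)"
          proof -
            have t1: "((\<lambda>e. e * sin e / e\<^sup>2) \<longlongrightarrow> 1) (at_right (0::real))" by real_asymp
            have t2: "((\<lambda>e. (cosh (e * s) - 1) / e\<^sup>2) \<longlongrightarrow> s\<^sup>2/2) (at_right (0::real))"
            proof (cases "s > 0")
              case True
              then show ?thesis by (real_asymp simp: power2_eq_square)
            next
              case F: False
              with False have "s < 0" by simp
              then show ?thesis by (real_asymp simp: power2_eq_square)
            qed
            have t3: "((\<lambda>e. (1 - cos e) / e\<^sup>2) \<longlongrightarrow> 1/2) (at_right (0::real))" by real_asymp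
            show ?thesis by (rule tendsto_divide[OF t1 tendsto_add[OF t2 t3]]) (use p in simp)
          qed
          moreover have "\<forall>\<^sub>F e in at_right 0. (e * sin e / e\<^sup>2) / ((cosh (e * s) - 1) / e\<^sup>2 + (1 - cos e) / e\<^sup>2)
               = e * sin e / (cosh (e * s) - cos e)"
            using ev3 by eventually_elim (simp add: divide_simps flip: add_divide_distrib)
          ultimately have "((\<lambda>e. e * sin e / (cosh (e * s) - cos e)) \<longlongrightarrow> 1 / (s\<^sup>2/2 + 1/2)) (at_right 0)"
            by (rule Lim_transform_eventually)
          moreover have "1 / (s\<^sup>2/2 + 1/2) = 2 / (1 + s\<^sup>2)" using p by (simp add: field_simps)
          ultimately show ?thesis by simp
        qed
        then have l1: "(\<lambda>n. Y n * sin (Y n) / (cosh (Y n * s) - cos (Y n))) \<longlonglongrightarrow> 2 / (1 + s\<^sup>2)"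
          by (rule filterlim_compose[OF _ Yr])
        have Y0: "(\<lambda>n. Y n * s) \<longlonglongrightarrow> 0 * s"
          using Yr by (intro tendsto_intros) (simp add: filterlim_at)
        have "isCont f 0" using cont by (simp add: continuous_on_eq_continuous_at)
        then have fl: "(\<lambda>n. f (Y n * s)) \<longlonglongrightarrow> f 0" using isCont_tendsto_compose Y0 by fastforce
        show "(\<lambda>n. g (Y n) s) \<longlonglongrightarrow> f 0 * (\<i> * of_real (2 / (1 + s\<^sup>2)))"
          unfolding g_def by (rule tendsto_mult[OF fl tendsto_mult[OF tendsto_const tendsto_of_real[OF l1]]])
      qed
      show "AE s in lborel. norm (g (Y n) s) \<le> (C * 4) / (1 + s\<^sup>2)" for n
      proof (rule AE_I2)
        fix s :: real
        have p: "(Y n)\<^sup>2 * (1 + s\<^sup>2) / 4 > 0" using Y(1)[of n] by (simp add: add_pos_nonneg)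
        have "\<bar>Y n * sin (Y n) / (cosh (Y n * s) - cos (Y n))\<bar> = Y n * sin (Y n) / (cosh (Y n * s) - cos (Y n))"
          using Y[of n] p den[of n s] by simp
        also have "\<dots> \<le> (Y n * Y n) / ((Y n)\<^sup>2 * (1 + s\<^sup>2) / 4)"
          using Y[of n] p den[of n s] by (intro frac_le mult_left_mono) auto
        also have "\<dots> = 4 / (1 + s\<^sup>2)" using Y(1)[of n] by (simp add: power2_eq_square)
        finally have b: "\<bar>Y n * sin (Y n) / (cosh (Y n * s) - cos (Y n))\<bar> \<le> 4 / (1 + s\<^sup>2)" .
        have "norm (g (Y n) s) = norm (f (Y n * s)) * \<bar>Y n * sin (Y n) / (cosh (Y n * s) - cos (Y n))\<bar>"
          unfolding g_def by (simp only: norm_mult norm_ii norm_of_real)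
        also have "\<dots> \<le> C * (4 / (1 + s\<^sup>2))" by (rule mult_mono[OF bd b]) (use C in auto)
        finally show "norm (g (Y n) s) \<le> (C * 4) / (1 + s\<^sup>2)" by simp
      qed
    qed
    then show "(\<lambda>n. \<integral>s. g (X n) s \<partial>lborel) \<longlonglongrightarrow> (\<integral>s. f 0 * (\<i> * of_real (2 / (1 + s\<^sup>2))) \<partial>lborel)"
      unfolding Y_def by (rule LIMSEQ_offset)
  qed
  have "(\<integral>s. inverse (1 + (s::real)\<^sup>2) \<partial>lborel) = pi"
    using LBINT_inverse_1_plus_square
    by (simp add: interval_lebesgue_integral_def einterval_def set_lebesgue_integral_def)
  then have "(\<integral>s. 2 * inverse (1 + (s::real)\<^sup>2) \<partial>lborel) = 2 * pi" by simp
  then have "(\<integral>s. complex_of_real (2 / (1 + s\<^sup>2)) \<partial>lborel) = of_real (2 * pi)"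
    by (subst integral_complex_of_real) (simp add: divide_inverse)
  then have "(\<integral>s. f 0 * (\<i> * of_real (2 / (1 + s\<^sup>2))) \<partial>lborel) = f 0 * (\<i> * of_real (2 * pi))"
    by (simp only: integral_mult_right_zero)
  then have "(\<integral>s. f 0 * (\<i> * of_real (2 / (1 + s\<^sup>2))) \<partial>lborel) = 2 * of_real pi * \<i> * f 0"
    by (simp add: mult_ac)
  with lim have "((\<lambda>e. \<integral>s. g e s \<partial>lborel) \<longlongrightarrow> 2 * of_real pi * \<i> * f 0) (at_right 0)" by simp
  then show ?thesis by (rule Lim_transform_eventually[OF _ subst])
qed

section \<open>The mass of the weight and the differential equation of its transform\<close>

lemma inverse_square_tendsto_0:
  assumes "F = at_top \<or> F = at_bot"
  shows "((\<lambda>v::real. C / (1 + v\<^sup>2)) \<longlongrightarrow> 0) F"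
  using assms by (auto, (real_asymp)+)

text \<open>The substitution t = exp v shows that this is Gamma(b) / a^b. It enters the argument
  through its positivity, its recurrence in \<open>b\<close> and an upper bound for large
  arguments.\<close>

definition gmass :: "real \<Rightarrow> real \<Rightarrow> real" where
  "gmass a b = (\<integral>v. exp (- a * exp v + b * v) \<partial>lborel)"

lemma integrable_gwt_real:
  assumes "a > 0" "b > 0" shows "integrable lborel (\<lambda>v::real. exp (- a * exp v + b * v))"
proof -
  obtain B where B: "\<And>v::real. exp (- a * exp v + b * v) \<le> B / (1 + v\<^sup>2)" using gwt_real_le[OF assms] by blast
  have "continuous_on UNIV (\<lambda>v::real. exp (- a * exp v + b * v))" by (intro continuous_intros)
  then have m: "(\<lambda>v::real. exp (- a * exp v + b * v)) \<in> borel_measurable lborel"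
    by (simp add: borel_measurable_continuous_onI)
  have "norm (exp (- a * exp v + b * v)) \<le> norm (B / (1 + v\<^sup>2))" for v :: real
    using B[of v] abs_ge_self[of "B / (1 + v\<^sup>2)"] unfolding real_norm_def abs_exp_cancel by linarith
  then show ?thesis by (intro Bochner_Integration.integrable_bound[OF integrable_inverse_square[of B] m]) auto
qed

lemma lborel_integral_gwt:
  "(\<integral>v. gwt a b (of_real v) \<partial>lborel) = of_real (gmass a b)"
  unfolding gmass_def gwt_of_real by (rule integral_complex_of_real)

lemma gmass_pos: assumes "a > 0" "b > 0" shows "gmass a b > 0"
proof -
  have "gmass a b \<noteq> 0"
  proof
    assume "gmass a b = 0"
    then have "AE v in lborel. exp (- a * exp v + b * v) = 0"
      unfolding gmass_def using integral_nonneg_eq_0_iff_AE[OF integrable_gwt_real[OF assms]] by auto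
    then have "AE v in (lborel::real measure). False" by simp
    then show False by (simp add: AE_iff_measurable[OF _ refl])
  qed
  moreover have "gmass a b \<ge> 0" unfolding gmass_def by (rule Bochner_Integration.integral_nonneg) simp
  ultimately show ?thesis by simp
qed

lemma has_vector_derivative_gwt_real:
  "((\<lambda>v. gwt a b (of_real v)) has_vector_derivative
     (of_real b - of_real a * exp (of_real v)) * gwt a b (of_real v)) (at v)"
proof -
  have "(gwt a b has_field_derivative (of_real b - of_real a * exp (of_real v)) * gwt a b (of_real v)) (at (of_real v))"
    unfolding gwt_def [abs_def] by (auto intro!: derivative_eq_intros simp: algebra_simps)
  from has_vector_derivative_real_field[OF this] show ?thesis by simp
qed

lemma has_field_derivative_gwt:
  "(gwt a b has_field_derivative (of_real b - of_real a * exp w) * gwt a b w) (at w)"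
  unfolding gwt_def [abs_def] by (auto intro!: derivative_eq_intros simp: algebra_simps)

text \<open>The functional equation of the Gamma function, obtained by integrating the derivative of
  the weight over the line.\<close>

lemma gmass_Suc: assumes "a > 0" "b > 0" shows "a * gmass a (b + 1) = b * gmass a b"
proof -
  have i: "integrable lborel (\<lambda>v. exp (- a * exp v + b * v))" "integrable lborel (\<lambda>v. exp (- a * exp v + (b+1) * v))"
    using integrable_gwt_real[of a b] integrable_gwt_real[of a "b+1"] assms by simp_all
  have eq: "(of_real b - of_real a * exp (of_real v)) * gwt a b (of_real v)
      = of_real (b * exp (- a * exp v + b * v) - a * exp (- a * exp v + (b+1) * v))" for v
  proof -
    have "exp (- a * exp v + (b+1) * v) = exp v * exp (- a * exp v + b * v)"
      by (simp add: algebra_simps flip: exp_add)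
    then show ?thesis by (simp only: gwt_of_real) (simp add: exp_of_real algebra_simps)
  qed
  obtain B where B: "\<And>v::real. exp (- a * exp v + b * v) \<le> B / (1 + v\<^sup>2)" "B > 0" using gwt_real_le[OF assms] by blast
  have lim: "((\<lambda>v. gwt a b (of_real v)) \<longlongrightarrow> 0) F" if "F = at_top \<or> F = at_bot" for F
  proof (rule Lim_null_comparison)
    show "\<forall>\<^sub>F v in F. norm (gwt a b (of_real v)) \<le> B / (1 + v\<^sup>2)"
      using B(1) by (simp add: gwt_of_real)
    show "((\<lambda>v. B / (1 + v\<^sup>2)) \<longlongrightarrow> 0) F" using that by (rule inverse_square_tendsto_0)
  qed
  have "(\<integral>v. (of_real b - of_real a * exp (of_real v)) * gwt a b (of_real v) \<partial>lborel) = (0::complex)"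
    by (rule lborel_integral_derivative_eq_0[OF has_vector_derivative_gwt_real])
       (use i in \<open>auto intro!: continuous_intros lim simp: eq simp del: of_real_diff of_real_mult\<close>)
  then have "(\<integral>v. (b * exp (- a * exp v + b * v) - a * exp (- a * exp v + (b+1) * v)) \<partial>lborel) = 0"
    unfolding eq by (simp only: integral_complex_of_real of_real_eq_0_iff)
  then show ?thesis using i unfolding gmass_def by simp
qed

text \<open>The w-derivative of the kernel is minus its v-derivative, so integration by parts moves
  it to the weight and produces the factor \<open>b - a * exp v\<close>. As exp v times the kernel
  is exp w times the kernel minus exp v, the factor may be replaced by \<open>b - a * exp w\<close>
  at the price of the constant \<open>a * gmass a (b + 1)\<close>, that is
  \<open>b * gmass a b\<close>.\<close>

lemma lcauchy_gwt_has_field_derivative: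
  assumes ab: "a > 0" "b > 0" and w: "-2*pi < Im w" "Im w < 0"
  shows "(lcauchy (gwt a b) has_field_derivative
     (of_real b - of_real a * exp w) * lcauchy (gwt a b) w + of_real (b * gmass a b)) (at w)"
proof -
  obtain B where B: "\<And>v::real. exp (- a * exp v + b * v) \<le> B / (1 + v\<^sup>2)" "B > 0" using gwt_real_le[OF ab] by blast
  obtain B' where B': "\<And>v::real. exp (- a * exp v + (b+1) * v) \<le> B' / (1 + v\<^sup>2)" using gwt_real_le[of a "b+1"] ab by auto
  let ?f = "\<lambda>v::real. gwt a b (of_real v)"
  let ?k = "\<lambda>v::real. lker (w - of_real v)"
  let ?k' = "\<lambda>v::real. - exp (w - of_real v) / (exp (w - of_real v) - 1)\<^sup>2"
  have bd: "norm (?f v) \<le> B / (1 + v\<^sup>2)" for v using B(1) by (simp add: gwt_of_real)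
  have meas: "?f \<in> borel_measurable borel"
    by (intro borel_measurable_continuous_onI continuous_intros)
  have ne: "exp (w - of_real v) \<noteq> 1" for v :: real using w by (intro exp_ne_1_strip) auto
  define s where "s = min (- Im w) (Im w + 2*pi) / 2"
  have s: "0 < s" "s \<le> pi/2" "-2*pi + s \<le> Im w" "Im w \<le> - s"
    using w by (auto simp: s_def min_def field_simps)
  have kb: "norm (?k v) \<le> 1 / sin s" for v using s by (intro norm_lker_le cos_le_cos_strip) auto
  have ss: "sin s > 0" using s by (simp add: sin_gt_zero)
  have e: "exp (of_real v) * ?f v = gwt a (b+1) (of_real v)" for v
    by (simp add: gwt_def algebra_simps flip: exp_add)
  have kk: "exp (of_real v) * ?k v = exp w * ?k v - exp (of_real v)" for v
    using exp_mult_lker[of w "of_real v", OF ne] by (simp add: algebra_simps)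
  define g where "g v = (of_real b - of_real a * exp w) * (?f v * ?k v) + of_real a * gwt a (b+1) (of_real v)" for v :: real
  have g: "g v = (of_real b - of_real a * exp (of_real v)) * ?f v * ?k v" for v
  proof -
    have "(of_real b - of_real a * exp (of_real v)) * ?f v * ?k v
       = of_real b * (?f v * ?k v) - of_real a * ?f v * (exp (of_real v) * ?k v)" by (simp add: algebra_simps)
    also have "\<dots> = g v" unfolding kk g_def e[symmetric] by (simp add: algebra_simps)
    finally show ?thesis by simp
  qed
  have i1: "integrable lborel (\<lambda>v. ?f v * ?k v)" by (rule integrable_lcauchy[OF meas bd w])
  have i2: "integrable lborel (\<lambda>v. gwt a (b+1) (of_real v))"
    unfolding gwt_of_real using integrable_gwt_real[of a "b+1"] ab by (intro integrable_of_real) simp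
  have ig: "integrable lborel g" unfolding g_def using i1 i2 by (intro Bochner_Integration.integrable_add integrable_mult_right)
  have vd: "((\<lambda>v. ?f v * ?k v) has_vector_derivative (g v - ?f v * ?k' v)) (at v)" for v
  proof -
    have "((\<lambda>z. lker (w - z)) has_field_derivative ?k' v * (0 - 1)) (at (of_real v))"
      by (rule DERIV_chain'[where f="\<lambda>z. w - z" and g=lker, OF _ has_field_derivative_lker[OF ne]])
         (auto intro!: derivative_eq_intros)
    from has_vector_derivative_real_field[OF this]
    have "(?k has_vector_derivative - ?k' v) (at v)" by simp
    from has_vector_derivative_mult[OF has_vector_derivative_gwt_real this]
    show ?thesis unfolding g by (simp add: algebra_simps)
  qed
  have i3: "integrable lborel (\<lambda>v. ?f v * ?k' v)"
  proof (rule Bochner_Integration.integrable_bound[OF integrable_inverse_square[of "B / sin s * (1 + 1 / sin s)"]])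
    show "(\<lambda>v. ?f v * ?k' v) \<in> borel_measurable lborel"
    proof -
      have "continuous_on UNIV (\<lambda>v. ?f v * ?k' v)"
        using ne by (intro continuous_intros) auto
      then show ?thesis unfolding measurable_lborel2 by (rule borel_measurable_continuous_onI)
    qed
    have "norm (?f v * ?k' v) \<le> B / sin s * (1 + 1 / sin s) / (1 + v\<^sup>2)" for v
    proof -
      \<comment> \<open>The kernel satisfies a Riccati equation, so its derivative inherits a bound
        from the kernel itself.\<close>
      have "?k' v = - ?k v * (1 + ?k v)"
        using ne[of v] by (simp add: lker_def field_simps power2_eq_square)
      then have "norm (?k' v) \<le> (1 / sin s) * (1 + 1 / sin s)"
        using kb[of v] norm_triangle_ineq[of 1 "?k v"] ss
        by (simp only: norm_mult norm_minus_cancel) (intro mult_mono; simp)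
      then have "norm (?f v) * norm (?k' v) \<le> (B / (1 + v\<^sup>2)) * ((1 / sin s) * (1 + 1 / sin s))"
        using B(2) by (intro mult_mono bd) auto
      moreover have "(B / (1 + v\<^sup>2)) * ((1 / sin s) * (1 + 1 / sin s)) = B / sin s * (1 + 1 / sin s) / (1 + v\<^sup>2)"
        by (simp add: mult_ac)
      ultimately show ?thesis by (simp only: norm_mult)
    qed
    then have "norm (?f v * ?k' v) \<le> norm (B / sin s * (1 + 1 / sin s) / (1 + v\<^sup>2))" for v
      using abs_ge_self[of "B / sin s * (1 + 1 / sin s) / (1 + v\<^sup>2)"] unfolding real_norm_def
      by (meson order_trans)
    then show "AE v in lborel. norm (?f v * ?k' v) \<le> norm (B / sin s * (1 + 1 / sin s) / (1 + v\<^sup>2))"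
      by blast
  qed
  have lim: "((\<lambda>v. ?f v * ?k v) \<longlongrightarrow> 0) F" if "F = at_top \<or> F = at_bot" for F
  proof (rule Lim_null_comparison)
    show "\<forall>\<^sub>F v in F. norm (?f v * ?k v) \<le> (B / sin s) / (1 + v\<^sup>2)"
      using norm_lcauchy_integrand_le[where H="gwt a b", OF bd s] by simp
    show "((\<lambda>v. (B / sin s) / (1 + v\<^sup>2)) \<longlongrightarrow> 0) F" using that by (rule inverse_square_tendsto_0)
  qed
  have "(\<integral>v. g v - ?f v * ?k' v \<partial>lborel) = 0"
  proof (rule lborel_integral_derivative_eq_0[OF vd])
    show "continuous_on UNIV (\<lambda>v. g v - ?f v * ?k' v)"
      unfolding g using ne by (intro continuous_intros) auto
  qed (use ig i3 lim in auto)
  then have "(\<integral>v. ?f v * ?k' v \<partial>lborel) = (\<integral>v. g v \<partial>lborel)"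
    unfolding Bochner_Integration.integral_diff[OF ig i3] by (simp only: right_minus_eq)
  also have "\<dots> = (of_real b - of_real a * exp w) * lcauchy (gwt a b) w + of_real a * of_real (gmass a (b+1))"
    unfolding g_def using i1 i2 by (simp add: lcauchy_def lborel_integral_gwt)
  also have "of_real a * of_real (gmass a (b+1)) = (of_real (b * gmass a b) :: complex)"
    using gmass_Suc[OF ab] by (metis of_real_mult)
  finally have "(\<integral>v. ?f v * ?k' v \<partial>lborel) = (of_real b - of_real a * exp w) * lcauchy (gwt a b) w + of_real (b * gmass a b)" .
  with lcauchy_has_field_derivative[where H="gwt a b", OF meas bd w] show ?thesis by simp
qed

lemma contour_integral_linepath_has_field_derivative:
  assumes "f holomorphic_on UNIV"
  shows "((\<lambda>w. contour_integral (linepath w0 w) f) has_field_derivative f w) (at w)"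
proof -
  obtain g where g: "\<And>x. (g has_field_derivative f x) (at x)"
    using holomorphic_convex_primitive'[of UNIV f] assms by auto
  have "contour_integral (linepath w0 w) f = g w - g w0" for w
  proof (rule contour_integral_unique)
    have "(f has_contour_integral (g (pathfinish (linepath w0 w)) - g (pathstart (linepath w0 w)))) (linepath w0 w)"
      by (rule contour_integral_primitive[where S=UNIV]) (use g in auto)
    then show "(f has_contour_integral (g w - g w0)) (linepath w0 w)" by simp
  qed
  then show ?thesis using g by (auto intro!: derivative_eq_intros)
qed

text \<open>The solution of the differential equation of \<open>lcauchy (gwt a b)\<close> that agrees with it at \<open>w = -i\<pi>\<close>.\<close>

definition gterm :: "real \<Rightarrow> real \<Rightarrow> complex \<Rightarrow> complex" where
  "gterm a b w = gwt a b w * (lcauchy (gwt a b) (- \<i> * of_real pi) / gwt a b (- \<i> * of_real pi)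
     + of_real (b * gmass a b) * contour_integral (linepath (- \<i> * of_real pi) w) (\<lambda>v. 1 / gwt a b v))"

text \<open>Division by the weight turns the linear equation into a plain primitive. Continuation,
  jump and bounds up to the cut are all read off this quotient.\<close>

lemma gterm_quotient_has_field_derivative:
  "((\<lambda>w. gterm a b w / gwt a b w) has_field_derivative of_real (b * gmass a b) / gwt a b w) (at w)"
proof -
  have "(\<lambda>v. 1 / gwt a b v) holomorphic_on UNIV" by (intro holomorphic_intros) auto
  note d = contour_integral_linepath_has_field_derivative[OF this]
  show ?thesis unfolding gterm_def by (auto intro!: derivative_eq_intros d)
qed

lemma gterm_holomorphic: "gterm a b holomorphic_on UNIV"
proof -
  have "(\<lambda>w. gterm a b w / gwt a b w) holomorphic_on UNIV"
    using gterm_quotient_has_field_derivative holomorphic_on_open by blast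
  from holomorphic_on_mult[OF gwt_holomorphic[OF holomorphic_on_ident] this]
  have "(\<lambda>w. gwt a b w * (gterm a b w / gwt a b w)) holomorphic_on UNIV" .
  then show ?thesis by simp
qed

lemma gterm_holomorphic' [holomorphic_intros]:
  "f holomorphic_on A \<Longrightarrow> (\<lambda>w. gterm a b (f w)) holomorphic_on A"
  using holomorphic_on_compose_gen[OF _ gterm_holomorphic, of f A a b] by (simp add: o_def)

lemma gterm_continuous [continuous_intros]:
  "continuous_on A f \<Longrightarrow> continuous_on A (\<lambda>w. gterm a b (f w))"
  by (rule continuous_on_compose2[OF holomorphic_on_imp_continuous_on[OF gterm_holomorphic]]) auto

lemma gterm_eq_lcauchy:
  assumes ab: "a > 0" "b > 0" and w: "-2*pi < Im w" "Im w < 0"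
  shows "gterm a b w = lcauchy (gwt a b) w"
proof -
  let ?S = "{w. -2*pi < Im w \<and> Im w < 0}"
  let ?d = "\<lambda>w. lcauchy (gwt a b) w / gwt a b w - gterm a b w / gwt a b w"
  have conv: "convex ?S"
    using convex_Int[OF convex_halfspace_Im_gt[of "-2*pi"] convex_halfspace_Im_lt[of 0]] by (simp add: Int_def)
  have "(?d has_field_derivative 0) (at z within ?S)" if "z \<in> ?S" for z
  proof (rule has_field_derivative_at_within)
    have "(?d has_field_derivative (((of_real b - of_real a * exp z) * lcauchy (gwt a b) z + of_real (b * gmass a b)) * gwt a b z
        - lcauchy (gwt a b) z * ((of_real b - of_real a * exp z) * gwt a b z)) / (gwt a b z * gwt a b z)
        - of_real (b * gmass a b) / gwt a b z) (at z)"
      by (intro DERIV_diff DERIV_divide lcauchy_gwt_has_field_derivative has_field_derivative_gwt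
          gterm_quotient_has_field_derivative) (use ab that in auto)
    moreover have quot: "((p * L + c) * g - L * (p * g)) / (g * g) - c / g = 0" if "g \<noteq> 0" for p L c g :: complex
      using that by (simp add: field_simps)
    ultimately show "(?d has_field_derivative 0) (at z)" by (simp only: quot[OF gwt_nonzero])
  qed
  then obtain c where c: "\<And>z. z \<in> ?S \<Longrightarrow> ?d z = c"
    using has_field_derivative_zero_constant[OF conv, of ?d] by blast
  have "c = 0" using c[of "- \<i> * of_real pi"] by (simp add: gterm_def)
  then have "lcauchy (gwt a b) w / gwt a b w - gterm a b w / gwt a b w = 0" using c[of w] w by simp
  then show ?thesis by (simp flip: diff_divide_distrib)
qed

text \<open>At w and at w - 2 pi i the same equation holds, so the jump divided by the weight has
  derivative 0. Its constant value is found at w = 0, where the limit from inside the strip is the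
  Plemelj formula.\<close>

lemma gterm_jump:
  assumes ab: "a > 0" "b > 0"
  shows "gterm a b w - gterm a b (w - 2 * of_real pi * \<i>) = 2 * of_real pi * \<i> * gwt a b w"
proof -
  let ?p = "2 * of_real pi * \<i> :: complex"
  let ?E = "exp (- 2 * of_real pi * \<i> * of_real b)"
  let ?q = "\<lambda>w. gterm a b w / gwt a b w"
  let ?d = "\<lambda>w. ?q w - ?E * ?q (w - ?p)"
  have d: "?d w = (gterm a b w - gterm a b (w - ?p)) / gwt a b w" for w
    unfolding gwt_shift_period by (simp add: divide_simps)
  have "(?d has_field_derivative 0) (at z within UNIV)" for z
  proof -
    have "((\<lambda>w. ?q (w - ?p)) has_field_derivative of_real (b * gmass a b) / gwt a b (z - ?p) * 1) (at z)"
      by (rule DERIV_chain'[OF _ gterm_quotient_has_field_derivative]) (auto intro!: derivative_eq_intros)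
    then have "(?d has_field_derivative of_real (b * gmass a b) / gwt a b z - ?E * (of_real (b * gmass a b) / gwt a b (z - ?p) * 1)) (at z)"
      by (intro DERIV_diff DERIV_cmult gterm_quotient_has_field_derivative)
    then show ?thesis by (simp add: gwt_shift_period)
  qed
  then obtain c where c: "\<And>z. ?d z = c"
    using has_field_derivative_zero_constant[of UNIV ?d] by auto
  obtain B where B: "\<And>v::real. exp (- a * exp v + b * v) \<le> B / (1 + v\<^sup>2)" "B > 0" using gwt_real_le[OF ab] by blast
  have bd: "norm (gwt a b (of_real v)) \<le> B / (1 + v\<^sup>2)" for v using B(1) by (simp add: gwt_of_real)
  have bd': "norm (gwt a b (of_real v)) \<le> B" for v
  proof -
    have "B / (1 + v\<^sup>2) \<le> B / 1" using B(2) by (intro frac_le) auto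
    then show ?thesis using bd[of v] by simp
  qed
  have meas: "(\<lambda>v. gwt a b (of_real v)) \<in> borel_measurable borel"
    by (intro borel_measurable_continuous_onI continuous_intros)
  have l1: "((\<lambda>e. \<integral>v. gwt a b (of_real v) * (lker (- of_real v - \<i> * of_real e) - lker (- of_real v + \<i> * of_real e)) \<partial>lborel)
            \<longlongrightarrow> 2 * of_real pi * \<i> * gwt a b (of_real 0)) (at_right (0::real))"
    by (rule lker_jump_integral_tendsto[OF _ bd']) (intro continuous_intros)
  have "\<forall>\<^sub>F e in at_right (0::real). e > 0 \<and> e < 2*pi"
    using eventually_at_right_real[of 0 "2*pi"] by simp
  then have ev: "\<forall>\<^sub>F e in at_right (0::real). (\<integral>v. gwt a b (of_real v) * (lker (- of_real v - \<i> * of_real e) - lker (- of_real v + \<i> * of_real e)) \<partial>lborel)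
     = gterm a b (- \<i> * of_real e) - gterm a b (\<i> * of_real e - ?p)"
  proof eventually_elim
    case (elim e)
    \<comment> \<open>By periodicity a point just above the cut is replaced by one just above Im w =
      -2 pi, which lies in the strip where the transform is defined.\<close>
    have k: "lker (- of_real v + \<i> * of_real e) = lker (\<i> * of_real e - ?p - of_real v)" for v :: real
      using lker_shift_period[of "- of_real v + \<i> * of_real e"] by (simp add: algebra_simps)
    have k': "lker (- of_real v - \<i> * of_real e) = lker (- \<i> * of_real e - of_real v)" for v :: real
      by (rule arg_cong[where f=lker]) simp
    have w: "-2*pi < Im (- \<i> * of_real e)" "Im (- \<i> * of_real e) < 0"
      "-2*pi < Im (\<i> * of_real e - ?p)" "Im (\<i> * of_real e - ?p) < 0"
      using elim by auto
    have i: "integrable lborel (\<lambda>v. gwt a b (of_real v) * lker (- \<i> * of_real e - of_real v))"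
       "integrable lborel (\<lambda>v. gwt a b (of_real v) * lker (\<i> * of_real e - ?p - of_real v))"
      by (rule integrable_lcauchy[OF meas bd w(1,2)], rule integrable_lcauchy[OF meas bd w(3,4)])
    show ?case
      unfolding k k' right_diff_distrib Bochner_Integration.integral_diff[OF i]
        gterm_eq_lcauchy[OF ab w(1,2)] gterm_eq_lcauchy[OF ab w(3,4)] lcauchy_def ..
  qed
  have "((\<lambda>e. gterm a b (- \<i> * of_real e) - gterm a b (\<i> * of_real e - ?p)) \<longlongrightarrow> gterm a b (- \<i> * of_real 0) - gterm a b (\<i> * of_real 0 - ?p)) (at_right (0::real))"
  proof -
    have "continuous_on UNIV (\<lambda>e::real. gterm a b (- \<i> * of_real e) - gterm a b (\<i> * of_real e - ?p))"
      by (intro continuous_intros)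
    then have "isCont (\<lambda>e::real. gterm a b (- \<i> * of_real e) - gterm a b (\<i> * of_real e - ?p)) 0"
      by (simp add: continuous_on_eq_continuous_at)
    then show ?thesis by (auto simp: isCont_def intro: tendsto_mono[OF at_le])
  qed
  with tendsto_unique[OF _ Lim_transform_eventually[OF l1 ev]]
  have "gterm a b 0 - gterm a b (0 - ?p) = ?p * gwt a b 0" by fastforce
  then have "c = ?p" using c[of 0] unfolding d by simp
  then have "(gterm a b w - gterm a b (w - ?p)) / gwt a b w = ?p" using c[of w] unfolding d by simp
  then show ?thesis by (simp add: field_simps)
qed

text \<open>The two bounds of the kernel give the two estimates. In the second, the factor exp v is
  absorbed by raising \<open>b\<close> to \<open>b + 1\<close>, which leaves decay in Re w.\<close>

lemma norm_gterm_le_interior: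
  assumes ab: "a > 0" "b > 0" and s: "0 < s" "s \<le> pi/2" "-2*pi + s \<le> Im w" "Im w \<le> - s"
  shows "norm (gterm a b w) \<le> gmass a b / sin s"
    "norm (gterm a b w) \<le> exp (- Re w) * gmass a (b+1) / sin s"
proof -
  have w: "-2*pi < Im w" "Im w < 0" using s by auto
  have ge: "gterm a b w = (\<integral>v. gwt a b (of_real v) * lker (w - of_real v) \<partial>lborel)"
    unfolding gterm_eq_lcauchy[OF ab w] lcauchy_def ..
  have c: "cos (Im (w - of_real v)) \<le> cos s" for v using s by (intro cos_le_cos_strip) auto
  note i = integrable_gwt_real[OF ab] integrable_gwt_real[of a "b+1"]
  have ss: "sin s > 0" using s by (simp add: sin_gt_zero)
  have "norm (gterm a b w) \<le> (\<integral>v. norm (gwt a b (of_real v) * lker (w - of_real v)) \<partial>lborel)"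
    unfolding ge by (rule integral_norm_bound)
  also have "\<dots> \<le> (\<integral>v. exp (- a * exp v + b * v) * (1 / sin s) \<partial>lborel)"
  proof (rule integral_mono')
    show "norm (gwt a b (of_real v) * lker (w - of_real v)) \<le> exp (- a * exp v + b * v) * (1 / sin s)" for v :: real
      unfolding norm_mult gwt_of_real norm_of_real abs_exp_cancel
      by (intro mult_left_mono norm_lker_le(1)[OF s(1,2) c]) simp
    show "integrable lborel (\<lambda>v. exp (- a * exp v + b * v) * (1 / sin s))"
      by (rule integrable_mult_left[OF i(1)])
  qed (use ss in auto)
  also have "\<dots> = gmass a b / sin s" unfolding integral_mult_left_zero gmass_def by (simp only: times_divide_eq_right mult_1_right)
  finally show "norm (gterm a b w) \<le> gmass a b / sin s" .
  have "norm (gterm a b w) \<le> (\<integral>v. norm (gwt a b (of_real v) * lker (w - of_real v)) \<partial>lborel)"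
    unfolding ge by (rule integral_norm_bound)
  also have "\<dots> \<le> (\<integral>v. exp (- a * exp v + (b + 1) * v) * (exp (- Re w) / sin s) \<partial>lborel)"
  proof (rule integral_mono')
    show "integrable lborel (\<lambda>v. exp (- a * exp v + (b + 1) * v) * (exp (- Re w) / sin s))"
      by (rule integrable_mult_left[OF i(2)]) (use ab in auto)
    fix v :: real
    have "norm (lker (w - of_real v)) \<le> exp v * (exp (- Re w) / sin s)"
      using norm_lker_le(2)[OF s(1,2) c, of v] by (simp add: exp_diff exp_minus field_simps)
    then have "exp (- a * exp v + b * v) * norm (lker (w - of_real v)) \<le> exp (- a * exp v + b * v) * (exp v * (exp (- Re w) / sin s))"
      by (rule mult_left_mono) simp
    also have "exp (- a * exp v + b * v) * (exp v * (exp (- Re w) / sin s)) = exp (- a * exp v + (b + 1) * v) * (exp (- Re w) / sin s)"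
    proof -
      have "exp (- a * exp v + (b + 1) * v) = exp (- a * exp v + b * v) * exp v"
        by (simp add: distrib_right flip: exp_add)
      then show ?thesis by (simp only: mult.assoc)
    qed
    finally show "norm (gwt a b (of_real v) * lker (w - of_real v)) \<le> exp (- a * exp v + (b + 1) * v) * (exp (- Re w) / sin s)"
      unfolding norm_mult gwt_of_real norm_of_real abs_exp_cancel .
    show "0 \<le> exp (- a * exp v + (b + 1) * v) * (exp (- Re w) / sin s)"
      using ss by (intro mult_nonneg_nonneg divide_nonneg_nonneg) auto
  qed
  also have "\<dots> = exp (- Re w) * gmass a (b+1) / sin s" unfolding integral_mult_left_zero gmass_def by (simp only: times_divide_eq_right times_divide_eq_left mult.commute)
  finally show "norm (gterm a b w) \<le> exp (- Re w) * gmass a (b+1) / sin s" .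
qed

text \<open>Moving vertically towards \<open>Im w = 0\<close> or \<open>Im w = - 2 pi\<close> the modulus of the weight decreases,
  so that the differential equation bounds the Cauchy transform up to the cut.\<close>

lemma norm_gterm_le_vertical:
  assumes ab: "a > 0" "b > 0" and re: "Re w1 = Re w"
    and cos: "\<And>v. v \<in> closed_segment w1 w \<Longrightarrow> cos (Im v) \<le> cos (Im w)"
  shows "norm (gterm a b w) \<le> norm (gterm a b w1) + norm (w - w1) * (b * gmass a b)"
proof -
  let ?q = "\<lambda>w. gterm a b w / gwt a b w"
  have K: "b * gmass a b \<ge> 0" using ab gmass_pos[OF ab] by simp
  have mono: "norm (gwt a b w) \<le> norm (gwt a b v)" if "v \<in> closed_segment w1 w" for v
  proof -
    have "Re v = Re w" using that re closed_segment_same_Re[of w1 w] by auto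
    then show ?thesis unfolding norm_gwt using cos[OF that] ab by simp
  qed
  have p: "norm (gwt a b w) > 0" by simp
  have "norm (?q w - ?q w1) \<le> b * gmass a b / norm (gwt a b w) * norm (w - w1)"
  proof (rule field_differentiable_bound[of "closed_segment w1 w"])
    show "(?q has_field_derivative of_real (b * gmass a b) / gwt a b z) (at z within closed_segment w1 w)" for z
      by (rule has_field_derivative_at_within[OF gterm_quotient_has_field_derivative])
    show "norm (of_real (b * gmass a b) / gwt a b z) \<le> b * gmass a b / norm (gwt a b w)"
      if "z \<in> closed_segment w1 w" for z
      using mono[OF that] K p unfolding norm_divide norm_of_real abs_of_nonneg[OF K]
      by (intro frac_le) auto
  qed auto
  then have "norm (?q w) \<le> norm (?q w1) + b * gmass a b / norm (gwt a b w) * norm (w - w1)"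
    using norm_triangle_ineq2[of "?q w" "?q w1"] by linarith
  then have "norm (gwt a b w) * norm (?q w) \<le> norm (gwt a b w) * (norm (?q w1) + b * gmass a b / norm (gwt a b w) * norm (w - w1))"
    by (rule mult_left_mono) simp
  also have "\<dots> = norm (gwt a b w) * norm (?q w1) + b * gmass a b * norm (w - w1)"
    using p unfolding distrib_left by (simp del: norm_divide)
  also have "norm (gwt a b w) * norm (?q w1) \<le> norm (gwt a b w1) * norm (?q w1)"
    by (intro mult_right_mono mono) auto
  also have "norm (gwt a b w1) * norm (?q w1) = norm (gterm a b w1)" by (simp add: norm_divide)
  also have "norm (gwt a b w) * norm (?q w) = norm (gterm a b w)" by (simp add: norm_divide)
  finally show ?thesis by (simp only: mult.commute)
qed

text \<open>The height s is left free. A small fixed s followed by large Re w gives decay at the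
  right end, and s = 1/sqrt x balances the two terms when b is of order x.\<close>

lemma norm_gterm_le_strip:
  assumes ab: "a > 0" "b > 0" and w: "-2*pi \<le> Im w" "Im w \<le> 0" and s: "0 < s" "s \<le> 1"
  shows "norm (gterm a b w) \<le> gmass a b / sin s + s * (b * gmass a b)"
    "norm (gterm a b w) \<le> exp (- Re w) * gmass a (b+1) / sin s + s * (b * gmass a b)"
proof -
  have spi: "s \<le> pi/2" using s pi_gt3 by linarith
  have K: "b * gmass a b \<ge> 0" using ab gmass_pos[OF ab] by simp
  obtain w1 where w1: "Re w1 = Re w" "-2*pi + s \<le> Im w1" "Im w1 \<le> - s" "norm (w - w1) \<le> s"
      "\<And>v. v \<in> closed_segment w1 w \<Longrightarrow> cos (Im v) \<le> cos (Im w)"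
  proof -
    consider "Im w > -s" | "Im w < -2*pi + s" | "-2*pi + s \<le> Im w" "Im w \<le> - s" by linarith
    then show thesis
    proof cases
      case 1
      show ?thesis
      proof (rule that[of "Complex (Re w) (-s)"])
        show "norm (w - Complex (Re w) (-s)) \<le> s" using 1 w by (simp add: cmod_def)
        fix v assume "v \<in> closed_segment (Complex (Re w) (-s)) w"
        then have "-s \<le> Im v" "Im v \<le> Im w" using 1 by (auto simp: closed_segment_same_Re closed_segment_eq_real_ivl)
        then have "cos (- Im v) \<le> cos (- Im w)" using w s spi by (intro cos_monotone_0_pi_le) auto
        then show "cos (Im v) \<le> cos (Im w)" by simp
      qed (use spi s pi_gt3 in auto)
    next
      case 2
      show ?thesis
      proof (rule that[of "Complex (Re w) (-2*pi+s)"])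
        show "norm (w - Complex (Re w) (-2*pi+s)) \<le> s" using 2 w by (simp add: cmod_def)
        fix v assume "v \<in> closed_segment (Complex (Re w) (-2*pi+s)) w"
        then have "-2*pi+s \<ge> Im v" "Im v \<ge> Im w" using 2 by (auto simp: closed_segment_same_Re closed_segment_eq_real_ivl)
        then have "cos (2*pi + Im v) \<le> cos (2*pi + Im w)" using w s spi by (intro cos_monotone_0_pi_le) auto
        then show "cos (Im v) \<le> cos (Im w)" by (simp add: cos_add)
      qed (use spi s pi_gt3 in auto)
    next
      case 3
      show ?thesis by (rule that[of w]) (use 3 s in simp_all)
    qed
  qed
  have "norm (gterm a b w) \<le> norm (gterm a b w1) + norm (w - w1) * (b * gmass a b)"
    by (rule norm_gterm_le_vertical[OF ab w1(1,5)])
  also have "norm (w - w1) * (b * gmass a b) \<le> s * (b * gmass a b)" by (intro mult_right_mono w1 K)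
  finally have *: "norm (gterm a b w) \<le> norm (gterm a b w1) + s * (b * gmass a b)" by simp
  show "norm (gterm a b w) \<le> gmass a b / sin s + s * (b * gmass a b)"
    using * norm_gterm_le_interior(1)[OF ab s(1) spi w1(2,3)] by linarith
  show "norm (gterm a b w) \<le> exp (- Re w) * gmass a (b+1) / sin s + s * (b * gmass a b)"
    using * norm_gterm_le_interior(2)[OF ab s(1) spi w1(2,3), unfolded w1(1)] by linarith
qed

subsection \<open>The complementary error function and the function \<open>c\<close>\<close>

lemma exp_minus_square_holomorphic: "(\<lambda>t::complex. exp (- t\<^sup>2)) holomorphic_on UNIV"
  by (intro holomorphic_intros)

lemma has_field_derivative_erfc:
  "(erfc has_field_derivative - (2 / of_real (sqrt pi)) * exp (- w\<^sup>2)) (at w)"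
  unfolding erfc_def [abs_def]
  by (auto intro!: derivative_eq_intros contour_integral_linepath_has_field_derivative[OF exp_minus_square_holomorphic])

lemma erfc_0 [simp]: "erfc 0 = 1" by (simp add: erfc_def)

lemma erfc_minus: "erfc (- w) = 2 - erfc w"
proof -
  have "((\<lambda>w. erfc w + erfc (- w)) has_field_derivative 0) (at z within UNIV)" for z
  proof -
    have "((\<lambda>w. erfc (- w)) has_field_derivative - (2 / of_real (sqrt pi)) * exp (- (- z)\<^sup>2) * (- 1)) (at z)"
      by (rule DERIV_chain'[where f=uminus and g=erfc, OF _ has_field_derivative_erfc]) (auto intro!: derivative_eq_intros)
    from DERIV_add[OF has_field_derivative_erfc this] show ?thesis by simp
  qed
  then obtain c where c: "\<And>z. erfc z + erfc (- z) = c"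
    using has_field_derivative_zero_constant[of UNIV "\<lambda>w. erfc w + erfc (- w)"] by auto
  have "c = 2" using c[of 0] by simp
  then show ?thesis using c[of w] by (simp add: algebra_simps)
qed

lemma erfc_cnj: "erfc (cnj w) = cnj (erfc w)"
proof -
  have "((\<lambda>w. cnj (erfc (cnj w)) - erfc w) has_field_derivative 0) (at z within UNIV)" for z
  proof -
    have "((cnj \<circ> erfc \<circ> cnj) has_field_derivative cnj (- (2 / of_real (sqrt pi)) * exp (- (cnj z)\<^sup>2))) (at z)"
      using has_field_derivative_cnj_cnj[OF has_field_derivative_erfc[of "cnj z"]] by (simp add: o_def)
    from DERIV_diff[OF this has_field_derivative_erfc[of z]]
    show ?thesis by (simp add: o_def exp_cnj)
  qed
  then obtain c where c: "\<And>z. cnj (erfc (cnj z)) - erfc z = c"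
    using has_field_derivative_zero_constant[of UNIV "\<lambda>w. cnj (erfc (cnj w)) - erfc w"] by auto
  have "c = 0" using c[of 0] by simp
  then have "cnj (erfc (cnj w)) = erfc w" using c[of w] by simp
  then show ?thesis by (metis complex_cnj_cnj)
qed

lemma erfc_of_real_tendsto_0: "((\<lambda>x::real. erfc (of_real x)) \<longlongrightarrow> 0) at_top"
proof -
  let ?g = "\<lambda>t::real. indicator {0..} t *\<^sub>R exp (- t\<^sup>2)"
  have g: "integrable lborel ?g" "(\<integral>t. ?g t \<partial>lborel) = sqrt pi / 2"
    using gaussian_moment_0 by (auto simp: has_bochner_integral_iff)
  have "((\<lambda>y. \<integral>t. indicator {..y} t *\<^sub>R ?g t \<partial>lborel) \<longlongrightarrow> sqrt pi / 2) at_top"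
    using tendsto_integral_at_top[OF sets_lborel g(1)] unfolding g(2) .
  moreover have "\<forall>\<^sub>F y in at_top. (\<integral>t. indicator {..y} t *\<^sub>R ?g t \<partial>lborel) = integral {0..y} (\<lambda>t. exp (- t\<^sup>2))"
    using eventually_ge_at_top[of 0]
  proof eventually_elim
    case (elim y)
    have "set_integrable lborel {0..y} (\<lambda>t. exp (- t\<^sup>2))"
      by (rule borel_integrable_atLeastAtMost') (intro continuous_intros)
    from set_borel_integral_eq_integral(2)[OF this]
    have "integral {0..y} (\<lambda>t. exp (- t\<^sup>2)) = (\<integral>t. indicator {0..y} t *\<^sub>R exp (- t\<^sup>2) \<partial>lborel)"
      by (simp only: set_lebesgue_integral_def)
    also have "\<dots> = (\<integral>t. indicator {..y} t *\<^sub>R ?g t \<partial>lborel)"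
      by (intro Bochner_Integration.integral_cong) (auto simp: indicator_def)
    finally show ?case by simp
  qed
  ultimately have "((\<lambda>y. integral {0..y} (\<lambda>t. exp (- t\<^sup>2))) \<longlongrightarrow> sqrt pi / 2) at_top"
    by (rule Lim_transform_eventually)
  then have "((\<lambda>y. 1 - 2 / complex_of_real (sqrt pi) * of_real (integral {0..y} (\<lambda>t. exp (- t\<^sup>2)))) \<longlongrightarrow> 1 - 2 / complex_of_real (sqrt pi) * of_real (sqrt pi / 2)) at_top"
    by (intro tendsto_intros)
  moreover have "\<forall>\<^sub>F y in at_top. 1 - 2 / complex_of_real (sqrt pi) * of_real (integral {0..y} (\<lambda>t. exp (- t\<^sup>2))) = erfc (of_real y)"
    using eventually_gt_at_top[of 0]
  proof eventually_elim
    case (elim y)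
    have "contour_integral (linepath 0 (of_real y)) (\<lambda>t. exp (- t\<^sup>2)) = integral {0..y} (\<lambda>t. exp (- (of_real t)\<^sup>2))"
      using contour_integral_linepath_Reals_eq[of 0 "of_real y" "\<lambda>t. exp (- t\<^sup>2)"] elim by simp
    also have "\<dots> = integral {0..y} (\<lambda>t. of_real (exp (- t\<^sup>2)))"
      by (simp flip: exp_of_real)
    also have "\<dots> = of_real (integral {0..y} (\<lambda>t. exp (- t\<^sup>2)))"
      by (rule integral_unique[OF has_integral_of_real])
         (intro integrable_integral integrable_continuous_interval continuous_intros)
    finally show ?case by (simp add: erfc_def)
  qed
  ultimately have "((\<lambda>y. erfc (of_real y)) \<longlongrightarrow> 1 - 2 / complex_of_real (sqrt pi) * of_real (sqrt pi / 2)) at_top"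
    by (rule Lim_transform_eventually)
  then show ?thesis by simp
qed

lemma norm_exp_minus_square: "norm (exp (- w\<^sup>2)) = exp ((Im w)\<^sup>2 - (Re w)\<^sup>2)"
  by (simp add: power2_eq_square)

lemma sqrt_pi_ge: "2 / sqrt pi \<le> 2" "sqrt pi \<le> 2" "sqrt pi > 0"
  using pi_gt3 pi_less_4 real_sqrt_le_mono[of pi 4] real_sqrt_le_mono[of 1 pi]
  by (simp_all add: divide_le_eq)

text \<open>The vertical segment from w + x to the real axis costs at most 2 |q| exp (q^2 - (p +
  x)^2), so the real case suffices.\<close>

lemma erfc_tendsto_0: "((\<lambda>x::real. erfc (w + of_real x)) \<longlongrightarrow> 0) at_top"
proof -
  define p q where "p = Re w" and "q = Im w"
  have w: "w = of_real p + \<i> * of_real q" by (simp add: p_def q_def complex_eq_iff)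
  have lim1: "((\<lambda>x. erfc (of_real (p + x))) \<longlongrightarrow> 0) at_top"
    by (rule filterlim_compose[OF erfc_of_real_tendsto_0]) (rule filterlim_tendsto_add_at_top[OF tendsto_const filterlim_ident])
  have "((\<lambda>x. erfc (w + of_real x) - erfc (of_real (p + x))) \<longlongrightarrow> 0) at_top"
  proof (rule Lim_null_comparison)
    have "norm (erfc (w + of_real x) - erfc (of_real (p + x))) \<le> 2 * exp (q\<^sup>2 - (p + x)\<^sup>2) * \<bar>q\<bar>" for x
    proof -
      have "norm (erfc (w + of_real x) - erfc (of_real (p + x))) \<le> 2 * exp (q\<^sup>2 - (p + x)\<^sup>2) * norm (w + of_real x - of_real (p + x))"
      proof (rule field_differentiable_bound[of "closed_segment (of_real (p + x)) (w + of_real x)"])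
        show "(erfc has_field_derivative - (2 / of_real (sqrt pi)) * exp (- z\<^sup>2)) (at z within S)" for z S
          by (rule has_field_derivative_at_within[OF has_field_derivative_erfc])
        fix z assume "z \<in> closed_segment (of_real (p + x)) (w + of_real x)"
        then have "Re z = p + x" "Im z \<in> closed_segment 0 q"
          by (auto simp: closed_segment_same_Re p_def q_def)
        then have "\<bar>Im z\<bar> \<le> \<bar>q\<bar>" "Re z = p + x" by (auto simp: closed_segment_eq_real_ivl split: if_splits)
        then have "(Im z)\<^sup>2 - (Re z)\<^sup>2 \<le> q\<^sup>2 - (p + x)\<^sup>2" using abs_le_square_iff by auto
        then show "norm (- (2 / of_real (sqrt pi)) * exp (- z\<^sup>2)) \<le> 2 * exp (q\<^sup>2 - (p + x)\<^sup>2)"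
          using sqrt_pi_ge unfolding norm_mult norm_exp_minus_square
          by (intro mult_mono) (auto simp: norm_divide)
      qed auto
      then show ?thesis by (simp add: w norm_mult)
    qed
    then show "\<forall>\<^sub>F x in at_top. norm (erfc (w + of_real x) - erfc (of_real (p + x))) \<le> 2 * exp (q\<^sup>2 - (p + x)\<^sup>2) * \<bar>q\<bar>"
      by simp
    have "((\<lambda>x. exp (q\<^sup>2 - (p + x)\<^sup>2)) \<longlongrightarrow> 0) at_top" by real_asymp
    then have "((\<lambda>x. 2 * exp (q\<^sup>2 - (p + x)\<^sup>2) * \<bar>q\<bar>) \<longlongrightarrow> 2 * 0 * \<bar>q\<bar>) at_top" by (intro tendsto_intros)
    then show "((\<lambda>x. 2 * exp (q\<^sup>2 - (p + x)\<^sup>2) * \<bar>q\<bar>) \<longlongrightarrow> 0) at_top" by simp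
  qed
  from tendsto_add[OF this lim1] show ?thesis by simp
qed

text \<open>Integrates the derivative of erfc along w + t, t > 0, where |exp (-(w + t)^2)| is exp (-
  Re (w^2)) exp (-2 t Re w - t^2). G is any real primitive of a majorant of the last factor: arctan
  gives a bound that includes Re w = 0, an exponential gives the gain 1 / Re w.\<close>

lemma norm_erfc_le_aux:
  assumes "continuous_on UNIV G" "\<And>t. (G has_real_derivative G' t) (at t)"
    and "\<And>t. t > 0 \<Longrightarrow> exp (- 2 * t * Re w - t\<^sup>2) \<le> G' t"
    and "\<And>t. t > 0 \<Longrightarrow> G t - G 0 \<le> K"
  shows "norm (erfc w) \<le> 2 * exp (- Re (w\<^sup>2)) * K"
proof -
  have "((\<lambda>T. norm (erfc w - erfc (w + of_real T))) \<longlongrightarrow> norm (erfc w - 0)) at_top"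
    by (intro tendsto_intros erfc_tendsto_0)
  moreover have "\<forall>\<^sub>F T in at_top. norm (erfc w - erfc (w + of_real T)) \<le> 2 * exp (- Re (w\<^sup>2)) * K"
    using eventually_gt_at_top[of 0]
  proof eventually_elim
    case (elim T)
    let ?A = "2 * exp (- Re (w\<^sup>2))"
    have d: "((\<lambda>t. erfc (w + of_real t)) has_vector_derivative - (2 / of_real (sqrt pi)) * exp (- (w + of_real t)\<^sup>2)) (at t)" for t
    proof -
      have "((\<lambda>z. erfc (w + z)) has_field_derivative - (2 / of_real (sqrt pi)) * exp (- (w + of_real t)\<^sup>2) * 1) (at (of_real t))"
        by (rule DERIV_chain'[where f="\<lambda>z. w + z" and g=erfc, OF _ has_field_derivative_erfc]) (auto intro!: derivative_eq_intros)
      from has_vector_derivative_real_field[OF this] show ?thesis by simp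
    qed
    have "norm (erfc (w + of_real T) - erfc (w + of_real 0)) \<le> ?A * G T - ?A * G 0"
    proof (rule differentiable_bound_general[where f="\<lambda>t. erfc (w + of_real t)" and \<phi>="\<lambda>t. ?A * G t"])
      show "continuous_on {0..T} (\<lambda>t. erfc (w + of_real t))"
        using d by (meson continuous_at_imp_continuous_on has_vector_derivative_continuous)
      show "continuous_on {0..T} (\<lambda>t. ?A * G t)"
        by (intro continuous_intros continuous_on_subset[OF assms(1)]) auto
      show "((\<lambda>t. ?A * G t) has_vector_derivative ?A * G' t) (at t)" for t
        using DERIV_cmult[OF assms(2), of ?A] by (simp add: has_real_derivative_iff_has_vector_derivative)
      show "norm (- (2 / of_real (sqrt pi)) * exp (- (w + of_real t)\<^sup>2)) \<le> ?A * G' t" if "0 < t" for t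
      proof -
        have "norm (exp (- (w + of_real t)\<^sup>2)) = exp (- Re (w\<^sup>2)) * exp (- 2 * t * Re w - t\<^sup>2)"
          by (simp add: power2_eq_square algebra_simps flip: exp_add)
        then have "norm (- (2 / of_real (sqrt pi)) * exp (- (w + of_real t)\<^sup>2))
            = (2 / sqrt pi) * (exp (- Re (w\<^sup>2)) * exp (- 2 * t * Re w - t\<^sup>2))"
          by (simp add: norm_mult norm_divide)
        also have "\<dots> \<le> 2 * (exp (- Re (w\<^sup>2)) * G' t)"
          using sqrt_pi_ge assms(3)[OF that] by (intro mult_mono mult_left_mono) auto
        finally show ?thesis by simp
      qed
    qed (use elim d in auto)
    also have "\<dots> = ?A * (G T - G 0)" by (simp add: algebra_simps)
    also have "\<dots> \<le> ?A * K" by (intro mult_left_mono assms(4)) (use elim in auto)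
    finally show ?case by (simp add: norm_minus_commute)
  qed
  ultimately have "norm (erfc w - 0) \<le> 2 * exp (- Re (w\<^sup>2)) * K"
    by (rule tendsto_upperbound) simp
  then show ?thesis by simp
qed

lemma norm_erfc_le:
  assumes "Re w \<ge> 0" shows "norm (erfc w) \<le> 4 * exp (- Re (w\<^sup>2))"
proof -
  have "norm (erfc w) \<le> 2 * exp (- Re (w\<^sup>2)) * 2"
  proof (rule norm_erfc_le_aux[where G=arctan and G'="\<lambda>t. inverse (1 + t\<^sup>2)"])
    show "continuous_on UNIV arctan" by (intro continuous_intros)
    show "(arctan has_real_derivative inverse (1 + t\<^sup>2)) (at t)" for t by (rule DERIV_arctan)
    show "exp (- 2 * t * Re w - t\<^sup>2) \<le> inverse (1 + t\<^sup>2)" if "t > 0" for t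
    proof -
      have "exp (- 2 * t * Re w - t\<^sup>2) \<le> exp (- t\<^sup>2)" using that assms by simp
      also have "\<dots> \<le> inverse (1 + t\<^sup>2)"
        unfolding exp_minus by (intro le_imp_inverse_le exp_ge_add_one_self) (simp add: add_pos_nonneg)
      finally show ?thesis .
    qed
    show "arctan t - arctan 0 \<le> 2" for t using arctan_bounded[of t] pi_less_4 by simp
  qed
  then show ?thesis by simp
qed

lemma norm_erfc_le':
  assumes "Re w > 0" shows "norm (erfc w) \<le> exp (- Re (w\<^sup>2)) / Re w"
proof -
  have "norm (erfc w) \<le> 2 * exp (- Re (w\<^sup>2)) * (1 / (2 * Re w))"
  proof (rule norm_erfc_le_aux[where G="\<lambda>t. - exp (- 2 * t * Re w) / (2 * Re w)" and G'="\<lambda>t. exp (- 2 * t * Re w)"])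
    show "continuous_on UNIV (\<lambda>t. - exp (- 2 * t * Re w) / (2 * Re w))" using assms by (intro continuous_intros) auto
    show "((\<lambda>t. - exp (- 2 * t * Re w) / (2 * Re w)) has_real_derivative exp (- 2 * t * Re w)) (at t)" for t
      using assms by (auto intro!: derivative_eq_intros simp: field_simps)
  qed (use assms in \<open>auto simp: field_simps\<close>)
  then show ?thesis by simp
qed

section \<open>The branch c in the shifted angle theta = phi - pi, which is Im w\<close>

definition gfun :: "real \<Rightarrow> complex" where
  "gfun \<theta> = 1 + \<i> * of_real \<theta> - exp (\<i> * of_real \<theta>)"

lemma Re_gfun: "Re (gfun \<theta>) = 1 - cos \<theta>" and Im_gfun: "Im (gfun \<theta>) = \<theta> - sin \<theta>"
  by (simp_all add: gfun_def Re_exp Im_exp)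

lemma norm_exp_ii_Taylor:
  assumes "\<bar>\<theta>\<bar> \<le> 1"
  shows "norm (exp (\<i> * of_real \<theta>) - (\<Sum>i\<le>n. (\<i> * of_real \<theta>) ^ i / fact i)) \<le> 3 * \<bar>\<theta>\<bar> ^ Suc n / fact n"
proof -
  have "norm (exp (\<i> * of_real \<theta>) - (\<Sum>i\<le>n. (\<i> * of_real \<theta>) ^ i / fact i))
      \<le> exp (norm (\<i> * of_real \<theta>)) * norm (\<i> * of_real \<theta>) ^ Suc n / fact n"
    by (rule Taylor_exp_field)
  also have "\<dots> = exp \<bar>\<theta>\<bar> * (\<bar>\<theta>\<bar> ^ Suc n / fact n)" by (simp add: norm_mult)
  also have "\<dots> \<le> 3 * (\<bar>\<theta>\<bar> ^ Suc n / fact n)"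
  proof (rule mult_right_mono)
    have "exp \<bar>\<theta>\<bar> \<le> exp 1" using assms by simp
    then show "exp \<bar>\<theta>\<bar> \<le> 3" using exp_le by linarith
  qed simp
  finally show ?thesis by simp
qed

text \<open>Keeps the principal square root off its cut. The real part 1 - cos theta is never
  negative, and where it vanishes the imaginary part theta - sin theta equals theta, which is
  nonzero.\<close>

lemma gfun_nonpos_iff:
  assumes "\<theta> \<noteq> 0" shows "2 * gfun \<theta> / (of_real \<theta>)\<^sup>2 \<notin> \<real>\<^sub>\<le>\<^sub>0"
proof
  assume "2 * gfun \<theta> / (of_real \<theta>)\<^sup>2 \<in> \<real>\<^sub>\<le>\<^sub>0"
  then have *: "Re (2 * gfun \<theta> / (of_real \<theta>)\<^sup>2) \<le> 0" "Im (2 * gfun \<theta> / (of_real \<theta>)\<^sup>2) = 0"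
    by (simp_all add: complex_nonpos_Reals_iff)
  define r where "r = 2 / \<theta>\<^sup>2"
  have r: "r > 0" using assms by (simp add: r_def)
  have eq: "2 * gfun \<theta> / (of_real \<theta>)\<^sup>2 = of_real r * gfun \<theta>" by (simp add: r_def)
  have "r * Re (gfun \<theta>) \<le> 0" "r * Im (gfun \<theta>) = 0" using * unfolding eq by simp_all
  then have "Re (gfun \<theta>) \<le> 0" "Im (gfun \<theta>) = 0" using r by (simp_all add: mult_le_0_iff)
  then have "cos \<theta> = 1" "\<theta> = sin \<theta>" using cos_le_one[of \<theta>] by (auto simp: Re_gfun Im_gfun intro: antisym)
  then have "\<theta> = 0" using cos_one_sin_zero[of \<theta>] by simp
  with assms show False by simp
qed

text \<open>Dividing by theta^2 removes the double zero of \<open>gfun\<close> at 0, so the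
  principal root is continuous everywhere and -theta times it is the required branch c.\<close>

definition crt :: "real \<Rightarrow> complex" where
  "crt \<theta> = (if \<theta> = 0 then 1 else csqrt (2 * gfun \<theta> / (of_real \<theta>)\<^sup>2))"

lemma crt_square: "(of_real \<theta> * crt \<theta>)\<^sup>2 / 2 = gfun \<theta>"
  by (cases "\<theta> = 0") (simp_all add: crt_def power_mult_distrib gfun_def)

lemma Re_crt_pos: "Re (crt \<theta>) > 0"
proof (cases "\<theta> = 0")
  case False
  let ?z = "2 * gfun \<theta> / (of_real \<theta>)\<^sup>2"
  have "Re (csqrt ?z) \<noteq> 0"
  proof
    assume 0: "Re (csqrt ?z) = 0"
    have "?z = (csqrt ?z)\<^sup>2" by simp
    also have "csqrt ?z = \<i> * of_real (Im (csqrt ?z))" using 0 by (simp add: complex_eq_iff)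
    also have "(\<dots>)\<^sup>2 = of_real (- (Im (csqrt ?z))\<^sup>2)" by (simp add: power_mult_distrib)
    finally have "?z \<in> \<real>\<^sub>\<le>\<^sub>0" by (metis nonpos_Reals_of_real_iff zero_le_power2 neg_le_0_iff_le)
    then show False using gfun_nonpos_iff[OF False] by simp
  qed
  then show ?thesis using csqrt_principal[of ?z] False by (auto simp: crt_def)
qed (simp add: crt_def)

lemma gfun_Taylor2:
  assumes "\<bar>\<theta>\<bar> \<le> 1" shows "norm (gfun \<theta> - of_real (\<theta>\<^sup>2 / 2)) \<le> 3/2 * \<bar>\<theta>\<bar> ^ 3"
proof -
  have set: "{..2::nat} = {0,1,2}" by auto
  have "gfun \<theta> - of_real (\<theta>\<^sup>2 / 2) = - (exp (\<i> * of_real \<theta>) - (\<Sum>i\<le>2. (\<i> * of_real \<theta>) ^ i / fact i))"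
    unfolding set by (simp add: gfun_def power_mult_distrib)
  then have "norm (gfun \<theta> - of_real (\<theta>\<^sup>2 / 2)) = norm (exp (\<i> * of_real \<theta>) - (\<Sum>i\<le>2. (\<i> * of_real \<theta>) ^ i / fact i))"
    by (simp only: norm_minus_cancel)
  also have "\<dots> \<le> 3 * \<bar>\<theta>\<bar> ^ Suc 2 / fact 2" by (rule norm_exp_ii_Taylor[OF assms])
  finally show ?thesis by (simp add: eval_nat_numeral)
qed

lemma gfun_Taylor4:
  fixes \<theta> :: real
  defines "s \<equiv> \<i> * complex_of_real \<theta>"
  assumes "\<bar>\<theta>\<bar> \<le> 1"
  shows "norm (gfun \<theta> + (s\<^sup>2 / 2 + s ^ 3 / 6 + s ^ 4 / 24)) \<le> \<bar>\<theta>\<bar> ^ 5"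
proof -
  have set: "{..4::nat} = {0,1,2,3,4}" by auto
  have "gfun \<theta> + (s\<^sup>2 / 2 + s ^ 3 / 6 + s ^ 4 / 24) = - (exp s - (\<Sum>i\<le>4. s ^ i / fact i))"
    unfolding set by (simp add: gfun_def s_def[symmetric] fact_numeral)
  then have "norm (gfun \<theta> + (s\<^sup>2 / 2 + s ^ 3 / 6 + s ^ 4 / 24)) = norm (exp s - (\<Sum>i\<le>4. s ^ i / fact i))"
    by (simp only: norm_minus_cancel)
  also have "\<dots> \<le> 3 * \<bar>\<theta>\<bar> ^ Suc 4 / fact 4" unfolding s_def by (rule norm_exp_ii_Taylor[OF assms(2)])
  also have "\<dots> \<le> \<bar>\<theta>\<bar> ^ 5" using zero_le_power[of "\<bar>\<theta>\<bar>" 5] by (simp add: fact_numeral)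
  finally show ?thesis .
qed

text \<open>An estimate for the square passes to the root because Re \<open>crt\<close> > 0 keeps
  the other factor \<open>crt\<close> + 1 away from 0. The finer expansion below uses the same
  device.\<close>

lemma crt_minus_1:
  assumes "\<bar>\<theta>\<bar> \<le> 1" shows "norm (crt \<theta> - 1) \<le> 3 * \<bar>\<theta>\<bar>"
proof (cases "\<theta> = 0")
  case False
  have "(crt \<theta>)\<^sup>2 - 1 = 2 / of_real (\<theta>\<^sup>2) * (gfun \<theta> - of_real (\<theta>\<^sup>2 / 2))"
    using False by (simp add: crt_def field_simps)
  then have "norm ((crt \<theta>)\<^sup>2 - 1) = 2 / \<theta>\<^sup>2 * norm (gfun \<theta> - of_real (\<theta>\<^sup>2 / 2))"
    by (simp only: norm_mult norm_divide norm_of_real norm_numeral) simp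
  also have "\<dots> \<le> 2 / \<theta>\<^sup>2 * (3/2 * \<bar>\<theta>\<bar> ^ 3)" by (intro mult_left_mono gfun_Taylor2 assms) simp
  also have "\<dots> = 3 * \<bar>\<theta>\<bar>" using False by (cases "\<theta> > 0") (simp_all add: eval_nat_numeral)
  finally have *: "norm ((crt \<theta>)\<^sup>2 - 1) \<le> 3 * \<bar>\<theta>\<bar>" .
  have "(crt \<theta>)\<^sup>2 - 1 = (crt \<theta> - 1) * (crt \<theta> + 1)" by (simp add: power2_eq_square algebra_simps)
  then have "norm (crt \<theta> - 1) * norm (crt \<theta> + 1) \<le> 3 * \<bar>\<theta>\<bar>" using * by (simp add: norm_mult)
  moreover have "1 \<le> norm (crt \<theta> + 1)"
    using Re_crt_pos[of \<theta>] complex_Re_le_cmod[of "crt \<theta> + 1"] by simp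
  then have "norm (crt \<theta> - 1) * 1 \<le> norm (crt \<theta> - 1) * norm (crt \<theta> + 1)" by (intro mult_left_mono) auto
  ultimately show ?thesis by simp
qed (simp add: crt_def)

lemma crt_expansion:
  assumes "\<bar>\<theta>\<bar> \<le> 1"
  shows "norm (crt \<theta> - (1 + \<i> * of_real \<theta> / 6 - of_real \<theta> ^ 2 / 36)) \<le> 6 * \<bar>\<theta>\<bar> ^ 3"
proof (cases "\<theta> = 0")
  case False
  define s where "s = \<i> * complex_of_real \<theta>"
  \<comment> \<open>The root truncated at second order: p^2 reproduces 1 + s/3 + s^2/12, the start
    of the expansion of the square of \<open>crt\<close> in s.\<close>
  define p where "p = 1 + s / 6 + s\<^sup>2 / 36"
  have s0: "s \<noteq> 0" using False by (simp add: s_def)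
  have ns: "norm s = \<bar>\<theta>\<bar>" by (simp add: s_def norm_mult)
  have p: "p = 1 + \<i> * of_real \<theta> / 6 - of_real \<theta> ^ 2 / 36"
    by (simp add: p_def s_def power_mult_distrib)
  have p2: "p\<^sup>2 = 1 + s / 3 + s\<^sup>2 / 12 + s ^ 3 / 108 + s ^ 4 / 1296"
    unfolding p_def by (simp add: power2_eq_square eval_nat_numeral algebra_simps)
  have c2: "(crt \<theta>)\<^sup>2 = - 2 * gfun \<theta> / s\<^sup>2" using False by (simp add: crt_def s_def power_mult_distrib)
  have eq: "(crt \<theta>)\<^sup>2 - p\<^sup>2 = (- 2) / s\<^sup>2 * (gfun \<theta> + (s\<^sup>2 / 2 + s ^ 3 / 6 + s ^ 4 / 24)) - (s ^ 3 / 108 + s ^ 4 / 1296)"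
  proof -
    have "(- 2) / s\<^sup>2 * (g + (s\<^sup>2 / 2 + s ^ 3 / 6 + s ^ 4 / 24)) = - 2 * g / s\<^sup>2 - (1 + s / 3 + s\<^sup>2 / 12)" for g
      using s0 by (simp add: field_simps eval_nat_numeral)
    then show ?thesis unfolding c2 p2 by simp
  qed
  have "norm ((crt \<theta>)\<^sup>2 - p\<^sup>2) \<le> norm ((- 2) / s\<^sup>2 * (gfun \<theta> + (s\<^sup>2 / 2 + s ^ 3 / 6 + s ^ 4 / 24))) + (norm (s ^ 3 / 108) + norm (s ^ 4 / 1296))"
    unfolding eq by (rule order_trans[OF norm_triangle_ineq4 add_left_mono[OF norm_triangle_ineq]])
  also have "\<dots> \<le> 2 / \<theta>\<^sup>2 * \<bar>\<theta>\<bar> ^ 5 + (\<bar>\<theta>\<bar> ^ 3 / 108 + \<bar>\<theta>\<bar> ^ 3 / 1296)"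
  proof (intro add_mono)
    have n2: "norm ((- 2) / s\<^sup>2) = 2 / \<theta>\<^sup>2" unfolding norm_divide norm_power ns by simp
    show "norm ((- 2) / s\<^sup>2 * (gfun \<theta> + (s\<^sup>2 / 2 + s ^ 3 / 6 + s ^ 4 / 24))) \<le> 2 / \<theta>\<^sup>2 * \<bar>\<theta>\<bar> ^ 5"
      unfolding norm_mult n2 by (rule mult_left_mono[OF gfun_Taylor4[OF assms, folded s_def]]) simp
    show "norm (s ^ 3 / 108) \<le> \<bar>\<theta>\<bar> ^ 3 / 108" unfolding norm_divide norm_power ns by simp
    have "\<bar>\<theta>\<bar> ^ 4 \<le> \<bar>\<theta>\<bar> ^ 3" using assms by (intro power_decreasing) auto
    then show "norm (s ^ 4 / 1296) \<le> \<bar>\<theta>\<bar> ^ 3 / 1296" unfolding norm_divide norm_power ns by simp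
  qed
  also have "2 / \<theta>\<^sup>2 * \<bar>\<theta>\<bar> ^ 5 = 2 * \<bar>\<theta>\<bar> ^ 3" using False by (cases "\<theta> > 0") (simp_all add: eval_nat_numeral)
  finally have *: "norm ((crt \<theta>)\<^sup>2 - p\<^sup>2) \<le> 3 * \<bar>\<theta>\<bar> ^ 3"
    using zero_le_power[of "\<bar>\<theta>\<bar>" 3] by linarith
  have "(crt \<theta>)\<^sup>2 - p\<^sup>2 = (crt \<theta> - p) * (crt \<theta> + p)" by (simp add: power2_eq_square algebra_simps)
  then have "norm (crt \<theta> - p) * norm (crt \<theta> + p) \<le> 3 * \<bar>\<theta>\<bar> ^ 3" using * by (simp add: norm_mult)
  moreover have "1 / 2 \<le> norm (crt \<theta> + p)"
  proof -
    have "\<theta>\<^sup>2 \<le> 1" using assms by (simp add: abs_square_le_1)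
    then have "1/2 \<le> Re p" by (simp add: p flip: of_real_power)
    then show ?thesis using Re_crt_pos[of \<theta>] complex_Re_le_cmod[of "crt \<theta> + p"] by simp
  qed
  then have "norm (crt \<theta> - p) * (1/2) \<le> norm (crt \<theta> - p) * norm (crt \<theta> + p)" by (intro mult_left_mono) auto
  ultimately show ?thesis by (simp add: p)
qed (simp add: crt_def)

lemma crt_continuous: "continuous_on UNIV crt"
  unfolding continuous_on_eq_continuous_at[OF open_UNIV]
proof
  fix \<theta> :: real
  show "isCont crt \<theta>"
  proof (cases "\<theta> = 0")
    case True
    have "((\<lambda>x. crt x - crt 0) \<longlongrightarrow> 0) (at 0)"
    proof (rule Lim_null_comparison)
      have "\<forall>\<^sub>F x in at (0::real). \<bar>x\<bar> \<le> 1"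
        by (rule eventually_at_ball'[of 1 0 UNIV, THEN eventually_mono]) (auto simp: dist_norm)
      then show "\<forall>\<^sub>F x in at 0. norm (crt x - crt 0) \<le> 3 * \<bar>x\<bar>"
        by eventually_elim (use crt_minus_1 in \<open>simp add: crt_def[of 0]\<close>)
      show "((\<lambda>x::real. 3 * \<bar>x\<bar>) \<longlongrightarrow> 0) (at 0)" by (auto intro!: tendsto_eq_intros)
    qed
    then show ?thesis using True by (simp add: isCont_def LIM_zero_iff)
  next
    case False
    have "isCont (\<lambda>x. 2 * gfun x / (of_real x)\<^sup>2) \<theta>"
      unfolding gfun_def using False by (intro continuous_intros) auto
    moreover have "isCont csqrt (2 * gfun \<theta> / (of_real \<theta>)\<^sup>2)"
      using gfun_nonpos_iff[OF False] by (rule continuous_at_csqrt)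
    ultimately have c: "isCont (\<lambda>x. csqrt (2 * gfun x / (of_real x)\<^sup>2)) \<theta>" by (rule isCont_o2)
    have "\<forall>\<^sub>F x in nhds \<theta>. x \<noteq> 0" using False by (simp add: t1_space_nhds)
    then have "\<forall>\<^sub>F x in nhds \<theta>. csqrt (2 * gfun x / (of_real x)\<^sup>2) = crt x"
      by eventually_elim (simp add: crt_def)
    from isCont_cong[OF this] show ?thesis using c by simp
  qed
qed

definition is_c_branch :: "(real \<Rightarrow> complex) \<Rightarrow> bool" where
  "is_c_branch c \<longleftrightarrow> continuous_on UNIV c \<and>
     (\<forall>\<phi>. (c \<phi>)\<^sup>2 / 2 = 1 + \<i> * of_real (\<phi> - pi) - exp (\<i> * of_real (\<phi> - pi))) \<and>
     (\<lambda>\<phi>. c \<phi> - (- of_real (\<phi> - pi) - \<i> / 6 * of_real (\<phi> - pi) ^ 2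
                   + 1 / 36 * of_real (\<phi> - pi) ^ 3))
       \<in> O[at pi](\<lambda>\<phi>. of_real (\<phi> - pi) ^ 4)"

lemma is_c_branch_crt: "is_c_branch (\<lambda>\<phi>. - of_real (\<phi> - pi) * crt (\<phi> - pi))"
  unfolding is_c_branch_def
proof (intro conjI allI)
  show "continuous_on UNIV (\<lambda>\<phi>. - of_real (\<phi> - pi) * crt (\<phi> - pi))"
    by (intro continuous_intros continuous_on_compose2[OF crt_continuous]) auto
  show "(- of_real (\<phi> - pi) * crt (\<phi> - pi))\<^sup>2 / 2 = 1 + \<i> * of_real (\<phi> - pi) - exp (\<i> * of_real (\<phi> - pi))" for \<phi>
    using crt_square[of "\<phi> - pi"] unfolding gfun_def mult_minus_left power2_minus .
  show "(\<lambda>\<phi>. - of_real (\<phi> - pi) * crt (\<phi> - pi) - (- of_real (\<phi> - pi) - \<i> / 6 * of_real (\<phi> - pi) ^ 2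
                   + 1 / 36 * of_real (\<phi> - pi) ^ 3)) \<in> O[at pi](\<lambda>\<phi>. of_real (\<phi> - pi) ^ 4)"
  proof (rule bigoI[where c=6])
    have "\<forall>\<^sub>F \<phi> in at pi. \<bar>\<phi> - pi\<bar> \<le> 1"
      by (rule eventually_at_ball'[of 1 pi UNIV, THEN eventually_mono]) (auto simp: dist_norm abs_minus_commute)
    then show "\<forall>\<^sub>F \<phi> in at pi. norm (- of_real (\<phi> - pi) * crt (\<phi> - pi) - (- of_real (\<phi> - pi) - \<i> / 6 * of_real (\<phi> - pi) ^ 2
                   + 1 / 36 * of_real (\<phi> - pi) ^ 3)) \<le> 6 * norm (complex_of_real (\<phi> - pi) ^ 4)"
    proof eventually_elim
      case (elim \<phi>)
      define t where "t = \<phi> - pi"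
      have "- of_real t * crt t - (- of_real t - \<i> / 6 * of_real t ^ 2 + 1 / 36 * of_real t ^ 3)
         = - of_real t * (crt t - (1 + \<i> * of_real t / 6 - of_real t ^ 2 / 36))"
        by (simp add: algebra_simps eval_nat_numeral)
      then have "norm (- of_real t * crt t - (- of_real t - \<i> / 6 * of_real t ^ 2 + 1 / 36 * of_real t ^ 3))
         = \<bar>t\<bar> * norm (crt t - (1 + \<i> * of_real t / 6 - of_real t ^ 2 / 36))"
        by (simp only: norm_mult norm_minus_cancel norm_of_real)
      also have "\<dots> \<le> \<bar>t\<bar> * (6 * \<bar>t\<bar> ^ 3)"
        by (intro mult_left_mono crt_expansion) (use elim in \<open>simp_all add: t_def\<close>)
      also have "\<dots> = 6 * norm (complex_of_real t ^ 4)" unfolding norm_power norm_of_real by (simp add: eval_nat_numeral)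
      finally show ?case by (simp only: t_def)
    qed
  qed
qed

text \<open>The slope -1 at pi selects the sign of the root on either side of pi.\<close>

lemma is_c_branch_slope:
  assumes "is_c_branch c"
  shows "((\<lambda>\<phi>. c \<phi> / of_real (\<phi> - pi)) \<longlongrightarrow> -1) (at pi)"
proof -
  let ?p = "\<lambda>\<phi>. - of_real (\<phi> - pi) - \<i> / 6 * of_real (\<phi> - pi) ^ 2 + 1 / 36 * of_real (\<phi> - pi) ^ 3 :: complex"
  obtain C where C: "\<forall>\<^sub>F \<phi> in at pi. norm (c \<phi> - ?p \<phi>) \<le> C * norm (complex_of_real (\<phi> - pi) ^ 4)"
    using assms unfolding is_c_branch_def by (auto elim!: landau_o.bigE)
  have "((\<lambda>\<phi>. (c \<phi> - ?p \<phi>) / of_real (\<phi> - pi)) \<longlongrightarrow> 0) (at pi)"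
  proof (rule Lim_null_comparison)
    show "\<forall>\<^sub>F \<phi> in at pi. norm ((c \<phi> - ?p \<phi>) / of_real (\<phi> - pi)) \<le> C * \<bar>\<phi> - pi\<bar> ^ 3"
      using C eventually_neq_at_within[of pi pi UNIV]
    proof eventually_elim
      case (elim \<phi>)
      have "norm ((c \<phi> - ?p \<phi>) / of_real (\<phi> - pi)) = norm (c \<phi> - ?p \<phi>) / \<bar>\<phi> - pi\<bar>"
        by (simp only: norm_divide norm_of_real)
      also have "\<dots> \<le> (C * norm (complex_of_real (\<phi> - pi) ^ 4)) / \<bar>\<phi> - pi\<bar>"
        by (intro divide_right_mono elim) simp
      also have "\<dots> = C * \<bar>\<phi> - pi\<bar> ^ 3"
        using elim unfolding norm_power norm_of_real by (simp add: eval_nat_numeral)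
      finally show ?case .
    qed
    show "((\<lambda>\<phi>. C * \<bar>\<phi> - pi\<bar> ^ 3) \<longlongrightarrow> 0) (at pi)" by (auto intro!: tendsto_eq_intros)
  qed
  moreover have "((\<lambda>\<phi>. -1 - \<i> / 6 * of_real (\<phi> - pi) + 1 / 36 * of_real (\<phi> - pi) ^ 2) \<longlongrightarrow> -1 - \<i> / 6 * of_real (pi - pi) + 1 / 36 * of_real (pi - pi) ^ 2) (at pi)"
    by (intro tendsto_intros)
  ultimately have "((\<lambda>\<phi>. (c \<phi> - ?p \<phi>) / of_real (\<phi> - pi) + (-1 - \<i> / 6 * of_real (\<phi> - pi) + 1 / 36 * of_real (\<phi> - pi) ^ 2)) \<longlongrightarrow> 0 + -1) (at pi)"
    by (intro tendsto_add) simp_all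
  moreover have "\<forall>\<^sub>F \<phi> in at pi. (c \<phi> - ?p \<phi>) / of_real (\<phi> - pi) + (-1 - \<i> / 6 * of_real (\<phi> - pi) + 1 / 36 * of_real (\<phi> - pi) ^ 2) = c \<phi> / of_real (\<phi> - pi)"
    using eventually_neq_at_within[of pi pi UNIV]
  proof eventually_elim
    case (elim \<phi>)
    define t where "t = complex_of_real (\<phi> - pi)"
    have "t \<noteq> 0" using elim by (simp add: t_def)
    then have "(c \<phi> - (- t - \<i> / 6 * t ^ 2 + 1 / 36 * t ^ 3)) / t + (-1 - \<i> / 6 * t + 1 / 36 * t ^ 2) = c \<phi> / t"
      by (simp add: field_simps eval_nat_numeral)
    then show ?case by (simp only: t_def)
  qed
  ultimately show ?thesis using Lim_transform_eventually by force
qed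

text \<open>Off pi neither branch vanishes, so their quotient is continuous with values 1 and -1,
  hence constant on a connected set; the equal slopes at pi make the constant 1.\<close>

lemma is_c_branch_unique_on:
  assumes c: "is_c_branch c" and d: "is_c_branch d"
    and S: "connected S" "pi \<notin> S" "at pi within S \<noteq> bot" "\<phi> \<in> S"
  shows "c \<phi> = d \<phi>"
proof -
  have c2: "(c x)\<^sup>2 / 2 = gfun (x - pi)" and d2: "(d x)\<^sup>2 / 2 = gfun (x - pi)" for x
    using c d unfolding is_c_branch_def gfun_def by blast+
  have sq: "(c x)\<^sup>2 = (d x)\<^sup>2" for x
    using c2[of x] d2[of x] by simp
  have nz: "d x \<noteq> 0" if "x \<in> S" for x
  proof
    assume "d x = 0"
    then have "gfun (x - pi) = 0" using d2[of x] by simp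
    moreover have "x - pi \<noteq> 0" using that S(2) by auto
    ultimately show False using gfun_nonpos_iff[of "x - pi"] by simp
  qed
  have "(\<lambda>x. c x / d x) constant_on S"
  proof (rule continuous_finite_range_constant[OF S(1)])
    show "continuous_on S (\<lambda>x. c x / d x)"
      using c d nz unfolding is_c_branch_def by (intro continuous_intros) (auto intro: continuous_on_subset)
    have "c x / d x = 1 \<or> c x / d x = -1" if "x \<in> S" for x
    proof -
      have "c x = d x \<or> c x = - d x" using sq[of x] by (simp add: power2_eq_iff)
      then show ?thesis using nz[OF that] by auto
    qed
    then have "(\<lambda>x. c x / d x) ` S \<subseteq> {1, -1}" by blast
    then show "finite ((\<lambda>x. c x / d x) ` S)" by (rule finite_subset) simp
  qed
  then obtain k where k: "\<And>x. x \<in> S \<Longrightarrow> c x / d x = k" unfolding constant_on_def by blast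
  have "((\<lambda>x. (c x / of_real (x - pi)) / (d x / of_real (x - pi))) \<longlongrightarrow> -1 / -1) (at pi)"
    by (intro tendsto_divide is_c_branch_slope c d) simp
  then have "((\<lambda>x. (c x / of_real (x - pi)) / (d x / of_real (x - pi))) \<longlongrightarrow> 1) (at pi within S)"
    using tendsto_within_subset[of _ _ pi UNIV S] by simp
  moreover have "\<forall>\<^sub>F x in at pi within S. (c x / of_real (x - pi)) / (d x / of_real (x - pi)) = k"
    unfolding eventually_at_filter using S(2) k by (auto intro!: always_eventually)
  ultimately have "((\<lambda>x. k) \<longlongrightarrow> 1) (at pi within S)" by (rule Lim_transform_eventually)
  then have "k = 1" using S(3) by (simp add: tendsto_const_iff)
  then show ?thesis using k[OF S(4)] nz[OF S(4)] by simp
qed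

lemma is_c_branch_unique:
  assumes c: "is_c_branch c" and d: "is_c_branch d" shows "c = d"
proof
  fix \<phi>
  consider "\<phi> < pi" | "\<phi> = pi" | "\<phi> > pi" by linarith
  then show "c \<phi> = d \<phi>"
  proof cases
    case 1
    then show ?thesis by (intro is_c_branch_unique_on[OF c d, of "{..<pi}"]) auto
  next
    case 2
    have "(c pi)\<^sup>2 / 2 = 1 + \<i> * of_real (pi - pi) - exp (\<i> * of_real (pi - pi))"
      "(d pi)\<^sup>2 / 2 = 1 + \<i> * of_real (pi - pi) - exp (\<i> * of_real (pi - pi))"
      using c d unfolding is_c_branch_def by blast+
    then show ?thesis using 2 by simp
  next
    case 3
    then show ?thesis by (intro is_c_branch_unique_on[OF c d, of "{pi<..}"]) auto
  qed
qed

lemma c_fun_eq: "c_fun \<phi> = - of_real (\<phi> - pi) * crt (\<phi> - pi)"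
proof -
  have "c_fun = (THE c. is_c_branch c)" unfolding c_fun_def is_c_branch_def ..
  also have "\<dots> = (\<lambda>\<phi>. - of_real (\<phi> - pi) * crt (\<phi> - pi))"
  proof (rule the_equality)
    show "is_c_branch (\<lambda>\<phi>. - of_real (\<phi> - pi) * crt (\<phi> - pi))" by (rule is_c_branch_crt)
    show "c = (\<lambda>\<phi>. - of_real (\<phi> - pi) * crt (\<phi> - pi))" if "is_c_branch c" for c
      using is_c_branch_unique[OF that is_c_branch_crt] .
  qed
  finally show ?thesis by (rule fun_cong)
qed

lemma c_fun_square: "(c_fun \<phi>)\<^sup>2 = 2 * gfun (\<phi> - pi)"
proof -
  have "(c_fun \<phi>)\<^sup>2 / 2 = gfun (\<phi> - pi)"
    using crt_square[of "\<phi> - pi"] unfolding c_fun_eq mult_minus_left power2_minus .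
  then show ?thesis by simp
qed

lemma c_fun_continuous: "continuous_on UNIV c_fun"
  using is_c_branch_crt unfolding is_c_branch_def c_fun_eq [abs_def] by blast

lemma Re_c_fun: "Re (c_fun \<phi>) = (pi - \<phi>) * Re (crt (\<phi> - pi))"
  by (simp add: c_fun_eq algebra_simps)

text \<open>The explicit square root only serves to show that some derivative D exists. Its value
  follows by differentiating c^2 = 2 \<open>gfun\<close>.\<close>

lemma c_fun_has_vector_derivative:
  assumes "\<phi> \<noteq> pi"
  shows "(c_fun has_vector_derivative (\<i> - \<i> * exp (\<i> * of_real (\<phi> - pi))) / c_fun \<phi>) (at \<phi>)"
proof -
  let ?G = "\<lambda>z. 1 + \<i> * (z - of_real pi) - exp (\<i> * (z - of_real pi))"
  let ?C = "\<lambda>z. - (z - of_real pi) * csqrt (2 * ?G z / (z - of_real pi)\<^sup>2)"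
  have np: "2 * ?G (of_real \<phi>) / (of_real \<phi> - of_real pi)\<^sup>2 \<notin> \<real>\<^sub>\<le>\<^sub>0"
    using gfun_nonpos_iff[of "\<phi> - pi"] assms by (simp add: gfun_def)
  have "(\<lambda>z. 2 * ?G z / (z - of_real pi)\<^sup>2) holomorphic_on - {of_real pi}"
    by (intro holomorphic_intros) auto
  then have "(\<lambda>z. 2 * ?G z / (z - of_real pi)\<^sup>2) field_differentiable (at (of_real \<phi>))"
    by (rule holomorphic_on_imp_differentiable_at) (use assms in auto)
  from field_differentiable_compose[OF this field_differentiable_at_csqrt[OF np]]
  obtain E where E: "((\<lambda>z. csqrt (2 * ?G z / (z - of_real pi)\<^sup>2)) has_field_derivative E) (at (of_real \<phi>))"
    unfolding field_differentiable_def o_def by blast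
  have "((\<lambda>z. - (z - of_real pi)) has_field_derivative - 1) (at (of_real \<phi>))"
    by (auto intro!: derivative_eq_intros)
  from has_vector_derivative_real_field[OF DERIV_mult[OF this E]]
  obtain D where D: "((\<lambda>x. ?C (of_real x)) has_vector_derivative D) (at \<phi>)" by blast
  have vd: "(c_fun has_vector_derivative D) (at \<phi>)"
  proof (rule has_vector_derivative_transform_within_open[OF D, of "- {pi}"])
    show "?C (of_real x) = c_fun x" if "x \<in> - {pi}" for x
      using that by (simp add: c_fun_eq crt_def gfun_def)
  qed (use assms in auto)
  have v1: "((\<lambda>x. c_fun x * c_fun x) has_vector_derivative c_fun \<phi> * D + D * c_fun \<phi>) (at \<phi>)"
    by (rule has_vector_derivative_mult[OF vd vd])
  have eq: "(\<lambda>x. c_fun x * c_fun x) = (\<lambda>x. 2 * gfun (x - pi))"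
    using c_fun_square by (simp add: power2_eq_square fun_eq_iff)
  have v2: "((\<lambda>x. 2 * gfun (x - pi)) has_vector_derivative 2 * (\<i> - \<i> * exp (\<i> * of_real (\<phi> - pi)))) (at \<phi>)"
  proof -
    have "((\<lambda>z. 2 * ?G z) has_field_derivative 2 * (\<i> - \<i> * exp (\<i> * (of_real \<phi> - of_real pi)))) (at (of_real \<phi>))"
      by (auto intro!: derivative_eq_intros)
    from has_vector_derivative_real_field[OF this] show ?thesis by (simp add: gfun_def)
  qed
  have "c_fun \<phi> * D + D * c_fun \<phi> = 2 * (\<i> - \<i> * exp (\<i> * of_real (\<phi> - pi)))"
    by (rule vector_derivative_unique_at[OF v1[unfolded eq] v2])
  then have cD: "c_fun \<phi> * D = \<i> - \<i> * exp (\<i> * of_real (\<phi> - pi))"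
    unfolding mult.commute[of D] mult_2[symmetric] by (simp only: mult_left_cancel[OF zero_neq_numeral[symmetric]])
  have nz: "c_fun \<phi> \<noteq> 0" using assms Re_crt_pos[of "\<phi> - pi"] Re_c_fun[of \<phi>] by auto
  have "D = (\<i> - \<i> * exp (\<i> * of_real (\<phi> - pi))) / c_fun \<phi>" unfolding cD[symmetric] using nz by simp
  with vd show ?thesis by simp
qed

text \<open>Quantifies that c' tends to -1 at pi. The constant is (3 + 3) / (1/2): the linear
  estimate of \<open>crt\<close>, the Taylor remainder of the exponential, and |\<open>crt\<close>|
  >= 1/2.\<close>

lemma c_fun_derivative_near:
  assumes "\<theta> \<noteq> 0" "\<bar>\<theta>\<bar> \<le> 1/6"
  shows "norm (1 + (\<i> - \<i> * exp (\<i> * of_real \<theta>)) / c_fun (\<theta> + pi)) \<le> 12 * \<bar>\<theta>\<bar>"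
proof -
  let ?e = "exp (\<i> * of_real \<theta>)"
  have u1: "norm (crt \<theta> - 1) \<le> 3 * \<bar>\<theta>\<bar>" using crt_minus_1[of \<theta>] assms by simp
  then have u: "norm (crt \<theta>) \<ge> 1/2" using assms norm_triangle_ineq2[of 1 "1 - crt \<theta>"] by (simp add: norm_minus_commute)
  have c: "c_fun (\<theta> + pi) = - of_real \<theta> * crt \<theta>" by (simp add: c_fun_eq)
  have "norm (?e - (\<Sum>i\<le>1. (\<i> * of_real \<theta>) ^ i / fact i)) \<le> 3 * \<bar>\<theta>\<bar> ^ Suc 1 / fact 1"
    by (rule norm_exp_ii_Taylor) (use assms in simp)
  then have g: "norm (?e - (1 + \<i> * of_real \<theta>)) \<le> 3 * \<bar>\<theta>\<bar>\<^sup>2" by (simp add: eval_nat_numeral)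
  have "1 + (\<i> - \<i> * ?e) / c_fun (\<theta> + pi) = (of_real \<theta> * (crt \<theta> - 1) + \<i> * (?e - (1 + \<i> * of_real \<theta>))) / (of_real \<theta> * crt \<theta>)"
  proof -
    have "crt \<theta> \<noteq> 0" using u by auto
    then show ?thesis unfolding c using assms by (simp add: field_simps)
  qed
  then have "norm (1 + (\<i> - \<i> * ?e) / c_fun (\<theta> + pi)) = norm (of_real \<theta> * (crt \<theta> - 1) + \<i> * (?e - (1 + \<i> * of_real \<theta>))) / (\<bar>\<theta>\<bar> * norm (crt \<theta>))"
    by (simp only: norm_divide norm_mult norm_of_real)
  also have "\<dots> \<le> (\<bar>\<theta>\<bar> * (3 * \<bar>\<theta>\<bar>) + 3 * \<bar>\<theta>\<bar>\<^sup>2) / (\<bar>\<theta>\<bar> * (1/2))"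
  proof (rule frac_le)
    have "norm (of_real \<theta> * (crt \<theta> - 1) + \<i> * (?e - (1 + \<i> * of_real \<theta>))) \<le> norm (of_real \<theta> * (crt \<theta> - 1)) + norm (\<i> * (?e - (1 + \<i> * of_real \<theta>)))"
      by (rule norm_triangle_ineq)
    also have "\<dots> \<le> \<bar>\<theta>\<bar> * (3 * \<bar>\<theta>\<bar>) + 3 * \<bar>\<theta>\<bar>\<^sup>2"
      unfolding norm_mult norm_ii norm_of_real mult_1_left by (intro add_mono mult_left_mono u1 g) simp
    finally show "norm (of_real \<theta> * (crt \<theta> - 1) + \<i> * (?e - (1 + \<i> * of_real \<theta>))) \<le> \<bar>\<theta>\<bar> * (3 * \<bar>\<theta>\<bar>) + 3 * \<bar>\<theta>\<bar>\<^sup>2" .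
  qed (use assms u in \<open>auto intro!: mult_left_mono\<close>)
  also have "\<dots> = 12 * \<bar>\<theta>\<bar>" using assms by (cases "\<theta> > 0") (simp_all add: power2_eq_square)
  finally show ?thesis .
qed

subsection \<open>Asymptotics of a single transform\<close>

text \<open>Here x stands for |sigma z| and theta for phi - pi, so the saddle point of the exponent
  is theta = 0.\<close>

definition tau :: "real \<Rightarrow> real \<Rightarrow> real \<Rightarrow> real \<Rightarrow> complex" where
  "tau a b x \<theta> = gterm a b (Complex (ln x) \<theta>) / (2 * of_real pi * \<i> * gwt a b (Complex (ln x) \<theta>))"

definition psi :: "real \<Rightarrow> real \<Rightarrow> complex" where
  "psi y \<theta> = erfc (c_fun (\<theta> + pi) * of_real (sqrt (y / 2))) / 2"

lemma exp_Complex_ln: "x > 0 \<Longrightarrow> exp (Complex (ln x) \<theta>) = of_real x * exp (\<i> * of_real \<theta>)"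
  by (simp add: complex_eq_iff Re_exp Im_exp)

lemma norm_exp_gfun: "norm (exp (- of_real y * gfun \<theta>)) = exp (- y * (1 - cos \<theta>))"
  by (simp add: Re_gfun)

text \<open>The reciprocal weight factors into its value at theta = 0, a phase turning at the rate b
  - a x, which stays bounded in the application, and exp (- a x \<open>gfun\<close> theta). The last
  factor also occurs in the derivative of \<open>psi\<close>, which makes the comparison
  possible.\<close>

lemma tau_has_vector_derivative:
  assumes "x > 0"
  shows "(tau a b x has_vector_derivative of_real (b * gmass a b / (2 * pi) * exp (a * x - b * ln x))
     * exp (- \<i> * of_real ((b - a * x) * \<theta>)) * exp (- of_real (a * x) * gfun \<theta>)) (at \<theta>)"
proof -
  let ?h = "\<lambda>z. of_real (ln x) + \<i> * z"
  have C: "Complex (ln x) t = ?h (of_real t)" for t by (simp add: Complex_eq)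
  have "((\<lambda>z. gterm a b (?h z) / gwt a b (?h z)) has_field_derivative
      of_real (b * gmass a b) / gwt a b (?h (of_real \<theta>)) * \<i>) (at (of_real \<theta>))"
    by (rule DERIV_chain'[where f="?h", OF _ gterm_quotient_has_field_derivative]) (auto intro!: derivative_eq_intros)
  from has_vector_derivative_real_field[OF DERIV_cdivide[OF this, of "2 * of_real pi * \<i>"]]
  have "(tau a b x has_vector_derivative of_real (b * gmass a b) / gwt a b (?h (of_real \<theta>)) * \<i> / (2 * of_real pi * \<i>)) (at \<theta>)"
    unfolding tau_def [abs_def] C by (simp add: mult.commute)
  moreover have "of_real (b * gmass a b) / gwt a b (?h (of_real \<theta>)) * \<i> / (2 * of_real pi * \<i>)
     = of_real (b * gmass a b / (2 * pi)) * (1 / gwt a b (Complex (ln x) \<theta>))"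
    unfolding C by simp
  moreover have "1 / gwt a b (Complex (ln x) \<theta>) = of_real (exp (a * x - b * ln x))
     * exp (- \<i> * of_real ((b - a * x) * \<theta>)) * exp (- of_real (a * x) * gfun \<theta>)"
  proof -
    have "1 / gwt a b (Complex (ln x) \<theta>) = exp (of_real a * exp (Complex (ln x) \<theta>) - of_real b * Complex (ln x) \<theta>)"
      by (simp add: gwt_def exp_diff exp_minus exp_add field_simps)
    also have "of_real a * exp (Complex (ln x) \<theta>) - of_real b * Complex (ln x) \<theta>
       = of_real (a * x - b * ln x) + (- \<i> * of_real ((b - a * x) * \<theta>)) + (- of_real (a * x) * gfun \<theta>)"
      unfolding exp_Complex_ln[OF assms] gfun_def by (simp add: C algebra_simps)
    finally show ?thesis by (simp only: exp_add exp_of_real)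
  qed
  ultimately show ?thesis by (simp add: mult.assoc)
qed

lemma norm_tau_le:
  assumes ab: "a > 0" "b > 0" and x: "x > 0" and s: "0 < s" "s \<le> pi/2" "-2*pi + s \<le> \<theta>" "\<theta> \<le> -s"
  shows "norm (tau a b x \<theta>) \<le> gmass a b / (2 * pi) * exp (a * x - b * ln x) / sin s * exp (- (a * x) * (1 - cos \<theta>))"
proof -
  have g: "norm (gwt a b (Complex (ln x) \<theta>)) = exp (- (a * x) * cos \<theta> + b * ln x)"
    using x by (simp add: norm_gwt)
  have "norm (gterm a b (Complex (ln x) \<theta>)) \<le> gmass a b / sin s"
    using s by (intro norm_gterm_le_interior ab) auto
  then have "norm (tau a b x \<theta>) \<le> (gmass a b / sin s) / (2 * pi * exp (- (a * x) * cos \<theta> + b * ln x))"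
  proof -
    have den: "norm (2 * of_real pi * \<i> * gwt a b (Complex (ln x) \<theta>)) = 2 * pi * exp (- (a * x) * cos \<theta> + b * ln x)"
      by (simp add: norm_mult g)
    assume "norm (gterm a b (Complex (ln x) \<theta>)) \<le> gmass a b / sin s"
    then show ?thesis unfolding tau_def norm_divide den by (rule divide_right_mono) simp
  qed
  also have "\<dots> = gmass a b / (2 * pi) / sin s * exp (- (- (a * x) * cos \<theta> + b * ln x))"
    unfolding exp_minus inverse_eq_divide by (simp add: mult_ac)
  also have "\<dots> = gmass a b / (2 * pi) / sin s * (exp (a * x - b * ln x) * exp (- (a * x) * (1 - cos \<theta>)))"
  proof -
    have "- (- (a * x) * cos \<theta> + b * ln x) = (a * x - b * ln x) + (- (a * x) * (1 - cos \<theta>))"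
      by (simp add: algebra_simps)
    then show ?thesis by (simp only: exp_add)
  qed
  finally show ?thesis by simp
qed

text \<open>The jump relation after normalisation: 1 - \<open>tau\<close> at theta is a unimodular
  multiple of \<open>tau\<close> at theta - 2 pi up to sign, so decay on the left of the saddle
  becomes decay of 1 - \<open>tau\<close> on the right.\<close>

lemma tau_shift:
  assumes ab: "a > 0" "b > 0"
  shows "tau a b x \<theta> = 1 + exp (- 2 * of_real pi * \<i> * of_real b) * tau a b x (\<theta> - 2 * pi)"
proof -
  let ?w = "Complex (ln x) \<theta>"
  let ?p = "2 * of_real pi * \<i> :: complex"
  have w: "Complex (ln x) (\<theta> - 2 * pi) = ?w - ?p" by (simp add: complex_eq_iff)
  have "exp (- ?p * of_real b) \<noteq> 0" by simp
  then have "exp (- ?p * of_real b) * tau a b x (\<theta> - 2 * pi) = gterm a b (?w - ?p) / (?p * gwt a b ?w)"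
    using gwt_shift_period[of a b ?w] unfolding tau_def w by simp
  moreover have "tau a b x \<theta> = (gterm a b (?w - ?p) + ?p * gwt a b ?w) / (?p * gwt a b ?w)"
    using gterm_jump[OF ab, of ?w] unfolding tau_def by (simp add: algebra_simps)
  moreover have "(gterm a b (?w - ?p) + ?p * gwt a b ?w) / (?p * gwt a b ?w) = 1 + gterm a b (?w - ?p) / (?p * gwt a b ?w)"
    unfolding add_divide_distrib by simp
  ultimately show ?thesis by simp
qed

lemma norm_one_minus_tau_le:
  assumes ab: "a > 0" "b > 0" and x: "x > 0" and s: "0 < s" "s \<le> pi/2" "s \<le> \<theta>" "\<theta> \<le> 2*pi - s"
  shows "norm (1 - tau a b x \<theta>) \<le> gmass a b / (2 * pi) * exp (a * x - b * ln x) / sin s * exp (- (a * x) * (1 - cos \<theta>))"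
proof -
  have "norm (exp (- 2 * of_real pi * \<i> * of_real b)) = 1" by simp
  then have "norm (1 - tau a b x \<theta>) = norm (tau a b x (\<theta> - 2 * pi))"
    using tau_shift[OF ab, of x \<theta>] by (simp add: norm_mult)
  also have "\<dots> \<le> gmass a b / (2 * pi) * exp (a * x - b * ln x) / sin s * exp (- (a * x) * (1 - cos (\<theta> - 2 * pi)))"
    using s by (intro norm_tau_le ab x) auto
  also have "cos (\<theta> - 2 * pi) = cos \<theta>" by (simp add: cos_diff)
  finally show ?thesis .
qed

text \<open>The square of the argument of erfc is exactly y \<open>gfun\<close> theta, so with y = a
  x the exponential factor agrees with that of \<open>tau\<close> and only the prefactors
  differ.\<close>

lemma psi_has_vector_derivative:
  assumes "y > 0" "\<theta> \<noteq> 0"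
  shows "(psi y has_vector_derivative - of_real (sqrt (y / 2) / sqrt pi)
     * ((\<i> - \<i> * exp (\<i> * of_real \<theta>)) / c_fun (\<theta> + pi)) * exp (- of_real y * gfun \<theta>)) (at \<theta>)"
proof -
  let ?q = "complex_of_real (sqrt (y / 2))"
  let ?c' = "(\<i> - \<i> * exp (\<i> * of_real \<theta>)) / c_fun (\<theta> + pi)"
  have "((\<lambda>t. c_fun (t + pi)) has_vector_derivative ?c') (at \<theta>)"
  proof -
    have "((c_fun \<circ> (\<lambda>t. t + pi)) has_vector_derivative 1 *\<^sub>R ?c') (at \<theta>)"
      using c_fun_has_vector_derivative[of "\<theta> + pi"] assms
      by (intro vector_diff_chain_at) (auto intro!: derivative_eq_intros simp: has_vector_derivative_def)
    then show ?thesis by (simp add: o_def)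
  qed
  then have c: "((\<lambda>t. c_fun (t + pi) * ?q) has_vector_derivative ?c' * ?q) (at \<theta>)"
    by (rule has_vector_derivative_mult_left)
  have q2: "?q\<^sup>2 = of_real (y / 2)" using assms by (simp flip: of_real_power)
  have sq: "(c_fun (\<theta> + pi) * ?q)\<^sup>2 = of_real y * gfun \<theta>"
    unfolding power_mult_distrib c_fun_square q2 by simp
  have e: "((\<lambda>w. erfc w / 2) has_field_derivative - (2 / of_real (sqrt pi)) * exp (- (of_real y * gfun \<theta>)) / 2)
      (at (c_fun (\<theta> + pi) * ?q))"
    using DERIV_cdivide[OF has_field_derivative_erfc[of "c_fun (\<theta> + pi) * ?q"], of 2] unfolding sq .
  from field_vector_diff_chain_at[OF c e]
  have "(psi y has_vector_derivative ?c' * ?q * (- (2 / of_real (sqrt pi)) * exp (- (of_real y * gfun \<theta>)) / 2)) (at \<theta>)"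
    unfolding psi_def [abs_def] o_def .
  moreover have "?c' * ?q * (- (2 / of_real (sqrt pi)) * exp (- (of_real y * gfun \<theta>)) / 2) =
      - of_real (sqrt (y / 2) / sqrt pi) * ?c' * exp (- of_real y * gfun \<theta>)" by (simp add: mult_ac)
  ultimately show ?thesis by (simp only:)
qed

lemma psi_continuous: "continuous_on UNIV (psi y)"
proof -
  have e: "continuous_on UNIV erfc"
    using DERIV_isCont[OF has_field_derivative_erfc] by (simp add: continuous_at_imp_continuous_on)
  have p: "continuous_on UNIV (\<lambda>t. t + pi)" by (intro continuous_intros)
  have "continuous_on UNIV (\<lambda>t. c_fun (t + pi))"
    by (rule continuous_on_compose2[OF c_fun_continuous p]) simp
  then have c: "continuous_on UNIV (\<lambda>t. c_fun (t + pi) * of_real (sqrt (y / 2)))"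
    by (rule continuous_on_mult_right)
  have "continuous_on UNIV (\<lambda>t. erfc (c_fun (t + pi) * of_real (sqrt (y / 2))))"
    by (rule continuous_on_compose2[OF e c]) simp
  then show ?thesis unfolding psi_def [abs_def]
    by (rule continuous_on_divide[OF _ continuous_on_const]) simp
qed

lemma psi_arg_square:
  assumes "y \<ge> 0" shows "Re ((c_fun (\<theta> + pi) * of_real (sqrt (y / 2)))\<^sup>2) = y * (1 - cos \<theta>)"
proof -
  have q2: "(complex_of_real (sqrt (y / 2)))\<^sup>2 = of_real (y / 2)" using assms by (simp flip: of_real_power)
  have "(c_fun (\<theta> + pi) * of_real (sqrt (y / 2)))\<^sup>2 = of_real y * gfun \<theta>"
    unfolding power_mult_distrib c_fun_square q2 by simp
  from arg_cong[OF this, of Re] show ?thesis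
    by (simp only: times_complex.sel Re_complex_of_real Im_complex_of_real Re_gfun mult_zero_left diff_0_right)
qed

lemma one_minus_psi: "1 - psi y \<theta> = erfc (- (c_fun (\<theta> + pi) * of_real (sqrt (y / 2)))) / 2"
  unfolding psi_def erfc_minus by (simp add: field_simps)

lemma norm_psi_le:
  assumes y: "y > 0"
  shows "\<theta> \<le> 0 \<Longrightarrow> norm (psi y \<theta>) \<le> 2 * exp (- y * (1 - cos \<theta>))"
    and "\<theta> \<ge> 0 \<Longrightarrow> norm (1 - psi y \<theta>) \<le> 2 * exp (- y * (1 - cos \<theta>))"
proof -
  let ?w = "c_fun (\<theta> + pi) * of_real (sqrt (y / 2))"
  have re: "Re ?w = - \<theta> * Re (crt \<theta>) * sqrt (y / 2)" by (simp add: Re_c_fun)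
  note sq = psi_arg_square[of y \<theta>]
  show "norm (psi y \<theta>) \<le> 2 * exp (- y * (1 - cos \<theta>))" if "\<theta> \<le> 0"
  proof -
    have "Re ?w \<ge> 0" unfolding re using that Re_crt_pos[of \<theta>] y by (simp add: mult_nonneg_nonneg mult_nonpos_nonneg)
    from norm_erfc_le[OF this] have "norm (erfc ?w) \<le> 4 * exp (- (y * (1 - cos \<theta>)))" using y sq by (simp only: less_imp_le)
    then show ?thesis unfolding psi_def norm_divide by simp
  qed
  show "norm (1 - psi y \<theta>) \<le> 2 * exp (- y * (1 - cos \<theta>))" if "\<theta> \<ge> 0"
  proof -
    have "Re (- ?w) \<ge> 0" using re that Re_crt_pos[of \<theta>] y by simp
    from norm_erfc_le[OF this] have "norm (erfc (- ?w)) \<le> 4 * exp (- (y * (1 - cos \<theta>)))"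
      unfolding power2_minus using y sq by (simp only: less_imp_le)
    then show ?thesis unfolding one_minus_psi norm_divide by simp
  qed
qed

text \<open>At distance d from the saddle the real part of the argument has modulus at least d eta
  sqrt y / 2, and the bound of erfc with 1 / Re w gains 1/sqrt y.\<close>

lemma norm_psi_le':
  assumes y: "y > 0" and eta: "0 < \<eta>" "\<eta> \<le> Re (crt \<theta>)" and d: "0 < d"
  shows "\<theta> \<le> - d \<Longrightarrow> norm (psi y \<theta>) \<le> exp (- y * (1 - cos \<theta>)) / (d * \<eta> * sqrt y)"
    and "d \<le> \<theta> \<Longrightarrow> norm (1 - psi y \<theta>) \<le> exp (- y * (1 - cos \<theta>)) / (d * \<eta> * sqrt y)"
proof -
  let ?w = "c_fun (\<theta> + pi) * of_real (sqrt (y / 2))"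
  have re: "Re ?w = - \<theta> * Re (crt \<theta>) * sqrt (y / 2)" by (simp add: Re_c_fun)
  have sq2: "sqrt y / 2 \<le> sqrt (y / 2)"
  proof -
    have "sqrt 2 \<le> 2" by (rule real_le_lsqrt) auto
    then show ?thesis using y unfolding real_sqrt_divide by (intro divide_left_mono) auto
  qed
  have low: "d * \<eta> * (sqrt y / 2) \<le> t * Re (crt \<theta>) * sqrt (y / 2)" if "d \<le> t" for t
    using that eta d y sq2 by (intro mult_mono) auto
  have pos: "0 < d * \<eta> * (sqrt y / 2)" using d eta y by simp
  note sq = psi_arg_square[of y \<theta>]
  have fin: "exp (- y * (1 - cos \<theta>)) / r / 2 \<le> exp (- y * (1 - cos \<theta>)) / (d * \<eta> * sqrt y)"
    if "d * \<eta> * (sqrt y / 2) \<le> r" for r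
  proof -
    have "exp (- y * (1 - cos \<theta>)) / r \<le> exp (- y * (1 - cos \<theta>)) / (d * \<eta> * (sqrt y / 2))"
      using that pos by (intro divide_left_mono) auto
    then have "exp (- y * (1 - cos \<theta>)) / r / 2 \<le> exp (- y * (1 - cos \<theta>)) / (d * \<eta> * (sqrt y / 2)) / 2"
      by (rule divide_right_mono) simp
    also have "\<dots> = exp (- y * (1 - cos \<theta>)) / (d * \<eta> * sqrt y)" by simp
    finally show ?thesis .
  qed
  show "norm (psi y \<theta>) \<le> exp (- y * (1 - cos \<theta>)) / (d * \<eta> * sqrt y)" if "\<theta> \<le> - d"
  proof -
    have l: "d * \<eta> * (sqrt y / 2) \<le> Re ?w" using low[of "- \<theta>"] that re by simp
    then have "norm (erfc ?w) \<le> exp (- Re (?w\<^sup>2)) / Re ?w" using pos by (intro norm_erfc_le') linarith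
    then have "norm (erfc ?w) \<le> exp (- (y * (1 - cos \<theta>))) / Re ?w" using y sq by (simp only: less_imp_le)
    then have "norm (psi y \<theta>) \<le> exp (- y * (1 - cos \<theta>)) / Re ?w / 2"
      unfolding psi_def norm_divide by (simp only: mult_minus_left norm_numeral divide_right_mono[OF _ zero_le_numeral])
    with fin[OF l] show ?thesis by linarith
  qed
  show "norm (1 - psi y \<theta>) \<le> exp (- y * (1 - cos \<theta>)) / (d * \<eta> * sqrt y)" if "d \<le> \<theta>"
  proof -
    have l: "d * \<eta> * (sqrt y / 2) \<le> Re (- ?w)" using low[of \<theta>] that re by simp
    then have "norm (erfc (- ?w)) \<le> exp (- Re ((- ?w)\<^sup>2)) / Re (- ?w)" using pos by (intro norm_erfc_le') linarith
    then have "norm (erfc (- ?w)) \<le> exp (- (y * (1 - cos \<theta>))) / Re (- ?w)"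
      unfolding power2_minus using y sq by (simp only: less_imp_le)
    then have "norm (1 - psi y \<theta>) \<le> exp (- y * (1 - cos \<theta>)) / Re (- ?w) / 2"
      unfolding one_minus_psi norm_divide by (simp only: mult_minus_left norm_numeral divide_right_mono[OF _ zero_le_numeral])
    with fin[OF l] show ?thesis by linarith
  qed
qed

lemma abs_le_2_sin:
  fixes t :: real assumes "0 \<le> t" "t \<le> 1/6" shows "t \<le> 2 * sin t"
proof -
  have "norm (exp (\<i> * of_real t) - (\<Sum>i\<le>1. (\<i> * of_real t) ^ i / fact i)) \<le> 3 * \<bar>t\<bar> ^ Suc 1 / fact 1"
    by (rule norm_exp_ii_Taylor) (use assms in simp)
  moreover have "\<bar>Im (exp (\<i> * of_real t) - (\<Sum>i\<le>1. (\<i> * of_real t) ^ i / fact i))\<bar> \<le>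
    norm (exp (\<i> * of_real t) - (\<Sum>i\<le>1. (\<i> * of_real t) ^ i / fact i))" by (rule abs_Im_le_cmod)
  ultimately have "\<bar>sin t - t\<bar> \<le> 3 * t\<^sup>2" by (simp add: Im_exp power2_eq_square)
  moreover have "3 * t\<^sup>2 \<le> t / 2" using mult_right_mono[of "6 * t" 1 t] assms by (simp add: power2_eq_square)
  ultimately show ?thesis by linarith
qed

lemma norm_exp_ii_minus_1: "norm (exp (- \<i> * of_real t) - 1) \<le> \<bar>t\<bar>"
  using iexp_approx1[of "-t" 0] by simp

text \<open>The constant kappa is chosen so that the prefactors of the two derivatives coincide.
  What remains is the phase plus c', which tends to 1 - 1 at the saddle and is O(theta). Without
  this linear factor the integrated error would not gain 1/sqrt y.\<close>

lemma tau_minus_psi_derivative_bound: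
  assumes x: "x > 0" and a: "a > 0" and b: "\<bar>b - a * x\<bar> \<le> R" "b > 0"
    and th: "\<theta> \<noteq> 0" "\<bar>\<theta>\<bar> \<le> 1/6"
  defines "K \<equiv> b * gmass a b / (2 * pi) * exp (a * x - b * ln x)"
  defines "\<kappa> \<equiv> K * sqrt pi / sqrt (a * x / 2)"
  obtains D where "((\<lambda>t. tau a b x t - of_real \<kappa> * psi (a * x) t) has_vector_derivative D) (at \<theta>)"
    "norm D \<le> K * (R + 12) * \<bar>\<theta>\<bar> * exp (- (a * x) * (1 - cos \<theta>))"
proof
  let ?c' = "(\<i> - \<i> * exp (\<i> * of_real \<theta>)) / c_fun (\<theta> + pi)"
  let ?e = "exp (- of_real (a * x) * gfun \<theta>)"
  let ?D = "of_real K * (exp (- \<i> * of_real ((b - a * x) * \<theta>)) + ?c') * ?e"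
  have y: "a * x > 0" using x a by simp
  have K: "K \<ge> 0" unfolding K_def using gmass_pos[OF a b(2)] b by simp
  have k: "\<kappa> * (sqrt (a * x / 2) / sqrt pi) = K" unfolding \<kappa>_def using a x by simp
  have "((\<lambda>t. tau a b x t - of_real \<kappa> * psi (a * x) t) has_vector_derivative
     (of_real K * exp (- \<i> * of_real ((b - a * x) * \<theta>)) * ?e
       - of_real \<kappa> * (- of_real (sqrt (a * x / 2) / sqrt pi) * ?c' * ?e))) (at \<theta>)"
    by (rule has_vector_derivative_diff[OF tau_has_vector_derivative[OF x, of a b \<theta>, folded K_def]
          has_vector_derivative_mult_right[OF psi_has_vector_derivative[OF y th(1)]]])
  moreover have "of_real K * exp (- \<i> * of_real ((b - a * x) * \<theta>)) * ?e
       - of_real \<kappa> * (- of_real (sqrt (a * x / 2) / sqrt pi) * ?c' * ?e) = ?D"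
  proof -
    have "of_real \<kappa> * (- of_real (sqrt (a * x / 2) / sqrt pi) * ?c' * ?e) = - (of_real (\<kappa> * (sqrt (a * x / 2) / sqrt pi)) * ?c' * ?e)"
      by (simp only: of_real_mult) (simp only: mult_minus_left mult_minus_right mult.assoc)
    then show ?thesis unfolding k by (simp add: algebra_simps)
  qed
  ultimately show "((\<lambda>t. tau a b x t - of_real \<kappa> * psi (a * x) t) has_vector_derivative ?D) (at \<theta>)" by (simp only:)
  have "norm (exp (- \<i> * of_real ((b - a * x) * \<theta>)) + ?c') \<le> norm (exp (- \<i> * of_real ((b - a * x) * \<theta>)) - 1) + norm (1 + ?c')"
    using norm_triangle_ineq[of "exp (- \<i> * of_real ((b - a * x) * \<theta>)) - 1" "1 + ?c'"] by (simp add: algebra_simps)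
  also have "\<dots> \<le> \<bar>(b - a * x) * \<theta>\<bar> + 12 * \<bar>\<theta>\<bar>"
    by (intro add_mono norm_exp_ii_minus_1 c_fun_derivative_near th)
  also have "\<dots> \<le> (R + 12) * \<bar>\<theta>\<bar>" using b(1) by (simp add: abs_mult distrib_right mult_right_mono)
  finally have fin: "K * norm (exp (- \<i> * of_real ((b - a * x) * \<theta>)) + ?c') * norm ?e \<le> K * ((R + 12) * \<bar>\<theta>\<bar>) * norm ?e"
    using K by (intro mult_right_mono mult_left_mono) auto
  have n: "norm ?D = K * norm (exp (- \<i> * of_real ((b - a * x) * \<theta>)) + ?c') * norm ?e"
    by (simp only: norm_mult norm_of_real abs_of_nonneg[OF K])
  show "norm ?D \<le> K * (R + 12) * \<bar>\<theta>\<bar> * exp (- (a * x) * (1 - cos \<theta>))"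
    using fin unfolding n norm_exp_gfun by (simp only: mult.assoc)
qed

text \<open>Compactness. The bound 7 exceeds 2 pi, so every angle that occurs below is
  covered.\<close>

lemma Re_crt_lower_bound:
  obtains \<eta> where "\<eta> > 0" "\<And>\<theta>. \<bar>\<theta>\<bar> \<le> 7 \<Longrightarrow> \<eta> \<le> Re (crt \<theta>)"
proof -
  have "continuous_on {-7..7} (\<lambda>\<theta>. Re (crt \<theta>))"
    by (intro continuous_intros continuous_on_subset[OF crt_continuous]) auto
  then obtain t where t: "t \<in> {-7..7}" "\<And>\<theta>. \<theta> \<in> {-7..7} \<Longrightarrow> Re (crt t) \<le> Re (crt \<theta>)"
    using continuous_attains_inf[of "{-7..7::real}" "\<lambda>\<theta>. Re (crt \<theta>)"] by auto
  show ?thesis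
  proof (rule that[OF Re_crt_pos[of t]])
    show "Re (crt t) \<le> Re (crt \<theta>)" if "\<bar>\<theta>\<bar> \<le> 7" for \<theta>
      using t(2)[of \<theta>] that by (simp add: abs_le_iff)
  qed
qed

text \<open>The constant \<open>\<kappa>\<close> tends to \<open>1\<close>, which is Stirling's formula; here this is a by-product of comparing
  both sides of the saddle point.\<close>

lemma tau_minus_kappa_psi:
  assumes x: "x > 0" and a: "a > 0" and b: "\<bar>b - a * x\<bar> \<le> R" and y: "2 * R \<le> a * x" and d: "0 < \<delta>" "\<delta> \<le> 1/6"
    and eta': "\<eta> > 0" "\<forall>\<theta>. \<bar>\<theta>\<bar> \<le> 7 \<longrightarrow> \<eta> \<le> Re (crt \<theta>)"
  defines "K \<equiv> b * gmass a b / (2 * pi) * exp (a * x - b * ln x)"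
  defines "\<kappa> \<equiv> K * sqrt pi / sqrt (a * x / 2)"
  defines "Q \<equiv> 1 / sin \<delta> + 1 / (\<delta> * \<eta>) + 2 * (R + 12)"
  shows "- 2 * pi + \<delta> \<le> \<theta> \<Longrightarrow> \<theta> \<le> 0 \<Longrightarrow>
      norm (tau a b x \<theta> - of_real \<kappa> * psi (a * x) \<theta>) \<le> Q * \<kappa> / sqrt (a * x) * exp (- (a * x) * (1 - cos \<theta>))"
    and "0 \<le> \<theta> \<Longrightarrow> \<theta> \<le> 2 * pi - \<delta> \<Longrightarrow>
      norm ((1 - tau a b x \<theta>) - of_real \<kappa> * (1 - psi (a * x) \<theta>)) \<le> Q * \<kappa> / sqrt (a * x) * exp (- (a * x) * (1 - cos \<theta>))"
    and "\<kappa> > 0" "K \<le> \<kappa> * sqrt (a * x)"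
proof -
  have eta: "\<eta> > 0" "\<And>\<theta>. \<bar>\<theta>\<bar> \<le> 7 \<Longrightarrow> \<eta> \<le> Re (crt \<theta>)" using eta' by auto
  let ?y = "a * x"
  let ?E = "\<lambda>\<theta>. exp (- ?y * (1 - cos \<theta>))"
  have yp: "?y > 0" using a x by simp
  have R: "R \<ge> 0" using b by linarith
  have b2: "b \<ge> ?y / 2" using b y by linarith
  then have bp: "b > 0" using yp by linarith
  have Kp: "K > 0" unfolding K_def using gmass_pos[OF a bp] bp by simp
  then show kp: "\<kappa> > 0" unfolding \<kappa>_def using yp by simp
  have Kk: "K \<le> \<kappa> * sqrt ?y"
  proof -
    have "K = \<kappa> * (sqrt (?y / 2) / sqrt pi)" unfolding \<kappa>_def using a x by simp
    also have "\<dots> \<le> \<kappa> * sqrt ?y"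
    proof (rule mult_left_mono)
      have "sqrt (?y / 2) / sqrt pi \<le> sqrt ?y / 1"
        using yp pi_gt3 by (intro frac_le real_sqrt_le_mono) auto
      then show "sqrt (?y / 2) / sqrt pi \<le> sqrt ?y" by simp
    qed (use kp in simp)
    finally show ?thesis .
  qed
  then show "K \<le> \<kappa> * sqrt (a * x)" .
  have sy: "sqrt ?y * sqrt ?y = ?y" "sqrt ?y > 0" using yp by simp_all
  have Kk2: "2 * K / ?y \<le> 2 * \<kappa> / sqrt ?y"
  proof -
    have "2 * K / ?y \<le> 2 * (\<kappa> * sqrt ?y) / ?y" using Kk yp by (intro divide_right_mono mult_left_mono) auto
    also have "\<dots> = 2 * \<kappa> / sqrt ?y"
    proof -
      have "2 * (\<kappa> * r) / (r * r) = 2 * \<kappa> / r" if "r > 0" for r :: real using that by (simp add: field_simps)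
      from this[OF sy(2)] show ?thesis unfolding sy(1) .
    qed
    finally show ?thesis .
  qed
  have Kb: "K / b \<le> \<kappa> / sqrt ?y"
  proof -
    have "K = \<kappa> * (sqrt (?y / 2) / sqrt pi)" unfolding \<kappa>_def using a x by simp
    also have "\<dots> \<le> \<kappa> * (sqrt ?y / 2)"
    proof (rule mult_left_mono)
      have "sqrt (?y / 2) / sqrt pi = sqrt (?y / (2 * pi))" by (simp flip: real_sqrt_divide)
      also have "\<dots> \<le> sqrt (?y / 4)" using yp pi_gt3 by (intro real_sqrt_le_mono divide_left_mono) auto
      also have "\<dots> = sqrt ?y / 2" by (simp add: real_sqrt_divide)
      finally show "sqrt (?y / 2) / sqrt pi \<le> sqrt ?y / 2" .
    qed (use kp in simp)
    finally have "K / b \<le> (\<kappa> * (sqrt ?y / 2)) / (?y / 2)"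
      using b2 yp Kp kp by (intro frac_le) auto
    also have "\<dots> = \<kappa> / sqrt ?y"
    proof -
      have "(\<kappa> * (r / 2)) / (r * r / 2) = \<kappa> / r" if "r > 0" for r :: real using that by (simp add: field_simps)
      from this[OF sy(2)] show ?thesis unfolding sy(1) .
    qed
    finally show ?thesis .
  qed
  have sd: "0 < \<delta>" "\<delta> \<le> pi / 2" using d pi_gt3 by auto
  have sins: "sin \<delta> > 0" using sd by (simp add: sin_gt_zero)
  \<comment> \<open>Away from the saddle \<open>tau\<close> and kappa \<open>psi\<close> are small
    separately, which accounts for the first two terms of Q. The third comes from integrating the
    derivative of the difference over |theta| < delta.\<close>
  let ?c = "1 / sin \<delta> + 1 / (\<delta> * \<eta>)"
  have Kg: "gmass a b / (2 * pi) * exp (a * x - b * ln x) / sin \<delta> = K / b * (1 / sin \<delta>)"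
    unfolding K_def using bp by simp
  have t1: "norm (tau a b x \<theta>) \<le> \<kappa> / sqrt ?y * (1 / sin \<delta>) * ?E \<theta>" if "- 2 * pi + \<delta> \<le> \<theta>" "\<theta> \<le> - \<delta>" for \<theta>
  proof -
    have "norm (tau a b x \<theta>) \<le> K / b * (1 / sin \<delta>) * ?E \<theta>"
      using norm_tau_le[OF a bp x sd, of \<theta>] that unfolding Kg by simp
    also have "\<dots> \<le> \<kappa> / sqrt ?y * (1 / sin \<delta>) * ?E \<theta>" using Kb sins by (intro mult_right_mono) auto
    finally show ?thesis .
  qed
  have t2: "norm (1 - tau a b x \<theta>) \<le> \<kappa> / sqrt ?y * (1 / sin \<delta>) * ?E \<theta>" if "\<delta> \<le> \<theta>" "\<theta> \<le> 2 * pi - \<delta>" for \<theta>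
  proof -
    have "norm (1 - tau a b x \<theta>) \<le> K / b * (1 / sin \<delta>) * ?E \<theta>"
      using norm_one_minus_tau_le[OF a bp x sd, of \<theta>] that unfolding Kg by simp
    also have "\<dots> \<le> \<kappa> / sqrt ?y * (1 / sin \<delta>) * ?E \<theta>" using Kb sins by (intro mult_right_mono) auto
    finally show ?thesis .
  qed
  have pi4: "pi < 3.5" using pi_approx by simp
  have p1: "norm (of_real \<kappa> * psi ?y \<theta>) \<le> \<kappa> / sqrt ?y * (1 / (\<delta> * \<eta>)) * ?E \<theta>" if "- 2 * pi + \<delta> \<le> \<theta>" "\<theta> \<le> - \<delta>" for \<theta>
  proof -
    have "norm (psi ?y \<theta>) \<le> ?E \<theta> / (\<delta> * \<eta> * sqrt ?y)"
      using that d pi4 by (intro norm_psi_le' yp eta) auto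
    then have "\<kappa> * norm (psi ?y \<theta>) \<le> \<kappa> * (?E \<theta> / (\<delta> * \<eta> * sqrt ?y))" using kp by (intro mult_left_mono) auto
    then show ?thesis using kp by (simp add: norm_mult mult_ac)
  qed
  have p2: "norm (of_real \<kappa> * (1 - psi ?y \<theta>)) \<le> \<kappa> / sqrt ?y * (1 / (\<delta> * \<eta>)) * ?E \<theta>" if "\<delta> \<le> \<theta>" "\<theta> \<le> 2 * pi - \<delta>" for \<theta>
  proof -
    have "norm (1 - psi ?y \<theta>) \<le> ?E \<theta> / (\<delta> * \<eta> * sqrt ?y)"
      using that d pi4 by (intro norm_psi_le' yp eta) auto
    then have "\<kappa> * norm (1 - psi ?y \<theta>) \<le> \<kappa> * (?E \<theta> / (\<delta> * \<eta> * sqrt ?y))" using kp by (intro mult_left_mono) auto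
    then show ?thesis using kp by (simp add: norm_mult mult_ac)
  qed
  let ?D = "\<lambda>\<theta>. tau a b x \<theta> - of_real \<kappa> * psi ?y \<theta>"
  let ?H = "\<lambda>\<theta>. (1 - tau a b x \<theta>) - of_real \<kappa> * (1 - psi ?y \<theta>)"
  have H: "?H \<theta> = (1 - of_real \<kappa>) - ?D \<theta>" for \<theta> by (simp add: algebra_simps)
  have D1: "norm (?D \<theta>) \<le> \<kappa> / sqrt ?y * ?c * ?E \<theta>" if "- 2 * pi + \<delta> \<le> \<theta>" "\<theta> \<le> - \<delta>" for \<theta>
    using order_trans[OF norm_triangle_ineq4 add_mono[OF t1[OF that] p1[OF that]]] by (simp add: algebra_simps)
  have D2: "norm (?H \<theta>) \<le> \<kappa> / sqrt ?y * ?c * ?E \<theta>" if "\<delta> \<le> \<theta>" "\<theta> \<le> 2 * pi - \<delta>" for \<theta>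
    using order_trans[OF norm_triangle_ineq4 add_mono[OF t2[OF that] p2[OF that]]] by (simp add: algebra_simps)
  have ex: "\<exists>D. (?D has_vector_derivative D) (at t) \<and> norm D \<le> K * (R + 12) * \<bar>t\<bar> * ?E t" if "t \<noteq> 0" "\<bar>t\<bar> \<le> 1/6" for t
    using tau_minus_psi_derivative_bound[OF x a b bp that] unfolding K_def[symmetric] \<kappa>_def[symmetric] by metis
  define D' where "D' t = (SOME D. (?D has_vector_derivative D) (at t) \<and> norm D \<le> K * (R + 12) * \<bar>t\<bar> * ?E t)" for t
  have D': "(?D has_vector_derivative D' t) (at t)" "norm (D' t) \<le> K * (R + 12) * \<bar>t\<bar> * ?E t" if "t \<noteq> 0" "\<bar>t\<bar> \<le> 1/6" for t
    using someI_ex[OF ex[OF that]] unfolding D'_def by blast+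
  have contD: "continuous_on UNIV ?D"
  proof -
    have "continuous_on UNIV (tau a b x)"
      by (intro continuous_at_imp_continuous_on ballI has_vector_derivative_continuous[OF tau_has_vector_derivative[OF x]])
    from continuous_on_diff[OF this continuous_on_mult_left[OF psi_continuous]] show ?thesis .
  qed
  \<comment> \<open>Since |t| <= 2 |sin t| and the derivative of \<open>?E\<close> is - y sin t
    times \<open>?E\<close>, the bound for the derivative of \<open>?D\<close> integrates exactly.
    The division by y turns K, which is at most kappa sqrt y, into an error of size kappa / sqrt
    y.\<close>
  let ?G = "\<lambda>t. K * 2 * (R + 12) / ?y * ?E t"
  have G: "(?G has_vector_derivative - (K * 2 * (R + 12) * sin t * ?E t)) (at t)" for t
  proof -
    have "(?E has_real_derivative ?E t * (- ?y * sin t)) (at t)"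
      by (auto intro!: derivative_eq_intros)
    from DERIV_cmult[OF this, of "K * 2 * (R + 12) / ?y"] show ?thesis
      using yp a x by (simp add: has_real_derivative_iff_has_vector_derivative mult_ac)
  qed
  have contG: "continuous_on S ?G" for S by (intro continuous_intros)
  have Gb: "?G t \<le> \<kappa> / sqrt ?y * (2 * (R + 12)) * ?E t" for t
  proof -
    have "K * 2 * (R + 12) / ?y * ?E t = (2 * K / ?y) * ((R + 12) * ?E t)" by simp
    also have "\<dots> \<le> (2 * \<kappa> / sqrt ?y) * ((R + 12) * ?E t)" using R by (intro mult_right_mono Kk2) auto
    also have "\<dots> = \<kappa> / sqrt ?y * (2 * (R + 12)) * ?E t" by simp
    finally show ?thesis .
  qed
  have Gp: "?G t \<ge> 0" for t using Kp R yp by simp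
  have Emono: "?E s \<le> ?E t" if "\<bar>t\<bar> \<le> s" "s \<le> pi" for s t
  proof -
    have "cos s \<le> cos \<bar>t\<bar>" using that by (intro cos_monotone_0_pi_le) auto
    then have "?y * (1 - cos t) \<le> ?y * (1 - cos s)" using yp by (intro mult_left_mono) auto
    then show ?thesis by simp
  qed
  have dpi: "\<delta> \<le> pi" using sd pi_gt_zero by linarith
  have cp: "?c \<ge> 0" using sins d eta by simp
  have Qc: "\<kappa> / sqrt ?y * ?c * e + \<kappa> / sqrt ?y * (2 * (R + 12)) * e = Q * \<kappa> / sqrt ?y * e" for e
  proof -
    have "r * c * e + r * l * e = (c + l) * r * e" for r c l :: real by (simp add: algebra_simps)
    from this[of "\<kappa> / sqrt ?y" ?c "2 * (R + 12)"] show ?thesis unfolding Q_def by (simp only: times_divide_eq_right)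
  qed
  have base: "\<kappa> / sqrt ?y * ?c * ?E \<theta> \<le> Q * \<kappa> / sqrt ?y * ?E \<theta>" for \<theta>
    using kp R sy unfolding Qc[symmetric] by simp
  show "norm (?D \<theta>) \<le> Q * \<kappa> / sqrt ?y * ?E \<theta>" if t: "- 2 * pi + \<delta> \<le> \<theta>" "\<theta> \<le> 0"
  proof (cases "\<theta> \<le> - \<delta>")
    case True
    then show ?thesis using order_trans[OF D1 base] t by blast
  next
    case False
    have "norm (?D \<theta> - ?D (- \<delta>)) \<le> ?G \<theta> - ?G (- \<delta>)"
    proof (rule differentiable_bound_general[where f'=D' and \<phi>'="\<lambda>t. - (K * 2 * (R + 12) * sin t * ?E t)"])
      fix s assume s: "- \<delta> < s" "s < \<theta>"
      have s0: "s \<noteq> 0" "\<bar>s\<bar> \<le> 1/6" "s < 0" using s t d by auto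
      show "(?D has_vector_derivative D' s) (at s)" by (rule D'(1)[OF s0(1,2)])
      have "- s \<le> 2 * sin (- s)" using s0 by (intro abs_le_2_sin) auto
      then have "K * (R + 12) * \<bar>s\<bar> * ?E s \<le> K * (R + 12) * (2 * - sin s) * ?E s"
        using s0 Kp R by (intro mult_right_mono mult_left_mono) auto
      with D'(2)[OF s0(1,2)] show "norm (D' s) \<le> - (K * 2 * (R + 12) * sin s * ?E s)" by (simp add: mult_ac)
    next
      show "continuous_on {- \<delta>..\<theta>} ?G" by (rule contG)
      show "continuous_on {- \<delta>..\<theta>} ?D" by (rule continuous_on_subset[OF contD]) simp
      show "- \<delta> < \<theta>" using False by simp
      show "(?G has_vector_derivative - (K * 2 * (R + 12) * sin t * ?E t)) (at t)" for t by (rule G)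
    qed
    then have "norm (?D \<theta>) \<le> norm (?D (- \<delta>)) + ?G \<theta>"
      using Gp[of "- \<delta>"] norm_triangle_ineq2[of "?D \<theta>" "?D (- \<delta>)"] by linarith
    moreover have "norm (?D (- \<delta>)) \<le> \<kappa> / sqrt ?y * ?c * ?E (- \<delta>)" using sd pi_gt_zero by (intro D1) auto
    moreover have "\<kappa> / sqrt ?y * ?c * ?E (- \<delta>) \<le> \<kappa> / sqrt ?y * ?c * ?E \<theta>"
    proof (rule mult_left_mono)
      show "?E (- \<delta>) \<le> ?E \<theta>" using Emono[of \<theta> \<delta>] False t dpi by simp
      show "0 \<le> \<kappa> / sqrt ?y * ?c" using kp cp sy by (intro mult_nonneg_nonneg divide_nonneg_pos) auto
    qed
    ultimately have "norm (?D \<theta>) \<le> \<kappa> / sqrt ?y * ?c * ?E \<theta> + ?G \<theta>" by linarith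
    then show ?thesis using Gb[of \<theta>] unfolding Qc[symmetric] by linarith
  qed
  show "norm (?H \<theta>) \<le> Q * \<kappa> / sqrt ?y * ?E \<theta>" if t: "0 \<le> \<theta>" "\<theta> \<le> 2 * pi - \<delta>"
  proof (cases "\<theta> \<ge> \<delta>")
    case True
    then show ?thesis using order_trans[OF D2 base] t by blast
  next
    case False
    \<comment> \<open>On this side the comparison starts from delta, where \<open>?H\<close> is
      small. As \<open>?D\<close> and \<open>?H\<close> add up to the constant 1 - kappa, they have
      the same increments up to sign.\<close>
    have "norm (?D \<delta> - ?D \<theta>) \<le> - ?G \<delta> - - ?G \<theta>"
    proof (rule differentiable_bound_general[where f'=D' and \<phi>="\<lambda>t. - ?G t" and \<phi>'="\<lambda>t. K * 2 * (R + 12) * sin t * ?E t"])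
      fix s assume s: "\<theta> < s" "s < \<delta>"
      have s0: "s \<noteq> 0" "\<bar>s\<bar> \<le> 1/6" "s > 0" using s t d by auto
      show "(?D has_vector_derivative D' s) (at s)" by (rule D'(1)[OF s0(1,2)])
      have "s \<le> 2 * sin s" using s0 by (intro abs_le_2_sin) auto
      then have "K * (R + 12) * \<bar>s\<bar> * ?E s \<le> K * (R + 12) * (2 * sin s) * ?E s"
        using s0 Kp R by (intro mult_right_mono mult_left_mono) auto
      with D'(2)[OF s0(1,2)] show "norm (D' s) \<le> K * 2 * (R + 12) * sin s * ?E s" by (simp add: mult_ac)
      show "((\<lambda>t. - ?G t) has_vector_derivative K * 2 * (R + 12) * sin s * ?E s) (at s)"
        using has_vector_derivative_minus[OF G[of s]] by simp
    next
      show "continuous_on {\<theta>..\<delta>} (\<lambda>t. - ?G t)" by (rule continuous_on_minus[OF contG])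
      show "continuous_on {\<theta>..\<delta>} ?D" by (rule continuous_on_subset[OF contD]) simp
      show "\<theta> < \<delta>" using False by simp
    qed
    then have "norm (?H \<theta> - ?H \<delta>) \<le> ?G \<theta> - ?G \<delta>" unfolding H by (simp add: algebra_simps)
    then have "norm (?H \<theta>) \<le> norm (?H \<delta>) + ?G \<theta>"
      using Gp[of "\<delta>"] norm_triangle_ineq2[of "?H \<theta>" "?H \<delta>"] by linarith
    moreover have "norm (?H \<delta>) \<le> \<kappa> / sqrt ?y * ?c * ?E \<delta>" using sd pi_gt_zero by (intro D2) auto
    moreover have "\<kappa> / sqrt ?y * ?c * ?E \<delta> \<le> \<kappa> / sqrt ?y * ?c * ?E \<theta>"
    proof (rule mult_left_mono)
      show "?E \<delta> \<le> ?E \<theta>" using Emono[of \<theta> \<delta>] False t dpi by simp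
      show "0 \<le> \<kappa> / sqrt ?y * ?c" using kp cp sy by (intro mult_nonneg_nonneg divide_nonneg_pos) auto
    qed
    ultimately have "norm (?H \<theta>) \<le> \<kappa> / sqrt ?y * ?c * ?E \<theta> + ?G \<theta>" by linarith
    then show ?thesis using Gb[of \<theta>] unfolding Qc[symmetric] by linarith
  qed
qed

text \<open>At theta = 0 both one-sided estimates apply, and the two quantities add up to 1 - kappa.
  This bounds 1 - kappa by a multiple of kappa / sqrt y, hence removes kappa from the comparison and
  bounds the mass.\<close>

lemma tau_asymptotics:
  assumes d: "0 < \<delta>" "\<delta> \<le> 1/6" and R: "R \<ge> 0"
  obtains C Y where "C > 0" "Y > 0"
    "\<And>a b x. x > 0 \<Longrightarrow> a > 0 \<Longrightarrow> \<bar>b - a * x\<bar> \<le> R \<Longrightarrow> Y \<le> a * x \<Longrightarrow>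
       b > 0 \<and> gmass a b \<le> C / sqrt (a * x) * exp (b * ln x - a * x)"
    "\<And>a b x \<theta>. x > 0 \<Longrightarrow> a > 0 \<Longrightarrow> \<bar>b - a * x\<bar> \<le> R \<Longrightarrow> Y \<le> a * x \<Longrightarrow>
       - 2 * pi + \<delta> \<le> \<theta> \<Longrightarrow> \<theta> \<le> 2 * pi - \<delta> \<Longrightarrow>
       norm (tau a b x \<theta> - psi (a * x) \<theta>) \<le> C / sqrt (a * x) * exp (- (a * x) * (1 - cos \<theta>))"
proof -
  obtain \<eta> where eta: "\<eta> > 0" "\<forall>\<theta>. \<bar>\<theta>\<bar> \<le> 7 \<longrightarrow> \<eta> \<le> Re (crt \<theta>)" using Re_crt_lower_bound by blast
  define Q where "Q = 1 / sin \<delta> + 1 / (\<delta> * \<eta>) + 2 * (R + 12)"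
  have "sin \<delta> > 0" using d pi_gt3 by (intro sin_gt_zero) auto
  then have Qp: "Q > 24" unfolding Q_def using d eta R by (simp add: add_pos_nonneg)
  \<comment> \<open>The first entry gives b >= a x / 2. The second makes 2 Q / sqrt y <= 1/2, from
    which kappa <= 2 and |1 - kappa| <= 4 Q / sqrt y.\<close>
  define Y where "Y = max (2 * R) ((4 * Q)\<^sup>2)"
  have Yp: "Y > 0" unfolding Y_def using Qp by (simp add: less_max_iff_disj)
  \<comment> \<open>The constant is 10 = 2 + 4 * 2: kappa <= 2 in the one-sided estimate, and |1 -
    kappa| times the bound 2 of \<open>psi\<close> or 1 - \<open>psi\<close>. The mass bound needs
    only 32 <= 10 Q.\<close>
  have main: "b > 0 \<and> gmass a b \<le> 10 * Q / sqrt (a * x) * exp (b * ln x - a * x) \<and>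
      (\<forall>\<theta>. - 2 * pi + \<delta> \<le> \<theta> \<longrightarrow> \<theta> \<le> 2 * pi - \<delta> \<longrightarrow>
       norm (tau a b x \<theta> - psi (a * x) \<theta>) \<le> 10 * Q / sqrt (a * x) * exp (- (a * x) * (1 - cos \<theta>)))"
    if x: "x > 0" and a: "a > 0" and b: "\<bar>b - a * x\<bar> \<le> R" and y: "Y \<le> a * x" for a b x
  proof -
    let ?y = "a * x"
    let ?E = "\<lambda>\<theta>. exp (- ?y * (1 - cos \<theta>))"
    have y2: "2 * R \<le> ?y" "(4 * Q)\<^sup>2 \<le> ?y" using y unfolding Y_def by auto
    have yp: "?y > 0" using a x by simp
    have bp: "b > 0" and b2: "b \<ge> ?y / 2" using b y2(1) yp by linarith+
    have sy: "4 * Q \<le> sqrt ?y" using y2(2) Qp by (intro real_le_rsqrt) auto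
    have sp: "sqrt ?y > 0" "sqrt ?y * sqrt ?y = ?y" using yp by simp_all
    define K where "K = b * gmass a b / (2 * pi) * exp (a * x - b * ln x)"
    define \<kappa> where "\<kappa> = K * sqrt pi / sqrt (a * x / 2)"
    note A = tau_minus_kappa_psi[OF x a b y2(1) d eta, folded K_def, folded \<kappa>_def Q_def]
    have kp: "\<kappa> > 0" by (rule A(3))
    have "norm ((tau a b x 0 - of_real \<kappa> * psi ?y 0) + ((1 - tau a b x 0) - of_real \<kappa> * (1 - psi ?y 0)))
       \<le> Q * \<kappa> / sqrt ?y + Q * \<kappa> / sqrt ?y"
      using d pi_gt3 A(1)[of 0] A(2)[of 0] by (intro order_trans[OF norm_triangle_ineq add_mono]) auto
    moreover have "(tau a b x 0 - of_real \<kappa> * psi ?y 0) + ((1 - tau a b x 0) - of_real \<kappa> * (1 - psi ?y 0)) = of_real (1 - \<kappa>)"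
      by (simp add: algebra_simps)
    ultimately have k1: "\<bar>1 - \<kappa>\<bar> \<le> 2 * Q / sqrt ?y * \<kappa>" by (simp only: norm_of_real) simp
    have "2 * Q / sqrt ?y \<le> 1/2" using sy sp by (simp add: field_simps)
    then have "2 * Q / sqrt ?y * \<kappa> \<le> 1/2 * \<kappa>" using kp by (intro mult_right_mono) auto
    with k1 have k2: "\<kappa> \<le> 2" by linarith
    have "2 * Q / sqrt ?y * \<kappa> \<le> 2 * Q / sqrt ?y * 2" using k2 Qp sp by (intro mult_left_mono) auto
    with k1 have k3: "\<bar>1 - \<kappa>\<bar> \<le> 4 * Q / sqrt ?y" by simp
    have k4: "Q * \<kappa> / sqrt ?y \<le> 2 * Q / sqrt ?y" using k2 Qp sp by (intro divide_right_mono) (auto simp: mult.commute)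
    have "K \<le> 2 * sqrt ?y" using A(4) k2 sp mult_right_mono[of \<kappa> 2 "sqrt ?y"] by linarith
    moreover have "gmass a b = 2 * pi * K / b * exp (b * ln x - a * x)"
    proof -
      have "exp (a * x - b * ln x) * exp (b * ln x - a * x) = 1" by (simp flip: exp_add)
      then show ?thesis unfolding K_def using bp by (simp add: field_simps)
    qed
    moreover have "2 * pi * K / b \<le> 10 * Q / sqrt ?y"
    proof -
      have Kp: "K \<ge> 0" unfolding K_def using gmass_pos[OF a bp] bp by simp
      have "2 * pi * K / b \<le> 2 * 4 * (2 * sqrt ?y) / (?y / 2)"
        using calculation(1) b2 yp pi_less_4 Kp by (intro frac_le mult_mono) auto
      also have "\<dots> = 32 / sqrt ?y"
      proof -
        have "2 * 4 * (2 * r) / (r * r / 2) = 32 / r" if "r > 0" for r :: real using that by (simp add: field_simps)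
        from this[OF sp(1)] show ?thesis unfolding sp(2) .
      qed
      also have "\<dots> \<le> 10 * Q / sqrt ?y" using Qp sp by (intro divide_right_mono) auto
      finally show ?thesis .
    qed
    ultimately have g: "gmass a b \<le> 10 * Q / sqrt ?y * exp (b * ln x - a * x)"
      by (simp only: mult_right_mono[OF _ exp_ge_zero])
    have fin: "norm (tau a b x \<theta> - psi ?y \<theta>) \<le> 10 * Q / sqrt ?y * ?E \<theta>" if t: "- 2 * pi + \<delta> \<le> \<theta>" "\<theta> \<le> 2 * pi - \<delta>" for \<theta>
    proof -
      have sum: "2 * Q / sqrt ?y * ?E \<theta> + 4 * Q / sqrt ?y * (2 * ?E \<theta>) = 10 * Q / sqrt ?y * ?E \<theta>"
        by (simp add: field_simps)
      have q: "Q * \<kappa> / sqrt ?y * ?E \<theta> \<le> 2 * Q / sqrt ?y * ?E \<theta>" by (intro mult_right_mono k4) simp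
      show ?thesis
      proof (cases "\<theta> \<le> 0")
        case True
        have "tau a b x \<theta> - psi ?y \<theta> = (tau a b x \<theta> - of_real \<kappa> * psi ?y \<theta>) + - (of_real (1 - \<kappa>) * psi ?y \<theta>)"
          by (simp add: algebra_simps)
        then have "norm (tau a b x \<theta> - psi ?y \<theta>) \<le> norm (tau a b x \<theta> - of_real \<kappa> * psi ?y \<theta>) + norm (of_real (1 - \<kappa>) * psi ?y \<theta>)"
          using norm_triangle_ineq[of "tau a b x \<theta> - of_real \<kappa> * psi ?y \<theta>" "- (of_real (1 - \<kappa>) * psi ?y \<theta>)"] by (simp only: norm_minus_cancel)
        also have "\<dots> \<le> 2 * Q / sqrt ?y * ?E \<theta> + 4 * Q / sqrt ?y * (2 * ?E \<theta>)"
        proof (rule add_mono)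
          show "norm (tau a b x \<theta> - of_real \<kappa> * psi ?y \<theta>) \<le> 2 * Q / sqrt ?y * ?E \<theta>"
            using A(1)[OF t(1) True] q by linarith
          show "norm (of_real (1 - \<kappa>) * psi ?y \<theta>) \<le> 4 * Q / sqrt ?y * (2 * ?E \<theta>)"
            unfolding norm_mult norm_of_real using norm_psi_le(1)[OF yp True] k3 Qp sp by (intro mult_mono) auto
        qed
        finally show ?thesis unfolding sum .
      next
        case False
        then have F: "0 \<le> \<theta>" by simp
        have "tau a b x \<theta> - psi ?y \<theta> = of_real (1 - \<kappa>) * (1 - psi ?y \<theta>) + - ((1 - tau a b x \<theta>) - of_real \<kappa> * (1 - psi ?y \<theta>))"
          by (simp add: algebra_simps)
        then have "norm (tau a b x \<theta> - psi ?y \<theta>) \<le> norm ((1 - tau a b x \<theta>) - of_real \<kappa> * (1 - psi ?y \<theta>)) + norm (of_real (1 - \<kappa>) * (1 - psi ?y \<theta>))"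
          using norm_triangle_ineq[of "of_real (1 - \<kappa>) * (1 - psi ?y \<theta>)" "- ((1 - tau a b x \<theta>) - of_real \<kappa> * (1 - psi ?y \<theta>))"]
          unfolding norm_minus_cancel by (simp only: add.commute)
        also have "\<dots> \<le> 2 * Q / sqrt ?y * ?E \<theta> + 4 * Q / sqrt ?y * (2 * ?E \<theta>)"
        proof (rule add_mono)
          show "norm ((1 - tau a b x \<theta>) - of_real \<kappa> * (1 - psi ?y \<theta>)) \<le> 2 * Q / sqrt ?y * ?E \<theta>"
            using A(2)[OF F t(2)] q by linarith
          show "norm (of_real (1 - \<kappa>) * (1 - psi ?y \<theta>)) \<le> 4 * Q / sqrt ?y * (2 * ?E \<theta>)"
            unfolding norm_mult norm_of_real using norm_psi_le(2)[OF yp F] k3 Qp sp by (intro mult_mono) auto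
        qed
        finally show ?thesis unfolding sum .
      qed
    qed
    show ?thesis by (intro conjI allI impI bp g fin)
  qed
  show ?thesis
  proof (rule that[of "10 * Q" Y])
    show "b > 0 \<and> gmass a b \<le> 10 * Q / sqrt (a * x) * exp (b * ln x - a * x)"
      if "x > 0" "a > 0" "\<bar>b - a * x\<bar> \<le> R" "Y \<le> a * x" for a b x
      using main[OF that] by (elim conjE) (rule conjI)
    show "norm (tau a b x \<theta> - psi (a * x) \<theta>) \<le> 10 * Q / sqrt (a * x) * exp (- (a * x) * (1 - cos \<theta>))"
      if "x > 0" "a > 0" "\<bar>b - a * x\<bar> \<le> R" "Y \<le> a * x" "- 2 * pi + \<delta> \<le> \<theta>" "\<theta> \<le> 2 * pi - \<delta>" for a b x \<theta>
      using main[OF that(1-4)] that(5,6) by (elim conjE allE impE)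
  qed (use Qp Yp in simp_all)
qed

subsection \<open>Complete homogeneous sums\<close>

text \<open>Newton's identity \<open>m h\<^sub>m = \<Sum> p\<^sub>j h\<^sub>m\<^sub>-\<^sub>j\<close>, with the power sums \<open>p\<^sub>j\<close> as free parameters.\<close>

fun hsum :: "(nat \<Rightarrow> complex) \<Rightarrow> nat \<Rightarrow> complex" where
  "hsum p 0 = 1"
| "hsum p (Suc m) = (\<Sum>i\<le>m. p (Suc i) * hsum p (m - i)) / of_nat (Suc m)"

declare hsum.simps(2) [simp del]

lemma hsum_rec: "of_nat m * hsum p m = (\<Sum>j=1..m. p j * hsum p (m - j))"
proof (cases m)
  case (Suc n)
  have "(\<Sum>j=1..Suc n. p j * hsum p (Suc n - j)) = (\<Sum>i\<le>n. p (Suc i) * hsum p (n - i))"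
    by (rule sum.reindex_bij_witness[of _ Suc "\<lambda>j. j - 1"]) auto
  moreover have "complex_of_nat (Suc n) \<noteq> 0" by (simp only: of_nat_eq_0_iff)
  ultimately show ?thesis unfolding Suc hsum.simps(2) by simp
qed simp

section \<open>The sum over partitions satisfies Newton's recurrence\<close>

lemma partition_solutions_finite: "finite (partition_solutions m)"
proof (rule finite_subset)
  have le: "k j \<le> m" if "k \<in> partition_solutions m" for k j
  proof (cases "j \<in> {1..m}")
    case True
    then have "j * k j \<le> (\<Sum>j=1..m. j * k j)" by (intro member_le_sum) auto
    also have "\<dots> = m" using that by (simp add: partition_solutions_def)
    finally have "j * k j \<le> m" .
    moreover have "1 * k j \<le> j * k j" using True by (intro mult_le_mono1) auto
    ultimately show ?thesis by linarith
  qed (use that in \<open>auto simp: partition_solutions_def\<close>)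
  show "partition_solutions m \<subseteq> {k. \<forall>j. (j \<in> {1..m} \<longrightarrow> k j \<in> {..m}) \<and> (j \<notin> {1..m} \<longrightarrow> k j = 0)}"
  proof
    fix k assume k: "k \<in> partition_solutions m"
    then show "k \<in> {k. \<forall>j. (j \<in> {1..m} \<longrightarrow> k j \<in> {..m}) \<and> (j \<notin> {1..m} \<longrightarrow> k j = 0)}"
      using le[OF k] unfolding partition_solutions_def by blast
  qed
  show "finite {k. \<forall>j. (j \<in> {1..m} \<longrightarrow> k j \<in> {..m}) \<and> (j \<notin> {1..m} \<longrightarrow> k j = (0::nat))}"
    by (rule finite_set_of_finite_funs) auto
qed

text \<open>The term of cycle type k when the complete homogeneous polynomial is written in power
  sums. With p_j half an error function it is the summand of the theorem.\<close>

definition pweight :: "(nat \<Rightarrow> complex) \<Rightarrow> nat \<Rightarrow> (nat \<Rightarrow> nat) \<Rightarrow> complex" where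
  "pweight p m k = (\<Prod>j=1..m. (p j / of_nat j) ^ k j / fact (k j))"

lemma pweight_extend:
  assumes "n \<le> m" "k \<in> partition_solutions n" shows "pweight p m k = pweight p n k"
  unfolding pweight_def
  by (rule prod.mono_neutral_right) (use assms in \<open>auto simp: partition_solutions_def\<close>)

text \<open>Write m as the sum of j k_j under the sum. For fixed j, raising k_j by one maps the
  solutions for m - j bijectively onto those for m with k_j > 0, and the factor j k_j is just what
  the weights lose.\<close>

lemma partition_sum_rec:
  "of_nat m * (\<Sum>k\<in>partition_solutions m. pweight p m k)
     = (\<Sum>j=1..m. p j * (\<Sum>k\<in>partition_solutions (m - j). pweight p (m - j) k))"
proof -
  have step: "p j * (\<Sum>k\<in>partition_solutions (m - j). pweight p (m - j) k)
      = (\<Sum>k\<in>partition_solutions m. of_nat (j * k j) * pweight p m k)" if j: "j \<in> {1..m}" for j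
  proof -
    let ?S = "{k \<in> partition_solutions m. k j > 0}"
    have upd: "(\<Sum>i=1..m. i * (k(j := v)) i) = (\<Sum>i\<in>{1..m}-{j}. i * k i) + j * v" for k v
      using j by (subst sum.remove[of _ j]) (auto intro!: sum.cong)
    have ext: "(\<Sum>i=1..m. i * k i) = (\<Sum>i=1..m-j. i * k i)" if "\<forall>i. i \<notin> {1..m - j} \<longrightarrow> k i = 0" for k
      by (rule sum.mono_neutral_right) (use that in auto)
    have "p j * (\<Sum>k\<in>partition_solutions (m - j). pweight p (m - j) k)
       = (\<Sum>k\<in>partition_solutions (m - j). p j * pweight p m k)"
      unfolding sum_distrib_left by (intro sum.cong refl) (simp add: pweight_extend[OF diff_le_self, symmetric])
    also have "\<dots> = (\<Sum>k\<in>?S. of_nat (j * k j) * pweight p m k)"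
    proof (rule sum.reindex_bij_witness[of _ "\<lambda>k. k(j := k j - 1)" "\<lambda>k. k(j := k j + 1)"])
      fix k assume k: "k \<in> partition_solutions (m - j)"
      then have z: "\<forall>i. i \<notin> {1..m - j} \<longrightarrow> k i = 0" and s: "(\<Sum>i=1..m-j. i * k i) = m - j"
        by (auto simp: partition_solutions_def)
      have s': "(\<Sum>i\<in>{1..m}-{j}. i * k i) + j * k j = m - j"
        using upd[of k "k j"] ext[OF z] s by simp
      have "(\<Sum>i=1..m. i * (k(j := k j + 1)) i) = m"
        unfolding upd using s' j by (simp add: algebra_simps)
      then show "k(j := k j + 1) \<in> ?S" using z j by (auto simp: partition_solutions_def)
      define A where "A = (\<Prod>i\<in>{1..m}-{j}. (p i / of_nat i) ^ k i / fact (k i))"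
      have a: "pweight p m (k(j := k j + 1)) = A * ((p j / of_nat j) ^ (k j + 1) / fact (k j + 1))"
        unfolding pweight_def A_def using j by (subst prod.remove[of _ j]) (auto intro!: prod.cong)
      have b: "pweight p m k = A * ((p j / of_nat j) ^ k j / fact (k j))"
        unfolding pweight_def A_def using j by (subst prod.remove[of _ j]) auto
      have c: "of_nat (j * (k j + 1)) * ((p j / of_nat j) ^ (k j + 1) / fact (k j + 1)) = p j * ((p j / of_nat j) ^ k j / fact (k j))"
      proof -
        have nz: "complex_of_nat j \<noteq> 0" "complex_of_nat (Suc (k j)) \<noteq> 0" using j by (simp_all only: of_nat_eq_0_iff) auto
        have "of_nat (j * (k j + 1)) * ((p j / of_nat j) ^ (k j + 1) / fact (k j + 1))
          = of_nat j * of_nat (Suc (k j)) * ((p j / of_nat j) * (p j / of_nat j) ^ k j / (of_nat (Suc (k j)) * fact (k j)))"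
          by (simp only: of_nat_mult Suc_eq_plus1[symmetric] power_Suc fact_Suc)
        also have "\<dots> = p j * ((p j / of_nat j) ^ k j / fact (k j))"
          using nz by (simp del: of_nat_Suc)
        finally show ?thesis .
      qed
      show "of_nat (j * (k(j := k j + 1)) j) * pweight p m (k(j := k j + 1)) = p j * pweight p m k"
        unfolding fun_upd_same a b by (simp only: mult.left_commute[of _ A] c)
    next
      fix k assume k: "k \<in> ?S"
      then have z: "\<forall>i. i \<notin> {1..m} \<longrightarrow> k i = 0" and s: "(\<Sum>i=1..m. i * k i) = m" and p: "k j > 0"
        by (auto simp: partition_solutions_def)
      have s': "(\<Sum>i\<in>{1..m}-{j}. i * k i) + j * k j = m" using upd[of k "k j"] s by simp
      let ?k = "k(j := k j - 1)"
      have sum: "(\<Sum>i=1..m. i * ?k i) = m - j"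
        unfolding upd using s' p j by (cases "k j") (auto simp: algebra_simps)
      have z': "?k i = 0" if "i \<notin> {1..m - j}" for i
      proof (cases "i \<in> {1..m}")
        case True
        show ?thesis
        proof (rule ccontr)
          assume "?k i \<noteq> 0"
          then have "i * 1 \<le> i * ?k i" by (intro mult_le_mono) auto
          also have "\<dots> \<le> (\<Sum>i=1..m. i * ?k i)" using True by (intro member_le_sum) auto
          finally show False using sum that True by auto
        qed
      qed (use z j in auto)
      have "(\<Sum>i=1..m-j. i * ?k i) = m - j" using ext[of ?k] z' sum by auto
      then show "?k \<in> partition_solutions (m - j)" using z' by (auto simp: partition_solutions_def)
      show "(k(j := k j - 1))(j := (k(j := k j - 1)) j + 1) = k" using p by auto
    qed auto
    also have "\<dots> = (\<Sum>k\<in>partition_solutions m. of_nat (j * k j) * pweight p m k)"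
      by (rule sum.mono_neutral_left[OF partition_solutions_finite]) auto
    finally show ?thesis .
  qed
  have "(\<Sum>j=1..m. p j * (\<Sum>k\<in>partition_solutions (m - j). pweight p (m - j) k))
     = (\<Sum>j=1..m. \<Sum>k\<in>partition_solutions m. of_nat (j * k j) * pweight p m k)"
    by (intro sum.cong refl step)
  also have "\<dots> = (\<Sum>k\<in>partition_solutions m. \<Sum>j=1..m. of_nat (j * k j) * pweight p m k)"
    by (rule sum.swap)
  also have "\<dots> = (\<Sum>k\<in>partition_solutions m. of_nat m * pweight p m k)"
  proof (rule sum.cong[OF refl])
    fix k assume "k \<in> partition_solutions m"
    then have "(\<Sum>j=1..m. j * k j) = m" by (simp add: partition_solutions_def)
    then show "(\<Sum>j=1..m. of_nat (j * k j) * pweight p m k) = of_nat m * pweight p m k"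
      unfolding sum_distrib_right[symmetric] of_nat_sum[symmetric] by simp
  qed
  finally show ?thesis by (simp only: sum_distrib_left[symmetric])
qed

lemma partition_sum_eq_hsum: "(\<Sum>k\<in>partition_solutions m. pweight p m k) = hsum p m"
proof (induction m rule: less_induct)
  case (less m)
  show ?case
  proof (cases "m = 0")
    case True
    have "partition_solutions 0 = {\<lambda>_. 0}" by (simp add: partition_solutions_def set_eq_iff fun_eq_iff)
    then show ?thesis using True by (simp add: pweight_def)
  next
    case False
    have "of_nat m * (\<Sum>k\<in>partition_solutions m. pweight p m k) = (\<Sum>j=1..m. p j * hsum p (m - j))"
      unfolding partition_sum_rec
      by (intro sum.cong refl arg_cong2[where f=times] less) (use False in auto)
    also have "\<dots> = of_nat m * hsum p m" by (simp add: hsum_rec)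
    finally show ?thesis using False by simp
  qed
qed

section \<open>Adjoining a variable, and bounds that respect the weights\<close>

lemma hsum_cong:
  assumes "\<And>j. 1 \<le> j \<Longrightarrow> j \<le> m \<Longrightarrow> p j = q j" shows "hsum p m = hsum q m"
  unfolding partition_sum_eq_hsum[symmetric] pweight_def using assms by (intro sum.cong prod.cong refl) auto

lemma hsum_scale: "hsum (\<lambda>j. l ^ j * p j) m = l ^ m * hsum p m"
proof (induction m rule: less_induct)
  case (less m)
  show ?case
  proof (cases "m = 0")
    case False
    have "of_nat m * hsum (\<lambda>j. l ^ j * p j) m = (\<Sum>j=1..m. l ^ j * p j * (l ^ (m - j) * hsum p (m - j)))"
      unfolding hsum_rec using less False by (intro sum.cong) auto
    also have "\<dots> = (\<Sum>j=1..m. l ^ m * (p j * hsum p (m - j)))"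
    proof (intro sum.cong refl)
      fix j assume "j \<in> {1..m}"
      then have "l ^ m = l ^ j * l ^ (m - j)" by (simp flip: power_add)
      then show "l ^ j * p j * (l ^ (m - j) * hsum p (m - j)) = l ^ m * (p j * hsum p (m - j))" by simp
    qed
    also have "\<dots> = of_nat m * (l ^ m * hsum p m)"
      unfolding sum_distrib_left[symmetric] hsum_rec[symmetric] by simp
    finally show ?thesis using False by simp
  qed simp
qed

text \<open>Adjoining a variable y adds y^j to the power sums and multiplies the generating function
  by 1 / (1 - y t). The recurrence form converts simultaneous jumps of all power sums into a jump of
  the chain of transforms.\<close>

lemma hsum_add_power:
  assumes pq: "\<And>j. p j = q j + y ^ j"
  shows "hsum p (Suc m) = hsum q (Suc m) + y * hsum p m"
    and "hsum p m = (\<Sum>i\<le>m. y ^ i * hsum q (m - i))"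
proof -
  have conv: "(\<Sum>i\<le>Suc m. y ^ i * h (Suc m - i)) = h (Suc m) + y * (\<Sum>i\<le>m. y ^ i * h (m - i))" for m and h :: "nat \<Rightarrow> complex"
    by (subst sum.atMost_Suc_shift) (simp add: sum_distrib_left mult.assoc)
  have main: "hsum p m = (\<Sum>i\<le>m. y ^ i * hsum q (m - i))" for m
  proof (induction m rule: less_induct)
    case (less m)
    show ?case
    proof (cases m)
      case (Suc n)
      have IH: "hsum p (m - j) = hsum q (m - j) + (if m - j = 0 then 0 else y * hsum p (m - j - 1))" if "1 \<le> j" "j \<le> m" for j
      proof (cases "m - j")
        case (Suc r)
        have "hsum p (Suc r) = (\<Sum>i\<le>Suc r. y ^ i * hsum q (Suc r - i))" using less[of "m - j"] that Suc by simp
        also have "\<dots> = hsum q (Suc r) + y * hsum p r"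
          using less[of r] that Suc conv[of "hsum q" r] by simp
        finally show ?thesis using Suc by simp
      qed simp
      have "of_nat m * hsum p m = (\<Sum>j=1..m. q j * hsum p (m - j)) + (\<Sum>j=1..m. y ^ j * hsum p (m - j))"
        unfolding hsum_rec pq by (simp add: distrib_right sum.distrib)
      have "of_nat m * hsum p m = (\<Sum>j=1..m. p j * (hsum q (m - j) + (if m - j = 0 then 0 else y * hsum p (m - j - 1))))"
        unfolding hsum_rec using IH by (intro sum.cong) auto
      also have "\<dots> = (\<Sum>j=1..m. q j * hsum q (m - j)) + (\<Sum>j=1..m. y ^ j * hsum q (m - j))
          + (\<Sum>j=1..m. p j * (if m - j = 0 then 0 else y * hsum p (m - j - 1)))"
        by (simp add: pq algebra_simps flip: sum.distrib)
      also have "(\<Sum>j=1..m. p j * (if m - j = 0 then 0 else y * hsum p (m - j - 1))) = y * (\<Sum>j=1..n. p j * hsum p (n - j))"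
      proof -
        have "(\<Sum>j=1..m. p j * (if m - j = 0 then 0 else y * hsum p (m - j - 1))) = (\<Sum>j=1..n. p j * (if m - j = 0 then 0 else y * hsum p (m - j - 1)))"
          by (rule sum.mono_neutral_right) (use Suc in auto)
        also have "\<dots> = (\<Sum>j=1..n. y * (p j * hsum p (n - j)))"
          using Suc by (intro sum.cong) auto
        finally show ?thesis by (simp add: sum_distrib_left)
      qed
      also have "(\<Sum>j=1..m. y ^ j * hsum q (m - j)) = y * (\<Sum>i\<le>n. y ^ i * hsum q (n - i))"
      proof -
        have "(\<Sum>j=1..m. y ^ j * hsum q (m - j)) = (\<Sum>i\<le>n. y ^ Suc i * hsum q (n - i))"
          unfolding Suc by (rule sum.reindex_bij_witness[of _ Suc "\<lambda>j. j - 1"]) auto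
        then show ?thesis by (simp add: sum_distrib_left mult.assoc)
      qed
      also have "(\<Sum>i\<le>n. y ^ i * hsum q (n - i)) = hsum p n" using less[of n] Suc by simp
      also have "(\<Sum>j=1..n. p j * hsum p (n - j)) = of_nat n * hsum p n" by (simp add: hsum_rec)
      also have "(\<Sum>j=1..m. q j * hsum q (m - j)) = of_nat m * hsum q m" by (simp add: hsum_rec)
      finally have "of_nat m * hsum p m = of_nat m * (hsum q m + y * hsum p n)"
        unfolding Suc by (simp add: algebra_simps)
      then have "hsum p m = hsum q m + y * hsum p n" using Suc by (simp del: of_nat_Suc)
      also have "\<dots> = (\<Sum>i\<le>m. y ^ i * hsum q (m - i))"
        using conv[of "hsum q" n] less[of n] Suc by simp
      finally show ?thesis .
    qed simp
  qed
  show "hsum p m = (\<Sum>i\<le>m. y ^ i * hsum q (m - i))" by (rule main)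
  show "hsum p (Suc m) = hsum q (Suc m) + y * hsum p m"
    unfolding main[of "Suc m"] main[of m] by (rule conv)
qed

text \<open>Giving p_j the weight j makes h_m homogeneous of weight m, so C' can be chosen
  independent of Q. Later Q is the peak of the weight, or an exponentially small quantity.\<close>

lemma hsum_bound:
  fixes C :: real
  assumes "C \<ge> 0"
  obtains C' where "C' \<ge> 0"
    "\<And>(p :: nat \<Rightarrow> complex) Q. Q \<ge> 0 \<Longrightarrow> (\<And>j. 1 \<le> j \<Longrightarrow> j \<le> m \<Longrightarrow> norm (p j) \<le> C * Q ^ j) \<Longrightarrow> norm (hsum p m) \<le> C' * Q ^ m"
proof -
  have "\<exists>C'\<ge>0. \<forall>(p :: nat \<Rightarrow> complex) Q. Q \<ge> 0 \<longrightarrow> (\<forall>j. 1 \<le> j \<longrightarrow> j \<le> m \<longrightarrow> norm (p j) \<le> C * Q ^ j) \<longrightarrow> norm (hsum p m) \<le> C' * Q ^ m"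
  proof (induction m rule: less_induct)
    case (less m)
    then obtain D where D: "\<And>n. n < m \<Longrightarrow> D n \<ge> 0"
      "\<And>n (p :: nat \<Rightarrow> complex) Q. n < m \<Longrightarrow> Q \<ge> 0 \<Longrightarrow> (\<And>j. 1 \<le> j \<Longrightarrow> j \<le> n \<Longrightarrow> norm (p j) \<le> C * Q ^ j) \<Longrightarrow> norm (hsum p n) \<le> D n * Q ^ n"
      by metis
    show ?case
    proof (cases "m = 0")
      case False
      show ?thesis
      proof (intro exI[of _ "\<Sum>j=1..m. C * D (m - j)"] conjI allI impI)
        show "0 \<le> (\<Sum>j=1..m. C * D (m - j))" using D(1) assms by (intro sum_nonneg mult_nonneg_nonneg) auto
        fix p :: "nat \<Rightarrow> complex" and Q :: real assume Q: "Q \<ge> 0" and p: "\<forall>j. 1 \<le> j \<longrightarrow> j \<le> m \<longrightarrow> norm (p j) \<le> C * Q ^ j"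
        have "norm (hsum p m) \<le> norm (of_nat m * hsum p m)"
          using False mult_right_mono[of 1 "real m" "norm (hsum p m)"] by (simp add: norm_mult)
        also have "\<dots> \<le> (\<Sum>j=1..m. norm (p j * hsum p (m - j)))" unfolding hsum_rec by (rule norm_sum)
        also have "\<dots> \<le> (\<Sum>j=1..m. C * D (m - j) * Q ^ m)"
        proof (rule sum_mono)
          fix j assume j: "j \<in> {1..m}"
          have "norm (p j) * norm (hsum p (m - j)) \<le> (C * Q ^ j) * (D (m - j) * Q ^ (m - j))"
            using j p Q assms by (intro mult_mono D(2)) auto
          also have "\<dots> = C * D (m - j) * Q ^ m" using j by (simp add: mult_ac flip: power_add)
          finally show "norm (p j * hsum p (m - j)) \<le> C * D (m - j) * Q ^ m" by (simp add: norm_mult)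
        qed
        finally show "norm (hsum p m) \<le> (\<Sum>j=1..m. C * D (m - j)) * Q ^ m" by (simp add: sum_distrib_right)
      qed
    qed (auto intro: exI[of _ 1])
  qed
  then show ?thesis using that by blast
qed

text \<open>Newton's identity with each difference of products telescoped. The relative error e
  enters linearly and C' again depends on neither Q nor e.\<close>

lemma hsum_lipschitz:
  fixes C :: real
  assumes "C \<ge> 0"
  obtains C' where "C' \<ge> 0"
    "\<And>(p :: nat \<Rightarrow> complex) (q :: nat \<Rightarrow> complex) Q e. Q \<ge> 0 \<Longrightarrow> e \<ge> 0 \<Longrightarrow> (\<And>j. 1 \<le> j \<Longrightarrow> j \<le> m \<Longrightarrow> norm (p j) \<le> C * Q ^ j) \<Longrightarrow>
       (\<And>j. 1 \<le> j \<Longrightarrow> j \<le> m \<Longrightarrow> norm (q j) \<le> C * Q ^ j) \<Longrightarrow>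
       (\<And>j. 1 \<le> j \<Longrightarrow> j \<le> m \<Longrightarrow> norm (p j - q j) \<le> C * Q ^ j * e) \<Longrightarrow>
       norm (hsum p m - hsum q m) \<le> C' * Q ^ m * e"
proof -
  obtain B where B: "\<And>n. B n \<ge> 0"
    "\<And>n (p :: nat \<Rightarrow> complex) Q. Q \<ge> 0 \<Longrightarrow> (\<And>j. 1 \<le> j \<Longrightarrow> j \<le> n \<Longrightarrow> norm (p j) \<le> C * Q ^ j) \<Longrightarrow> norm (hsum p n) \<le> B n * Q ^ n"
  proof -
    have "\<exists>C'\<ge>0. \<forall>(p :: nat \<Rightarrow> complex) Q. Q \<ge> 0 \<longrightarrow> (\<forall>j. 1 \<le> j \<longrightarrow> j \<le> n \<longrightarrow> norm (p j) \<le> C * Q ^ j) \<longrightarrow> norm (hsum p n) \<le> C' * Q ^ n" for n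
      using hsum_bound[OF assms, of n] by metis
    then show ?thesis using that by metis
  qed
  have "\<exists>C'\<ge>0. \<forall>(p :: nat \<Rightarrow> complex) (q :: nat \<Rightarrow> complex) Q e. Q \<ge> 0 \<longrightarrow> e \<ge> 0 \<longrightarrow> (\<forall>j. 1 \<le> j \<longrightarrow> j \<le> m \<longrightarrow> norm (p j) \<le> C * Q ^ j) \<longrightarrow>
       (\<forall>j. 1 \<le> j \<longrightarrow> j \<le> m \<longrightarrow> norm (q j) \<le> C * Q ^ j) \<longrightarrow>
       (\<forall>j. 1 \<le> j \<longrightarrow> j \<le> m \<longrightarrow> norm (p j - q j) \<le> C * Q ^ j * e) \<longrightarrow>
       norm (hsum p m - hsum q m) \<le> C' * Q ^ m * e"
  proof (induction m rule: less_induct)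
    case (less m)
    then obtain D where D: "\<And>n. n < m \<Longrightarrow> D n \<ge> 0"
      "\<And>n (p :: nat \<Rightarrow> complex) (q :: nat \<Rightarrow> complex) Q e. n < m \<Longrightarrow> Q \<ge> 0 \<Longrightarrow> e \<ge> 0 \<Longrightarrow> (\<And>j. 1 \<le> j \<Longrightarrow> j \<le> n \<Longrightarrow> norm (p j) \<le> C * Q ^ j) \<Longrightarrow>
       (\<And>j. 1 \<le> j \<Longrightarrow> j \<le> n \<Longrightarrow> norm (q j) \<le> C * Q ^ j) \<Longrightarrow>
       (\<And>j. 1 \<le> j \<Longrightarrow> j \<le> n \<Longrightarrow> norm (p j - q j) \<le> C * Q ^ j * e) \<Longrightarrow>
       norm (hsum p n - hsum q n) \<le> D n * Q ^ n * e"
      by metis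
    show ?case
    proof (cases "m = 0")
      case False
      show ?thesis
      proof (intro exI[of _ "\<Sum>j=1..m. C * (B (m - j) + D (m - j))"] conjI allI impI)
        show "0 \<le> (\<Sum>j=1..m. C * (B (m - j) + D (m - j)))"
          using D(1) B(1) assms by (intro sum_nonneg mult_nonneg_nonneg add_nonneg_nonneg) auto
        fix p q :: "nat \<Rightarrow> complex" and Q e :: real
        assume Q: "Q \<ge> 0" and e: "e \<ge> 0" and p: "\<forall>j. 1 \<le> j \<longrightarrow> j \<le> m \<longrightarrow> norm (p j) \<le> C * Q ^ j"
          and q: "\<forall>j. 1 \<le> j \<longrightarrow> j \<le> m \<longrightarrow> norm (q j) \<le> C * Q ^ j"
          and pq: "\<forall>j. 1 \<le> j \<longrightarrow> j \<le> m \<longrightarrow> norm (p j - q j) \<le> C * Q ^ j * e"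
        have "norm (hsum p m - hsum q m) \<le> norm (of_nat m * hsum p m - of_nat m * hsum q m)"
          using False mult_right_mono[of 1 "real m" "norm (hsum p m - hsum q m)"]
          by (simp add: norm_mult flip: right_diff_distrib)
        also have "\<dots> \<le> (\<Sum>j=1..m. norm (p j * hsum p (m - j) - q j * hsum q (m - j)))"
          unfolding hsum_rec sum_subtractf[symmetric] by (rule norm_sum)
        also have "\<dots> \<le> (\<Sum>j=1..m. C * (B (m - j) + D (m - j)) * Q ^ m * e)"
        proof (rule sum_mono)
          fix j assume j: "j \<in> {1..m}"
          have "p j * hsum p (m - j) - q j * hsum q (m - j) = (p j - q j) * hsum p (m - j) + q j * (hsum p (m - j) - hsum q (m - j))"
            by (simp add: algebra_simps)
          then have "norm (p j * hsum p (m - j) - q j * hsum q (m - j)) \<le> norm (p j - q j) * norm (hsum p (m - j)) + norm (q j) * norm (hsum p (m - j) - hsum q (m - j))"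
            using norm_triangle_ineq[of "(p j - q j) * hsum p (m - j)" "q j * (hsum p (m - j) - hsum q (m - j))"] by (simp add: norm_mult)
          also have "\<dots> \<le> (C * Q ^ j * e) * (B (m - j) * Q ^ (m - j)) + (C * Q ^ j) * (D (m - j) * Q ^ (m - j) * e)"
            using j p q pq Q e assms by (intro add_mono mult_mono D(2) B(2)) auto
          also have "\<dots> = C * (B (m - j) + D (m - j)) * (Q ^ j * Q ^ (m - j)) * e"
            by (simp add: algebra_simps)
          also have "Q ^ j * Q ^ (m - j) = Q ^ m" using j by (simp flip: power_add)
          finally show "norm (p j * hsum p (m - j) - q j * hsum q (m - j)) \<le> C * (B (m - j) + D (m - j)) * Q ^ m * e" .
        qed
        finally show "norm (hsum p m - hsum q m) \<le> (\<Sum>j=1..m. C * (B (m - j) + D (m - j))) * Q ^ m * e"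
          by (simp add: sum_distrib_right)
      qed
    qed (auto intro: exI[of _ 0])
  qed
  then show ?thesis using that by blast
qed

subsection \<open>The chain of Cauchy transforms\<close>

text \<open>The power 2 pi i to the j - 1 is chosen so that the j-th power sum jumps by (2 pi i
  f)^j, exactly the effect of adjoining the single variable 2 pi i f.\<close>

definition sfun :: "real \<Rightarrow> nat \<Rightarrow> complex \<Rightarrow> complex" where
  "sfun b m w = hsum (\<lambda>j. (2 * of_real pi * \<i>) ^ (j - 1) * gterm (real j) (real j * b) w) m"

lemma sfun_0 [simp]: "sfun b 0 w = 1" by (simp add: sfun_def)

lemma hsum_holomorphic:
  assumes "\<And>j. 1 \<le> j \<Longrightarrow> p j holomorphic_on A"
  shows "(\<lambda>w. hsum (\<lambda>j. p j w) m) holomorphic_on A"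
proof (induction m rule: less_induct)
  case (less m)
  show ?case
  proof (cases m)
    case (Suc n)
    have "(\<lambda>w. (\<Sum>i\<le>n. p (Suc i) w * hsum (\<lambda>j. p j w) (n - i)) / of_nat (Suc n)) holomorphic_on A"
      using less assms Suc of_nat_neq_0[of n, where ?'a=complex] by (intro holomorphic_on_divide holomorphic_on_sum holomorphic_on_mult holomorphic_on_const) (auto simp del: of_nat_Suc)
    then show ?thesis unfolding Suc hsum.simps(2) .
  qed simp
qed

lemma sfun_holomorphic: "sfun b m holomorphic_on A"
  unfolding sfun_def [abs_def]
  by (intro hsum_holomorphic holomorphic_on_mult holomorphic_on_const holomorphic_on_subset[OF gterm_holomorphic]) auto

lemma gwt_power: "gwt 1 b w ^ j = gwt (real j) (real j * b) w"
  by (simp add: gwt_def algebra_simps flip: exp_of_nat_mult)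

lemma sfun_jump:
  assumes "b > 0"
  shows "sfun b (Suc m) w - sfun b (Suc m) (w - 2 * of_real pi * \<i>) = 2 * of_real pi * \<i> * gwt 1 b w * sfun b m w"
proof -
  let ?p = "2 * of_real pi * \<i> :: complex"
  let ?P = "\<lambda>w j. ?p ^ (j - 1) * gterm (real j) (real j * b) w"
  \<comment> \<open>The polynomial never looks at index 0; the value there merely makes p_j = q_j +
    y^j true for y^0 = 1.\<close>
  let ?q = "\<lambda>j. if j = 0 then ?P w 0 - 1 else ?P (w - ?p) j"
  have "?P w j = ?q j + (?p * gwt 1 b w) ^ j" for j
  proof (cases "j = 0")
    case False
    then have "gterm (real j) (real j * b) w = gterm (real j) (real j * b) (w - ?p) + ?p * gwt 1 b w ^ j"
      using gterm_jump[of "real j" "real j * b" w] assms by (simp add: gwt_power algebra_simps)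
    moreover have "?p ^ j = ?p ^ (j - 1) * ?p" using False by (metis power_minus_mult neq0_conv)
    ultimately show ?thesis using False by (simp add: power_mult_distrib distrib_left mult.assoc)
  qed simp
  from hsum_add_power(1)[of "?P w" ?q, OF this, of m]
  have "sfun b (Suc m) w = hsum ?q (Suc m) + ?p * gwt 1 b w * sfun b m w" unfolding sfun_def .
  moreover have "hsum ?q (Suc m) = sfun b (Suc m) (w - ?p)"
    unfolding sfun_def by (rule hsum_cong) simp
  ultimately show ?thesis by simp
qed

lemma gterm_bounded_strip:
  assumes "a > 0" "b > 0"
  obtains B where "B \<ge> 0" "\<And>w. -2*pi \<le> Im w \<Longrightarrow> Im w \<le> 0 \<Longrightarrow> norm (gterm a b w) \<le> B"
proof (rule that)
  have "sin (1::real) > 0" using pi_gt3 by (intro sin_gt_zero) auto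
  then show "0 \<le> gmass a b / sin 1 + 1 * (b * gmass a b)" using gmass_pos[OF assms] assms by simp
  show "norm (gterm a b w) \<le> gmass a b / sin 1 + 1 * (b * gmass a b)" if "-2*pi \<le> Im w" "Im w \<le> 0" for w
    using norm_gterm_le_strip(1)[OF assms that, of 1] by simp
qed

text \<open>The order of choice matters: s is fixed first to make the boundary term at most e/2, and
  L is then taken so large that the kernel term, which contains 1 / sin s, is small too.\<close>

lemma gterm_small_right:
  assumes ab: "a > 0" "b > 0" and e: "e > 0"
  obtains L where "\<And>w. -2*pi \<le> Im w \<Longrightarrow> Im w \<le> 0 \<Longrightarrow> Re w \<ge> L \<Longrightarrow> norm (gterm a b w) \<le> e"
proof -
  define K where "K = b * gmass a b"
  have K: "K > 0" unfolding K_def using ab gmass_pos[OF ab] by simp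
  define s where "s = min 1 (e / (2 * K))"
  have s: "0 < s" "s \<le> 1" "s * K \<le> e / 2"
  proof -
    show "0 < s" "s \<le> 1" unfolding s_def using e K by auto
    have "s * K \<le> e / (2 * K) * K" unfolding s_def using K by (intro mult_right_mono) auto
    then show "s * K \<le> e / 2" using K by simp
  qed
  have ss: "sin s > 0" using s pi_gt3 by (intro sin_gt_zero) auto
  have "((\<lambda>u. exp (- u) * gmass a (b+1) / sin s) \<longlongrightarrow> 0 * gmass a (b+1) / sin s) at_top"
  proof -
    have "((\<lambda>u::real. exp (- u)) \<longlongrightarrow> 0) at_top" by real_asymp
    then show ?thesis using ss by (intro tendsto_intros) auto
  qed
  then have "\<forall>\<^sub>F u in at_top. exp (- u) * gmass a (b+1) / sin s < e / 2"
    using e by (intro order_tendstoD(2)[of _ "0 * gmass a (b+1) / sin s"]) auto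
  then obtain L where L: "\<And>u. u \<ge> L \<Longrightarrow> exp (- u) * gmass a (b+1) / sin s < e / 2"
    by (auto simp: eventually_at_top_linorder)
  have "norm (gterm a b w) \<le> e" if w: "-2*pi \<le> Im w" "Im w \<le> 0" "Re w \<ge> L" for w
    using norm_gterm_le_strip(2)[OF ab w(1,2) s(1,2)] L[OF w(3)] s(3) unfolding K_def by linarith
  then show ?thesis using that by blast
qed

lemma sfun_bounded_strip:
  assumes "b > 0"
  obtains B where "B \<ge> 0" "\<And>w. -2*pi \<le> Im w \<Longrightarrow> Im w \<le> 0 \<Longrightarrow> norm (sfun b m w) \<le> B"
proof -
  have "\<exists>B\<ge>0. \<forall>w. -2*pi \<le> Im w \<longrightarrow> Im w \<le> 0 \<longrightarrow> norm (gterm (real j) (real j * b) w) \<le> B" if "j \<ge> 1" for j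
    using gterm_bounded_strip[of "real j" "real j * b"] assms that by (auto; metis)
  then obtain G where G: "\<And>j. j \<ge> 1 \<Longrightarrow> G j \<ge> 0"
    "\<And>j w. j \<ge> 1 \<Longrightarrow> -2*pi \<le> Im w \<Longrightarrow> Im w \<le> 0 \<Longrightarrow> norm (gterm (real j) (real j * b) w) \<le> G j" by metis
  define C where "C = (\<Sum>j=1..m. (2 * pi) ^ (j - 1) * G j)"
  have C0: "C \<ge> 0" unfolding C_def using G(1) by (intro sum_nonneg mult_nonneg_nonneg) auto
  have C: "norm ((2 * of_real pi * \<i>) ^ (j - 1) * gterm (real j) (real j * b) w) \<le> C * 1 ^ j"
    if "1 \<le> j" "j \<le> m" "-2*pi \<le> Im w" "Im w \<le> 0" for j w
  proof -
    have "norm ((2 * of_real pi * \<i>) ^ (j - 1) * gterm (real j) (real j * b) w) \<le> (2 * pi) ^ (j - 1) * G j"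
      unfolding norm_mult norm_power using G(2)[OF that(1,3,4)] by (intro mult_mono) (auto simp: norm_mult)
    also have "\<dots> \<le> C" unfolding C_def using that G(1) by (intro member_le_sum) auto
    finally show ?thesis by simp
  qed
  obtain B where B: "B \<ge> 0" "\<And>(p :: nat \<Rightarrow> complex) Q. Q \<ge> 0 \<Longrightarrow> (\<And>j. 1 \<le> j \<Longrightarrow> j \<le> m \<Longrightarrow> norm (p j) \<le> C * Q ^ j) \<Longrightarrow> norm (hsum p m) \<le> B * Q ^ m"
    using hsum_bound[OF C0, of m] by metis
  show ?thesis
  proof (rule that[OF B(1)])
    fix w assume w: "-2*pi \<le> Im w" "Im w \<le> 0"
    have "norm (sfun b m w) \<le> B * 1 ^ m" unfolding sfun_def by (rule B(2)) (use C w in auto)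
    then show "norm (sfun b m w) \<le> B" by simp
  qed
qed

lemma sfun_small_right:
  assumes b: "b > 0" and m: "m \<ge> 1" and e: "e > 0"
  obtains L where "\<And>w. -2*pi \<le> Im w \<Longrightarrow> Im w \<le> 0 \<Longrightarrow> Re w \<ge> L \<Longrightarrow> norm (sfun b m w) \<le> e"
proof -
  obtain B where B: "B \<ge> 0" "\<And>(p :: nat \<Rightarrow> complex) Q. Q \<ge> 0 \<Longrightarrow> (\<And>j. 1 \<le> j \<Longrightarrow> j \<le> m \<Longrightarrow> norm (p j) \<le> 1 * Q ^ j) \<Longrightarrow> norm (hsum p m) \<le> B * Q ^ m"
    using hsum_bound[of 1 m] by auto
  define Q where "Q = min 1 (e / (B + 1))"
  have Q: "0 < Q" "Q \<le> 1" "Q * (B + 1) \<le> e"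
  proof -
    show "0 < Q" "Q \<le> 1" unfolding Q_def using e B(1) by auto
    have "Q * (B + 1) \<le> e / (B + 1) * (B + 1)" unfolding Q_def using B(1) by (intro mult_right_mono) auto
    then show "Q * (B + 1) \<le> e" using B(1) by simp
  qed
  have "\<exists>L. \<forall>w. -2*pi \<le> Im w \<longrightarrow> Im w \<le> 0 \<longrightarrow> Re w \<ge> L \<longrightarrow> norm (gterm (real j) (real j * b) w) \<le> Q ^ j / (2 * pi) ^ (j - 1)" if "j \<ge> 1" for j
    using gterm_small_right[of "real j" "real j * b" "Q ^ j / (2 * pi) ^ (j - 1)"] b that Q(1) by (auto; metis)
  then obtain L where L: "\<And>j w. j \<ge> 1 \<Longrightarrow> -2*pi \<le> Im w \<Longrightarrow> Im w \<le> 0 \<Longrightarrow> Re w \<ge> L j \<Longrightarrow>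
     norm (gterm (real j) (real j * b) w) \<le> Q ^ j / (2 * pi) ^ (j - 1)" by metis
  show ?thesis
  proof (rule that[of "Max (L ` {1..m})"])
    fix w assume w: "-2*pi \<le> Im w" "Im w \<le> 0" "Max (L ` {1..m}) \<le> Re w"
    have "norm (sfun b m w) \<le> B * Q ^ m" unfolding sfun_def
    proof (rule B(2))
      fix j assume j: "1 \<le> j" "j \<le> m"
      then have "L j \<le> Max (L ` {1..m})" by (intro Max_ge) auto
      then have "norm (gterm (real j) (real j * b) w) \<le> Q ^ j / (2 * pi) ^ (j - 1)" using w j by (intro L) auto
      then have "(2 * pi) ^ (j - 1) * norm (gterm (real j) (real j * b) w) \<le> (2 * pi) ^ (j - 1) * (Q ^ j / (2 * pi) ^ (j - 1))"
        by (intro mult_left_mono) auto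
      moreover have "norm ((2 * of_real pi * \<i>) ^ (j - 1)) = (2 * pi) ^ (j - 1)" unfolding norm_power by (simp add: norm_mult)
      ultimately show "norm ((2 * of_real pi * \<i>) ^ (j - 1) * gterm (real j) (real j * b) w) \<le> 1 * Q ^ j"
        unfolding norm_mult by simp
    qed (use Q in simp)
    also have "\<dots> \<le> B * Q"
      using power_decreasing[of 1 m Q] m Q B(1) by (intro mult_left_mono) auto
    also have "\<dots> \<le> Q * (B + 1)" using Q by (simp add: algebra_simps)
    finally show "norm (sfun b m w) \<le> e" using Q(3) by linarith
  qed
qed

text \<open>Turns uniform decay into a majorant that depends on Re w alone, as the rectangle
  argument requires. The supremum is replaced by 0 where no point of A lies further to the
  right.\<close>

lemma uniform_bound_function:
  fixes A :: "complex set"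
  assumes small: "\<And>e. e > 0 \<Longrightarrow> \<exists>L. \<forall>w\<in>A. Re w \<ge> L \<longrightarrow> norm (f w) \<le> e"
    and bd: "\<And>w. w \<in> A \<Longrightarrow> norm (f w) \<le> B"
  obtains S where "(S \<longlongrightarrow> 0) at_top" "\<And>w. w \<in> A \<Longrightarrow> norm (f w :: complex) \<le> S (Re w)"
proof -
  define S where "S L = (SUP w\<in>{w\<in>A. Re w \<ge> L}. norm (f w)) " for L
  define T where "T L = (if \<exists>w\<in>A. Re w \<ge> L then S L else 0)" for L
  have ba: "bdd_above ((\<lambda>w. norm (f w)) ` {w\<in>A. Re w \<ge> L})" for L using bd by (intro bdd_aboveI[of _ B]) auto
  have T0: "0 \<le> T L" for L
  proof (cases "\<exists>w\<in>A. Re w \<ge> L")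
    case True
    then obtain w where w: "w \<in> A" "Re w \<ge> L" by blast
    have "0 \<le> norm (f w)" by simp
    also have "\<dots> \<le> S L" unfolding S_def using w by (intro cSUP_upper ba) auto
    finally show ?thesis using True by (simp add: T_def)
  qed (simp add: T_def)
  show ?thesis
  proof (rule that[of T])
    show "(T \<longlongrightarrow> 0) at_top"
    proof (rule order_tendstoI)
      show "\<forall>\<^sub>F L in at_top. a < T L" if "a < 0" for a by (intro always_eventually allI less_le_trans[OF that T0])
      fix e :: real assume e: "0 < e"
      obtain L0 where L0: "\<forall>w\<in>A. Re w \<ge> L0 \<longrightarrow> norm (f w) \<le> e / 2" using small[of "e/2"] e by auto
      show "\<forall>\<^sub>F L in at_top. T L < e"
        using eventually_ge_at_top[of L0]
      proof eventually_elim
        case (elim L)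
        have "T L \<le> e / 2"
        proof (cases "\<exists>w\<in>A. Re w \<ge> L")
          case True
          then have "S L \<le> e / 2"
            unfolding S_def using L0 elim by (intro cSUP_least) force+
          then show ?thesis using True by (simp add: T_def)
        next
          case False
          then show ?thesis using e unfolding T_def by (simp only: if_False)
        qed
        then show ?case using e by simp
      qed
    qed
    fix w assume w: "w \<in> A"
    then have "norm (f w) \<le> S (Re w)" unfolding S_def by (intro cSUP_upper ba) auto
    moreover have "\<exists>v\<in>A. Re v \<ge> Re w" using w by auto
    ultimately show "norm (f w) \<le> T (Re w)" by (simp add: T_def)
  qed
qed

text \<open>The function v -> E(v) / (1 - exp (w0 - v)) has its only pole in the strip at w0, with
  residue E(w0). The kernel is periodic, so the two edges of the strip differ by the jump of E times
  the kernel. The vertical sides vanish because E decays on the right and the kernel on the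
  left.\<close>

lemma lcauchy_of_jump:
  assumes hol: "E holomorphic_on UNIV"
    and jump: "\<And>u::real. E (of_real u) - E (of_real u - 2 * of_real pi * \<i>) = 2 * of_real pi * \<i> * h (of_real u)"
    and bd: "\<And>w. -2*pi \<le> Im w \<Longrightarrow> Im w \<le> 0 \<Longrightarrow> norm (E w) \<le> B"
    and small: "\<And>e. e > 0 \<Longrightarrow> \<exists>L. \<forall>w. -2*pi \<le> Im w \<longrightarrow> Im w \<le> 0 \<longrightarrow> Re w \<ge> L \<longrightarrow> norm (E w) \<le> e"
    and h: "\<And>u::real. norm (h (of_real u)) \<le> D / (1 + u\<^sup>2)"
    and w0: "-2*pi < Im w0" "Im w0 < 0"
  shows "E w0 = lcauchy h w0"
proof -
  let ?p = "2 * of_real pi * \<i> :: complex"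
  define g where "g w = 1 - exp (w0 - w)" for w
  define H where "H w = E w / g w" for w
  \<comment> \<open>The open strip enlarged by d contains the closed one, yet Im (w0 - w) stays
    below 2 pi in modulus, so w0 remains the only zero of g.\<close>
  define d where "d = min (- Im w0) (Im w0 + 2*pi) / 2"
  have d: "d > 0" "d < - Im w0" "d < Im w0 + 2 * pi" using w0 by (auto simp: d_def)
  have d2: "2 * d \<le> - Im w0" "2 * d \<le> Im w0 + 2 * pi" by (auto simp: d_def)
  have dpi: "d \<le> pi / 2" using d2 by linarith
  let ?S = "{w. - 2*pi - d < Im w} \<inter> {w. Im w < d}"
  have Sopen: "open ?S" by (intro open_Int open_halfspace_Im_gt open_halfspace_Im_lt)
  have Sconv: "convex ?S" by (intro convex_Int convex_halfspace_Im_gt convex_halfspace_Im_lt)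
  have g0: "w = w0" if "g w = 0" "w \<in> ?S" for w
  proof -
    from that(1) have "exp (w0 - w) = 1" by (simp add: g_def)
    then obtain n :: int where n: "Re (w0 - w) = 0" "Im (w0 - w) = of_int (2 * n) * pi" by (auto simp: exp_eq_1)
    have "\<bar>Im (w0 - w)\<bar> < 2 * pi" using that(2) d w0 by (auto simp: abs_if)
    then have "\<bar>of_int (2 * n)\<bar> * pi < 2 * pi" unfolding n abs_mult by simp
    then have "\<bar>real_of_int (2 * n)\<bar> < 2" using pi_gt_zero by (simp only: mult_less_cancel_right_pos)
    then have "n = 0" by linarith
    then show "w = w0" using n by (simp add: complex_eq_iff)
  qed
  have gk: "1 / g w = - lker (w0 - w)" for w by (simp add: g_def lker_def minus_divide_right)
  have ghol: "g holomorphic_on A" for A unfolding g_def [abs_def] by (intro holomorphic_intros)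
  have Hhol: "H holomorphic_on ?S - {w0}"
    unfolding H_def [abs_def]
    by (intro holomorphic_on_divide ghol holomorphic_on_subset[OF hol]) (use g0 in auto)
  have gd: "(g has_field_derivative 1) (at w0)" unfolding g_def [abs_def]
    by (auto intro!: derivative_eq_intros)
  have res: "residue H w0 = E w0"
  proof (rule residue_simple'[OF Sopen _ Hhol])
    show "w0 \<in> ?S" using w0 d by auto
    have "((\<lambda>w. (g w - g w0) / (w - w0)) \<longlongrightarrow> 1) (at w0)" using gd by (simp add: has_field_derivative_iff)
    then have "((\<lambda>w. g w / (w - w0)) \<longlongrightarrow> 1) (at w0)" by (simp add: g_def)
    moreover have "(E \<longlongrightarrow> E w0) (at w0)"
      using holomorphic_on_imp_continuous_on[OF hol] by (simp add: continuous_on_eq_continuous_at isCont_def)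
    ultimately have "((\<lambda>w. E w / (g w / (w - w0))) \<longlongrightarrow> E w0 / 1) (at w0)" by (intro tendsto_divide) simp_all
    then show "((\<lambda>w. H w * (w - w0)) \<longlongrightarrow> E w0) (at w0)" by (simp add: H_def)
  qed
  let ?A = "{w. -2*pi \<le> Im w \<and> Im w \<le> 0}"
  obtain S where S: "(S \<longlongrightarrow> 0) at_top" "\<And>w. w \<in> ?A \<Longrightarrow> norm (E w) \<le> S (Re w)"
  proof (rule uniform_bound_function[of ?A E B])
    show "\<exists>L. \<forall>w\<in>?A. L \<le> Re w \<longrightarrow> norm (E w) \<le> e" if "e > 0" for e using small[OF that] by auto
  qed (use bd in auto)
  have B: "B \<ge> 0" using order_trans[OF norm_ge_zero bd[of 0]] by simp
  define x0 where "x0 = Re w0"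
  define L0 where "L0 = \<bar>x0\<bar> + 1"
  have e2: "2 \<le> exp t" if "1 \<le> t" for t :: real using exp_ge_add_one_self[of t] that by linarith
  have side: "norm (H (Complex L t)) \<le> 2 * \<bar>S L\<bar> + 2 * B * exp (- x0 - L)"
      "norm (H (Complex (- L) t)) \<le> 2 * \<bar>S L\<bar> + 2 * B * exp (- x0 - L)"
    if L: "L \<ge> L0" and t: "-2*pi \<le> t" "t \<le> 0" for L t
  proof -
    have "exp (x0 - L) * 2 \<le> exp (x0 - L) * exp (L - x0)"
      using L by (intro mult_left_mono e2) (auto simp: L0_def)
    also have "\<dots> = 1" by (simp flip: exp_add)
    finally have r: "exp (x0 - L) \<le> 1/2" by simp
    have "norm (exp (w0 - Complex L t)) = exp (x0 - L)" by (simp add: x0_def)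
    then have "1/2 \<le> norm (g (Complex L t))"
      unfolding g_def using r norm_triangle_ineq2[of 1 "exp (w0 - Complex L t)"] by simp
    moreover have "norm (E (Complex L t)) \<le> \<bar>S L\<bar>" using S(2)[of "Complex L t"] t by simp
    ultimately have "norm (H (Complex L t)) \<le> \<bar>S L\<bar> / (1/2)"
      unfolding H_def norm_divide by (intro frac_le) auto
    moreover have "2 * B * exp (- x0 - L) \<ge> 0" using B by simp
    ultimately show "norm (H (Complex L t)) \<le> 2 * \<bar>S L\<bar> + 2 * B * exp (- x0 - L)" by simp
    have r': "2 \<le> exp (x0 + L)" using L by (intro e2) (auto simp: L0_def)
    have "norm (exp (w0 - Complex (- L) t)) = exp (x0 + L)" by (simp add: x0_def)
    then have "exp (x0 + L) / 2 \<le> norm (g (Complex (-L) t))"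
      unfolding g_def using r' norm_triangle_ineq3[of 1 "exp (w0 - Complex (- L) t)"] by simp
    moreover have "norm (E (Complex (-L) t)) \<le> B" using t by (intro bd) auto
    ultimately have "norm (H (Complex (-L) t)) \<le> B / (exp (x0 + L) / 2)"
      unfolding H_def norm_divide using B by (intro frac_le) auto
    also have "\<dots> = 2 * B * exp (- x0 - L)" by (simp add: exp_minus exp_diff exp_add field_simps)
    finally show "norm (H (Complex (- L) t)) \<le> 2 * \<bar>S L\<bar> + 2 * B * exp (- x0 - L)" by simp
  qed
  have pim: "path_image (rectpath (Complex (-L) (-2*pi)) (Complex L 0)) \<subseteq> ?S - {w0}" if "L \<ge> L0" for L
  proof -
    have "L > 0" "\<bar>x0\<bar> < L" using that by (auto simp: L0_def)
    then show ?thesis using d w0 by (auto simp: path_image_rectpath x0_def)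
  qed
  have cH: "continuous_on (?S - {w0}) H" by (rule holomorphic_on_imp_continuous_on[OF Hhol])
  have dd: "H (Complex u (-2*pi)) - H (Complex u 0) = 2 * of_real pi * \<i> * (h (of_real u) * lker (w0 - of_real u))" for u
  proof -
    have c1: "Complex u (-2*pi) = of_real u - ?p" "Complex u 0 = of_real u" by (simp_all add: complex_eq_iff)
    have H': "H w = - E w * lker (w0 - w)" for w
    proof -
      have "H w = E w * (1 / g w)" by (simp add: H_def)
      then show ?thesis unfolding gk by simp
    qed
    have "lker (w0 - (of_real u - ?p)) = lker (w0 - of_real u)"
      using lker_shift_period[of "w0 - of_real u + ?p"] by (simp add: algebra_simps)
    then have "H (Complex u (-2*pi)) - H (Complex u 0) = (E (of_real u) - E (of_real u - ?p)) * lker (w0 - of_real u)"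
      unfolding c1 H' by (simp add: algebra_simps)
    then show ?thesis unfolding jump by simp
  qed
  have mh: "(\<lambda>u::real. h (of_real u)) \<in> borel_measurable borel"
  proof -
    have "h (of_real u) = (E (of_real u) - E (of_real u - ?p)) / ?p" for u :: real unfolding jump by simp
    moreover have "continuous_on UNIV (\<lambda>u::real. (E (of_real u) - E (of_real u - ?p)) / ?p)"
      by (intro continuous_intros continuous_on_compose2[OF holomorphic_on_imp_continuous_on[OF hol]]) auto
    ultimately show ?thesis by (simp only: borel_measurable_continuous_onI)
  qed
  have int: "integrable lborel (\<lambda>u. h (of_real u) * lker (w0 - of_real u))"
    by (rule integrable_lcauchy[OF mh h w0])
  have "(\<integral>u. H (Complex u (-2*pi)) - H (Complex u 0) \<partial>lborel) = 2 * of_real pi * \<i> * E w0"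
  proof (rule lborel_integral_strip_difference[of "-2*pi" 0 L0 H "\<lambda>L. 2 * \<bar>S L\<bar> + 2 * B * exp (- x0 - L)"])
    show "continuous_on (path_image (rectpath (Complex (- L) (- 2 * pi)) (Complex L 0))) H" if "L0 \<le> L" for L
      by (rule continuous_on_subset[OF cH pim[OF that]])
    have "((\<lambda>L. exp (- x0 - L)) \<longlongrightarrow> 0) at_top" by real_asymp
    then have "((\<lambda>L. 2 * \<bar>S L\<bar> + 2 * B * exp (- x0 - L)) \<longlongrightarrow> 2 * \<bar>0\<bar> + 2 * B * 0) at_top"
      by (intro tendsto_add tendsto_mult tendsto_const tendsto_rabs S(1))
    then show "((\<lambda>L. 2 * \<bar>S L\<bar> + 2 * B * exp (- x0 - L)) \<longlongrightarrow> 0) at_top" by simp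
    show "integrable lborel (\<lambda>u. H (Complex u (- 2 * pi)) - H (Complex u 0))"
      unfolding dd using int by (rule integrable_mult_right)
    show "contour_integral (rectpath (Complex (- L) (- 2 * pi)) (Complex L 0)) H = 2 * of_real pi * \<i> * E w0" if L: "L0 \<le> L" for L
    proof -
      have Lp: "L > 0" "\<bar>x0\<bar> < L" using L by (auto simp: L0_def)
      have "contour_integral (rectpath (Complex (- L) (- 2 * pi)) (Complex L 0)) H
         = 2 * pi * \<i> * (\<Sum>p\<in>{w0}. winding_number (rectpath (Complex (- L) (- 2 * pi)) (Complex L 0)) p * residue H p)"
      proof (rule Residue_theorem[OF Sopen convex_connected[OF Sconv] _ Hhol valid_path_rectpath _ pim[OF L]])
        show "\<forall>z. z \<notin> ?S \<longrightarrow> winding_number (rectpath (Complex (- L) (- 2 * pi)) (Complex L 0)) z = 0"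
          using Lp d by (intro allI impI winding_number_rectpath_outside) (auto simp: in_cbox_complex_iff)
      qed auto
      moreover have "winding_number (rectpath (Complex (- L) (- 2 * pi)) (Complex L 0)) w0 = 1"
        using Lp w0 by (intro winding_number_rectpath) (auto simp: in_box_complex_iff x0_def)
      ultimately show ?thesis using res by simp
    qed
  qed (use side in \<open>auto simp: L0_def\<close>)
  then have "2 * of_real pi * \<i> * lcauchy h w0 = 2 * of_real pi * \<i> * E w0"
    unfolding dd lcauchy_def by (simp only: integral_mult_right_zero)
  then show ?thesis by simp
qed

section \<open>Lowering the innermost exponent\<close>

lemma norm_gwt_weight_le:
  assumes "a > 0" "real n < b"
  obtains D where "\<And>w. \<bar>Im w\<bar> \<le> 1 \<Longrightarrow> norm (gwt a b w) * (1 + exp (- real n * Re w)) \<le> D / (1 + (Re w)\<^sup>2)" "D > 0"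
proof -
  obtain B1 where B1: "\<And>w. \<bar>Im w\<bar> \<le> 1 \<Longrightarrow> norm (gwt a b w) \<le> B1 / (1 + (Re w)\<^sup>2)" "B1 > 0"
    using norm_gwt_le[of a b] assms by force
  obtain B2 where B2: "\<And>w. \<bar>Im w\<bar> \<le> 1 \<Longrightarrow> norm (gwt a (b - real n) w) \<le> B2 / (1 + (Re w)\<^sup>2)" "B2 > 0"
    using norm_gwt_le[of a "b - real n"] assms by force
  \<comment> \<open>The growth exp (- n Re w) at the left end just lowers \<open>b\<close> by n,
    which is harmless as long as n < b.\<close>
  have "norm (gwt a b w) * exp (- real n * Re w) = norm (gwt a (b - real n) w)" for w
    unfolding norm_gwt by (simp add: algebra_simps flip: exp_add)
  then have "norm (gwt a b w) * (1 + exp (- real n * Re w)) \<le> (B1 + B2) / (1 + (Re w)\<^sup>2)" if "\<bar>Im w\<bar> \<le> 1" for w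
    using B1(1)[OF that] B2(1)[OF that] by (simp add: distrib_left add_divide_distrib)
  then show ?thesis using that B1(2) B2(2) by (meson add_pos_pos)
qed

lemma sfun_lcauchy:
  assumes b: "b > 0" and w: "-2*pi < Im w" "Im w < 0"
  shows "sfun b (Suc m) w = lcauchy (\<lambda>v. gwt 1 b v * sfun b m v) w"
proof -
  obtain B where B: "\<And>w. -2*pi \<le> Im w \<Longrightarrow> Im w \<le> 0 \<Longrightarrow> norm (sfun b (Suc m) w) \<le> B" using sfun_bounded_strip[OF b] by metis
  obtain B' where B': "B' \<ge> 0" "\<And>w. -2*pi \<le> Im w \<Longrightarrow> Im w \<le> 0 \<Longrightarrow> norm (sfun b m w) \<le> B'" using sfun_bounded_strip[OF b] by metis
  obtain D where D: "\<And>w. \<bar>Im w\<bar> \<le> 1 \<Longrightarrow> norm (gwt 1 b w) \<le> D / (1 + (Re w)\<^sup>2)" "D > 0" using norm_gwt_le[of 1 b] b by force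
  show ?thesis
  proof (rule lcauchy_of_jump[OF sfun_holomorphic _ B _ _ w])
    show "sfun b (Suc m) (of_real u) - sfun b (Suc m) (of_real u - 2 * of_real pi * \<i>) = 2 * of_real pi * \<i> * (gwt 1 b (of_real u) * sfun b m (of_real u))" for u
      using sfun_jump[OF b, of m "of_real u"] by (simp add: mult.assoc)
    show "\<exists>L. \<forall>w. -2*pi \<le> Im w \<longrightarrow> Im w \<le> 0 \<longrightarrow> L \<le> Re w \<longrightarrow> norm (sfun b (Suc m) w) \<le> e" if "e > 0" for e
      using sfun_small_right[OF b _ that, of "Suc m"] by (metis le_numeral_extra(4) less_eq_Suc_le zero_less_Suc One_nat_def)
    show "norm (gwt 1 b (of_real u) * sfun b m (of_real u)) \<le> (D * B') / (1 + u\<^sup>2)" for u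
    proof -
      have "norm (gwt 1 b (of_real u)) * norm (sfun b m (of_real u)) \<le> D / (1 + u\<^sup>2) * B'"
        using D(1)[of "of_real u"] B'(2)[of "of_real u"] D(2) by (intro mult_mono) auto
      then show ?thesis by (simp add: norm_mult)
    qed
  qed
qed

text \<open>For J = \<open>jfun n b\<close> this is the integral of f(v) exp v times
  \<open>jfun (Suc n) b j\<close>. It is the summand free of w that the kernel identity splits off
  when the transform is multiplied by exp w; the earlier constants enter through the corrections
  already contained in the integrand.\<close>

fun kap :: "real \<Rightarrow> (nat \<Rightarrow> complex \<Rightarrow> complex) \<Rightarrow> nat \<Rightarrow> complex" where
  "kap b J 0 = (\<integral>v. gwt 1 b (of_real v) * J 0 (of_real v) \<partial>lborel)"
| "kap b J (Suc j) = (\<integral>v. gwt 1 b (of_real v) * (J (Suc j) (of_real v)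
      + (\<Sum>i\<le>j. kap b J (j - i) * sfun b i (of_real v))) \<partial>lborel)"

declare kap.simps [simp del]

lemma kap_eq:
  "kap b J j = (\<integral>v. gwt 1 b (of_real v) * (J j (of_real v)
      + (\<Sum>i<j. kap b J (j - Suc i) * sfun b i (of_real v))) \<partial>lborel)"
  by (cases j) (simp_all add: kap.simps lessThan_Suc_atMost)

text \<open>The transforms whose innermost factor is \<open>exp (- n w)\<close>; \<open>kap\<close> collects the constants split off when
  \<open>n\<close> is lowered by one.\<close>

primrec jfun :: "nat \<Rightarrow> real \<Rightarrow> nat \<Rightarrow> complex \<Rightarrow> complex" where
  "jfun 0 b = sfun b"
| "jfun (Suc n) b = (\<lambda>m w. exp (- w) * (jfun n b m w + (\<Sum>i<m. kap b (jfun n b) (m - Suc i) * sfun b i w)))"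

lemma jfun_0: "jfun n b 0 w = exp (- of_nat n * w)"
  by (induction n) (simp_all add: algebra_simps flip: exp_add)

lemma jfun_holomorphic: "jfun n b m holomorphic_on A"
proof (induction n arbitrary: m)
  case 0
  then show ?case by (simp add: sfun_holomorphic)
next
  case (Suc n)
  have "(\<lambda>w. exp (- w)) holomorphic_on A" by (intro holomorphic_intros)
  then show ?case unfolding jfun.simps
    by (intro holomorphic_on_mult holomorphic_on_add holomorphic_on_sum holomorphic_on_const sfun_holomorphic Suc)
qed

lemma jfun_continuous_of_real: "continuous_on UNIV (\<lambda>v::real. jfun n b m (of_real v))"
  by (rule continuous_on_compose2[OF holomorphic_on_imp_continuous_on[OF jfun_holomorphic[where A=UNIV]]])
     (auto intro!: continuous_intros)

lemma exp_weight_step: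
  fixes u :: real shows "exp (- u) * (1 + exp (- real n * u)) \<le> 2 * (1 + exp (- real (Suc n) * u))"
    "exp (- u) \<le> 1 + exp (- real (Suc n) * u)"
proof -
  show *: "exp (- u) \<le> 1 + exp (- real (Suc n) * u)"
  proof (cases "u \<ge> 0")
    case True
    then have "exp (- u) \<le> 1" by simp
    then show ?thesis using exp_ge_zero[of "- real (Suc n) * u"] by linarith
  next
    case False
    then have "1 * (- u) \<le> real (Suc n) * (- u)" by (intro mult_right_mono) auto
    then have "- u \<le> - real (Suc n) * u" by (simp only: mult_minus_left mult_minus_right mult_1)
    then have "exp (- u) \<le> exp (- real (Suc n) * u)" by (simp only: exp_le_cancel_iff)
    then show ?thesis by linarith
  qed
  have "exp (- u) * exp (- real n * u) = exp (- real (Suc n) * u)" by (simp add: algebra_simps flip: exp_add)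
  then show "exp (- u) * (1 + exp (- real n * u)) \<le> 2 * (1 + exp (- real (Suc n) * u))"
    using * exp_ge_zero[of "- real (Suc n) * u"] by (simp add: distrib_left)
qed

lemma jfun_bound:
  assumes b: "b > 0"
  obtains B where "B \<ge> 0" "\<And>w. -2*pi \<le> Im w \<Longrightarrow> Im w \<le> 0 \<Longrightarrow> norm (jfun n b m w) \<le> B * (1 + exp (- real n * Re w))"
proof -
  have S: "\<exists>B\<ge>0. \<forall>w. -2*pi \<le> Im w \<longrightarrow> Im w \<le> 0 \<longrightarrow> norm (sfun b m w) \<le> B" for m
    using sfun_bounded_strip[OF b, of m] by metis
  have "\<exists>B\<ge>0. \<forall>w. -2*pi \<le> Im w \<longrightarrow> Im w \<le> 0 \<longrightarrow> norm (jfun n b m w) \<le> B * (1 + exp (- real n * Re w))"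
  proof (induction n arbitrary: m)
    case 0
    obtain B where "B \<ge> 0" "\<forall>w. -2*pi \<le> Im w \<longrightarrow> Im w \<le> 0 \<longrightarrow> norm (sfun b m w) \<le> B" using S by blast
    then show ?case by (intro exI[of _ B]) (auto intro: order_trans)
  next
    case (Suc n)
    obtain B where B: "B \<ge> 0" "\<And>w. -2*pi \<le> Im w \<Longrightarrow> Im w \<le> 0 \<Longrightarrow> norm (jfun n b m w) \<le> B * (1 + exp (- real n * Re w))"
      using Suc[of m] by blast
    obtain C where C: "\<And>i. C i \<ge> 0" "\<And>i w. -2*pi \<le> Im w \<Longrightarrow> Im w \<le> 0 \<Longrightarrow> norm (sfun b i w) \<le> C i"
      using S by metis
    define D where "D = (\<Sum>i<m. norm (kap b (jfun n b) (m - Suc i)) * C i)"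
    have D0: "D \<ge> 0" unfolding D_def using C(1) by (intro sum_nonneg mult_nonneg_nonneg) auto
    show ?case
    proof (intro exI[of _ "B * 2 + D"] conjI allI impI)
      show "0 \<le> B * 2 + D" using B(1) D0 by simp
      fix w assume w: "-2*pi \<le> Im w" "Im w \<le> 0"
      let ?u = "Re w"
      have "norm (\<Sum>i<m. kap b (jfun n b) (m - Suc i) * sfun b i w) \<le> D"
        unfolding D_def by (intro sum_norm_le) (simp add: norm_mult mult_left_mono C(2)[OF w])
      then have "norm (jfun n b m w + (\<Sum>i<m. kap b (jfun n b) (m - Suc i) * sfun b i w)) \<le> B * (1 + exp (- real n * ?u)) + D"
        using B(2)[OF w] norm_triangle_ineq[of "jfun n b m w"] by (smt (verit))
      then have "norm (jfun (Suc n) b m w) \<le> exp (- ?u) * (B * (1 + exp (- real n * ?u)) + D)"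
        by (simp add: norm_mult mult_left_mono)
      also have "\<dots> = B * (exp (- ?u) * (1 + exp (- real n * ?u))) + D * exp (- ?u)"
        by (simp add: algebra_simps)
      also have "\<dots> \<le> B * (2 * (1 + exp (- real (Suc n) * ?u))) + D * (1 + exp (- real (Suc n) * ?u))"
        by (intro add_mono mult_left_mono exp_weight_step B(1) D0)
      also have "\<dots> = (B * 2 + D) * (1 + exp (- real (Suc n) * ?u))" by (simp add: algebra_simps)
      finally show "norm (jfun (Suc n) b m w) \<le> (B * 2 + D) * (1 + exp (- real (Suc n) * ?u))" .
    qed
  qed
  then show ?thesis using that by blast
qed

lemma gwt_jfun_bound:
  assumes b: "real n < b"
  obtains D where "D \<ge> 0" "\<And>v::real. norm (gwt 1 b (of_real v) * jfun n b m (of_real v)) \<le> D / (1 + v\<^sup>2)"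
proof -
  have bp: "b > 0" using b by (meson le_less_trans of_nat_0_le_iff)
  obtain B where B: "B \<ge> 0" "\<And>w. -2*pi \<le> Im w \<Longrightarrow> Im w \<le> 0 \<Longrightarrow> norm (jfun n b m w) \<le> B * (1 + exp (- real n * Re w))"
    using jfun_bound[OF bp] by metis
  obtain D where D: "\<And>w. \<bar>Im w\<bar> \<le> 1 \<Longrightarrow> norm (gwt 1 b w) * (1 + exp (- real n * Re w)) \<le> D / (1 + (Re w)\<^sup>2)" "D > 0"
    using norm_gwt_weight_le[OF _ b, of 1] by auto
  have "norm (gwt 1 b (of_real v) * jfun n b m (of_real v)) \<le> (B * D) / (1 + v\<^sup>2)" for v :: real
  proof -
    have "norm (gwt 1 b (of_real v)) * norm (jfun n b m (of_real v)) \<le> norm (gwt 1 b (of_real v)) * (B * (1 + exp (- real n * v)))"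
      using B(2)[of "of_real v"] by (intro mult_left_mono) auto
    also have "\<dots> = B * (norm (gwt 1 b (of_real v)) * (1 + exp (- real n * v)))" by simp
    also have "\<dots> \<le> B * (D / (1 + v\<^sup>2))" using D(1)[of "of_real v"] B(1) by (intro mult_left_mono) auto
    finally show ?thesis by (simp add: norm_mult)
  qed
  then show ?thesis using that[of "B * D"] B(1) D(2) by simp
qed

lemma gwt_jfun_measurable: "(\<lambda>v::real. gwt 1 b (of_real v) * jfun n b m (of_real v)) \<in> borel_measurable borel"
  by (intro borel_measurable_continuous_onI continuous_on_mult jfun_continuous_of_real gwt_continuous) (intro continuous_intros)

lemma integrable_of_inverse_square_bound:
  fixes f :: "real \<Rightarrow> complex"
  assumes "f \<in> borel_measurable borel" "\<And>v. norm (f v) \<le> D / (1 + v\<^sup>2)"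
  shows "integrable lborel f"
proof (rule Bochner_Integration.integrable_bound[OF integrable_inverse_square[of D]])
  show "f \<in> borel_measurable lborel" using assms(1) by simp
  have "norm (f v) \<le> norm (D / (1 + v\<^sup>2))" for v
    using order_trans[OF assms(2) abs_ge_self] by simp
  then show "AE v in lborel. norm (f v) \<le> norm (D / (1 + v\<^sup>2))" by blast
qed

text \<open>In the induction step exp w times the transform equals the integral of G plus the
  transform of G. The factor exp (- v) built into level n + 1 cancels exp v, so G involves only
  level n and the hypothesis applies term by term.\<close>

lemma jfun_lcauchy:
  assumes b: "real n < b" and w: "-2*pi < Im w" "Im w < 0"
  shows "jfun n b (Suc m) w = lcauchy (\<lambda>v. gwt 1 b v * jfun n b m v) w"
  using b
proof (induction n arbitrary: m)
  case 0
  then show ?case using sfun_lcauchy[OF _ w, of b m] by simp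
next
  case (Suc n)
  have bn: "real n < b" and bp: "b > 0" using Suc.prems by auto
  let ?k = "\<lambda>v::real. lker (w - of_real v)"
  let ?g = "\<lambda>v::real. gwt 1 b (of_real v)"
  have ne: "exp (w - of_real v) \<noteq> 1" for v :: real using w by (intro exp_ne_1_strip) auto
  have i1: "integrable lborel (\<lambda>v. ?g v * jfun n b m (of_real v))"
       and i2: "integrable lborel (\<lambda>v. ?g v * jfun n b m (of_real v) * ?k v)"
  proof -
    obtain D where "\<And>v::real. norm (?g v * jfun n b m (of_real v)) \<le> D / (1 + v\<^sup>2)" using gwt_jfun_bound[OF bn] by metis
    from integrable_of_inverse_square_bound[OF gwt_jfun_measurable this]
      integrable_lcauchy[where H="\<lambda>v. gwt 1 b v * jfun n b m v", OF gwt_jfun_measurable this w]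
    show "integrable lborel (\<lambda>v. ?g v * jfun n b m (of_real v))"
       "integrable lborel (\<lambda>v. ?g v * jfun n b m (of_real v) * ?k v)" by auto
  qed
  have s1: "integrable lborel (\<lambda>v. ?g v * sfun b i (of_real v))"
    and s2: "integrable lborel (\<lambda>v. ?g v * sfun b i (of_real v) * ?k v)" for i
  proof -
    obtain D where D: "\<And>v::real. norm (?g v * jfun 0 b i (of_real v)) \<le> D / (1 + v\<^sup>2)" using gwt_jfun_bound[of 0 b i] bp by auto
    from integrable_of_inverse_square_bound[OF gwt_jfun_measurable D]
      integrable_lcauchy[where H="\<lambda>v. gwt 1 b v * jfun 0 b i v", OF gwt_jfun_measurable D w]
    show "integrable lborel (\<lambda>v. ?g v * sfun b i (of_real v))"
       "integrable lborel (\<lambda>v. ?g v * sfun b i (of_real v) * ?k v)" by auto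
  qed
  let ?c = "\<lambda>i. kap b (jfun n b) (m - Suc i)"
  define G where "G v = ?g v * (jfun n b m (of_real v) + (\<Sum>i<m. ?c i * sfun b i (of_real v)))" for v :: real
  have G: "G v = ?g v * jfun n b m (of_real v) + (\<Sum>i<m. ?c i * (?g v * sfun b i (of_real v)))" for v
    unfolding G_def by (simp add: distrib_left sum_distrib_left mult.left_commute)
  have Gk: "G v * ?k v = ?g v * jfun n b m (of_real v) * ?k v + (\<Sum>i<m. ?c i * (?g v * sfun b i (of_real v) * ?k v))" for v
    unfolding G by (simp add: distrib_right sum_distrib_right mult.assoc)
  have iG: "integrable lborel G" unfolding G
    by (intro Bochner_Integration.integrable_add Bochner_Integration.integrable_sum integrable_mult_right i1 s1)
  have iGk: "integrable lborel (\<lambda>v. G v * ?k v)" unfolding Gk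
    by (intro Bochner_Integration.integrable_add Bochner_Integration.integrable_sum integrable_mult_right i2 s2)
  have IG: "(\<integral>v. G v \<partial>lborel) = kap b (jfun n b) m" unfolding G_def kap_eq[of b "jfun n b" m] ..
  have IGk: "(\<integral>v. G v * ?k v \<partial>lborel) = jfun n b (Suc m) w + (\<Sum>i<m. ?c i * sfun b (Suc i) w)"
  proof -
    have ism: "integrable lborel (\<lambda>v. \<Sum>i<m. ?c i * (?g v * sfun b i (of_real v) * ?k v))"
      by (intro Bochner_Integration.integrable_sum integrable_mult_right s2)
    have "(\<integral>v. G v * ?k v \<partial>lborel) = (\<integral>v. ?g v * jfun n b m (of_real v) * ?k v \<partial>lborel)
        + (\<Sum>i<m. ?c i * (\<integral>v. ?g v * sfun b i (of_real v) * ?k v \<partial>lborel))"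
      unfolding Gk Bochner_Integration.integral_add[OF i2 ism]
      by (subst Bochner_Integration.integral_sum) (auto intro!: integrable_mult_right s2)
    also have "(\<integral>v. ?g v * jfun n b m (of_real v) * ?k v \<partial>lborel) = jfun n b (Suc m) w"
      unfolding Suc.IH[OF bn] lcauchy_def ..
    also have "(\<Sum>i<m. ?c i * (\<integral>v. ?g v * sfun b i (of_real v) * ?k v \<partial>lborel)) = (\<Sum>i<m. ?c i * sfun b (Suc i) w)"
      unfolding sfun_lcauchy[OF bp w] lcauchy_def ..
    finally show ?thesis .
  qed
  have pt: "exp w * (?g v * jfun (Suc n) b m (of_real v) * ?k v) = G v + G v * ?k v" for v
  proof -
    have "exp w * (?g v * jfun (Suc n) b m (of_real v) * ?k v) = ?g v * jfun (Suc n) b m (of_real v) * (exp w * ?k v)"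
      by (simp only: mult.left_commute mult.assoc)
    also have "exp w * ?k v = exp (of_real v) * (1 + ?k v)" by (rule exp_mult_lker[OF ne])
    also have "?g v * jfun (Suc n) b m (of_real v) * (exp (of_real v) * (1 + ?k v))
        = (exp (- of_real v) * exp (of_real v)) * (G v * (1 + ?k v))"
      unfolding G_def jfun.simps by (simp only: mult.left_commute mult.assoc mult.commute)
    also have "exp (- of_real v) * exp (of_real v) = (1::complex)" by (simp flip: exp_add)
    finally show ?thesis by (simp add: distrib_left)
  qed
  have "exp w * lcauchy (\<lambda>v. gwt 1 b v * jfun (Suc n) b m v) w = (\<integral>v. G v + G v * ?k v \<partial>lborel)"
    unfolding lcauchy_def pt[symmetric] by (simp only: integral_mult_right_zero)
  also have "\<dots> = kap b (jfun n b) m + (jfun n b (Suc m) w + (\<Sum>i<m. ?c i * sfun b (Suc i) w))"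
    unfolding Bochner_Integration.integral_add[OF iG iGk] IG IGk ..
  \<comment> \<open>The constant just split off is the new term i = 0, since \<open>sfun b 0\<close>
    is 1.\<close>
  also have "\<dots> = jfun n b (Suc m) w + (\<Sum>i<Suc m. kap b (jfun n b) (Suc m - Suc i) * sfun b i w)"
    unfolding sum.lessThan_Suc_shift by (simp add: algebra_simps)
  finally have e: "exp w * lcauchy (\<lambda>v. gwt 1 b v * jfun (Suc n) b m v) w = jfun n b (Suc m) w + (\<Sum>i<Suc m. kap b (jfun n b) (Suc m - Suc i) * sfun b i w)" .
  have "lcauchy (\<lambda>v. gwt 1 b v * jfun (Suc n) b m v) w = (exp (- w) * exp w) * lcauchy (\<lambda>v. gwt 1 b v * jfun (Suc n) b m v) w"
    by (simp flip: exp_add)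
  also have "\<dots> = exp (- w) * (exp w * lcauchy (\<lambda>v. gwt 1 b v * jfun (Suc n) b m v) w)" by (rule mult.assoc)
  also have "\<dots> = jfun (Suc n) b (Suc m) w" unfolding e by simp
  finally show ?case ..
qed

subsection \<open>Slightly separated rays\<close>

text \<open>Each ray is recentred on the real line. Consecutive rays are an angle e apart, so the
  inner transform is read at v - i e, just below its cut. The shift in the initial function
  compensates this, so that on the innermost line it is exp (- n v).\<close>

primrec chain :: "real \<Rightarrow> nat \<Rightarrow> real \<Rightarrow> nat \<Rightarrow> complex \<Rightarrow> complex" where
  "chain b n e 0 = (\<lambda>w. exp (- of_nat n * (w + \<i> * of_real e)))"
| "chain b n e (Suc m) = lcauchy (\<lambda>v. gwt 1 b v * chain b n e m (v - \<i> * of_real e))"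

lemma integral_tendsto_inverse_square:
  fixes s :: "nat \<Rightarrow> real \<Rightarrow> complex"
  assumes "\<And>i. s i \<in> borel_measurable borel" "\<And>i v. norm (s i v) \<le> D / (1 + v\<^sup>2)" "\<And>v. (\<lambda>i. s i v) \<longlonglongrightarrow> f v"
  shows "(\<lambda>i. \<integral>v. s i v \<partial>lborel) \<longlonglongrightarrow> (\<integral>v. f v \<partial>lborel)"
proof (rule integral_dominated_convergence[where w="\<lambda>v. D / (1 + v\<^sup>2)"])
  show "f \<in> borel_measurable lborel"
    by (rule borel_measurable_LIMSEQ_metric[of s]) (use assms in auto)
qed (use assms integrable_inverse_square in auto)

lemma lker_tendsto:
  assumes "y \<longlonglongrightarrow> w" "exp w \<noteq> 1"
  shows "(\<lambda>i. lker (y i)) \<longlonglongrightarrow> lker w"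
  unfolding lker_def using assms by (intro tendsto_divide tendsto_diff tendsto_exp tendsto_const) auto

text \<open>The upper edges 1 / (j + 1) decrease but stay positive: each step leaves a gap for a new
  integration line, and the real axis remains inside, where the limit is needed.\<close>

definition chain_strip :: "nat \<Rightarrow> complex set" where
  "chain_strip j = {w. -1 < Im w \<and> Im w < 1 / real (Suc j)}"

lemma chain_strip_props: "open (chain_strip j)" "convex (chain_strip j)"
proof -
  have "chain_strip j = {w. Im w > -1} \<inter> {w. Im w < 1 / real (Suc j)}" by (auto simp: chain_strip_def)
  then show "open (chain_strip j)" "convex (chain_strip j)"
    by (simp_all add: open_Int open_halfspace_Im_gt open_halfspace_Im_lt convex_Int convex_halfspace_Im_gt convex_halfspace_Im_lt)
qed

text \<open>Each step loses part of the strip above the real axis: the integration line of the next transform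
  is shifted to height \<open>d\<close>, away from the points where that transform is evaluated.\<close>

lemma chain_limit:
  fixes e :: "nat \<Rightarrow> real"
  assumes b: "real n < b" and e: "\<And>i. 0 < e i" "\<And>i. e i < 1/2" "e \<longlonglongrightarrow> 0"
  shows "\<exists>\<Psi> B. B \<ge> 0 \<and> (\<forall>i. \<Psi> i holomorphic_on chain_strip j) \<and>
     (\<forall>i. \<forall>w\<in>chain_strip j. Im w < 0 \<longrightarrow> \<Psi> i w = chain b n (e i) j w) \<and>
     (\<forall>i. \<forall>w\<in>chain_strip j. norm (\<Psi> i w) \<le> B * (1 + exp (- real n * Re w))) \<and>
     (\<forall>w\<in>chain_strip j. \<forall>y. y \<longlonglongrightarrow> w \<longrightarrow> (\<lambda>i. \<Psi> i (y i)) \<longlonglongrightarrow> jfun n b j w)"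
proof (induction j)
  case 0
  show ?case
  proof (intro exI[of _ "\<lambda>i. chain b n (e i) 0"] exI[of _ 1] conjI allI ballI impI)
    show "chain b n (e i) 0 holomorphic_on chain_strip 0" for i unfolding chain.simps by (intro holomorphic_intros)
    show "norm (chain b n (e i) 0 w) \<le> 1 * (1 + exp (- real n * Re w))" for i w by simp
    fix w :: complex and y assume "y \<longlonglongrightarrow> w"
    then have "(\<lambda>i. exp (- of_nat n * (y i + \<i> * of_real (e i)))) \<longlonglongrightarrow> exp (- of_nat n * (w + \<i> * of_real 0))"
      by (intro tendsto_intros e)
    then show "(\<lambda>i. chain b n (e i) 0 (y i)) \<longlonglongrightarrow> jfun n b 0 w" by (simp add: jfun_0)
  qed auto
next
  case (Suc j)
  \<comment> \<open>Convergence is stated along moving points because the next step evaluates the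
    j-th function at v - i e_i, which itself depends on the index.\<close>
  obtain \<Psi> B where B: "B \<ge> 0" and hol: "\<And>i. \<Psi> i holomorphic_on chain_strip j"
    and eq: "\<And>i w. w \<in> chain_strip j \<Longrightarrow> Im w < 0 \<Longrightarrow> \<Psi> i w = chain b n (e i) j w"
    and bd: "\<And>i w. w \<in> chain_strip j \<Longrightarrow> norm (\<Psi> i w) \<le> B * (1 + exp (- real n * Re w))"
    and lim: "\<And>w y. w \<in> chain_strip j \<Longrightarrow> y \<longlonglongrightarrow> w \<Longrightarrow> (\<lambda>i. \<Psi> i (y i)) \<longlonglongrightarrow> jfun n b j w"
    using Suc by metis
  obtain D where D: "\<And>w. \<bar>Im w\<bar> \<le> 1 \<Longrightarrow> norm (gwt 1 b w) * (1 + exp (- real n * Re w)) \<le> D / (1 + (Re w)\<^sup>2)" "D > 0"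
    using norm_gwt_weight_le[OF _ b, of 1] by auto
  \<comment> \<open>r is the upper edge of the new strip and d lies halfway between it and the old
    edge.\<close>
  define r where "r = 1 / real (Suc (Suc j))"
  define d where "d = (r + 1 / real (Suc j)) / 2"
  have rj: "r < 1 / real (Suc j)" unfolding r_def by (intro divide_strict_left_mono) auto
  have d: "r < d" "d < 1 / real (Suc j)" "0 < r" using rj by (auto simp: d_def r_def)
  have d1: "d < 1" using d(2) by (rule less_le_trans) simp
  have memv: "v - \<i> * of_real (e i) \<in> chain_strip j" if "0 \<le> Im v" "Im v \<le> d" for v i
    using that e(1,2)[of i] d by (auto simp: chain_strip_def)
  have memv0: "v \<in> chain_strip j" if "0 \<le> Im v" "Im v \<le> d" for v
    using that d by (auto simp: chain_strip_def)
  have gen: "norm (gwt 1 b v * \<Phi>) \<le> (B * D) / (1 + (Re v)\<^sup>2)"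
    if "norm \<Phi> \<le> B * (1 + exp (- real n * Re v))" "0 \<le> Im v" "Im v \<le> d" for v \<Phi>
  proof -
    have "norm (gwt 1 b v) * norm \<Phi> \<le> norm (gwt 1 b v) * (B * (1 + exp (- real n * Re v)))"
      using that(1) by (intro mult_left_mono) auto
    also have "\<dots> = B * (norm (gwt 1 b v) * (1 + exp (- real n * Re v)))" by simp
    also have "\<dots> \<le> B * (D / (1 + (Re v)\<^sup>2))" using D(1)[of v] that d1 B by (intro mult_left_mono) auto
    finally show ?thesis by (simp add: norm_mult)
  qed
  define h where "h i v = gwt 1 b v * \<Psi> i (v - \<i> * of_real (e i))" for i v
  define h0 where "h0 v = gwt 1 b v * jfun n b j v" for v
  have hbd: "norm (h i v) \<le> (B * D) / (1 + (Re v)\<^sup>2)" if "0 \<le> Im v" "Im v \<le> d" for i v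
    unfolding h_def using bd[OF memv[OF that], of i i] by (intro gen that) simp
  have jbd: "norm (jfun n b j w) \<le> B * (1 + exp (- real n * Re w))" if "w \<in> chain_strip j" for w
  proof (rule tendsto_upperbound)
    show "(\<lambda>i. norm (\<Psi> i w)) \<longlonglongrightarrow> norm (jfun n b j w)" by (intro tendsto_norm lim that) simp
    show "\<forall>\<^sub>F i in sequentially. norm (\<Psi> i w) \<le> B * (1 + exp (- real n * Re w))" using bd[OF that] by simp
  qed simp
  have h0bd: "norm (h0 v) \<le> (B * D) / (1 + (Re v)\<^sup>2)" if "0 \<le> Im v" "Im v \<le> d" for v
    unfolding h0_def by (intro gen jbd memv0 that)
  have hhol: "h i holomorphic_on {v. 0 \<le> Im v \<and> Im v \<le> d}" for i
  proof -
    have "(\<lambda>v. \<Psi> i (v - \<i> * of_real (e i))) holomorphic_on {v. 0 \<le> Im v \<and> Im v \<le> d}"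
      by (rule holomorphic_on_compose_gen[of "\<lambda>v. v - \<i> * of_real (e i)" "{v. 0 \<le> Im v \<and> Im v \<le> d}" "\<Psi> i" "chain_strip j", unfolded o_def])
         (use hol memv in \<open>auto intro!: holomorphic_on_diff holomorphic_on_ident holomorphic_on_const\<close>)
    then show ?thesis unfolding h_def [abs_def] by (intro holomorphic_on_mult gwt_holomorphic holomorphic_on_ident)
  qed
  have h0hol: "h0 holomorphic_on A" for A
    unfolding h0_def [abs_def] by (intro holomorphic_on_mult gwt_holomorphic holomorphic_on_ident jfun_holomorphic)
  have line: "continuous_on UNIV (\<lambda>u::real. H (of_real u + \<i> * of_real t))"
    if "H holomorphic_on {v. 0 \<le> Im v \<and> Im v \<le> d}" "0 \<le> t" "t \<le> d" for H :: "complex \<Rightarrow> complex" and t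
    by (rule continuous_on_compose2[OF holomorphic_on_imp_continuous_on[OF that(1)]])
       (use that in \<open>auto intro!: continuous_intros\<close>)
  have meas: "(\<lambda>u::real. H (of_real u + \<i> * of_real d)) \<in> borel_measurable borel" "(\<lambda>u::real. H (of_real u)) \<in> borel_measurable borel"
    if "H holomorphic_on {v. 0 \<le> Im v \<and> Im v \<le> d}" for H :: "complex \<Rightarrow> complex"
    using line[OF that, of d] line[OF that, of 0] d by (auto intro!: borel_measurable_continuous_onI)
  \<comment> \<open>The same transform with the contour lifted to Im v = d. It agrees with the
    original one below the real axis and is holomorphic up to height r < d, so it continues across
    the cut.\<close>
  define T where "T H w = lcauchy (\<lambda>u. H (u + \<i> * of_real d)) (w - \<i> * of_real d)" for H w
  have dsin: "0 < min (d - r) 1" "min (d - r) 1 \<le> pi / 2" using d pi_gt3 by linarith+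
  define s where "s = min (d - r) 1"
  have s: "0 < s" "s \<le> pi / 2" "s \<le> d - r" using dsin by (auto simp: s_def)
  have wd: "- 2 * pi + s \<le> Im (w - \<i> * of_real d)" "Im (w - \<i> * of_real d) \<le> - s" if "w \<in> chain_strip (Suc j)" for w
  proof -
    have "-1 < Im w" "Im w < r" using that unfolding chain_strip_def r_def by auto
    moreover have "s \<le> 1" by (simp add: s_def)
    ultimately show "- 2 * pi + s \<le> Im (w - \<i> * of_real d)" "Im (w - \<i> * of_real d) \<le> - s"
      using s(3) d1 pi_gt3 by simp_all
  qed
  have wd': "-2*pi < Im (w - \<i> * of_real d)" "Im (w - \<i> * of_real d) < 0" if "w \<in> chain_strip (Suc j)" for w
    using wd[OF that] s by linarith+
  have Thol: "T H holomorphic_on chain_strip (Suc j)"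
    if H: "H holomorphic_on {v. 0 \<le> Im v \<and> Im v \<le> d}" "\<And>v. 0 \<le> Im v \<Longrightarrow> Im v \<le> d \<Longrightarrow> norm (H v) \<le> (B * D) / (1 + (Re v)\<^sup>2)" for H
  proof -
    have "lcauchy (\<lambda>u. H (u + \<i> * of_real d)) holomorphic_on {w. -2*pi < Im w \<and> Im w < 0}"
    proof (rule lcauchy_holomorphic[where B="B * D"])
      show "(\<lambda>v::real. H (of_real v + \<i> * of_real d)) \<in> borel_measurable borel" by (rule meas(1)[OF H(1)])
      show "norm (H (of_real v + \<i> * of_real d)) \<le> (B * D) / (1 + v\<^sup>2)" for v :: real
        using H(2)[of "of_real v + \<i> * of_real d"] d by simp
    qed
    then have "(lcauchy (\<lambda>u. H (u + \<i> * of_real d)) \<circ> (\<lambda>w. w - \<i> * of_real d)) holomorphic_on chain_strip (Suc j)"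
      using wd' by (intro holomorphic_on_compose_gen[where t="{w. -2*pi < Im w \<and> Im w < 0}"]) (auto intro!: holomorphic_intros)
    then show ?thesis by (simp add: o_def T_def [abs_def])
  qed
  have Tshift: "T H w = lcauchy H w"
    if H: "H holomorphic_on {v. 0 \<le> Im v \<and> Im v \<le> d}" "\<And>v. 0 \<le> Im v \<Longrightarrow> Im v \<le> d \<Longrightarrow> norm (H v) \<le> (B * D) / (1 + (Re v)\<^sup>2)"
      and w: "w \<in> chain_strip (Suc j)" "Im w < 0" for H w
  proof -
    define s' where "s' = min (- Im w) 1"
    have s': "0 < s'" "s' \<le> pi / 2" "s' \<le> - Im w" using w pi_gt3 by (auto simp: s'_def)
    have im: "- 2 * pi + s' \<le> Im (w - v)" "Im (w - v) \<le> - s'" if "0 \<le> Im v" "Im v \<le> d" for v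
      using that w d1 s' pi_gt3 by (auto simp: chain_strip_def s'_def)
    have "(\<integral>u. H (Complex u 0) * lker (w - Complex u 0) \<partial>lborel) = (\<integral>u. H (Complex u d) * lker (w - Complex u d) \<partial>lborel)"
    proof (rule lborel_integral_strip_shift[where B="B * D / sin s'" and \<alpha>=0 and \<beta>=d])
      show "0 < d" using d by linarith
      show "(\<lambda>v. H v * lker (w - v)) holomorphic_on {z. 0 \<le> Im z \<and> Im z \<le> d}"
      proof (intro holomorphic_on_mult H(1) lker_holomorphic holomorphic_on_diff holomorphic_on_const holomorphic_on_ident)
        fix v assume "v \<in> {z. 0 \<le> Im z \<and> Im z \<le> d}"
        then show "exp (w - v) \<noteq> 1" using im[of v] s' by (intro exp_ne_1_strip) auto
      qed
      fix v assume v: "0 \<le> Im v" "Im v \<le> d"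
      have "norm (lker (w - v)) \<le> 1 / sin s'" using s' im[OF v] by (intro norm_lker_le cos_le_cos_strip) auto
      then have "norm (H v) * norm (lker (w - v)) \<le> ((B * D) / (1 + (Re v)\<^sup>2)) * (1 / sin s')"
        using H(2)[OF v] B D(2) by (intro mult_mono) auto
      then show "norm (H v * lker (w - v)) \<le> B * D / sin s' / (1 + (Re v)\<^sup>2)" by (simp add: norm_mult mult.commute)
    qed
    then show ?thesis unfolding T_def lcauchy_def by (simp add: Complex_eq algebra_simps)
  qed
  have Tbd: "norm (T H w) \<le> B * D / sin s * pi"
    if H: "\<And>v. 0 \<le> Im v \<Longrightarrow> Im v \<le> d \<Longrightarrow> norm (H v) \<le> (B * D) / (1 + (Re v)\<^sup>2)" and w: "w \<in> chain_strip (Suc j)" for H w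
    unfolding T_def
  proof (rule norm_lcauchy_le[OF _ s(1,2) wd[OF w]])
    show "norm (H (of_real v + \<i> * of_real d)) \<le> (B * D) / (1 + v\<^sup>2)" for v :: real
      using H[of "of_real v + \<i> * of_real d"] d by simp
  qed
  have ch: "lcauchy (h i) w = chain b n (e i) (Suc j) w" for i w
  proof -
    have "h i (of_real v) = gwt 1 b (of_real v) * chain b n (e i) j (of_real v - \<i> * of_real (e i))" for v :: real
      unfolding h_def using memv[of "of_real v" i] d e(1)[of i] by (subst eq) auto
    then show ?thesis unfolding chain.simps lcauchy_def by simp
  qed
  \<comment> \<open>The integral representation of \<open>jfun\<close> holds below the real axis;
    the identity theorem carries it to the whole strip.\<close>
  have T0: "T h0 w = jfun n b (Suc j) w" if w: "w \<in> chain_strip (Suc j)" for w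
  proof (rule analytic_continuation_open[of "chain_strip (Suc j) \<inter> {w. Im w < 0}" "chain_strip (Suc j)" "T h0" "jfun n b (Suc j)"])
    show "open (chain_strip (Suc j) \<inter> {w. Im w < 0})" by (intro open_Int chain_strip_props open_halfspace_Im_lt)
    have "- \<i> / 2 \<in> chain_strip (Suc j) \<inter> {w. Im w < 0}" by (auto simp: chain_strip_def intro: less_trans[of _ 0])
    then show "chain_strip (Suc j) \<inter> {w. Im w < 0} \<noteq> {}" by blast
    show "T h0 holomorphic_on chain_strip (Suc j)" by (rule Thol[OF h0hol h0bd])
    show "T h0 z = jfun n b (Suc j) z" if z: "z \<in> chain_strip (Suc j) \<inter> {w. Im w < 0}" for z
    proof -
      have "T h0 z = lcauchy h0 z" using z by (intro Tshift[OF h0hol h0bd]) auto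
      also have "\<dots> = jfun n b (Suc j) z"
        using z pi_gt3 jfun_lcauchy[OF b, of z j] unfolding h0_def [abs_def] by (auto simp: chain_strip_def)
      finally show ?thesis .
    qed
  qed (use w chain_strip_props jfun_holomorphic in \<open>auto intro: convex_connected\<close>)
  show ?case
  proof (intro exI[of _ "\<lambda>i. T (h i)"] exI[of _ "B * D / sin s * pi"] conjI allI ballI impI)
    have ss: "sin s > 0" using s by (simp add: sin_gt_zero)
    show c0: "0 \<le> B * D / sin s * pi" using B D(2) ss by simp
    show "T (h i) holomorphic_on chain_strip (Suc j)" for i by (rule Thol[OF hhol hbd])
    show "T (h i) w = chain b n (e i) (Suc j) w" if "w \<in> chain_strip (Suc j)" "Im w < 0" for i w
      unfolding ch[symmetric] by (rule Tshift[OF hhol hbd that])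
    show "norm (T (h i) w) \<le> B * D / sin s * pi * (1 + exp (- real n * Re w))" if "w \<in> chain_strip (Suc j)" for i w
    proof -
      have "B * D / sin s * pi * 1 \<le> B * D / sin s * pi * (1 + exp (- real n * Re w))"
        using c0 by (intro mult_left_mono) auto
      then show ?thesis using Tbd[where H="h i", OF hbd that] by simp
    qed
    fix w y assume w: "w \<in> chain_strip (Suc j)" and y: "y \<longlonglongrightarrow> w"
    \<comment> \<open>The points y i lie in the strip only eventually; for the others the lifted
      transform need not be controlled.\<close>
    obtain N where N: "\<And>i. i \<ge> N \<Longrightarrow> y i \<in> chain_strip (Suc j)"
      using topological_tendstoD[OF y chain_strip_props(1) w] by (auto simp: eventually_sequentially)
    have yN: "(\<lambda>i. y (i + N)) \<longlonglongrightarrow> w" using y by (rule LIMSEQ_ignore_initial_segment)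
    have eN: "(\<lambda>i. e (i + N)) \<longlonglongrightarrow> 0" using e(3) by (rule LIMSEQ_ignore_initial_segment)
    have "(\<lambda>i. T (h (i + N)) (y (i + N))) \<longlonglongrightarrow> T h0 w"
      unfolding T_def lcauchy_def
    proof (rule integral_tendsto_inverse_square[where D="B * D / sin s"])
      let ?z = "\<lambda>v::real. of_real v + \<i> * of_real d"
      show "(\<lambda>v. h (i + N) (?z v) * lker (y (i + N) - \<i> * of_real d - of_real v)) \<in> borel_measurable borel" for i
      proof (intro borel_measurable_times meas(1)[OF hhol] borel_measurable_continuous_onI)
        show "continuous_on UNIV (\<lambda>v::real. lker (y (i + N) - \<i> * of_real d - of_real v))"
          using wd'[OF N[of "i + N"]] by (intro continuous_intros exp_ne_1_strip) auto
      qed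
      show "norm (h (i + N) (?z v) * lker (y (i + N) - \<i> * of_real d - of_real v)) \<le> B * D / sin s / (1 + v\<^sup>2)" for i v
        proof (rule norm_lcauchy_integrand_le[where H="\<lambda>v. h (i + N) (v + \<i> * of_real d)", OF _ s(1,2) wd[OF N[of "i + N"]]])
        show "norm (h (i + N) (of_real u + \<i> * of_real d)) \<le> (B * D) / (1 + u\<^sup>2)" for u :: real
          using hbd[of "?z u" "i + N"] d by simp
      qed auto
      fix v :: real
      have "(\<lambda>i. h (i + N) (?z v)) \<longlonglongrightarrow> h0 (?z v)"
      proof -
        have "(\<lambda>i. ?z v - \<i> * of_real (e i)) \<longlonglongrightarrow> ?z v - \<i> * of_real 0" by (intro tendsto_intros e)
        then have "(\<lambda>i. \<Psi> i (?z v - \<i> * of_real (e i))) \<longlonglongrightarrow> jfun n b j (?z v)"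
          using d by (intro lim memv0) auto
        then have "(\<lambda>i. h i (?z v)) \<longlonglongrightarrow> h0 (?z v)" unfolding h_def h0_def by (intro tendsto_mult tendsto_const)
        then show ?thesis by (rule LIMSEQ_ignore_initial_segment)
      qed
      moreover have "(\<lambda>i. lker (y (i + N) - \<i> * of_real d - of_real v)) \<longlonglongrightarrow> lker (w - \<i> * of_real d - of_real v)"
        using wd'[OF w] by (intro lker_tendsto tendsto_diff tendsto_const yN exp_ne_1_strip) auto
      ultimately show "(\<lambda>i. h (i + N) (?z v) * lker (y (i + N) - \<i> * of_real d - of_real v)) \<longlonglongrightarrow> h0 (?z v) * lker (w - \<i> * of_real d - of_real v)"
        by (rule tendsto_mult)
    qed
    then have "(\<lambda>i. T (h i) (y i)) \<longlonglongrightarrow> T h0 w" by (rule LIMSEQ_offset)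
    then show "(\<lambda>i. T (h i) (y i)) \<longlonglongrightarrow> jfun n b (Suc j) w" unfolding T0[OF w] .
  qed
qed

subsection \<open>Hyperterminants as iterated Cauchy transforms\<close>

text \<open>Change of variables r = exp v for absolutely integrable real functions. Measurability on
  the half-line is assumed separately so that the result can be brought back from the completed
  measure.\<close>

lemma integral_exp_substitution_real:
  fixes f :: "real \<Rightarrow> real"
  assumes m: "(\<lambda>r. indicator {0<..} r *\<^sub>R f r) \<in> borel_measurable borel"
    and int: "integrable lborel (\<lambda>v. exp v * f (exp v))"
  shows "set_integrable lborel {0<..} f" "(LBINT r:{0<..}. f r) = (\<integral>v. exp v * f (exp v) \<partial>lborel)"
proof -
  have rng: "exp ` (UNIV :: real set) = {0<..}"
  proof
    show "{0<..} \<subseteq> exp ` (UNIV :: real set)"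
    proof
      fix x :: real assume "x \<in> {0<..}"
      then have "x = exp (ln x)" by simp
      then show "x \<in> exp ` UNIV" by blast
    qed
  qed auto
  have m0: "(\<lambda>v. exp v * f (exp v)) \<in> borel_measurable lborel" using int by (rule borel_measurable_integrable)
  have "integrable lebesgue (\<lambda>v. exp v * f (exp v))"
    using int by (subst integrable_completion[OF m0])
  then have A: "(\<lambda>v. \<bar>exp v\<bar> * f (exp v)) absolutely_integrable_on UNIV"
    by (simp add: set_integrable_def)
  have I: "integral UNIV (\<lambda>v. \<bar>exp v\<bar> * f (exp v)) = (\<integral>v. exp v * f (exp v) \<partial>lborel)"
    using integral_lborel[OF int] by simp
  have "f absolutely_integrable_on (exp ` UNIV) \<and> integral (exp ` UNIV) f = (\<integral>v. exp v * f (exp v) \<partial>lborel)"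
  proof (rule iffD1[OF has_absolute_integral_change_of_variables_1'[where S=UNIV and g=exp and g'=exp]])
    show "(exp has_field_derivative exp x) (at x within UNIV)" for x :: real by (rule DERIV_exp)
    show "inj_on exp (UNIV :: real set)" by (simp add: inj_on_def)
  qed (use A I in auto)
  then have f: "f absolutely_integrable_on {0<..}" "integral {0<..} f = (\<integral>v. exp v * f (exp v) \<partial>lborel)"
    unfolding rng by blast+
  have m': "(\<lambda>r. indicator {0<..} r *\<^sub>R f r) \<in> borel_measurable lborel" using m by simp
  show s: "set_integrable lborel {0<..} f"
    using f(1) unfolding set_integrable_def by (subst (asm) integrable_completion[OF m'])
  show "(LBINT r:{0<..}. f r) = (\<integral>v. exp v * f (exp v) \<partial>lborel)"
    unfolding set_borel_integral_eq_integral(2)[OF s] by (rule f(2))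
qed

text \<open>In use \<open>a\<close> is |sigma|: the coordinate v = ln (a r) brings every ray to the
  same real line. Real and imaginary parts are treated separately.\<close>

lemma integral_log_substitution:
  fixes G :: "real \<Rightarrow> complex"
  assumes G: "G \<in> borel_measurable borel" "integrable lborel G" and a: "a > 0"
    and F: "\<And>r. r > 0 \<Longrightarrow> F r = G (ln (a * r)) / of_real r"
  shows "(LBINT r:{0<..}. F r) = (\<integral>v. G v \<partial>lborel)"
proof -
  have tr: "integrable lborel (\<lambda>v. G (ln a + v))" "(\<integral>v. G (ln a + v) \<partial>lborel) = (\<integral>v. G v \<partial>lborel)"
    using lborel_integrable_real_affine[OF G(2), of 1 "ln a"] lborel_integral_real_affine[of 1 G "ln a"] by simp_all
  have sub: "exp v * (h (G (ln (a * exp v))) / exp v) = h (G (ln a + v))" for v and h :: "complex \<Rightarrow> real"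
    using a by (simp add: ln_mult)
  have part: "set_integrable lborel {0<..} (\<lambda>r. h (G (ln (a * r))) / r)"
      "(LBINT r:{0<..}. h (G (ln (a * r))) / r) = (\<integral>v. h (G (ln a + v)) \<partial>lborel)"
    if h: "h = Re \<or> h = Im" for h
  proof -
    have [measurable]: "G \<in> borel_measurable borel" "h \<in> borel_measurable borel"
      using G(1) h by auto
    have m: "(\<lambda>r. indicator {0<..} r *\<^sub>R (h (G (ln (a * r))) / r)) \<in> borel_measurable borel" by measurable
    have "integrable lborel (\<lambda>v. h (G (ln a + v)))"
      using h tr(1) by (auto intro: integrable_Re integrable_Im)
    then have i: "integrable lborel (\<lambda>v. exp v * (h (G (ln (a * exp v))) / exp v))" unfolding sub .
    note integral_exp_substitution_real[OF m i]
    then show "set_integrable lborel {0<..} (\<lambda>r. h (G (ln (a * r))) / r)"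
      "(LBINT r:{0<..}. h (G (ln (a * r))) / r) = (\<integral>v. h (G (ln a + v)) \<partial>lborel)" unfolding sub by auto
  qed
  note R = part[of Re, OF disjI1[OF refl]] and J = part[of Im, OF disjI2[OF refl]]
  let ?R = "\<lambda>r. indicator {0<..} r *\<^sub>R (Re (G (ln (a * r))) / r)"
  let ?I = "\<lambda>r. indicator {0<..} r *\<^sub>R (Im (G (ln (a * r))) / r)"
  have dec: "indicator {0<..} r *\<^sub>R F r = of_real (?R r) + \<i> * of_real (?I r)" for r
    by (auto simp: indicator_def F complex_eq_iff)
  have iR: "integrable lborel (\<lambda>r. complex_of_real (?R r))"
    using R(1) unfolding set_integrable_def by (rule integrable_of_real)
  have iI: "integrable lborel (\<lambda>r. \<i> * complex_of_real (?I r))"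
    using J(1) unfolding set_integrable_def by (intro integrable_mult_right integrable_of_real)
  have "(LBINT r:{0<..}. F r) = (\<integral>r. of_real (?R r) + \<i> * of_real (?I r) \<partial>lborel)"
    unfolding set_lebesgue_integral_def dec ..
  also have "\<dots> = of_real (\<integral>r. ?R r \<partial>lborel) + \<i> * of_real (\<integral>r. ?I r \<partial>lborel)"
    unfolding Bochner_Integration.integral_add[OF iR iI] integral_mult_right_zero integral_complex_of_real ..
  also have "\<dots> = of_real (Re (\<integral>v. G (ln a + v) \<partial>lborel)) + \<i> * of_real (Im (\<integral>v. G (ln a + v) \<partial>lborel))"
    using R(2) J(2) unfolding set_lebesgue_integral_def integral_Re[OF tr(1)] integral_Im[OF tr(1)] by simp
  also have "\<dots> = (\<integral>v. G (ln a + v) \<partial>lborel)" by (simp add: complex_eq_iff)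
  finally show ?thesis using tr(2) by simp
qed

section \<open>The multiple integral as a nested recursion, and its limit for equal
  directions\<close>

lemma ray_integral_mult: "ray_integral \<eta> (\<lambda>t. c * g t) = c * ray_integral \<eta> g"
proof -
  have "indicator {0<..} r *\<^sub>R (c * g (polar r \<eta>) * cis \<eta>) = c * (indicator {0<..} r *\<^sub>R (g (polar r \<eta>) * cis \<eta>))" for r :: real
    by (simp add: mult.assoc)
  then show ?thesis unfolding ray_integral_def set_lebesgue_integral_def by (simp only: integral_mult_right_zero)
qed

lemma iterated_ray_integral_mult: "iterated_ray_integral \<eta>s (\<lambda>ts. c * f ts) = c * iterated_ray_integral \<eta>s f"
proof (induction \<eta>s arbitrary: f)
  case (Cons \<eta> \<eta>s)
  show ?case by (simp only: iterated_ray_integral.simps Cons ray_integral_mult)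
qed simp

text \<open>Each inner integral depends on the outer variables only through its immediate
  predecessor, so the list-indexed product becomes a recursion on the integrals with that
  predecessor as argument.\<close>

primrec hiter :: "(complex \<times> log_surface) list \<Rightarrow> log_surface \<Rightarrow> complex" where
  "hiter [] z = 1"
| "hiter (p # ps) z = ray_integral (pi - argument (snd p))
     (\<lambda>t. exp (proj (snd p) * proj t) * lpow t (fst p - 1) / (proj z - proj t) * hiter ps t)"

lemma hyperterminant_integral_eq_hiter:
  "hyperterminant_integral (map fst ps) (map snd ps) z = hiter ps z"
proof (induction ps arbitrary: z)
  case Nil
  then show ?case by (simp add: hyperterminant_integral_def)
next
  case (Cons p ps)
  let ?F = "\<lambda>z ts. \<Prod>k<length ps. exp (proj (map snd ps ! k) * proj (ts ! k)) * lpow (ts ! k) (map fst ps ! k - 1)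
            / (proj ((z # ts) ! k) - proj (ts ! k))"
  have IH: "iterated_ray_integral (map (\<lambda>\<sigma>. pi - argument \<sigma>) (map snd ps)) (?F t) = hiter ps t" for t
    using Cons[of t] by (simp add: hyperterminant_integral_def)
  have "hyperterminant_integral (map fst (p # ps)) (map snd (p # ps)) z
     = ray_integral (pi - argument (snd p)) (\<lambda>t. iterated_ray_integral (map (\<lambda>\<sigma>. pi - argument \<sigma>) (map snd ps))
          (\<lambda>ts. exp (proj (snd p) * proj t) * lpow t (fst p - 1) / (proj z - proj t) * ?F t ts))"
    unfolding hyperterminant_integral_def by (simp add: prod.lessThan_Suc_shift del: prod.lessThan_Suc)
  also have "\<dots> = hiter (p # ps) z" unfolding iterated_ray_integral_mult IH by simp
  finally show ?case .
qed

lemma modulus_nonzero [simp]: "modulus t \<noteq> 0"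
  using modulus_pos[of t] by (rule less_imp_neq[THEN not_sym])

lemma proj_eq_exp: "proj t = exp (of_real (ln (modulus t)) + \<i> * of_real (argument t))"
  by (simp add: Defs.proj_def rcis_def exp_add cis_conv_exp exp_of_real)

lemma argument_rotate_by [simp]: "argument (rotate_by \<alpha> t) = argument t + \<alpha>"
  and modulus_rotate_by [simp]: "modulus (rotate_by \<alpha> t) = modulus t"
  by (simp_all add: rotate_by_def)

text \<open>The index i counts from the innermost variable: i = 0 carries the exponent N - n and no
  rotation, and the head of the list has the largest rotation. Prolonging the list thus leaves the
  inner part unchanged.\<close>

definition pairs :: "real \<Rightarrow> nat \<Rightarrow> log_surface \<Rightarrow> real \<Rightarrow> nat \<Rightarrow> (complex \<times> log_surface) list" where
  "pairs N n \<sigma> e l = map (\<lambda>i. (of_real N - (if i = 0 then of_nat n else 0), rotate_by (real i * e) \<sigma>)) (rev [0..<l])"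

lemma pairs_Suc: "pairs N n \<sigma> e (Suc l) = (of_real N - (if l = 0 then of_nat n else 0), rotate_by (real l * e) \<sigma>) # pairs N n \<sigma> e l"
  by (simp add: pairs_def)

lemma rev_upt_eq: "rev [0..<m] = map (\<lambda>k. m - Suc k) [0..<m]"
  by (rule nth_equalityI) (auto simp: rev_nth)

lemma map_snd_pairs: "map snd (pairs N n \<sigma> e m) = perturb e (replicate m \<sigma>)"
proof -
  have "map snd (pairs N n \<sigma> e m) = map (\<lambda>k. rotate_by (real (m - Suc k) * e) \<sigma>) [0..<m]"
    by (simp add: pairs_def rev_upt_eq o_def)
  also have "\<dots> = perturb e (replicate m \<sigma>)" unfolding perturb_def by (intro map_cong) auto
  finally show ?thesis .
qed

lemma map_fst_pairs:
  assumes "m \<ge> 1"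
  shows "map fst (pairs N n \<sigma> e m) = replicate (m - 1) (of_real N) @ [of_real N - of_nat n]"
proof -
  obtain k where m: "m = Suc k" using assms by (cases m) auto
  have "map fst (pairs N n \<sigma> e m) = map (\<lambda>i. of_real N - (if i = 0 then of_nat n else 0)) (rev [0..<m])"
    by (simp add: pairs_def o_def)
  also have "[0..<m] = 0 # map Suc [0..<k]" unfolding m map_Suc_upt by (simp add: upt_conv_Cons)
  also have "map (\<lambda>i. complex_of_real N - (if i = 0 then of_nat n else 0)) (rev (0 # map Suc [0..<k]))
     = rev (map (\<lambda>i. of_real N) [0..<k]) @ [of_real N - of_nat n]"
    by (simp add: rev_map o_def)
  also have "rev (map (\<lambda>i. complex_of_real N) [0..<k]) = replicate (m - 1) (of_real N)"
    unfolding m map_replicate_const by simp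
  finally show ?thesis .
qed

lemma chain_props:
  assumes b: "real n < b" and e: "l = 0 \<or> 0 < e \<and> e < 1"
  shows "(\<lambda>v::real. gwt 1 b (of_real v) * chain b n e l (of_real v - \<i> * of_real e)) \<in> borel_measurable borel \<and>
    (\<exists>D. \<forall>v::real. norm (gwt 1 b (of_real v) * chain b n e l (of_real v - \<i> * of_real e)) \<le> D / (1 + v\<^sup>2))"
  using e
proof (induction l)
  case 0
  obtain D where D: "\<And>w. \<bar>Im w\<bar> \<le> 1 \<Longrightarrow> norm (gwt 1 b w) * (1 + exp (- real n * Re w)) \<le> D / (1 + (Re w)\<^sup>2)" "D > 0"
    using norm_gwt_weight_le[OF _ b, of 1] by auto
  have c: "chain b n e 0 (of_real v - \<i> * of_real e) = exp (- of_nat n * of_real v)" for v by simp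
  have "norm (gwt 1 b (of_real v) * exp (- of_nat n * of_real v)) \<le> D / (1 + v\<^sup>2)" for v :: real
  proof -
    have "norm (gwt 1 b (of_real v) * exp (- of_nat n * of_real v)) \<le> norm (gwt 1 b (of_real v)) * (1 + exp (- real n * v))"
      unfolding norm_mult by (intro mult_left_mono) auto
    also have "\<dots> \<le> D / (1 + v\<^sup>2)" using D(1)[of "of_real v"] by simp
    finally show ?thesis .
  qed
  moreover have "continuous_on UNIV (\<lambda>v::real. gwt 1 b (of_real v) * exp (- of_nat n * of_real v))"
    by (intro continuous_intros)
  ultimately show ?case unfolding c using borel_measurable_continuous_onI by blast
next
  case (Suc l)
  have e: "0 < e" "e < 1" using Suc.prems by auto
  define H where "H v = gwt 1 b v * chain b n e l (v - \<i> * of_real e)" for v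
  obtain D where H: "(\<lambda>v::real. H (of_real v)) \<in> borel_measurable borel" "\<And>v::real. norm (H (of_real v)) \<le> D / (1 + v\<^sup>2)"
    using Suc e unfolding H_def by metis
  have ch: "chain b n e (Suc l) = lcauchy H" unfolding H_def [abs_def] by simp
  have im: "- 2 * pi + e \<le> Im (of_real v - \<i> * of_real e)" "Im (of_real v - \<i> * of_real e) \<le> - e" for v
    using e pi_gt3 by auto
  have epi: "e \<le> pi / 2" using e pi_gt3 by linarith
  have b1: "norm (lcauchy H (of_real v - \<i> * of_real e)) \<le> D / sin e * pi" for v
    by (rule norm_lcauchy_le[OF H(2) e(1) epi im])
  have D0: "D \<ge> 0" using order_trans[OF norm_ge_zero H(2)[of 0]] by simp
  have se: "sin e > 0" using e epi by (intro sin_gt_zero) auto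
  have bp: "b > 0" using b by (meson le_less_trans of_nat_0_le_iff)
  obtain B where B: "\<And>w. \<bar>Im w\<bar> \<le> 1 \<Longrightarrow> norm (gwt 1 b w) \<le> B / (1 + (Re w)\<^sup>2)" "B > 0"
    using norm_gwt_le[of 1 b] bp by auto
  have "continuous_on UNIV (\<lambda>v::real. lcauchy H (of_real v - \<i> * of_real e))"
    by (rule continuous_on_compose2[OF holomorphic_on_imp_continuous_on[OF lcauchy_holomorphic[OF H]]])
       (use e pi_gt3 in \<open>auto intro!: continuous_intros\<close>)
  then have "(\<lambda>v::real. gwt 1 b (of_real v) * lcauchy H (of_real v - \<i> * of_real e)) \<in> borel_measurable borel"
    by (intro borel_measurable_continuous_onI continuous_on_mult gwt_continuous) (auto intro!: continuous_intros)
  moreover have "norm (gwt 1 b (of_real v) * lcauchy H (of_real v - \<i> * of_real e)) \<le> (B * (D / sin e * pi)) / (1 + v\<^sup>2)" for v :: real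
  proof -
    have "norm (gwt 1 b (of_real v)) * norm (lcauchy H (of_real v - \<i> * of_real e)) \<le> (B / (1 + v\<^sup>2)) * (D / sin e * pi)"
      using B(1)[of "of_real v"] b1[of v] B(2) by (intro mult_mono) auto
    then show ?thesis by (simp add: norm_mult mult.commute)
  qed
  ultimately show ?case unfolding ch by blast
qed

text \<open>On the i-th ray log t is v - ln |sigma| plus i times the direction of the ray. The power
  of t is therefore the exponential in v times this constant.\<close>

definition phase :: "real \<Rightarrow> nat \<Rightarrow> log_surface \<Rightarrow> real \<Rightarrow> nat \<Rightarrow> complex" where
  "phase b n \<sigma> e l = (\<Prod>i<l. exp ((of_real b - (if i = 0 then of_nat n else 0))
      * (- of_real (ln (modulus \<sigma>)) + \<i> * of_real (pi - argument \<sigma> - real i * e))))"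

text \<open>The coordinate of z relative to a ray rotated by t: its imaginary part vanishes when z
  points in the direction pi - arg sigma - t.\<close>

definition wcoord :: "log_surface \<Rightarrow> log_surface \<Rightarrow> real \<Rightarrow> complex" where
  "wcoord \<sigma> z t = Complex (ln (modulus (\<sigma> * z))) (argument (\<sigma> * z) - pi + t)"

text \<open>One substitution per integral. The outermost of l + 1 rays is rotated by l e, hence the
  raised coordinate at the outside, while every inner evaluation happens at depth e below the next
  line.\<close>

lemma hiter_pairs:
  assumes b: "real n < b" and e: "l = 0 \<or> 0 < e \<and> e < 1"
    and im: "-2*pi < Im (wcoord \<sigma> z (real l * e))" "Im (wcoord \<sigma> z (real l * e)) < 0"
  shows "hiter (pairs (b + 1) n \<sigma> e (Suc l)) z = phase b n \<sigma> e (Suc l) * chain b n e (Suc l) (wcoord \<sigma> z (real l * e))"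
  using e im
proof (induction l arbitrary: z rule: less_induct)
  fix l z
  assume IH: "\<And>k z. k < l \<Longrightarrow> k = 0 \<or> 0 < e \<and> e < 1 \<Longrightarrow> -2*pi < Im (wcoord \<sigma> z (real k * e)) \<Longrightarrow> Im (wcoord \<sigma> z (real k * e)) < 0 \<Longrightarrow>
    hiter (pairs (b + 1) n \<sigma> e (Suc k)) z = phase b n \<sigma> e (Suc k) * chain b n e (Suc k) (wcoord \<sigma> z (real k * e))"
    and e: "l = 0 \<or> 0 < e \<and> e < 1"
    and im: "-2*pi < Im (wcoord \<sigma> z (real l * e))" "Im (wcoord \<sigma> z (real l * e)) < 0"
  define a where "a = modulus \<sigma>"
  define \<alpha> where "\<alpha> = argument \<sigma>"
  define \<eta> where "\<eta> = pi - \<alpha> - real l * e"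
  define b' where "b' = of_real b - (if l = 0 then of_nat n else 0 :: complex)"
  define W where "W = wcoord \<sigma> z (real l * e)"
  define H where "H v = gwt 1 b v * chain b n e l (v - \<i> * of_real e)" for v
  define P where "P = phase b n \<sigma> e l"
  define E where "E = exp (b' * (- of_real (ln a) + \<i> * of_real \<eta>))"
  have a: "a > 0" by (simp add: a_def)
  have PE: "phase b n \<sigma> e (Suc l) = P * E"
    unfolding phase_def P_def E_def b'_def a_def \<eta>_def \<alpha>_def by (simp add: mult.commute)
  obtain D where H: "(\<lambda>v::real. H (of_real v)) \<in> borel_measurable borel" "\<And>v::real. norm (H (of_real v)) \<le> D / (1 + v\<^sup>2)"
    using chain_props[OF b e] unfolding H_def by blast
  define G where "G v = P * E * (H (of_real v) * lker (W - of_real v))" for v :: real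
  have W: "-2*pi < Im W" "Im W < 0" using im unfolding W_def .
  have iH: "integrable lborel (\<lambda>v. H (of_real v) * lker (W - of_real v))" by (rule integrable_lcauchy[OF H W])
  have iG: "integrable lborel G" unfolding G_def using iH by (rule integrable_mult_right)
  have mG: "G \<in> borel_measurable borel" using borel_measurable_integrable[OF iG] by simp
  have IG: "(\<integral>v. G v \<partial>lborel) = P * E * lcauchy H W" unfolding G_def lcauchy_def by (rule integral_mult_right_zero)
  define t where "t r = polar r \<eta>" for r
  have prev: "exp (b' * (of_real (ln r) + \<i> * of_real \<eta>)) * hiter (pairs (b + 1) n \<sigma> e l) (t r)
     = P * E * (exp (of_real b * of_real (ln (a * r))) * chain b n e l (of_real (ln (a * r)) - \<i> * of_real e))" if r: "r > 0" for r
  proof -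
    have lnar: "ln (a * r) = ln a + ln r" using a r by (simp add: ln_mult)
    have ex: "exp (b' * (of_real (ln r) + \<i> * of_real \<eta>)) = E * exp (b' * of_real (ln (a * r)))"
      unfolding E_def lnar by (simp add: algebra_simps flip: exp_add)
    show ?thesis
    proof (cases l)
      case 0
      then have "P = 1" "hiter (pairs (b + 1) n \<sigma> e l) (t r) = 1" by (simp_all add: P_def phase_def pairs_def)
      moreover have "exp (b' * of_real (ln (a * r))) = exp (of_real b * of_real (ln (a * r))) * chain b n e l (of_real (ln (a * r)) - \<i> * of_real e)"
        unfolding b'_def 0 by (simp add: algebra_simps flip: exp_add)
      ultimately show ?thesis unfolding ex by simp
    next
      case (Suc k)
      \<comment> \<open>A point of the current ray lies an angle e short of the next ray, which is
        why the recursion of \<open>chain\<close> evaluates at v - i e.\<close>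
      have wc: "wcoord \<sigma> (t r) (real k * e) = of_real (ln (a * r)) - \<i> * of_real e"
        using r a unfolding wcoord_def t_def Suc \<eta>_def
        by (simp add: complex_eq_iff a_def[symmetric] \<alpha>_def[symmetric] algebra_simps)
      have e': "0 < e" "e < 1" "k < l" using e Suc by auto
      have "hiter (pairs (b + 1) n \<sigma> e (Suc k)) (t r) = phase b n \<sigma> e (Suc k) * chain b n e (Suc k) (of_real (ln (a * r)) - \<i> * of_real e)"
        unfolding wc[symmetric]
        by (rule IH[OF e'(3)]) (use e' pi_gt3 in \<open>auto simp: wc\<close>)
      moreover have "b' = of_real b" unfolding b'_def Suc by simp
      ultimately show ?thesis unfolding ex P_def Suc by simp
    qed
  qed
  have F: "exp (proj (rotate_by (real l * e) \<sigma>) * proj (t r)) * lpow (t r) (of_real (b + 1) - (if l = 0 then of_nat n else 0) - 1) / (proj z - proj (t r))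
        * hiter (pairs (b + 1) n \<sigma> e l) (t r) * cis \<eta> = G (ln (a * r)) / of_real r" if r: "r > 0" for r
  proof -
    have lnar: "ln (a * r) = ln a + ln r" using a r by (simp add: ln_mult)
    \<comment> \<open>The directions are chosen so that the rotated sigma times t has argument
      exactly pi; the exponential becomes exp (- |sigma| r) whatever the rotation.\<close>
    have p1: "exp (proj (rotate_by (real l * e) \<sigma>) * proj (t r)) = exp (- exp (of_real (ln (a * r))))"
    proof -
      have "proj (rotate_by (real l * e) \<sigma>) * proj (t r) = rcis (a * r) pi"
        using r unfolding Defs.proj_def t_def by (simp add: rcis_mult a_def[symmetric] \<alpha>_def[symmetric] \<eta>_def)
      also have "\<dots> = - exp (of_real (ln (a * r)))" using a r by (simp add: rcis_def exp_of_real)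
      finally show ?thesis by simp
    qed
    have p2: "lpow (t r) (of_real (b + 1) - (if l = 0 then of_nat n else 0) - 1) = exp (b' * (of_real (ln r) + \<i> * of_real \<eta>))"
      using r by (simp add: lpow_def t_def b'_def algebra_simps)
    have pt: "proj (t r) = of_real r * cis \<eta>" using r by (simp add: Defs.proj_def t_def rcis_def)
    have Wt: "proj z / proj (t r) = exp (W - of_real (ln (a * r)))"
    proof -
      have "W - of_real (ln (a * r)) = (of_real (ln (modulus z)) + \<i> * of_real (argument z)) - (of_real (ln r) + \<i> * of_real \<eta>)"
        unfolding W_def wcoord_def lnar using a r
        by (simp add: complex_eq_iff \<eta>_def \<alpha>_def a_def ln_mult)
      then show ?thesis using r unfolding proj_eq_exp t_def by (simp add: exp_diff)
    qed
    have nz: "proj (t r) \<noteq> 0" using r unfolding pt by simp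
    have k: "cis \<eta> / (proj z - proj (t r)) = lker (W - of_real (ln (a * r))) / of_real r"
    proof -
      have "proj z - proj (t r) = (exp (W - of_real (ln (a * r))) - 1) * (of_real r * cis \<eta>)"
        unfolding Wt[symmetric] using nz unfolding pt[symmetric] by (simp add: left_diff_distrib)
      then show ?thesis using r unfolding lker_def by simp
    qed
    have gw: "exp (- exp (of_real (ln (a * r)))) * exp (of_real b * of_real (ln (a * r))) = gwt 1 b (of_real (ln (a * r)))"
      by (simp add: gwt_def flip: exp_add)
    have "exp (proj (rotate_by (real l * e) \<sigma>) * proj (t r)) * lpow (t r) (of_real (b + 1) - (if l = 0 then of_nat n else 0) - 1) / (proj z - proj (t r))
        * hiter (pairs (b + 1) n \<sigma> e l) (t r) * cis \<eta>
      = exp (- exp (of_real (ln (a * r)))) * (exp (b' * (of_real (ln r) + \<i> * of_real \<eta>)) * hiter (pairs (b + 1) n \<sigma> e l) (t r)) * (cis \<eta> / (proj z - proj (t r)))"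
      unfolding p1 p2 by simp
    also have "\<dots> = P * E * ((exp (- exp (of_real (ln (a * r)))) * exp (of_real b * of_real (ln (a * r)))) * chain b n e l (of_real (ln (a * r)) - \<i> * of_real e)
        * (lker (W - of_real (ln (a * r))) / of_real r))"
      unfolding prev[OF r] k by (simp only: mult.assoc mult.left_commute)
    also have "\<dots> = G (ln (a * r)) / of_real r" unfolding gw G_def H_def by simp
    finally show ?thesis .
  qed
  have "hiter (pairs (b + 1) n \<sigma> e (Suc l)) z = (LBINT r:{0<..}. exp (proj (rotate_by (real l * e) \<sigma>) * proj (t r)) * lpow (t r) (of_real (b + 1) - (if l = 0 then of_nat n else 0) - 1) / (proj z - proj (t r))
        * hiter (pairs (b + 1) n \<sigma> e l) (t r) * cis \<eta>)"
    unfolding pairs_Suc hiter.simps ray_integral_def fst_conv snd_conv t_def argument_rotate_by \<eta>_def \<alpha>_def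
    by (simp only: diff_diff_eq)
  also have "\<dots> = (\<integral>v. G v \<partial>lborel)" by (rule integral_log_substitution[OF mG iG a F])
  finally show "hiter (pairs (b + 1) n \<sigma> e (Suc l)) z = phase b n \<sigma> e (Suc l) * chain b n e (Suc l) (wcoord \<sigma> z (real l * e))"
    unfolding IG PE W_def[symmetric] chain.simps H_def [abs_def] .
qed

lemma wcoord_add: "wcoord \<sigma> z t = wcoord \<sigma> z 0 + \<i> * of_real t"
  by (simp add: wcoord_def complex_eq_iff)

text \<open>\<open>chain_limit\<close> reaches down to Im w > -1 only, whereas the outermost
  transform is needed on the full strip. There w stays away from the cut, so one dominated
  convergence on the real line finishes the passage to the limit.\<close>

lemma chain_tendsto:
  fixes e :: "nat \<Rightarrow> real"
  assumes b: "real n < b" and e: "\<And>i. 0 < e i" "\<And>i. e i < 1/2" "e \<longlonglongrightarrow> 0"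
    and w: "-2*pi < Im w" "Im w < 0"
  shows "(\<lambda>i. chain b n (e i) (Suc l) (w + \<i> * of_real (real l * e i))) \<longlonglongrightarrow> jfun n b (Suc l) w"
proof -
  obtain \<Psi> B where B: "B \<ge> 0"
    and eq: "\<And>i w. w \<in> chain_strip l \<Longrightarrow> Im w < 0 \<Longrightarrow> \<Psi> i w = chain b n (e i) l w"
    and bd: "\<And>i w. w \<in> chain_strip l \<Longrightarrow> norm (\<Psi> i w) \<le> B * (1 + exp (- real n * Re w))"
    and lim: "\<And>w y. w \<in> chain_strip l \<Longrightarrow> y \<longlonglongrightarrow> w \<Longrightarrow> (\<lambda>i. \<Psi> i (y i)) \<longlonglongrightarrow> jfun n b l w"
    using chain_limit[OF b e, of l] by metis
  obtain D where D: "\<And>w. \<bar>Im w\<bar> \<le> 1 \<Longrightarrow> norm (gwt 1 b w) * (1 + exp (- real n * Re w)) \<le> D / (1 + (Re w)\<^sup>2)" "D > 0"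
    using norm_gwt_weight_le[OF _ b, of 1] by auto
  have mem: "of_real v - \<i> * of_real (e i) \<in> chain_strip l" "of_real v \<in> chain_strip l" for v i
  proof -
    have "- 1 < - e i" "- e i < 0" using e(1,2)[of i] by linarith+
    moreover have "0 < 1 / real (Suc l)" by simp
    ultimately show "of_real v - \<i> * of_real (e i) \<in> chain_strip l" "of_real v \<in> chain_strip l"
      unfolding chain_strip_def by (auto simp del: of_nat_Suc intro: less_trans[of _ 0])
  qed
  define h where "h i v = gwt 1 b v * chain b n (e i) l (v - \<i> * of_real (e i))" for i v
  have h: "h i (of_real v) = gwt 1 b (of_real v) * \<Psi> i (of_real v - \<i> * of_real (e i))" for i and v :: real
    unfolding h_def using mem(1)[of v i] e(1)[of i] by (subst eq) auto
  have hbd: "norm (h i (of_real v)) \<le> (B * D) / (1 + v\<^sup>2)" for i and v :: real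
  proof -
    have "norm (\<Psi> i (of_real v - \<i> * of_real (e i))) \<le> B * (1 + exp (- real n * v))"
      using bd[OF mem(1)[of v i], of i] by simp
    then have "norm (h i (of_real v)) \<le> norm (gwt 1 b (of_real v)) * (B * (1 + exp (- real n * v)))"
      unfolding h norm_mult by (intro mult_left_mono) auto
    also have "\<dots> = B * (norm (gwt 1 b (of_real v)) * (1 + exp (- real n * v)))" by simp
    also have "\<dots> \<le> B * (D / (1 + v\<^sup>2))" using D(1)[of "of_real v"] B by (intro mult_left_mono) auto
    finally show ?thesis by simp
  qed
  have hm: "(\<lambda>v::real. h i (of_real v)) \<in> borel_measurable borel" for i
    using chain_props[OF b, of l "e i"] e(1,2)[of i] unfolding h_def by auto
  define s where "s = min (- Im w / 2) (min 1 (Im w + 2 * pi))"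
  have s: "0 < s" "s \<le> 1" "s \<le> - Im w / 2" "s \<le> Im w + 2 * pi" using w by (auto simp: s_def)
  have spi: "s \<le> pi / 2" using s(2) pi_gt3 by linarith
  let ?W = "\<lambda>i. w + \<i> * of_real (real l * e i)"
  have le: "(\<lambda>i. real l * e i) \<longlonglongrightarrow> 0" using tendsto_mult[OF tendsto_const[of "real l"] e(3)] by simp
  have Wlim: "?W \<longlonglongrightarrow> w" using tendsto_add[OF tendsto_const[of w] tendsto_mult[OF tendsto_const[of \<i>] tendsto_of_real[OF le]]] by simp
  obtain N where N: "\<And>i. i \<ge> N \<Longrightarrow> real l * e i < s"
    using order_tendstoD(2)[OF le s(1)] by (auto simp: eventually_sequentially)
  have im: "-2*pi + s \<le> Im (?W (i + N))" "Im (?W (i + N)) \<le> - s" for i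
  proof -
    have "real l * e (i + N) < s" using N[of "i + N"] by simp
    moreover have "0 \<le> real l * e (i + N)" using e(1)[of "i + N"] by simp
    ultimately show "-2*pi + s \<le> Im (?W (i + N))" "Im (?W (i + N)) \<le> - s" using s by simp_all
  qed
  have "(\<lambda>i. \<integral>v. h (i + N) (of_real v) * lker (?W (i + N) - of_real v) \<partial>lborel)
     \<longlonglongrightarrow> (\<integral>v. (gwt 1 b (of_real v) * jfun n b l (of_real v)) * lker (w - of_real v) \<partial>lborel)"
  proof (rule integral_tendsto_inverse_square[where D="B * D / sin s"])
    show "(\<lambda>v. h (i + N) (of_real v) * lker (?W (i + N) - of_real v)) \<in> borel_measurable borel" for i
    proof (intro borel_measurable_times hm borel_measurable_continuous_onI)
      have "-2*pi < Im (?W (i + N))" "Im (?W (i + N)) < 0" using im[of i] s by linarith+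
      then show "continuous_on UNIV (\<lambda>v::real. lker (?W (i + N) - of_real v))"
        by (intro continuous_intros exp_ne_1_strip) auto
    qed
    show "norm (h (i + N) (of_real v) * lker (?W (i + N) - of_real v)) \<le> B * D / sin s / (1 + v\<^sup>2)" for i v
      by (rule norm_lcauchy_integrand_le[OF hbd s(1) spi im])
    fix v :: real
    have "(\<lambda>i. of_real v - \<i> * of_real (e i)) \<longlonglongrightarrow> of_real v - \<i> * of_real 0" by (intro tendsto_intros e)
    then have "(\<lambda>i. \<Psi> i (of_real v - \<i> * of_real (e i))) \<longlonglongrightarrow> jfun n b l (of_real v)"
      by (intro lim mem) simp
    then have "(\<lambda>i. h i (of_real v)) \<longlonglongrightarrow> gwt 1 b (of_real v) * jfun n b l (of_real v)"
      unfolding h by (intro tendsto_mult tendsto_const)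
    moreover have "(\<lambda>i. lker (?W i - of_real v)) \<longlonglongrightarrow> lker (w - of_real v)"
      using w by (intro lker_tendsto tendsto_diff tendsto_const Wlim exp_ne_1_strip) auto
    ultimately have "(\<lambda>i. h i (of_real v) * lker (?W i - of_real v)) \<longlonglongrightarrow> (gwt 1 b (of_real v) * jfun n b l (of_real v)) * lker (w - of_real v)"
      by (rule tendsto_mult)
    then show "(\<lambda>i. h (i + N) (of_real v) * lker (?W (i + N) - of_real v)) \<longlonglongrightarrow> (gwt 1 b (of_real v) * jfun n b l (of_real v)) * lker (w - of_real v)"
      by (rule LIMSEQ_ignore_initial_segment)
  qed
  then have "(\<lambda>i. \<integral>v. h i (of_real v) * lker (?W i - of_real v) \<partial>lborel)
     \<longlonglongrightarrow> (\<integral>v. (gwt 1 b (of_real v) * jfun n b l (of_real v)) * lker (w - of_real v) \<partial>lborel)"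
    by (rule LIMSEQ_offset)
  then show ?thesis unfolding jfun_lcauchy[OF b w] chain.simps lcauchy_def h_def .
qed

lemma phase_tendsto:
  assumes "e \<longlonglongrightarrow> 0"
  shows "(\<lambda>i. phase b n \<sigma> (e i) l) \<longlonglongrightarrow> phase b n \<sigma> 0 l"
  unfolding phase_def by (intro tendsto_intros assms)

lemma phase_0:
  "phase b n \<sigma> 0 (Suc l) = exp ((of_real (real (Suc l) * b) - of_nat n) * (- of_real (ln (modulus \<sigma>)) + \<i> * of_real (pi - argument \<sigma>)))"
proof (induction l)
  case (Suc l)
  have "phase b n \<sigma> 0 (Suc (Suc l)) = phase b n \<sigma> 0 (Suc l) * exp (of_real b * (- of_real (ln (modulus \<sigma>)) + \<i> * of_real (pi - argument \<sigma>)))"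
    unfolding phase_def by simp
  also have "\<dots> = exp ((of_real (real (Suc (Suc l)) * b) - of_nat n) * (- of_real (ln (modulus \<sigma>)) + \<i> * of_real (pi - argument \<sigma>)))"
    unfolding Suc exp_add[symmetric] by (rule arg_cong[of _ _ exp]) (simp add: algebra_simps)
  finally show ?case .
qed (simp add: phase_def)

lemma rotate_by_0: "rotate_by 0 \<sigma> = \<sigma>" by (simp add: rotate_by_def)

text \<open>The sector |arg(sigma z)| < pi is exactly -2 pi < Im w < 0. A single ray is not
  perturbed; with two or more all directions agree, so the limit definition applies and both factors
  of \<open>hiter_pairs\<close> converge.\<close>

lemma hyperterminant_sector_eq:
  assumes b: "real n < b" and z: "\<bar>argument (\<sigma> * z)\<bar> < pi"
  shows "hyperterminant_sector (replicate l (of_real (b + 1)) @ [of_real (b + 1) - of_nat n]) (replicate (Suc l) \<sigma>) z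
     = phase b n \<sigma> 0 (Suc l) * jfun n b (Suc l) (wcoord \<sigma> z 0)"
proof -
  let ?Ns = "replicate l (complex_of_real (b + 1)) @ [of_real (b + 1) - of_nat n]"
  define w where "w = wcoord \<sigma> z 0"
  have w: "-2*pi < Im w" "Im w < 0" using z by (auto simp: w_def wcoord_def)
  have hi: "hyperterminant_integral ?Ns (perturb e (replicate (Suc l) \<sigma>)) z = hiter (pairs (b + 1) n \<sigma> e (Suc l)) z" for e
    using hyperterminant_integral_eq_hiter[of "pairs (b + 1) n \<sigma> e (Suc l)" z]
    by (simp only: map_snd_pairs map_fst_pairs[of "Suc l"] diff_Suc_1)
  show ?thesis
  proof (cases "l = 0")
    case True
    have "\<not> consecutive_args_agree (replicate (Suc l) \<sigma>)" using True by (simp add: consecutive_args_agree_def)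
    then have "hyperterminant_sector ?Ns (replicate (Suc l) \<sigma>) z = hyperterminant_integral ?Ns (perturb 0 (replicate (Suc l) \<sigma>)) z"
      using True by (simp add: hyperterminant_sector_def perturb_def rotate_by_0)
    also have "\<dots> = phase b n \<sigma> 0 (Suc l) * chain b n 0 (Suc l) (wcoord \<sigma> z (real l * 0))"
      unfolding hi using True w by (intro hiter_pairs b) (auto simp: w_def)
    also have "chain b n 0 (Suc l) (wcoord \<sigma> z (real l * 0)) = jfun n b (Suc l) w"
      unfolding jfun_lcauchy[OF b w] using True by (simp add: lcauchy_def jfun_0 w_def)
    finally show ?thesis unfolding w_def .
  next
    case False
    then have l: "l > 0" by simp
    have "consecutive_args_agree (replicate (Suc l) \<sigma>)" unfolding consecutive_args_agree_def
      using l by (intro exI[of _ 0] conjI exI[of _ "0::int"]) auto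
    moreover have "Lim (at_right 0) (\<lambda>\<epsilon>. hyperterminant_integral ?Ns (perturb \<epsilon> (replicate (Suc l) \<sigma>)) z)
       = phase b n \<sigma> 0 (Suc l) * jfun n b (Suc l) w"
      unfolding hi
    proof (rule tendsto_Lim)
      \<comment> \<open>The bound - Im w / l keeps the raised coordinate w + i l e below the
        cut.\<close>
      define d where "d = min (1/2) (- Im w / real l)"
      have d: "0 < d" "d \<le> 1/2" "d \<le> - Im w / real l"
        using divide_pos_pos[of "- Im w" "real l"] w l unfolding d_def by linarith+
      show "((\<lambda>\<epsilon>. hiter (pairs (b + 1) n \<sigma> \<epsilon> (Suc l)) z) \<longlongrightarrow> phase b n \<sigma> 0 (Suc l) * jfun n b (Suc l) w) (at_right 0)"
      proof (rule tendsto_at_right_sequentially[OF d(1)])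
        fix e :: "nat \<Rightarrow> real"
        assume e: "\<And>i. 0 < e i" "\<And>i. e i < d" "e \<longlonglongrightarrow> 0"
        have e2: "e i < 1/2" for i using e(2)[of i] d(2) by linarith
        have eq: "hiter (pairs (b + 1) n \<sigma> (e i) (Suc l)) z = phase b n \<sigma> (e i) (Suc l) * chain b n (e i) (Suc l) (w + \<i> * of_real (real l * e i))" for i
        proof -
          have "e i < - Im w / real l" using e(2)[of i] d(3) by linarith
          then have "e i * real l < - Im w" using l by (intro iffD1[OF pos_less_divide_eq]) simp_all
          then have "real l * e i < - Im w" by (simp only: mult.commute)
          moreover have "0 \<le> real l * e i" using e(1)[of i] by simp
          ultimately have im: "-2*pi < Im (wcoord \<sigma> z (real l * e i))" "Im (wcoord \<sigma> z (real l * e i)) < 0"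
            using w unfolding wcoord_add[of \<sigma> z "real l * e i"] w_def[symmetric] by simp_all
          show ?thesis unfolding w_def wcoord_add[of \<sigma> z "real l * e i", symmetric]
            by (rule hiter_pairs[OF b _ im]) (use e(1)[of i] e2[of i] in simp)
        qed
        show "(\<lambda>i. hiter (pairs (b + 1) n \<sigma> (e i) (Suc l)) z) \<longlonglongrightarrow> phase b n \<sigma> 0 (Suc l) * jfun n b (Suc l) w"
          unfolding eq by (intro tendsto_mult phase_tendsto chain_tendsto b e e2 w)
      qed
    qed simp
    ultimately show ?thesis unfolding hyperterminant_sector_def w_def by simp
  qed
qed

text \<open>As \<open>jfun\<close> is entire, the formula found on the sector is itself a
  continuation, and the identity theorem in the logarithmic chart makes it the only one.\<close>

lemma hyperterminant_eq:
  assumes b: "real n < b"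
  shows "hyperterminant (replicate l (of_real (b + 1)) @ [of_real (b + 1) - of_nat n]) (replicate (Suc l) \<sigma>)
     = (\<lambda>z. phase b n \<sigma> 0 (Suc l) * jfun n b (Suc l) (wcoord \<sigma> z 0))"
  unfolding hyperterminant_def
proof (rule the_equality)
  let ?G = "\<lambda>z. phase b n \<sigma> 0 (Suc l) * jfun n b (Suc l) (wcoord \<sigma> z 0)"
  define c where "c = Complex (ln (modulus \<sigma>)) (argument \<sigma> - pi)"
  have wc: "wcoord \<sigma> (polar (exp (Re w)) (Im w)) 0 = w + c" for w
    by (simp add: wcoord_def c_def complex_eq_iff ln_mult)
  have "(jfun n b (Suc l) \<circ> (\<lambda>w. w + c)) holomorphic_on UNIV"
    by (intro holomorphic_on_compose_gen[OF _ jfun_holomorphic[where A=UNIV]] holomorphic_intros) auto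
  then have holG: "holomorphic_log_surface ?G"
    unfolding holomorphic_log_surface_def wc o_def by (intro holomorphic_on_mult holomorphic_on_const)
  let ?S = "hyperterminant_sector (replicate l (of_real (b + 1)) @ [of_real (b + 1) - of_nat n]) (replicate (Suc l) \<sigma>)"
  have sec: "?S z = ?G z" if "\<bar>argument (\<sigma> * z)\<bar> < pi" for z by (rule hyperterminant_sector_eq[OF b that])
  show "holomorphic_log_surface ?G \<and> (\<forall>z. \<bar>argument (hd (replicate (Suc l) \<sigma>) * z)\<bar> < pi \<longrightarrow> ?G z = ?S z)"
    using holG sec by simp
  fix G assume G: "holomorphic_log_surface G \<and> (\<forall>z. \<bar>argument (hd (replicate (Suc l) \<sigma>) * z)\<bar> < pi \<longrightarrow> G z = ?S z)"
  have Geq: "G z = ?G z" if "\<bar>argument (\<sigma> * z)\<bar> < pi" for z using G sec[OF that] that by simp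
  let ?P = "\<lambda>w. polar (exp (Re w)) (Im w)"
  let ?U = "{w. - pi - argument \<sigma> < Im w} \<inter> {w. Im w < pi - argument \<sigma>}"
  have all: "G (?P w) = ?G (?P w)" for w
  proof (rule analytic_continuation_open[of ?U UNIV "\<lambda>w. G (?P w)" "\<lambda>w. ?G (?P w)"])
    show "open ?U" by (intro open_Int open_halfspace_Im_gt open_halfspace_Im_lt)
    have "Complex 0 (- argument \<sigma>) \<in> ?U" by simp
    then show "?U \<noteq> {}" by blast
    show "(\<lambda>w. G (?P w)) holomorphic_on UNIV" "(\<lambda>w. ?G (?P w)) holomorphic_on UNIV"
      using G holG unfolding holomorphic_log_surface_def by blast+
    show "G (?P v) = ?G (?P v)" if "v \<in> ?U" for v using that by (intro Geq) auto
  qed auto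
  show "G = ?G"
  proof
    fix z
    have "?P (Complex (ln (modulus z)) (argument z)) = z" by simp
    then show "G z = ?G z" using all[of "Complex (ln (modulus z)) (argument z)"] by (simp only:)
  qed
qed

text \<open>Because exp w = - sigma z, the m-th power of the weight at w contains exp (m sigma z),
  and its remaining power combines with the phase into the power of z. Only exp (n w) is left over,
  and sigma and z survive through w alone.\<close>

lemma normalised_hyperterminant_eq:
  assumes b: "real n < b"
  shows "exp (- of_nat (Suc l) * proj (\<sigma> * z)) / ((2 * of_real pi * \<i>) ^ Suc l * lpow z (of_real (real (Suc l) * (b + 1) - real (Suc l) - real n)))
      * hyperterminant (replicate l (of_real (b + 1)) @ [of_real (b + 1) - of_nat n]) (replicate (Suc l) \<sigma>) z
     = exp (of_nat n * wcoord \<sigma> z 0) * jfun n b (Suc l) (wcoord \<sigma> z 0) / (2 * of_real pi * \<i> * gwt 1 b (wcoord \<sigma> z 0)) ^ Suc l"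
proof -
  define w where "w = wcoord \<sigma> z 0"
  define k where "k = complex_of_real (real (Suc l) * b) - of_nat n"
  define Z where "Z = complex_of_real (ln (modulus z)) + \<i> * of_real (argument z)"
  define S where "S = - complex_of_real (ln (modulus \<sigma>)) + \<i> * of_real (pi - argument \<sigma>)"
  have wZ: "w = Z - S"
    by (simp add: w_def wcoord_def Z_def S_def complex_eq_iff ln_mult)
  have ew: "exp w = - proj (\<sigma> * z)"
  proof -
    have "w = (of_real (ln (modulus (\<sigma> * z))) + \<i> * of_real (argument (\<sigma> * z))) - of_real pi * \<i>"
      by (simp add: w_def wcoord_def complex_eq_iff)
    then have "exp w = proj (\<sigma> * z) / exp (of_real pi * \<i>)" unfolding proj_eq_exp by (simp only: exp_diff)
    then show ?thesis by simp
  qed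
  have L: "lpow z (of_real (real (Suc l) * (b + 1) - real (Suc l) - real n)) = exp (k * Z)"
    unfolding lpow_def k_def Z_def by (rule arg_cong[of _ _ exp], rule arg_cong2[of _ _ _ _ times]) (simp_all add: algebra_simps)
  have g: "gwt 1 b w ^ Suc l = exp (of_nat (Suc l) * proj (\<sigma> * z)) * (exp (k * w) * exp (of_nat n * w))"
    unfolding gwt_def ew exp_of_nat_mult[symmetric] exp_add[symmetric] k_def by (rule arg_cong[of _ _ exp]) (simp add: algebra_simps)
  have ph: "phase b n \<sigma> 0 (Suc l) = exp (k * S)" unfolding phase_0 k_def S_def ..
  have kw: "exp (k * w) = exp (k * Z) / exp (k * S)" unfolding wZ by (simp add: right_diff_distrib exp_diff)
  have ep: "exp (- of_nat (Suc l) * proj (\<sigma> * z)) = 1 / exp (of_nat (Suc l) * proj (\<sigma> * z))"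
    by (simp only: mult_minus_left exp_minus inverse_eq_divide)
  have alg: "1 / p / (t * u) * (v * J) = e * J / (t * (p * (u / v * e)))"
    if "p \<noteq> 0" "u \<noteq> 0" "v \<noteq> 0" "e \<noteq> 0" for p t u v J e :: complex
    using that by (simp add: mult.commute mult.left_commute)
  show ?thesis
    unfolding hyperterminant_eq[OF b] w_def[symmetric] ph L power_mult_distrib[of _ "gwt 1 b w"] g kw ep
    by (rule alg) (rule exp_not_eq_zero)+
qed

text \<open>The weight is real on the line of integration, so conjugation commutes with the
  transform. It reflects the strip upwards, and one period brings it back.\<close>

lemma gterm_cnj:
  assumes ab: "a > 0" "b > 0"
  shows "gterm a b (cnj w - 2 * of_real pi * \<i>) = cnj (gterm a b w)"
proof -
  let ?p = "2 * of_real pi * \<i> :: complex"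
  let ?E = "\<lambda>w. cnj (gterm a b (cnj w - ?p))"
  have "(\<lambda>w. gterm a b (w - ?p)) holomorphic_on cnj ` UNIV" by (intro holomorphic_intros)
  from holomorphic_on_compose_cnj_cnj[OF this open_UNIV]
  have hE: "?E holomorphic_on UNIV" by (simp add: o_def)
  have "?E w = gterm a b w"
  proof (rule analytic_continuation_open[of "{w. - 2 * pi < Im w} \<inter> {w. Im w < 0}" UNIV ?E "gterm a b"])
    show "open ({w. - 2 * pi < Im w} \<inter> {w. Im w < 0})"
      by (intro open_Int open_halfspace_Im_gt open_halfspace_Im_lt)
    have "Complex 0 (- pi) \<in> {w. - 2 * pi < Im w} \<inter> {w. Im w < 0}" by simp
    then show "{w. - 2 * pi < Im w} \<inter> {w. Im w < 0} \<noteq> {}" by blast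
    fix w assume w: "w \<in> {w. - 2 * pi < Im w} \<inter> {w. Im w < 0}"
    have k: "cnj (gwt a b (of_real v) * lker (cnj w - ?p - of_real v)) = gwt a b (of_real v) * lker (w - of_real v)" for v
    proof -
      have "lker (cnj w - ?p - of_real v) = lker (cnj w - of_real v)"
        using lker_shift_period[of "cnj w - of_real v"] by (simp add: algebra_simps)
      then show ?thesis by (simp add: gwt_of_real lker_def exp_cnj)
    qed
    have "?E w = cnj (lcauchy (gwt a b) (cnj w - ?p))" using w by (subst gterm_eq_lcauchy[OF ab]) auto
    also have "\<dots> = lcauchy (gwt a b) w"
      unfolding lcauchy_def Bochner_Integration.integral_cnj[symmetric] k ..
    also have "\<dots> = gterm a b w" using w by (subst gterm_eq_lcauchy[OF ab]) auto
    finally show "?E w = gterm a b w" .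
  qed (use hE gterm_holomorphic in auto)
  then show ?thesis by (metis complex_cnj_cnj)
qed

text \<open>Source of the second expansion. The minus sign is that of the conjugate of 2 pi i and
  becomes the factor (-1)^k_j in the sum.\<close>

lemma tau_reflect:
  assumes ab: "a > 0" "b > 0"
  shows "exp (- 2 * of_real pi * \<i> * of_real b) * tau a b x (- \<theta> - 2 * pi) = - cnj (tau a b x \<theta>)"
proof -
  let ?p = "2 * of_real pi * \<i> :: complex"
  define w where "w = Complex (ln x) \<theta>"
  define e where "e = exp (- 2 * of_real pi * \<i> * complex_of_real b)"
  have w': "Complex (ln x) (- \<theta> - 2 * pi) = cnj w - ?p" by (simp add: w_def complex_eq_iff)
  have "gwt a b (cnj w) = cnj (gwt a b w)" by (simp add: gwt_def exp_cnj)
  then have g: "gwt a b (cnj w - ?p) = e * cnj (gwt a b w)" unfolding gwt_shift_period e_def by simp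
  have "e \<noteq> 0" "cnj (gwt a b w) \<noteq> 0" by (simp_all add: e_def gwt_nonzero)
  then have "e * (cnj (gterm a b w) / (?p * (e * cnj (gwt a b w)))) = cnj (gterm a b w) / (?p * cnj (gwt a b w))"
    by simp
  then show ?thesis
    unfolding tau_def w' gterm_cnj[OF ab] g w_def[symmetric] e_def[symmetric] by simp
qed

text \<open>Weighted homogeneity: the j-th power sum is (2 pi i f)^j times the j-th normalised
  transform, so the common factor leaves with exponent k.\<close>

lemma sfun_eq_hsum_tau:
  "sfun b k (Complex (ln x) \<theta>) = (2 * of_real pi * \<i> * gwt 1 b (Complex (ln x) \<theta>)) ^ k * hsum (\<lambda>j. tau (real j) (real j * b) x \<theta>) k"
proof -
  let ?w = "Complex (ln x) \<theta>"
  let ?p = "2 * of_real pi * \<i> :: complex"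
  have "(2 * of_real pi * \<i>) ^ (j - 1) * gterm (real j) (real j * b) ?w = (?p * gwt 1 b ?w) ^ j * tau (real j) (real j * b) x \<theta>" if "1 \<le> j" for j
  proof -
    have "?p ^ j = ?p ^ (j - 1) * ?p" using that by (metis power_minus_mult less_le_trans zero_less_one)
    then show ?thesis unfolding tau_def power_mult_distrib gwt_power by (simp add: gwt_nonzero)
  qed
  then have "sfun b k ?w = hsum (\<lambda>j. (?p * gwt 1 b ?w) ^ j * tau (real j) (real j * b) x \<theta>) k"
    unfolding sfun_def by (intro hsum_cong) simp
  then show ?thesis unfolding hsum_scale .
qed

lemma jfun_expansion:
  "exp (of_nat n * w) * jfun n b m w = sfun b m w
    + (\<Sum>i<n. exp (of_nat i * w) * (\<Sum>k<m. kap b (jfun i b) (m - Suc k) * sfun b k w))"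
proof (induction n)
  case (Suc n)
  have "exp (of_nat (Suc n) * w) * jfun (Suc n) b m w
    = (exp (of_nat (Suc n) * w) * exp (- w)) * (jfun n b m w + (\<Sum>k<m. kap b (jfun n b) (m - Suc k) * sfun b k w))"
    by (simp add: mult.assoc)
  also have "exp (of_nat (Suc n) * w) * exp (- w) = exp (of_nat n * w)"
    unfolding exp_add[symmetric] by (rule arg_cong[of _ _ exp]) (simp add: algebra_simps)
  finally show ?case using Suc by (simp add: distrib_left)
qed simp

lemma norm_integral_le_integral:
  fixes F :: "real \<Rightarrow> complex"
  assumes "integrable lborel G" "\<And>v. norm (F v) \<le> G v"
  shows "norm (\<integral>v. F v \<partial>lborel) \<le> (\<integral>v. G v \<partial>lborel)"
proof -
  have "norm (\<integral>v. F v \<partial>lborel) \<le> (\<integral>v. norm (F v) \<partial>lborel)" by (rule integral_norm_bound)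
  also have "\<dots> \<le> (\<integral>v. G v \<partial>lborel)"
    by (rule integral_mono'[OF assms]) (rule order_trans[OF norm_ge_zero assms(2)])
  finally show ?thesis .
qed

lemma sin_ge_half:
  fixes s :: real assumes "0 < s" "s \<le> 1" shows "s / 2 \<le> sin s"
proof -
  have "sin 0 - 0 / 2 \<le> sin s - s / 2"
  proof (rule DERIV_nonneg_imp_nondecreasing[of 0 s "\<lambda>t. sin t - t / 2"])
    show "0 \<le> s" using assms by simp
    fix t assume t: "0 \<le> t" "t \<le> s"
    have "cos (pi / 3) \<le> cos t" using t assms pi_gt3 by (intro cos_monotone_0_pi_le) auto
    then have "0 \<le> cos t - 1 / 2" unfolding cos_60 by simp
    moreover have "((\<lambda>t. sin t - t / 2) has_real_derivative (cos t - 1 / 2)) (at t)"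
      by (auto intro!: derivative_eq_intros)
    ultimately show "\<exists>y. ((\<lambda>t. sin t - t / 2) has_real_derivative y) (at t) \<and> 0 \<le> y" by blast
  qed
  then show ?thesis by simp
qed

subsection \<open>Estimates for large \<open>|\<sigma>z|\<close>\<close>

text \<open>The value of the weight at ln x, close to its maximum at ln b because b - x stays
  bounded.\<close>

definition gpeak :: "real \<Rightarrow> real \<Rightarrow> real" where
  "gpeak b x = exp (b * ln x - x)"

lemma gpeak_pos [simp]: "gpeak b x > 0" by (simp add: gpeak_def)

text \<open>Collects what holds beyond one threshold X with one constant C0, uniformly in b, j and
  i, so that the inductions below never have to adjust thresholds.\<close>

locale large_modulus =
  fixes m n :: nat and R \<delta> X C0 :: real
  assumes X: "1 \<le> X" and C0: "0 \<le> C0"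
    and b_gt: "\<And>x b. X \<le> x \<Longrightarrow> \<bar>b - x\<bar> \<le> R \<Longrightarrow> real n < b"
    and b_le: "\<And>x b. X \<le> x \<Longrightarrow> \<bar>b - x\<bar> \<le> R \<Longrightarrow> b \<le> 2 * x"
    and gmass_le: "\<And>x b j. X \<le> x \<Longrightarrow> \<bar>b - x\<bar> \<le> R \<Longrightarrow> 1 \<le> j \<Longrightarrow> j \<le> m \<Longrightarrow>
        gmass (real j) (real j * b) \<le> C0 / sqrt x * gpeak b x ^ j"
    and gmass_diff_le: "\<And>x b i. X \<le> x \<Longrightarrow> \<bar>b - x\<bar> \<le> R \<Longrightarrow> i \<le> n \<Longrightarrow>
        gmass 1 (b - real i) \<le> C0 / sqrt x * gpeak b x / x ^ i"
    and tau_psi: "\<And>x b j \<theta>. X \<le> x \<Longrightarrow> \<bar>b - x\<bar> \<le> R \<Longrightarrow> 1 \<le> j \<Longrightarrow> j \<le> m \<Longrightarrow>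
        - 2 * pi + \<delta> \<le> \<theta> \<Longrightarrow> \<theta> \<le> 2 * pi - \<delta> \<Longrightarrow>
        norm (tau (real j) (real j * b) x \<theta> - psi (real j * x) \<theta>) \<le> C0 / sqrt x * exp (- x * (1 - cos \<theta>)) ^ j"
begin

lemma b_pos: "X \<le> x \<Longrightarrow> \<bar>b - x\<bar> \<le> R \<Longrightarrow> 0 < b"
  using b_gt[of x b] of_nat_0_le_iff[of n, where ?'a=real] by linarith

lemma sfun_real_bound:
  obtains C where "C \<ge> 0" "\<And>x b v k. X \<le> x \<Longrightarrow> \<bar>b - x\<bar> \<le> R \<Longrightarrow> k \<le> m \<Longrightarrow>
    norm (sfun b k (of_real v)) \<le> C * gpeak b x ^ k"
proof -
  define D where "D = (2 * pi) ^ m * (C0 * (2 + 2 * real m))"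
  have D0: "D \<ge> 0" unfolding D_def using C0 by simp
  have p: "norm ((2 * of_real pi * \<i>) ^ (j - 1) * gterm (real j) (real j * b) (of_real v)) \<le> D * gpeak b x ^ j"
    if x: "X \<le> x" and b: "\<bar>b - x\<bar> \<le> R" and j: "1 \<le> j" "j \<le> m" for x b j v
  proof -
    have x1: "1 \<le> x" using x X by linarith
    \<comment> \<open>Both terms of the strip estimate are then of order sqrt x times the mass, and
      this sqrt x cancels the 1/sqrt x in the bound of the mass: on the cut itself a transform is no
      larger than the peak to the power j.\<close>
    define s where "s = 1 / sqrt x"
    have sx: "sqrt x \<ge> 1" using x1 by simp
    have s: "0 < s" "s \<le> 1" using sx by (auto simp: s_def)
    have bp: "0 < b" by (rule b_pos[OF x b])
    have jb: "real j > 0" "real j * b > 0" using j bp by auto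
    define M where "M = gmass (real j) (real j * b)"
    have M: "0 < M" "M \<le> C0 / sqrt x * gpeak b x ^ j" unfolding M_def by (rule gmass_pos[OF jb], rule gmass_le[OF x b j])
    have "norm (gterm (real j) (real j * b) (of_real v)) \<le> M / sin s + s * (real j * b * M)"
      unfolding M_def using norm_gterm_le_strip(1)[OF jb _ _ s, of "of_real v"] by simp
    also have "\<dots> \<le> M * (2 * sqrt x) + M * (2 * real m * sqrt x)"
    proof (rule add_mono)
      have "M / sin s \<le> M / (s / 2)" using sin_ge_half[OF s] s M by (intro divide_left_mono) auto
      then show "M / sin s \<le> M * (2 * sqrt x)" by (simp add: s_def mult.commute)
      have "real j * b \<le> real m * (2 * x)" using j b_le[OF x b] bp by (intro mult_mono) auto
      then have "s * (real j * b) \<le> s * (real m * (2 * x))" using s by (intro mult_left_mono) auto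
      also have "\<dots> = 2 * real m * (x / sqrt x)" by (simp add: s_def)
      also have "x / sqrt x = sqrt x" using x1 by (simp add: real_div_sqrt)
      finally have "M * (s * (real j * b)) \<le> M * (2 * real m * sqrt x)" using M by (intro mult_left_mono) auto
      then show "s * (real j * b * M) \<le> M * (2 * real m * sqrt x)" by (simp add: mult.commute mult.left_commute)
    qed
    also have "\<dots> = M * ((2 + 2 * real m) * sqrt x)" by (simp add: algebra_simps)
    also have "\<dots> \<le> (C0 / sqrt x * gpeak b x ^ j) * ((2 + 2 * real m) * sqrt x)"
      using M sx by (intro mult_right_mono) auto
    also have "\<dots> = C0 * (2 + 2 * real m) * gpeak b x ^ j" using sx by simp
    finally have 1: "norm (gterm (real j) (real j * b) (of_real v)) \<le> C0 * (2 + 2 * real m) * gpeak b x ^ j" .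
    have "norm ((2 * of_real pi * \<i>) ^ (j - 1) :: complex) = (2 * pi) ^ (j - 1)" unfolding norm_power by (simp add: norm_mult)
    also have "\<dots> \<le> (2 * pi) ^ m" using j pi_gt3 by (intro power_increasing) auto
    finally have "norm ((2 * of_real pi * \<i>) ^ (j - 1) :: complex) * norm (gterm (real j) (real j * b) (of_real v))
       \<le> (2 * pi) ^ m * (C0 * (2 + 2 * real m) * gpeak b x ^ j)"
      using 1 by (intro mult_mono) auto
    then show ?thesis unfolding norm_mult D_def by (simp only: mult.assoc)
  qed
  have "\<exists>C\<ge>0. \<forall>(p :: nat \<Rightarrow> complex) Q. Q \<ge> 0 \<longrightarrow> (\<forall>j. 1 \<le> j \<longrightarrow> j \<le> k \<longrightarrow> norm (p j) \<le> D * Q ^ j) \<longrightarrow> norm (hsum p k) \<le> C * Q ^ k" for k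
    using hsum_bound[OF D0, of k] by metis
  then obtain C where C: "\<And>k. C k \<ge> (0::real)"
    "\<And>k (p :: nat \<Rightarrow> complex) Q. Q \<ge> 0 \<Longrightarrow> (\<And>j. 1 \<le> j \<Longrightarrow> j \<le> k \<Longrightarrow> norm (p j) \<le> D * Q ^ j) \<Longrightarrow> norm (hsum p k) \<le> C k * Q ^ k"
    by metis
  show ?thesis
  proof (rule that[of "\<Sum>k\<le>m. C k"])
    show "0 \<le> (\<Sum>k\<le>m. C k)" using C(1) by (intro sum_nonneg) auto
    fix x b v k assume x: "X \<le> x" and b: "\<bar>b - x\<bar> \<le> R" and k: "k \<le> m"
    have "norm (sfun b k (of_real v)) \<le> C k * gpeak b x ^ k"
      unfolding sfun_def by (rule C(2)) (use p[OF x b] k less_imp_le[OF gpeak_pos] in auto)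
    also have "\<dots> \<le> (\<Sum>k\<le>m. C k) * gpeak b x ^ k"
      using k C(1) less_imp_le[OF gpeak_pos] by (intro mult_right_mono member_le_sum) auto
    finally show "norm (sfun b k (of_real v)) \<le> (\<Sum>k\<le>m. C k) * gpeak b x ^ k" .
  qed
qed

text \<open>The factor exp (- i v) lowers \<open>b\<close> by i, which divides the bound of the mass
  by x^i. Growth like (x exp (- v))^i is thus harmless, as the weight is concentrated near exp v =
  x.\<close>

lemma integral_weight:
  assumes x: "X \<le> x" and b: "\<bar>b - x\<bar> \<le> R" and i: "i \<le> n" and AB: "0 \<le> A" "0 \<le> B"
  shows "integrable lborel (\<lambda>v. exp (- exp v + b * v) * (A + B * (x * exp (- v)) ^ i))"
    "(\<integral>v. exp (- exp v + b * v) * (A + B * (x * exp (- v)) ^ i) \<partial>lborel) \<le> (A + B) * (C0 / sqrt x * gpeak b x)"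
proof -
  have x1: "1 \<le> x" using x X by linarith
  have bp: "0 < b" "0 < b - real i" using b_gt[OF x b] b_pos[OF x b] i by auto
  have pw: "(x * exp (- v)) ^ i = x ^ i * exp (- real i * v)" for v
    by (simp add: power_mult_distrib exp_of_nat_mult[symmetric])
  have e: "exp (- exp v + b * v) * (A + B * (x * exp (- v)) ^ i)
     = A * exp (- 1 * exp v + b * v) + (B * x ^ i) * exp (- 1 * exp v + (b - real i) * v)" for v
    unfolding pw by (simp add: algebra_simps flip: exp_add)
  have i1: "integrable lborel (\<lambda>v. A * exp (- 1 * exp v + b * v))"
    and i2: "integrable lborel (\<lambda>v. (B * x ^ i) * exp (- 1 * exp v + (b - real i) * v))"
    by (intro integrable_mult_right integrable_gwt_real bp; simp)+
  show "integrable lborel (\<lambda>v. exp (- exp v + b * v) * (A + B * (x * exp (- v)) ^ i))"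
    unfolding e by (rule Bochner_Integration.integrable_add[OF i1 i2])
  have "(\<integral>v. exp (- exp v + b * v) * (A + B * (x * exp (- v)) ^ i) \<partial>lborel) = A * gmass 1 b + (B * x ^ i) * gmass 1 (b - real i)"
    unfolding e Bochner_Integration.integral_add[OF i1 i2] integral_mult_right_zero gmass_def ..
  also have "\<dots> \<le> A * (C0 / sqrt x * gpeak b x) + (B * x ^ i) * (C0 / sqrt x * gpeak b x / x ^ i)"
    using gmass_diff_le[OF x b, of 0] gmass_diff_le[OF x b i] AB x1 by (intro add_mono mult_left_mono) auto
  also have "(B * x ^ i) * (C0 / sqrt x * gpeak b x / x ^ i) = B * (C0 / sqrt x * gpeak b x)" using x1 by simp
  finally show "(\<integral>v. exp (- exp v + b * v) * (A + B * (x * exp (- v)) ^ i) \<partial>lborel) \<le> (A + B) * (C0 / sqrt x * gpeak b x)"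
    by (simp only: distrib_right)
qed

text \<open>The outer integral against the weight has mass of order peak / sqrt x, so every constant
  gains 1/sqrt x over its integrand. This puts all terms produced by n > 0 into the error.\<close>

lemma kap_step:
  assumes i: "i \<le> n" and C: "C \<ge> 0"
    and J: "\<And>x b v j. X \<le> x \<Longrightarrow> \<bar>b - x\<bar> \<le> R \<Longrightarrow> j \<le> m \<Longrightarrow>
       norm (jfun i b j (of_real v)) \<le> C * gpeak b x ^ j / x ^ i * (1 + (x * exp (- v)) ^ i)"
  shows "\<exists>K\<ge>0. \<forall>x b j. X \<le> x \<longrightarrow> \<bar>b - x\<bar> \<le> R \<longrightarrow> j \<le> m \<longrightarrow>
      norm (kap b (jfun i b) j) \<le> K * gpeak b x ^ Suc j / (sqrt x * x ^ i)"
proof -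
  obtain S where S: "S \<ge> 0" "\<And>x b v k. X \<le> x \<Longrightarrow> \<bar>b - x\<bar> \<le> R \<Longrightarrow> k \<le> m \<Longrightarrow>
    norm (sfun b k (of_real v)) \<le> S * gpeak b x ^ k" using sfun_real_bound by metis
  have one: "\<exists>K\<ge>0. \<forall>x b. X \<le> x \<longrightarrow> \<bar>b - x\<bar> \<le> R \<longrightarrow> j \<le> m \<longrightarrow>
      norm (kap b (jfun i b) j) \<le> K * gpeak b x ^ Suc j / (sqrt x * x ^ i)" for j
  proof (induction j rule: less_induct)
    case (less j)
    have "\<forall>l. \<exists>K\<ge>0. l < j \<longrightarrow> (\<forall>x b. X \<le> x \<longrightarrow> \<bar>b - x\<bar> \<le> R \<longrightarrow> l \<le> m \<longrightarrow>
      norm (kap b (jfun i b) l) \<le> K * gpeak b x ^ Suc l / (sqrt x * x ^ i))"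
      using less by (metis order_refl)
    then obtain K where K: "\<And>l. K l \<ge> 0"
      "\<And>l x b. l < j \<Longrightarrow> X \<le> x \<Longrightarrow> \<bar>b - x\<bar> \<le> R \<Longrightarrow> l \<le> m \<Longrightarrow>
        norm (kap b (jfun i b) l) \<le> K l * gpeak b x ^ Suc l / (sqrt x * x ^ i)" by metis
    define T where "T = (\<Sum>k<j. K (j - Suc k) * S)"
    have T0: "T \<ge> 0" unfolding T_def using K(1) S(1) by (intro sum_nonneg mult_nonneg_nonneg) auto
    show ?case
    proof (intro exI[of _ "(C + T + C) * C0"] conjI allI impI)
      show "0 \<le> (C + T + C) * C0" using C T0 C0 by simp
      fix x b assume x: "X \<le> x" and b: "\<bar>b - x\<bar> \<le> R" and j: "j \<le> m"
      have x1: "1 \<le> x" using x X by linarith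
      have sx: "1 \<le> sqrt x" using x1 by simp
      define f where "f = gpeak b x"
      have f: "f > 0" by (simp add: f_def)
      define A where "A = f ^ j / x ^ i"
      have A: "A > 0" using f x1 by (simp add: A_def)
      have sm: "norm (\<Sum>k<j. kap b (jfun i b) (j - Suc k) * sfun b k (of_real v)) \<le> T * A" for v
        unfolding T_def sum_distrib_right
      proof (rule sum_norm_le)
        fix k assume k: "k \<in> {..<j}"
        have "norm (kap b (jfun i b) (j - Suc k)) \<le> K (j - Suc k) * f ^ Suc (j - Suc k) / (sqrt x * x ^ i)"
          unfolding f_def using k j x b by (intro K(2)) auto
        \<comment> \<open>The 1/sqrt x of the earlier constants is given up here; the integration
          that follows supplies a new one.\<close>
        also have "\<dots> \<le> K (j - Suc k) * f ^ Suc (j - Suc k) / (1 * x ^ i)"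
          using x1 sx f K(1) by (intro divide_left_mono mult_right_mono mult_nonneg_nonneg) auto
        finally have "norm (kap b (jfun i b) (j - Suc k) * sfun b k (of_real v))
           \<le> (K (j - Suc k) * f ^ Suc (j - Suc k) / (1 * x ^ i)) * (S * f ^ k)"
          unfolding norm_mult using S(2)[OF x b, of k v, folded f_def] k j K(1) x1 f
          by (intro mult_mono divide_nonneg_nonneg mult_nonneg_nonneg zero_le_power) auto
        also have "\<dots> = K (j - Suc k) * S * ((f ^ Suc (j - Suc k) * f ^ k) / x ^ i)" by simp
        also have "f ^ Suc (j - Suc k) * f ^ k = f ^ j" unfolding power_add[symmetric] using k by simp
        finally show "norm (kap b (jfun i b) (j - Suc k) * sfun b k (of_real v)) \<le> K (j - Suc k) * S * A"
          unfolding A_def .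
      qed
      let ?F = "\<lambda>v. gwt 1 b (of_real v) * (jfun i b j (of_real v) + (\<Sum>k<j. kap b (jfun i b) (j - Suc k) * sfun b k (of_real v)))"
      have AB: "0 \<le> (C + T) * A" "0 \<le> C * A" using C T0 A by auto
      have "norm (kap b (jfun i b) j) \<le> (\<integral>v. exp (- exp v + b * v) * ((C + T) * A + (C * A) * (x * exp (- v)) ^ i) \<partial>lborel)"
        unfolding kap_eq[of b "jfun i b" j]
      proof (rule norm_integral_le_integral[OF integral_weight(1)[OF x b i AB]])
        fix v
        have "norm (jfun i b j (of_real v)) \<le> C * A * (1 + (x * exp (- v)) ^ i)"
          using J[OF x b j, of v] unfolding A_def f_def by simp
        then have "norm (jfun i b j (of_real v) + (\<Sum>k<j. kap b (jfun i b) (j - Suc k) * sfun b k (of_real v)))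
            \<le> C * A * (1 + (x * exp (- v)) ^ i) + T * A"
          using sm[of v] by (rule norm_triangle_mono)
        also have "\<dots> = (C + T) * A + (C * A) * (x * exp (- v)) ^ i" by (simp add: algebra_simps)
        finally show "norm (?F v) \<le> exp (- exp v + b * v) * ((C + T) * A + (C * A) * (x * exp (- v)) ^ i)"
          unfolding norm_mult by (intro mult_mono) (auto simp: gwt_of_real)
      qed
      also have "\<dots> \<le> ((C + T) * A + C * A) * (C0 / sqrt x * gpeak b x)" by (rule integral_weight(2)[OF x b i AB])
      also have "\<dots> = (C + T + C) * C0 * gpeak b x ^ Suc j / (sqrt x * x ^ i)"
        unfolding A_def f_def by (simp add: algebra_simps add_divide_distrib)
      finally show "norm (kap b (jfun i b) j) \<le> (C + T + C) * C0 * gpeak b x ^ Suc j / (sqrt x * x ^ i)" .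
    qed
  qed
  then obtain K where K: "\<And>j. K j \<ge> 0" "\<And>j x b. X \<le> x \<Longrightarrow> \<bar>b - x\<bar> \<le> R \<Longrightarrow> j \<le> m \<Longrightarrow>
      norm (kap b (jfun i b) j) \<le> K j * gpeak b x ^ Suc j / (sqrt x * x ^ i)" by metis
  show ?thesis
  proof (intro exI[of _ "\<Sum>j\<le>m. K j"] conjI allI impI)
    show "0 \<le> (\<Sum>j\<le>m. K j)" using K(1) by (intro sum_nonneg) auto
    fix x b j assume x: "X \<le> x" and b: "\<bar>b - x\<bar> \<le> R" and j: "j \<le> m"
    have "0 \<le> x" using x X by linarith
    note K(2)[OF x b j]
    also have "K j * gpeak b x ^ Suc j / (sqrt x * x ^ i) \<le> (\<Sum>j\<le>m. K j) * gpeak b x ^ Suc j / (sqrt x * x ^ i)"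
      using j K(1) \<open>0 \<le> x\<close> less_imp_le[OF gpeak_pos[of b x]]
      by (intro divide_right_mono mult_right_mono member_le_sum) auto
    finally show "norm (kap b (jfun i b) j) \<le> (\<Sum>j\<le>m. K j) * gpeak b x ^ Suc j / (sqrt x * x ^ i)" .
  qed
qed

text \<open>Writing exp (- v) as (x exp (- v)) / x, each lowering gains 1/x near the peak exp v = x;
  the factor in parentheses records the growth as v tends to minus infinity. The step needs the
  constants of the previous level, hence the interplay with \<open>kap_step\<close>.\<close>

lemma jfun_real_bound:
  "i \<le> n \<Longrightarrow> \<exists>C\<ge>0. \<forall>x b v j. X \<le> x \<longrightarrow> \<bar>b - x\<bar> \<le> R \<longrightarrow> j \<le> m \<longrightarrow>
       norm (jfun i b j (of_real v)) \<le> C * gpeak b x ^ j / x ^ i * (1 + (x * exp (- v)) ^ i)"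
proof (induction i)
  case 0
  obtain S where S: "S \<ge> 0" "\<And>x b v k. X \<le> x \<Longrightarrow> \<bar>b - x\<bar> \<le> R \<Longrightarrow> k \<le> m \<Longrightarrow>
    norm (sfun b k (of_real v)) \<le> S * gpeak b x ^ k" using sfun_real_bound by metis
  show ?case
  proof (intro exI[of _ S] conjI S(1) allI impI)
    fix x b v j assume h: "X \<le> x" "\<bar>b - x\<bar> \<le> R" "j \<le> m"
    have "0 \<le> S * gpeak b x ^ j" using S(1) less_imp_le[OF gpeak_pos[of b x]] by simp
    then show "norm (jfun 0 b j (of_real v)) \<le> S * gpeak b x ^ j / x ^ 0 * (1 + (x * exp (- v)) ^ 0)"
      using S(2)[OF h, of v] by simp
  qed
next
  case (Suc i)
  obtain S where S: "S \<ge> 0" "\<And>x b v k. X \<le> x \<Longrightarrow> \<bar>b - x\<bar> \<le> R \<Longrightarrow> k \<le> m \<Longrightarrow>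
    norm (sfun b k (of_real v)) \<le> S * gpeak b x ^ k" using sfun_real_bound by metis
  obtain C where C: "C \<ge> 0" "\<And>x b v j. X \<le> x \<Longrightarrow> \<bar>b - x\<bar> \<le> R \<Longrightarrow> j \<le> m \<Longrightarrow>
       norm (jfun i b j (of_real v)) \<le> C * gpeak b x ^ j / x ^ i * (1 + (x * exp (- v)) ^ i)"
    using Suc by (metis Suc_leD)
  obtain K where K: "K \<ge> 0" "\<And>x b j. X \<le> x \<Longrightarrow> \<bar>b - x\<bar> \<le> R \<Longrightarrow> j \<le> m \<Longrightarrow>
      norm (kap b (jfun i b) j) \<le> K * gpeak b x ^ Suc j / (sqrt x * x ^ i)"
    using kap_step[OF _ C] Suc.prems by (metis Suc_leD)
  show ?case
  proof (intro exI[of _ "2 * C + real m * (K * S)"] conjI allI impI)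
    show "0 \<le> 2 * C + real m * (K * S)" using C(1) K(1) S(1) by simp
    fix x b v j assume x: "X \<le> x" and b: "\<bar>b - x\<bar> \<le> R" and j: "j \<le> m"
    have x1: "1 \<le> x" using x X by linarith
    have sx: "1 \<le> sqrt x" using x1 by simp
    define f where "f = gpeak b x"
    have f: "f > 0" by (simp add: f_def)
    define A where "A = f ^ j / x ^ i"
    have A: "A > 0" using f x1 by (simp add: A_def)
    define t where "t = x * exp (- v)"
    have t: "t > 0" using x1 by (simp add: t_def)
    have "norm (\<Sum>k<j. kap b (jfun i b) (j - Suc k) * sfun b k (of_real v)) \<le> (\<Sum>k<j. K * S * A)"
    proof (rule sum_norm_le)
      fix k assume k: "k \<in> {..<j}"
      have "norm (kap b (jfun i b) (j - Suc k)) \<le> K * f ^ Suc (j - Suc k) / (sqrt x * x ^ i)"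
        unfolding f_def using k j x b by (intro K(2)) auto
      also have "\<dots> \<le> K * f ^ Suc (j - Suc k) / (1 * x ^ i)"
        using x1 sx f K(1) by (intro divide_left_mono mult_right_mono mult_nonneg_nonneg) auto
      finally have "norm (kap b (jfun i b) (j - Suc k) * sfun b k (of_real v))
         \<le> (K * f ^ Suc (j - Suc k) / (1 * x ^ i)) * (S * f ^ k)"
        unfolding norm_mult using S(2)[OF x b, of k v, folded f_def] k j K(1) x1 f
          by (intro mult_mono divide_nonneg_nonneg mult_nonneg_nonneg zero_le_power) auto
      also have "\<dots> = K * S * ((f ^ Suc (j - Suc k) * f ^ k) / x ^ i)" by simp
      also have "f ^ Suc (j - Suc k) * f ^ k = f ^ j" unfolding power_add[symmetric] using k by simp
      finally show "norm (kap b (jfun i b) (j - Suc k) * sfun b k (of_real v)) \<le> K * S * A"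
        unfolding A_def .
    qed
    also have "\<dots> = real j * (K * S * A)" by simp
    also have "\<dots> \<le> real m * (K * S * A)" using j K(1) S(1) A by (intro mult_right_mono) auto
    finally have sm: "norm (\<Sum>k<j. kap b (jfun i b) (j - Suc k) * sfun b k (of_real v)) \<le> real m * (K * S * A)" .
    have jb: "norm (jfun i b j (of_real v)) \<le> C * A * (1 + t ^ i)"
      using C(2)[OF x b j, of v] unfolding A_def f_def t_def by simp
    have w: "t * (1 + t ^ i) \<le> 2 * (1 + t ^ Suc i)" "t \<le> 1 + t ^ Suc i"
    proof -
      show *: "t \<le> 1 + t ^ Suc i"
      proof (cases "t \<le> 1")
        case True
        then show ?thesis using zero_less_power[OF t, of "Suc i"] by linarith
      next
        case False
        then show ?thesis using self_le_power[of t "Suc i"] by linarith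
      qed
      then show "t * (1 + t ^ i) \<le> 2 * (1 + t ^ Suc i)" using t by (simp add: distrib_left)
    qed
    have "norm (jfun (Suc i) b j (of_real v)) = exp (- v) * norm (jfun i b j (of_real v) + (\<Sum>k<j. kap b (jfun i b) (j - Suc k) * sfun b k (of_real v)))"
      by (simp add: norm_mult)
    also have "\<dots> \<le> exp (- v) * (C * A * (1 + t ^ i) + real m * (K * S * A))"
      by (intro mult_left_mono norm_triangle_mono jb sm) simp
    also have "exp (- v) = t / x" using x1 by (simp add: t_def)
    also have "t / x * (C * A * (1 + t ^ i) + real m * (K * S * A)) = A / x * (C * (t * (1 + t ^ i)) + real m * (K * S) * t)"
      by (simp add: algebra_simps add_divide_distrib)
    also have "\<dots> \<le> A / x * (C * (2 * (1 + t ^ Suc i)) + real m * (K * S) * (1 + t ^ Suc i))"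
      using w A x1 C(1) K(1) S(1) by (intro mult_left_mono add_mono) auto
    also have "\<dots> = (2 * C + real m * (K * S)) * (A / x) * (1 + t ^ Suc i)" by (simp only: distrib_left distrib_right mult.assoc mult.commute mult.left_commute)
    also have "A / x = f ^ j / x ^ Suc i" by (simp add: A_def)
    finally show "norm (jfun (Suc i) b j (of_real v)) \<le> (2 * C + real m * (K * S)) * gpeak b x ^ j / x ^ Suc i * (1 + (x * exp (- v)) ^ Suc i)"
      unfolding f_def t_def by (simp only: times_divide_eq_right)
  qed
qed

lemma kap_bound:
  obtains K where "K \<ge> 0" "\<And>i x b j. i < n \<Longrightarrow> X \<le> x \<Longrightarrow> \<bar>b - x\<bar> \<le> R \<Longrightarrow> j \<le> m \<Longrightarrow>
      norm (kap b (jfun i b) j) \<le> K * gpeak b x ^ Suc j / (sqrt x * x ^ i)"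
proof -
  have "\<exists>K\<ge>0. i < n \<longrightarrow> (\<forall>x b j. X \<le> x \<longrightarrow> \<bar>b - x\<bar> \<le> R \<longrightarrow> j \<le> m \<longrightarrow>
      norm (kap b (jfun i b) j) \<le> K * gpeak b x ^ Suc j / (sqrt x * x ^ i))" for i
  proof (cases "i < n")
    case True
    then have "i \<le> n" by simp
    then obtain C where C: "C \<ge> 0" "\<And>x b v j. X \<le> x \<Longrightarrow> \<bar>b - x\<bar> \<le> R \<Longrightarrow> j \<le> m \<Longrightarrow>
       norm (jfun i b j (of_real v)) \<le> C * gpeak b x ^ j / x ^ i * (1 + (x * exp (- v)) ^ i)"
      using jfun_real_bound by metis
    show ?thesis using kap_step[OF \<open>i \<le> n\<close> C] by blast
  qed (auto intro: exI[of _ 0])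
  then obtain K where K: "\<And>i. K i \<ge> (0::real)" "\<And>i x b j. i < n \<Longrightarrow> X \<le> x \<Longrightarrow> \<bar>b - x\<bar> \<le> R \<Longrightarrow> j \<le> m \<Longrightarrow>
      norm (kap b (jfun i b) j) \<le> K i * gpeak b x ^ Suc j / (sqrt x * x ^ i)" by metis
  show ?thesis
  proof (rule that[of "\<Sum>i<n. K i"])
    show "0 \<le> (\<Sum>i<n. K i)" using K(1) by (intro sum_nonneg) auto
    fix i x b j assume i: "i < n" and x: "X \<le> x" and b: "\<bar>b - x\<bar> \<le> R" and j: "j \<le> m"
    have "0 \<le> x" using x X by linarith
    note K(2)[OF i x b j]
    also have "K i * gpeak b x ^ Suc j / (sqrt x * x ^ i) \<le> (\<Sum>i<n. K i) * gpeak b x ^ Suc j / (sqrt x * x ^ i)"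
      using i K(1) \<open>0 \<le> x\<close> less_imp_le[OF gpeak_pos[of b x]]
      by (intro divide_right_mono mult_right_mono member_le_sum) auto
    finally show "norm (kap b (jfun i b) j) \<le> (\<Sum>i<n. K i) * gpeak b x ^ Suc j / (sqrt x * x ^ i)" .
  qed
qed

text \<open>At angle theta the weight has modulus peak / q with q = exp (- x (1 - cos theta)). After
  normalisation a term with a shorter chain of length k keeps q^(m - k) / sqrt x, while |exp (i w)|
  = x^i cancels the x^i in the bound of the constants.\<close>

lemma jfun_minus_hsum_tau:
  obtains K where "K \<ge> 0" "\<And>x b \<theta>. X \<le> x \<Longrightarrow> \<bar>b - x\<bar> \<le> R \<Longrightarrow>
    norm (exp (of_nat n * Complex (ln x) \<theta>) * jfun n b m (Complex (ln x) \<theta>) / (2 * of_real pi * \<i> * gwt 1 b (Complex (ln x) \<theta>)) ^ m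
       - hsum (\<lambda>j. tau (real j) (real j * b) x \<theta>) m)
     \<le> K / sqrt x * (\<Sum>k<m. exp (- x * (1 - cos \<theta>)) ^ (m - k) * norm (hsum (\<lambda>j. tau (real j) (real j * b) x \<theta>) k))"
proof -
  obtain K where K: "K \<ge> 0" "\<And>i x b j. i < n \<Longrightarrow> X \<le> x \<Longrightarrow> \<bar>b - x\<bar> \<le> R \<Longrightarrow> j \<le> m \<Longrightarrow>
      norm (kap b (jfun i b) j) \<le> K * gpeak b x ^ Suc j / (sqrt x * x ^ i)" using kap_bound by metis
  show ?thesis
  proof (rule that[of "real n * K"])
    show "0 \<le> real n * K" using K(1) by simp
    fix x b \<theta> assume x: "X \<le> x" and b: "\<bar>b - x\<bar> \<le> R"
    have x1: "1 \<le> x" using x X by linarith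
    define w where "w = Complex (ln x) \<theta>"
    define h where "h k = hsum (\<lambda>j. tau (real j) (real j * b) x \<theta>) k" for k
    define g where "g = 2 * of_real pi * \<i> * gwt 1 b w"
    define q where "q = exp (- x * (1 - cos \<theta>))"
    have g0: "g \<noteq> 0" by (simp add: g_def gwt_nonzero)
    have q0: "q > 0" by (simp add: q_def)
    have ng: "norm g = 2 * pi * (gpeak b x / q)"
    proof -
      have "norm (gwt 1 b w) = exp (b * ln x - x - - x * (1 - cos \<theta>))"
        unfolding norm_gwt w_def using x1 by (simp add: algebra_simps)
      then show ?thesis unfolding g_def gpeak_def q_def exp_diff[symmetric] by (simp add: norm_mult)
    qed
    have sf: "sfun b k w = g ^ k * h k" for k unfolding w_def g_def h_def by (rule sfun_eq_hsum_tau)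
    have ew: "norm (exp (of_nat i * w)) = x ^ i" for i
      using x1 by (simp add: w_def exp_of_nat_mult norm_power)
    have tm: "norm (exp (of_nat i * w) * (kap b (jfun i b) (m - Suc k) * sfun b k w)) / norm g ^ m \<le> K / sqrt x * (q ^ (m - k) * norm (h k))"
      if i: "i < n" and k: "k < m" for i k
    proof -
      have gm: "norm g ^ m = norm g ^ (m - k) * norm g ^ k" unfolding power_add[symmetric] using k by simp
      have kp: "norm (kap b (jfun i b) (m - Suc k)) \<le> K * gpeak b x ^ (m - k) / (sqrt x * x ^ i)"
      proof -
        have "Suc (m - Suc k) = m - k" using k by simp
        then show ?thesis using K(2)[OF i x b, of "m - Suc k"] k by simp
      qed
      have "gpeak b x / q \<le> norm g" 
        unfolding ng using mult_right_mono[of 1 "2 * pi" "gpeak b x / q"] pi_gt3 q0 less_imp_le[OF gpeak_pos[of b x]] by simp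
      then have g1: "(gpeak b x / q) ^ (m - k) \<le> norm g ^ (m - k)"
        using q0 less_imp_le[OF gpeak_pos[of b x]] by (intro power_mono) auto
      have gq: "gpeak b x ^ (m - k) = q ^ (m - k) * (gpeak b x / q) ^ (m - k)" unfolding power_mult_distrib[symmetric] using q0 by simp
      have "norm (exp (of_nat i * w) * (kap b (jfun i b) (m - Suc k) * sfun b k w)) / norm g ^ m
         = x ^ i * norm (kap b (jfun i b) (m - Suc k)) * norm (h k) / norm g ^ (m - k)"
        unfolding norm_mult sf norm_power ew gm using g0 by simp
      also have "\<dots> \<le> x ^ i * (K * gpeak b x ^ (m - k) / (sqrt x * x ^ i)) * norm (h k) / norm g ^ (m - k)"
        using x1 kp by (intro divide_right_mono mult_right_mono mult_left_mono) auto
      also have "\<dots> = K / sqrt x * norm (h k) * q ^ (m - k) * ((gpeak b x / q) ^ (m - k) / norm g ^ (m - k))"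
        unfolding gq using x1 by simp
      also have "\<dots> \<le> K / sqrt x * norm (h k) * q ^ (m - k) * 1"
        using g1 g0 K(1) q0 x1 by (intro mult_left_mono) auto
      finally show ?thesis by (simp add: mult.commute mult.left_commute)
    qed
    have "exp (of_nat n * w) * jfun n b m w / g ^ m - h m
       = (\<Sum>i<n. \<Sum>k<m. exp (of_nat i * w) * (kap b (jfun i b) (m - Suc k) * sfun b k w)) / g ^ m"
      unfolding jfun_expansion sf[of m] sum_distrib_left using g0 by (simp add: add_divide_distrib)
    also have "norm \<dots> \<le> (\<Sum>i<n. \<Sum>k<m. norm (exp (of_nat i * w) * (kap b (jfun i b) (m - Suc k) * sfun b k w))) / norm g ^ m"
      unfolding norm_divide norm_power by (intro divide_right_mono order_trans[OF norm_sum] sum_mono norm_sum) auto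
    also have "\<dots> \<le> (\<Sum>i<n. \<Sum>k<m. K / sqrt x * (q ^ (m - k) * norm (h k)))"
      unfolding sum_divide_distrib by (intro sum_mono tm) auto
    also have "\<dots> = real n * K / sqrt x * (\<Sum>k<m. q ^ (m - k) * norm (h k))"
      by (simp add: sum_distrib_left mult.assoc)
    finally show "norm (exp (of_nat n * Complex (ln x) \<theta>) * jfun n b m (Complex (ln x) \<theta>) / (2 * of_real pi * \<i> * gwt 1 b (Complex (ln x) \<theta>)) ^ m
       - hsum (\<lambda>j. tau (real j) (real j * b) x \<theta>) m)
     \<le> real n * K / sqrt x * (\<Sum>k<m. exp (- x * (1 - cos \<theta>)) ^ (m - k) * norm (hsum (\<lambda>j. tau (real j) (real j * b) x \<theta>) k))"
      unfolding w_def h_def g_def q_def .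
  qed
qed

end

text \<open>One statement for both sides of the saddle. For theta <= 0 every term of index j has
  size q^j: take Q = q, t = 1. For theta > 0 the terms are merely bounded while their errors are
  O(q): take Q = 1, t = q. Here r is 1/sqrt x.\<close>

lemma hsum_error:
  assumes C0: "C0 \<ge> (0::real)"
  obtains K where "K \<ge> 0" "\<And>(p :: nat \<Rightarrow> complex) s q Q t r. 0 \<le> q \<Longrightarrow> 0 \<le> Q \<Longrightarrow> 0 \<le> t \<Longrightarrow> t \<le> 1 \<Longrightarrow> 0 \<le> r \<Longrightarrow> r \<le> 1 \<Longrightarrow>
     (\<And>k. k < m \<Longrightarrow> q ^ (m - k) * Q ^ k \<le> Q ^ m * t) \<Longrightarrow>
     (\<And>j. 1 \<le> j \<Longrightarrow> j \<le> m \<Longrightarrow> norm (s j) \<le> 3 * Q ^ j) \<Longrightarrow>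
     (\<And>j. 1 \<le> j \<Longrightarrow> j \<le> m \<Longrightarrow> norm (p j - s j) \<le> C0 * r * (Q ^ j * t)) \<Longrightarrow>
     norm (hsum p m - hsum s m) \<le> K * r * (Q ^ m * t) \<and> (\<Sum>k<m. q ^ (m - k) * norm (hsum p k)) \<le> K * (Q ^ m * t)"
proof -
  have C3: "0 \<le> 3 + C0" using C0 by simp
  obtain L where L: "L \<ge> 0"
    "\<And>(p :: nat \<Rightarrow> complex) (q :: nat \<Rightarrow> complex) Q e. Q \<ge> 0 \<Longrightarrow> e \<ge> 0 \<Longrightarrow> (\<And>j. 1 \<le> j \<Longrightarrow> j \<le> m \<Longrightarrow> norm (p j) \<le> (3 + C0) * Q ^ j) \<Longrightarrow>
       (\<And>j. 1 \<le> j \<Longrightarrow> j \<le> m \<Longrightarrow> norm (q j) \<le> (3 + C0) * Q ^ j) \<Longrightarrow>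
       (\<And>j. 1 \<le> j \<Longrightarrow> j \<le> m \<Longrightarrow> norm (p j - q j) \<le> (3 + C0) * Q ^ j * e) \<Longrightarrow>
       norm (hsum p m - hsum q m) \<le> L * Q ^ m * e"
    using hsum_lipschitz[OF C3, of m] by metis
  have "\<exists>C\<ge>0. \<forall>(p :: nat \<Rightarrow> complex) Q. Q \<ge> 0 \<longrightarrow> (\<forall>j. 1 \<le> j \<longrightarrow> j \<le> k \<longrightarrow> norm (p j) \<le> (3 + C0) * Q ^ j) \<longrightarrow> norm (hsum p k) \<le> C * Q ^ k" for k
    using hsum_bound[OF C3, of k] by metis
  then obtain B where B: "\<And>k. B k \<ge> (0::real)"
    "\<And>k (p :: nat \<Rightarrow> complex) Q. Q \<ge> 0 \<Longrightarrow> (\<And>j. 1 \<le> j \<Longrightarrow> j \<le> k \<Longrightarrow> norm (p j) \<le> (3 + C0) * Q ^ j) \<Longrightarrow> norm (hsum p k) \<le> B k * Q ^ k"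
    by metis
  have B0: "0 \<le> (\<Sum>k<m. B k)" using B(1) by (intro sum_nonneg) auto
  show ?thesis
  proof (rule that[of "L + (\<Sum>k<m. B k)"])
    show "0 \<le> L + (\<Sum>k<m. B k)" using L(1) B0 by simp
    fix p s :: "nat \<Rightarrow> complex" and q Q t r :: real
    assume q: "0 \<le> q" and Q: "0 \<le> Q" and t: "0 \<le> t" "t \<le> 1" and r: "0 \<le> r" "r \<le> 1"
      and qQ: "\<And>k. k < m \<Longrightarrow> q ^ (m - k) * Q ^ k \<le> Q ^ m * t"
      and s: "\<And>j. 1 \<le> j \<Longrightarrow> j \<le> m \<Longrightarrow> norm (s j) \<le> 3 * Q ^ j"
      and ps: "\<And>j. 1 \<le> j \<Longrightarrow> j \<le> m \<Longrightarrow> norm (p j - s j) \<le> C0 * r * (Q ^ j * t)"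
    have Qm: "0 \<le> Q ^ j" for j using Q by simp
    have s': "norm (s j) \<le> (3 + C0) * Q ^ j" if "1 \<le> j" "j \<le> m" for j
    proof -
      have "0 \<le> C0 * Q ^ j" using C0 Qm by simp
      then show ?thesis using s[OF that] by (simp add: distrib_right)
    qed
    have p': "norm (p j) \<le> (3 + C0) * Q ^ j" if "1 \<le> j" "j \<le> m" for j
    proof -
      have "r * t \<le> 1" using r t by (simp add: mult_le_one)
      then have "(C0 * Q ^ j) * (r * t) \<le> (C0 * Q ^ j) * 1" using C0 Qm by (intro mult_left_mono) auto
      moreover have "C0 * r * (Q ^ j * t) = (C0 * Q ^ j) * (r * t)" by (simp add: algebra_simps)
      ultimately have "norm (p j - s j) \<le> C0 * Q ^ j" using ps[OF that] by linarith
      then show ?thesis using s[OF that] norm_triangle_sub[of "p j" "s j"] by (simp add: distrib_right)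
    qed
    have "norm (hsum p m - hsum s m) \<le> L * Q ^ m * (r * t)"
    proof (rule L(2)[OF Q _ p' s'])
      show "norm (p j - s j) \<le> (3 + C0) * Q ^ j * (r * t)" if "1 \<le> j" "j \<le> m" for j
      proof -
        have "0 \<le> 3 * (Q ^ j * (r * t))" using Qm r t by simp
        moreover have "(3 + C0) * Q ^ j * (r * t) = 3 * (Q ^ j * (r * t)) + C0 * r * (Q ^ j * t)" by (simp add: algebra_simps)
        ultimately show ?thesis using ps[OF that] by linarith
      qed
    qed (use r t in simp_all)
    also have "L * Q ^ m * (r * t) = L * (r * (Q ^ m * t))" by (simp add: mult.assoc mult.left_commute)
    also have "\<dots> \<le> (L + (\<Sum>k<m. B k)) * (r * (Q ^ m * t))" using B0 r t Qm by (intro mult_right_mono) auto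
    finally have 1: "norm (hsum p m - hsum s m) \<le> (L + (\<Sum>k<m. B k)) * r * (Q ^ m * t)" by (simp only: mult.assoc)
    have "(\<Sum>k<m. q ^ (m - k) * norm (hsum p k)) \<le> (\<Sum>k<m. B k * (Q ^ m * t))"
    proof (rule sum_mono)
      fix k assume k: "k \<in> {..<m}"
      have "norm (hsum p k) \<le> B k * Q ^ k" using k by (intro B(2) Q p') auto
      then have "q ^ (m - k) * norm (hsum p k) \<le> q ^ (m - k) * (B k * Q ^ k)" using q by (intro mult_left_mono) auto
      also have "\<dots> = B k * (q ^ (m - k) * Q ^ k)" by simp
      also have "\<dots> \<le> B k * (Q ^ m * t)" using qQ k B(1) by (intro mult_left_mono) auto
      finally show "q ^ (m - k) * norm (hsum p k) \<le> B k * (Q ^ m * t)" .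
    qed
    also have "\<dots> = (\<Sum>k<m. B k) * (Q ^ m * t)" by (simp only: sum_distrib_right)
    also have "\<dots> \<le> (L + (\<Sum>k<m. B k)) * (Q ^ m * t)" using L(1) t Qm by (intro mult_right_mono) auto
    finally show "norm (hsum p m - hsum s m) \<le> (L + (\<Sum>k<m. B k)) * r * (Q ^ m * t) \<and>
       (\<Sum>k<m. q ^ (m - k) * norm (hsum p k)) \<le> (L + (\<Sum>k<m. B k)) * (Q ^ m * t)" using 1 by simp
  qed
qed

definition normalised_jfun :: "nat \<Rightarrow> nat \<Rightarrow> real \<Rightarrow> real \<Rightarrow> real \<Rightarrow> complex" where
  "normalised_jfun m n b x \<theta> = exp (of_nat n * Complex (ln x) \<theta>) * jfun n b m (Complex (ln x) \<theta>)
      / (2 * of_real pi * \<i> * gwt 1 b (Complex (ln x) \<theta>)) ^ m"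

context large_modulus begin

lemma normalised_jfun_asymptotics:
  obtains K where "\<And>x b \<theta>. X \<le> x \<Longrightarrow> \<bar>b - x\<bar> \<le> R \<Longrightarrow> - 2 * pi + \<delta> \<le> \<theta> \<Longrightarrow> \<theta> \<le> 2 * pi - \<delta> \<Longrightarrow>
      norm (normalised_jfun m n b x \<theta> - hsum (\<lambda>j. psi (real j * x) \<theta>) m)
        \<le> K / sqrt x * (if \<theta> \<le> 0 then exp (- x * (1 - cos \<theta>)) ^ m else exp (- x * (1 - cos \<theta>)))"
    "\<And>x b \<theta>. X \<le> x \<Longrightarrow> \<bar>b - x\<bar> \<le> R \<Longrightarrow> - 2 * pi + \<delta> \<le> \<theta> \<Longrightarrow> \<theta> \<le> 2 * pi - \<delta> \<Longrightarrow>
      norm (exp (- 2 * of_real pi * \<i> * of_real b) ^ m * normalised_jfun m n b x (- \<theta> - 2 * pi) - hsum (\<lambda>j. - cnj (psi (real j * x) \<theta>)) m)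
        \<le> K / sqrt x * (if \<theta> \<le> 0 then exp (- x * (1 - cos \<theta>)) ^ m else exp (- x * (1 - cos \<theta>)))"
proof -
  obtain K where K: "K \<ge> 0" "\<And>(p :: nat \<Rightarrow> complex) s q Q t r. 0 \<le> q \<Longrightarrow> 0 \<le> Q \<Longrightarrow> 0 \<le> t \<Longrightarrow> t \<le> 1 \<Longrightarrow> 0 \<le> r \<Longrightarrow> r \<le> 1 \<Longrightarrow>
     (\<And>k. k < m \<Longrightarrow> q ^ (m - k) * Q ^ k \<le> Q ^ m * t) \<Longrightarrow>
     (\<And>j. 1 \<le> j \<Longrightarrow> j \<le> m \<Longrightarrow> norm (s j) \<le> 3 * Q ^ j) \<Longrightarrow>
     (\<And>j. 1 \<le> j \<Longrightarrow> j \<le> m \<Longrightarrow> norm (p j - s j) \<le> C0 * r * (Q ^ j * t)) \<Longrightarrow>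
     norm (hsum p m - hsum s m) \<le> K * r * (Q ^ m * t) \<and> (\<Sum>k<m. q ^ (m - k) * norm (hsum p k)) \<le> K * (Q ^ m * t)"
    using hsum_error[OF C0, of m] by blast
  obtain L where L: "L \<ge> 0" "\<And>x b \<theta>. X \<le> x \<Longrightarrow> \<bar>b - x\<bar> \<le> R \<Longrightarrow>
    norm (normalised_jfun m n b x \<theta> - hsum (\<lambda>j. tau (real j) (real j * b) x \<theta>) m)
     \<le> L / sqrt x * (\<Sum>k<m. exp (- x * (1 - cos \<theta>)) ^ (m - k) * norm (hsum (\<lambda>j. tau (real j) (real j * b) x \<theta>) k))"
    using jfun_minus_hsum_tau unfolding normalised_jfun_def by blast
  define M where "M = L * K + K"
  \<comment> \<open>Kept abstract in p and s so that it serves \<open>tau\<close> and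
    \<open>psi\<close> as well as their negated conjugates, which have the same moduli.\<close>
  have gen: "norm (a - hsum s m) \<le> M / sqrt x * (if \<theta> \<le> 0 then q ^ m else q)"
    if x: "X \<le> x" and q: "q = exp (- x * (1 - cos \<theta>))"
      and a: "norm (a - hsum p m) \<le> L / sqrt x * (\<Sum>k<m. q ^ (m - k) * norm (hsum p k))"
      and s: "\<And>j. 1 \<le> j \<Longrightarrow> norm (s j) = norm (psi (real j * x) \<theta>)"
      and ps: "\<And>j. 1 \<le> j \<Longrightarrow> j \<le> m \<Longrightarrow> norm (p j - s j) \<le> C0 / sqrt x * q ^ j"
    for a :: complex and p s x \<theta> q
  proof -
    have x1: "1 \<le> x" using x X by linarith
    define r where "r = 1 / sqrt x"
    have r: "0 \<le> r" "r \<le> 1" using x1 by (auto simp: r_def)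
    have q1: "0 < q" "q \<le> 1" using x1 unfolding q by (auto simp: mult_nonneg_nonneg)
    have qj: "exp (- (real j * x) * (1 - cos \<theta>)) = q ^ j" for j
      unfolding q by (simp add: exp_of_nat_mult[symmetric] algebra_simps)
    have qle: "q ^ j \<le> 1" for j using q1 by (intro power_le_one) auto
    have ps': "norm (p j - s j) \<le> C0 * r * q ^ j" if "1 \<le> j" "j \<le> m" for j
      using ps[OF that] by (simp add: r_def)
    define W where "W = (if \<theta> \<le> 0 then q ^ m else q)"
    have "norm (hsum p m - hsum s m) \<le> K * r * W \<and> (\<Sum>k<m. q ^ (m - k) * norm (hsum p k)) \<le> K * W"
    proof (cases "\<theta> \<le> 0")
      case True
      have "norm (hsum p m - hsum s m) \<le> K * r * (q ^ m * 1) \<and> (\<Sum>k<m. q ^ (m - k) * norm (hsum p k)) \<le> K * (q ^ m * 1)"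
      proof (rule K(2))
        show "q ^ (m - k) * q ^ k \<le> q ^ m * 1" if "k < m" for k
          using that unfolding power_add[symmetric] by simp
        show "norm (s j) \<le> 3 * q ^ j" if "1 \<le> j" "j \<le> m" for j
        proof -
          have "norm (s j) \<le> 2 * q ^ j"
            using norm_psi_le(1)[of "real j * x" \<theta>] x1 that True unfolding s[OF that(1)] qj by simp
          then show ?thesis using q1 zero_le_power[of q j] by linarith
        qed
      qed (use q1 r ps' in auto)
      then show ?thesis using True by (simp add: W_def)
    next
      case False
      have "norm (hsum p m - hsum s m) \<le> K * r * (1 ^ m * q) \<and> (\<Sum>k<m. q ^ (m - k) * norm (hsum p k)) \<le> K * (1 ^ m * q)"
      proof (rule K(2))
        have qq: "q ^ j \<le> q" if "1 \<le> j" for j using power_decreasing[of 1 j q] q1 that by simp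
        show "q ^ (m - k) * 1 ^ k \<le> 1 ^ m * q" if "k < m" for k using that qq[of "m - k"] by simp
        show "norm (s j) \<le> 3 * 1 ^ j" if "1 \<le> j" "j \<le> m" for j
        proof -
          have "norm (1 - psi (real j * x) \<theta>) \<le> 2 * q ^ j"
            using norm_psi_le(2)[of "real j * x" \<theta>] x1 that False unfolding qj by simp
          moreover have "norm (psi (real j * x) \<theta>) \<le> norm (1::complex) + norm (1 - psi (real j * x) \<theta>)"
            using norm_triangle_ineq4[of 1 "1 - psi (real j * x) \<theta>"] by simp
          ultimately show ?thesis unfolding s[OF that(1)] using qle[of j] by simp
        qed
        show "norm (p j - s j) \<le> C0 * r * (1 ^ j * q)" if "1 \<le> j" "j \<le> m" for j
        proof -
          have "C0 * r * q ^ j \<le> C0 * r * q" using qq[OF that(1)] C0 r by (intro mult_left_mono) auto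
          then show ?thesis using ps'[OF that] by simp
        qed
      qed (use q1 r in auto)
      then show ?thesis using False by (simp add: W_def)
    qed
    then have 1: "norm (hsum p m - hsum s m) \<le> K * r * W" and 2: "(\<Sum>k<m. q ^ (m - k) * norm (hsum p k)) \<le> K * W" by auto
    have "norm (a - hsum s m) \<le> norm (a - hsum p m) + norm (hsum p m - hsum s m)"
      using norm_triangle_ineq[of "a - hsum p m" "hsum p m - hsum s m"] by simp
    also have "\<dots> \<le> L * r * (K * W) + K * r * W"
    proof (rule add_mono[OF _ 1])
      have "L * r * (\<Sum>k<m. q ^ (m - k) * norm (hsum p k)) \<le> L * r * (K * W)" using 2 L(1) r by (intro mult_left_mono) auto
      then show "norm (a - hsum p m) \<le> L * r * (K * W)" using a by (simp add: r_def)
    qed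
    also have "\<dots> = M / sqrt x * W" by (simp add: M_def r_def algebra_simps add_divide_distrib)
    finally show ?thesis unfolding W_def .
  qed
  show ?thesis
  proof (rule that[of M])
    fix x b \<theta> assume x: "X \<le> x" and b: "\<bar>b - x\<bar> \<le> R" and th: "- 2 * pi + \<delta> \<le> \<theta>" "\<theta> \<le> 2 * pi - \<delta>"
    show "norm (normalised_jfun m n b x \<theta> - hsum (\<lambda>j. psi (real j * x) \<theta>) m)
        \<le> M / sqrt x * (if \<theta> \<le> 0 then exp (- x * (1 - cos \<theta>)) ^ m else exp (- x * (1 - cos \<theta>)))"
      by (rule gen[OF x refl L(2)[OF x b] refl tau_psi[OF x b _ _ th]])
  next
    fix x b \<theta> assume x: "X \<le> x" and b: "\<bar>b - x\<bar> \<le> R" and th: "- 2 * pi + \<delta> \<le> \<theta>" "\<theta> \<le> 2 * pi - \<delta>"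
    define e where "e = exp (- 2 * of_real pi * \<i> * complex_of_real b)"
    have ne: "norm e = 1" by (simp add: e_def)
    let ?p = "\<lambda>j. - cnj (tau (real j) (real j * b) x \<theta>)"
    have bp: "b > 0" by (rule b_pos[OF x b])
    have hs: "hsum ?p k = e ^ k * hsum (\<lambda>j. tau (real j) (real j * b) x (- \<theta> - 2 * pi)) k" for k
    proof -
      have "e ^ j = exp (- 2 * of_real pi * \<i> * of_real (real j * b))" for j
        unfolding e_def exp_of_nat_mult[symmetric] by (rule arg_cong[of _ _ exp]) (simp add: algebra_simps)
      then have "?p j = e ^ j * tau (real j) (real j * b) x (- \<theta> - 2 * pi)" if "1 \<le> j" for j
        using tau_reflect[of "real j" "real j * b" x \<theta>] bp that by simp
      then show ?thesis unfolding hsum_scale[symmetric] by (intro hsum_cong) simp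
    qed
    have nh: "norm (hsum ?p k) = norm (hsum (\<lambda>j. tau (real j) (real j * b) x (- \<theta> - 2 * pi)) k)" for k
      unfolding hs norm_mult norm_power ne by simp
    have c: "cos (- \<theta> - 2 * pi) = cos \<theta>"
    proof -
      have "- \<theta> - 2 * pi = - (\<theta> + 2 * pi)" by simp
      then show ?thesis by (simp only: cos_minus cos_periodic)
    qed
    show "norm (exp (- 2 * of_real pi * \<i> * of_real b) ^ m * normalised_jfun m n b x (- \<theta> - 2 * pi) - hsum (\<lambda>j. - cnj (psi (real j * x) \<theta>)) m)
        \<le> M / sqrt x * (if \<theta> \<le> 0 then exp (- x * (1 - cos \<theta>)) ^ m else exp (- x * (1 - cos \<theta>)))"
      unfolding e_def[symmetric]
    proof (rule gen[OF x refl, where p="?p"])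
      have "e ^ m * normalised_jfun m n b x (- \<theta> - 2 * pi) - hsum ?p m
         = e ^ m * (normalised_jfun m n b x (- \<theta> - 2 * pi) - hsum (\<lambda>j. tau (real j) (real j * b) x (- \<theta> - 2 * pi)) m)"
        unfolding hs by (simp only: right_diff_distrib)
      then have "norm (e ^ m * normalised_jfun m n b x (- \<theta> - 2 * pi) - hsum ?p m)
         = norm (normalised_jfun m n b x (- \<theta> - 2 * pi) - hsum (\<lambda>j. tau (real j) (real j * b) x (- \<theta> - 2 * pi)) m)"
        by (simp only: norm_mult norm_power ne power_one mult_1)
      then show "norm (e ^ m * normalised_jfun m n b x (- \<theta> - 2 * pi) - hsum ?p m)
         \<le> L / sqrt x * (\<Sum>k<m. exp (- x * (1 - cos \<theta>)) ^ (m - k) * norm (hsum ?p k))"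
        using L(2)[OF x b, of "- \<theta> - 2 * pi"] unfolding nh c by (simp only:)
      show "norm (- cnj (psi (real j * x) \<theta>)) = norm (psi (real j * x) \<theta>)" for j by simp
      show "norm (?p j - - cnj (psi (real j * x) \<theta>)) \<le> C0 / sqrt x * exp (- x * (1 - cos \<theta>)) ^ j" if "1 \<le> j" "j \<le> m" for j
      proof -
        have "?p j - - cnj (psi (real j * x) \<theta>) = - cnj (tau (real j) (real j * b) x \<theta> - psi (real j * x) \<theta>)" by simp
        then have "norm (?p j - - cnj (psi (real j * x) \<theta>)) = norm (tau (real j) (real j * b) x \<theta> - psi (real j * x) \<theta>)"
          by (simp only: norm_minus_cancel complex_mod_cnj)
        then show ?thesis using tau_psi[OF x b that th] by (simp only:)
      qed
    qed
  qed
qed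

end

section \<open>Existence of the threshold, and assembly of both expansions\<close>

lemma large_modulus_exists:
  assumes d: "0 < \<delta>" "\<delta> \<le> 1/6" and R: "R \<ge> 0"
  obtains X C0 where "large_modulus m n R \<delta> X C0"
proof -
  \<comment> \<open>One radius for both uses: j b differs from j x by at most m R, and b - i differs
    from x by at most R + n.\<close>
  have "0 \<le> real (Suc m) * R + real n" using R by simp
  then obtain C Y where C: "C > 0" and Y: "Y > 0" and
    gm: "\<And>a b x. x > 0 \<Longrightarrow> a > 0 \<Longrightarrow> \<bar>b - a * x\<bar> \<le> real (Suc m) * R + real n \<Longrightarrow> Y \<le> a * x \<Longrightarrow>
       b > 0 \<and> gmass a b \<le> C / sqrt (a * x) * exp (b * ln x - a * x)" and
    tp: "\<And>a b x \<theta>. x > 0 \<Longrightarrow> a > 0 \<Longrightarrow> \<bar>b - a * x\<bar> \<le> real (Suc m) * R + real n \<Longrightarrow> Y \<le> a * x \<Longrightarrow>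
       - 2 * pi + \<delta> \<le> \<theta> \<Longrightarrow> \<theta> \<le> 2 * pi - \<delta> \<Longrightarrow>
       norm (tau a b x \<theta> - psi (a * x) \<theta>) \<le> C / sqrt (a * x) * exp (- (a * x) * (1 - cos \<theta>))"
    using tau_asymptotics[OF d] by metis
  \<comment> \<open>The last entry forces n < b and b <= 2 x whenever |b - x| <= R.\<close>
  define X where "X = max 1 (max Y (real n + R + 1))"
  have sc: "x > 0" "real j > 0" "\<bar>real j * b - real j * x\<bar> \<le> real (Suc m) * R + real n" "Y \<le> real j * x"
      "C / sqrt (real j * x) \<le> C / sqrt x"
    if "X \<le> x" "\<bar>b - x\<bar> \<le> R" "1 \<le> j" "j \<le> m" for x b j
  proof -
    show x: "x > 0" and j: "real j > 0" using that by (auto simp: X_def)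
    have "\<bar>real j * b - real j * x\<bar> = real j * \<bar>b - x\<bar>" unfolding right_diff_distrib[symmetric] abs_mult by simp
    also have "\<dots> \<le> real (Suc m) * R" using that R by (intro mult_mono) auto
    finally show "\<bar>real j * b - real j * x\<bar> \<le> real (Suc m) * R + real n" by simp
    have jx: "x \<le> real j * x" using x that by simp
    then show "Y \<le> real j * x" using that by (auto simp: X_def)
    show "C / sqrt (real j * x) \<le> C / sqrt x" using jx x C by (intro divide_left_mono) auto
  qed
  have "large_modulus m n R \<delta> X C"
  proof
    show "1 \<le> X" "0 \<le> C" using C by (auto simp: X_def)
    show "real n < b" "b \<le> 2 * x" if "X \<le> x" "\<bar>b - x\<bar> \<le> R" for x b
      using that by (auto simp: X_def)
    show "gmass (real j) (real j * b) \<le> C / sqrt x * gpeak b x ^ j" if h: "X \<le> x" "\<bar>b - x\<bar> \<le> R" "1 \<le> j" "j \<le> m" for x b j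
    proof -
      have "gmass (real j) (real j * b) \<le> C / sqrt (real j * x) * exp (real j * b * ln x - real j * x)"
        using gm[OF sc(1-4)[OF h]] by blast
      also have "exp (real j * b * ln x - real j * x) = gpeak b x ^ j"
        unfolding gpeak_def exp_of_nat_mult[symmetric] by (simp add: algebra_simps)
      also have "C / sqrt (real j * x) * gpeak b x ^ j \<le> C / sqrt x * gpeak b x ^ j"
        using sc(5)[OF h] less_imp_le[OF gpeak_pos[of b x]] by (intro mult_right_mono) auto
      finally show ?thesis .
    qed
    show "gmass 1 (b - real i) \<le> C / sqrt x * gpeak b x / x ^ i" if h: "X \<le> x" "\<bar>b - x\<bar> \<le> R" "i \<le> n" for x b i
    proof -
      have x: "x > 0" "Y \<le> x" using h by (auto simp: X_def)
      have "0 \<le> real m * R" using R by simp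
      moreover have "real (Suc m) * R = R + real m * R" by (simp add: algebra_simps)
      moreover have "\<bar>b - real i - x\<bar> \<le> R + real n" using h by simp
      ultimately have "\<bar>b - real i - 1 * x\<bar> \<le> real (Suc m) * R + real n" by linarith
      then have "gmass 1 (b - real i) \<le> C / sqrt (1 * x) * exp ((b - real i) * ln x - 1 * x)"
        using gm[of x 1 "b - real i"] x by simp
      also have "exp ((b - real i) * ln x - 1 * x) = exp ((b * ln x - x) - real i * ln x)" by (simp add: algebra_simps)
      also have "\<dots> = gpeak b x / x ^ i"
        unfolding exp_diff[of "b * ln x - x"] exp_of_nat_mult gpeak_def using x by simp
      finally show ?thesis by simp
    qed
    show "norm (tau (real j) (real j * b) x \<theta> - psi (real j * x) \<theta>) \<le> C / sqrt x * exp (- x * (1 - cos \<theta>)) ^ j"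
      if h: "X \<le> x" "\<bar>b - x\<bar> \<le> R" "1 \<le> j" "j \<le> m" and th: "- 2 * pi + \<delta> \<le> \<theta>" "\<theta> \<le> 2 * pi - \<delta>" for x b j \<theta>
    proof -
      have "norm (tau (real j) (real j * b) x \<theta> - psi (real j * x) \<theta>) \<le> C / sqrt (real j * x) * exp (- (real j * x) * (1 - cos \<theta>))"
        by (rule tp[OF sc(1-4)[OF h] th])
      also have "exp (- (real j * x) * (1 - cos \<theta>)) = exp (- x * (1 - cos \<theta>)) ^ j"
        unfolding exp_of_nat_mult[symmetric] by (simp add: algebra_simps)
      also have "C / sqrt (real j * x) * exp (- x * (1 - cos \<theta>)) ^ j \<le> C / sqrt x * exp (- x * (1 - cos \<theta>)) ^ j"
        using sc(5)[OF h] by (intro mult_right_mono) auto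
      finally show ?thesis .
    qed
  qed
  then show ?thesis by (rule that)
qed

text \<open>Half of c^2 has real part 1 - cos (phi - pi), so the error terms of the theorem are
  powers of q divided by sqrt x.\<close>

lemma norm_exp_c_fun_square:
  assumes "0 \<le> x"
  shows "norm (exp (- (of_nat m / 2) * of_real x * (c_fun \<phi>)\<^sup>2) / of_real (sqrt x)) = exp (- x * (1 - cos (\<phi> - pi))) ^ m / sqrt x"
    "norm (exp (- (1 / 2) * of_real x * (c_fun \<phi>)\<^sup>2) / of_real (sqrt x)) = exp (- x * (1 - cos (\<phi> - pi))) / sqrt x"
proof -
  have *: "norm (exp (- (of_nat m / 2) * of_real x * (c_fun \<phi>)\<^sup>2) / of_real (sqrt x)) = exp (- x * (1 - cos (\<phi> - pi))) ^ m / sqrt x" for m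
  proof -
    have re: "Re (of_real a * u) = a * Re u" for a u by simp
    have "- (of_nat m / 2) * of_real x * (c_fun \<phi>)\<^sup>2 = of_real (- real m * x) * gfun (\<phi> - pi)"
      unfolding c_fun_square by simp
    then have "Re (- (of_nat m / 2) * of_real x * (c_fun \<phi>)\<^sup>2) = - real m * x * Re (gfun (\<phi> - pi))"
      by (simp only: re)
    then have "norm (exp (- (of_nat m / 2) * of_real x * (c_fun \<phi>)\<^sup>2)) = exp (real m * (- x * (1 - cos (\<phi> - pi))))"
      unfolding norm_exp_eq_Re Re_gfun by simp
    also have "\<dots> = exp (- x * (1 - cos (\<phi> - pi))) ^ m" by (rule exp_of_nat_mult)
    finally show ?thesis unfolding norm_divide using assms by simp
  qed
  show "norm (exp (- (of_nat m / 2) * of_real x * (c_fun \<phi>)\<^sup>2) / of_real (sqrt x)) = exp (- x * (1 - cos (\<phi> - pi))) ^ m / sqrt x" by (rule *)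
  show "norm (exp (- (1 / 2) * of_real x * (c_fun \<phi>)\<^sup>2) / of_real (sqrt x)) = exp (- x * (1 - cos (\<phi> - pi))) / sqrt x"
    using *[of 1] by simp
qed

lemma partition_sum_psi:
  "(\<Sum>k\<in>partition_solutions m. \<Prod>j=1..m. 1 / ((2 * of_nat j) ^ k j * fact (k j)) * erfc (c_fun \<phi> * of_real (sqrt (real j / 2 * x))) ^ k j)
     = hsum (\<lambda>j. psi (real j * x) (\<phi> - pi)) m"
  "(\<Sum>k\<in>partition_solutions m. \<Prod>j=1..m. (- 1) ^ k j / ((2 * of_nat j) ^ k j * fact (k j)) * erfc (cnj (c_fun \<phi>) * of_real (sqrt (real j / 2 * x))) ^ k j)
     = hsum (\<lambda>j. - cnj (psi (real j * x) (\<phi> - pi))) m"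
proof -
  have p: "psi (real j * x) (\<phi> - pi) = erfc (c_fun \<phi> * of_real (sqrt (real j / 2 * x))) / 2" for j
    by (simp add: psi_def)
  have c: "- cnj (psi (real j * x) (\<phi> - pi)) = - erfc (cnj (c_fun \<phi>) * of_real (sqrt (real j / 2 * x))) / 2" for j
    unfolding p by (simp flip: erfc_cnj)
  show "(\<Sum>k\<in>partition_solutions m. \<Prod>j=1..m. 1 / ((2 * of_nat j) ^ k j * fact (k j)) * erfc (c_fun \<phi> * of_real (sqrt (real j / 2 * x))) ^ k j)
     = hsum (\<lambda>j. psi (real j * x) (\<phi> - pi)) m"
    unfolding partition_sum_eq_hsum[symmetric] pweight_def p
    by (intro sum.cong prod.cong refl) (simp add: power_divide power_mult_distrib)
  have m1: "(- e / 2 / of_nat j) ^ k / fact k = (- 1) ^ k / ((2 * of_nat j) ^ k * fact k) * e ^ k" for e :: complex and j k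
    using power_minus[of "e / (2 * of_nat j)" k] by (simp add: power_divide power_mult_distrib)
  show "(\<Sum>k\<in>partition_solutions m. \<Prod>j=1..m. (- 1) ^ k j / ((2 * of_nat j) ^ k j * fact (k j)) * erfc (cnj (c_fun \<phi>) * of_real (sqrt (real j / 2 * x))) ^ k j)
     = hsum (\<lambda>j. - cnj (psi (real j * x) (\<phi> - pi))) m"
    unfolding partition_sum_eq_hsum[symmetric] pweight_def c m1 ..
qed

theorem theorem5p1:
  fixes m n :: nat and \<delta> R :: real
  assumes "m \<ge> 1" and "\<delta> > 0"
  shows "\<exists>C X :: real. \<forall>(\<sigma>::log_surface) (z::log_surface) (\<rho>::real).
    \<bar>\<rho>\<bar> \<le> R \<longrightarrow> modulus (\<sigma> * z) \<ge> X \<longrightarrow>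
    (let x = modulus (\<sigma> * z);
         \<phi> = argument (\<sigma> * z);
         N = x + \<rho>;
         F = hyperterminant (replicate (m - 1) (complex_of_real N) @ [complex_of_real N - of_nat n])
               (replicate m \<sigma>) z;
         A = exp (- of_nat m * proj (\<sigma> * z))
               / ((2 * of_real pi * \<i>) ^ m * lpow z (of_real (real m * N - real m - real n))) * F;
         E\<^sub>1 = A - (\<Sum>k\<in>partition_solutions m. \<Prod>j=1..m.
               1 / ((2 * of_nat j) ^ k j * fact (k j))
                 * erfc (c_fun \<phi> * of_real (sqrt (real j / 2 * x))) ^ k j);
         E\<^sub>2 = exp (- 2 * of_real pi * \<i> * of_nat m * of_real N) * A
             - (\<Sum>k\<in>partition_solutions m. \<Prod>j=1..m.
               (- 1) ^ k j / ((2 * of_nat j) ^ k j * fact (k j))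
                 * erfc (cnj (c_fun (- \<phi>)) * of_real (sqrt (real j / 2 * x))) ^ k j)
     in
       (- pi + \<delta> \<le> \<phi> \<and> \<phi> \<le> pi \<longrightarrow>
          norm E\<^sub>1 \<le> C * norm (exp (- (of_nat m / 2) * of_real x * (c_fun \<phi>)\<^sup>2) / of_real (sqrt x))) \<and>
       (pi < \<phi> \<and> \<phi> \<le> 3 * pi - \<delta> \<longrightarrow>
          norm E\<^sub>1 \<le> C * norm (exp (- (1 / 2) * of_real x * (c_fun \<phi>)\<^sup>2) / of_real (sqrt x))) \<and>
       (- pi \<le> \<phi> \<and> \<phi> \<le> pi - \<delta> \<longrightarrow>
          norm E\<^sub>2 \<le> C * norm (exp (- (of_nat m / 2) * of_real x * (c_fun (- \<phi>))\<^sup>2) / of_real (sqrt x))) \<and>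
       (- 3 * pi + \<delta> \<le> \<phi> \<and> \<phi> < - pi \<longrightarrow>
          norm E\<^sub>2 \<le> C * norm (exp (- (1 / 2) * of_real x * (c_fun (- \<phi>))\<^sup>2) / of_real (sqrt x))))"
proof -
  \<comment> \<open>The bound 1/6 is the radius on which the local estimates of c' and of sin near
    the saddle hold.\<close>
  define \<delta>' where "\<delta>' = min \<delta> (1/6)"
  have d: "0 < \<delta>'" "\<delta>' \<le> 1/6" "\<delta>' \<le> \<delta>" using assms by (auto simp: \<delta>'_def)
  \<comment> \<open>The weight has exponent b = N - 1, so b - x is rho - 1, and the locale needs a
    nonnegative radius.\<close>
  define R' where "R' = max R 0 + 1"
  obtain X C0 where "large_modulus m n R' \<delta>' X C0"
    using large_modulus_exists[OF d(1,2), of R' m n] by (auto simp: R'_def)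
  then interpret large_modulus m n R' \<delta>' X C0 .
  obtain K where K: "\<And>x b \<theta>. X \<le> x \<Longrightarrow> \<bar>b - x\<bar> \<le> R' \<Longrightarrow> - 2 * pi + \<delta>' \<le> \<theta> \<Longrightarrow> \<theta> \<le> 2 * pi - \<delta>' \<Longrightarrow>
      norm (normalised_jfun m n b x \<theta> - hsum (\<lambda>j. psi (real j * x) \<theta>) m)
        \<le> K / sqrt x * (if \<theta> \<le> 0 then exp (- x * (1 - cos \<theta>)) ^ m else exp (- x * (1 - cos \<theta>)))"
    "\<And>x b \<theta>. X \<le> x \<Longrightarrow> \<bar>b - x\<bar> \<le> R' \<Longrightarrow> - 2 * pi + \<delta>' \<le> \<theta> \<Longrightarrow> \<theta> \<le> 2 * pi - \<delta>' \<Longrightarrow>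
      norm (exp (- 2 * of_real pi * \<i> * of_real b) ^ m * normalised_jfun m n b x (- \<theta> - 2 * pi) - hsum (\<lambda>j. - cnj (psi (real j * x) \<theta>)) m)
        \<le> K / sqrt x * (if \<theta> \<le> 0 then exp (- x * (1 - cos \<theta>)) ^ m else exp (- x * (1 - cos \<theta>)))"
    using normalised_jfun_asymptotics by metis
  show ?thesis
  proof (rule exI[of _ K], rule exI[of _ X], intro allI impI)
    fix \<sigma> z :: log_surface and \<rho> :: real
    assume \<rho>: "\<bar>\<rho>\<bar> \<le> R" and x: "X \<le> modulus (\<sigma> * z)"
    define x where "x = modulus (\<sigma> * z)"
    define \<phi> where "\<phi> = argument (\<sigma> * z)"
    define N where "N = x + \<rho>"
    define b where "b = N - 1"
    define F where "F = hyperterminant (replicate (m - 1) (complex_of_real N) @ [complex_of_real N - of_nat n]) (replicate m \<sigma>) z"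
    define A where "A = exp (- of_nat m * proj (\<sigma> * z)) / ((2 * of_real pi * \<i>) ^ m * lpow z (of_real (real m * N - real m - real n))) * F"
    have x: "X \<le> x" using x unfolding x_def .
    have x0: "0 < x" by (simp add: x_def)
    have b: "\<bar>b - x\<bar> \<le> R'" using \<rho> by (auto simp: b_def N_def R'_def)
    have nb: "real n < b" by (rule b_gt[OF x b])
    have Nb: "N = b + 1" by (simp add: b_def)
    obtain l where l: "m = Suc l" using assms(1) by (cases m) auto
    have w: "wcoord \<sigma> z 0 = Complex (ln x) (\<phi> - pi)" by (simp add: wcoord_def x_def \<phi>_def)
    have A: "A = normalised_jfun m n b x (\<phi> - pi)"
      using normalised_hyperterminant_eq[OF nb, of l \<sigma> z]
      unfolding A_def F_def Nb normalised_jfun_def w[symmetric] l diff_Suc_1 .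
    \<comment> \<open>N and b differ by 1, which exp (- 2 pi i N) does not see.\<close>
    have N: "exp (- 2 * of_real pi * \<i> * of_nat m * of_real N) = exp (- 2 * of_real pi * \<i> * of_real b) ^ m"
    proof -
      have "exp (- 2 * of_real pi * \<i> * of_nat m * of_real N) = (exp (- 2 * of_real pi * \<i> * of_real b) * exp (- (2 * of_real pi * \<i>))) ^ m"
        unfolding Nb exp_add[symmetric] exp_of_nat_mult[symmetric] by (rule arg_cong[of _ _ exp]) (simp add: algebra_simps)
      also have "exp (- (2 * of_real pi * \<i>)) = 1" by (simp add: exp_minus)
      finally show ?thesis by simp
    qed
    \<comment> \<open>The second expansion is the reflected estimate at theta = - phi - pi, whose
      reflected angle - theta - 2 pi is phi - pi again.\<close>
    have r: "- (- \<phi> - pi) - 2 * pi = \<phi> - pi" by simp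
    define E1 where "E1 = A - (\<Sum>k\<in>partition_solutions m. \<Prod>j=1..m.
               1 / ((2 * of_nat j) ^ k j * fact (k j))
                 * erfc (c_fun \<phi> * of_real (sqrt (real j / 2 * x))) ^ k j)"
    define E2 where "E2 = exp (- 2 * of_real pi * \<i> * of_nat m * of_real N) * A
             - (\<Sum>k\<in>partition_solutions m. \<Prod>j=1..m.
               (- 1) ^ k j / ((2 * of_nat j) ^ k j * fact (k j))
                 * erfc (cnj (c_fun (- \<phi>)) * of_real (sqrt (real j / 2 * x))) ^ k j)"
    have e1: "norm E1 \<le> K / sqrt x * (if \<phi> - pi \<le> 0 then exp (- x * (1 - cos (\<phi> - pi))) ^ m else exp (- x * (1 - cos (\<phi> - pi))))"
      if "- pi + \<delta> \<le> \<phi>" "\<phi> \<le> 3 * pi - \<delta>"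
      unfolding E1_def A partition_sum_psi using that d(3) by (intro K(1) x b) auto
    have e2: "norm E2 \<le> K / sqrt x * (if - \<phi> - pi \<le> 0 then exp (- x * (1 - cos (- \<phi> - pi))) ^ m else exp (- x * (1 - cos (- \<phi> - pi))))"
      if "- 3 * pi + \<delta> \<le> \<phi>" "\<phi> \<le> pi - \<delta>"
      using K(2)[OF x b, of "- \<phi> - pi"] that d(3) unfolding E2_def A N partition_sum_psi r by simp
    have sx: "0 \<le> x" using x0 by simp
    have d0: "pi + \<delta> > 0" using assms pi_gt_zero by linarith
    have "(- pi + \<delta> \<le> \<phi> \<and> \<phi> \<le> pi \<longrightarrow>
          norm E1 \<le> K * norm (exp (- (of_nat m / 2) * of_real x * (c_fun \<phi>)\<^sup>2) / of_real (sqrt x))) \<and>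
       (pi < \<phi> \<and> \<phi> \<le> 3 * pi - \<delta> \<longrightarrow>
          norm E1 \<le> K * norm (exp (- (1 / 2) * of_real x * (c_fun \<phi>)\<^sup>2) / of_real (sqrt x))) \<and>
       (- pi \<le> \<phi> \<and> \<phi> \<le> pi - \<delta> \<longrightarrow>
          norm E2 \<le> K * norm (exp (- (of_nat m / 2) * of_real x * (c_fun (- \<phi>))\<^sup>2) / of_real (sqrt x))) \<and>
       (- 3 * pi + \<delta> \<le> \<phi> \<and> \<phi> < - pi \<longrightarrow>
          norm E2 \<le> K * norm (exp (- (1 / 2) * of_real x * (c_fun (- \<phi>))\<^sup>2) / of_real (sqrt x)))"
      unfolding norm_exp_c_fun_square[OF sx]
    proof (intro conjI impI)
      assume h: "- pi + \<delta> \<le> \<phi> \<and> \<phi> \<le> pi"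
      have c: "- pi + \<delta> \<le> \<phi>" "\<phi> \<le> 3 * pi - \<delta>" "\<phi> - pi \<le> 0"
        using conjunct1[OF h] conjunct2[OF h] by linarith+
      show "norm E1 \<le> K * (exp (- x * (1 - cos (\<phi> - pi))) ^ m / sqrt x)"
        using e1[OF c(1,2)] unfolding if_P[OF c(3)] by (simp only: times_divide_eq_left times_divide_eq_right)
    next
      assume h: "pi < \<phi> \<and> \<phi> \<le> 3 * pi - \<delta>"
      have c: "- pi + \<delta> \<le> \<phi>" "\<phi> \<le> 3 * pi - \<delta>" "\<not> \<phi> - pi \<le> 0"
        using conjunct1[OF h] conjunct2[OF h] by linarith+
      show "norm E1 \<le> K * (exp (- x * (1 - cos (\<phi> - pi))) / sqrt x)"
        using e1[OF c(1,2)] unfolding if_not_P[OF c(3)] by (simp only: times_divide_eq_left times_divide_eq_right)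
    next
      assume h: "- pi \<le> \<phi> \<and> \<phi> \<le> pi - \<delta>"
      have c: "- 3 * pi + \<delta> \<le> \<phi>" "\<phi> \<le> pi - \<delta>" "- \<phi> - pi \<le> 0"
        using conjunct1[OF h] conjunct2[OF h] by linarith+
      show "norm E2 \<le> K * (exp (- x * (1 - cos (- \<phi> - pi))) ^ m / sqrt x)"
        using e2[OF c(1,2)] unfolding if_P[OF c(3)] by (simp only: times_divide_eq_left times_divide_eq_right)
    next
      assume h: "- 3 * pi + \<delta> \<le> \<phi> \<and> \<phi> < - pi"
      have c: "- 3 * pi + \<delta> \<le> \<phi>" "\<phi> \<le> pi - \<delta>" "\<not> - \<phi> - pi \<le> 0"
        using conjunct1[OF h] conjunct2[OF h] by linarith+
      show "norm E2 \<le> K * (exp (- x * (1 - cos (- \<phi> - pi))) / sqrt x)"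
        using e2[OF c(1,2)] unfolding if_not_P[OF c(3)] by (simp only: times_divide_eq_left times_divide_eq_right)
    qed
    then show "let x = modulus (\<sigma> * z);
         \<phi> = argument (\<sigma> * z);
         N = x + \<rho>;
         F = hyperterminant (replicate (m - 1) (complex_of_real N) @ [complex_of_real N - of_nat n])
               (replicate m \<sigma>) z;
         A = exp (- of_nat m * proj (\<sigma> * z))
               / ((2 * of_real pi * \<i>) ^ m * lpow z (of_real (real m * N - real m - real n))) * F;
         E\<^sub>1 = A - (\<Sum>k\<in>partition_solutions m. \<Prod>j=1..m.
               1 / ((2 * of_nat j) ^ k j * fact (k j))
                 * erfc (c_fun \<phi> * of_real (sqrt (real j / 2 * x))) ^ k j);
         E\<^sub>2 = exp (- 2 * of_real pi * \<i> * of_nat m * of_real N) * A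
             - (\<Sum>k\<in>partition_solutions m. \<Prod>j=1..m.
               (- 1) ^ k j / ((2 * of_nat j) ^ k j * fact (k j))
                 * erfc (cnj (c_fun (- \<phi>)) * of_real (sqrt (real j / 2 * x))) ^ k j)
     in
       (- pi + \<delta> \<le> \<phi> \<and> \<phi> \<le> pi \<longrightarrow>
          norm E\<^sub>1 \<le> K * norm (exp (- (of_nat m / 2) * of_real x * (c_fun \<phi>)\<^sup>2) / of_real (sqrt x))) \<and>
       (pi < \<phi> \<and> \<phi> \<le> 3 * pi - \<delta> \<longrightarrow>
          norm E\<^sub>1 \<le> K * norm (exp (- (1 / 2) * of_real x * (c_fun \<phi>)\<^sup>2) / of_real (sqrt x))) \<and>
       (- pi \<le> \<phi> \<and> \<phi> \<le> pi - \<delta> \<longrightarrow>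
          norm E\<^sub>2 \<le> K * norm (exp (- (of_nat m / 2) * of_real x * (c_fun (- \<phi>))\<^sup>2) / of_real (sqrt x))) \<and>
       (- 3 * pi + \<delta> \<le> \<phi> \<and> \<phi> < - pi \<longrightarrow>
          norm E\<^sub>2 \<le> K * norm (exp (- (1 / 2) * of_real x * (c_fun (- \<phi>))\<^sup>2) / of_real (sqrt x)))"
      unfolding Let_def E1_def E2_def A_def F_def N_def x_def \<phi>_def .
  qed
qed

end
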